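(* Let $\mathcal{W}$ be a cocomplete monoidal category whose monoidal product preserves colimits in each variable. The functor $\Phi:\mathrm{StrMon}(\mathcal{N}ec,\mathcal{W})\to \mathrm{Fun}(\mathbf{\Delta},\mathcal{W}\mathrm{Cat})$ is fully faithful. Hence, there is an equivalence of categories $$\mathrm{Nerve}_{\mathcal{N}ec}(\mathcal{W}\mathrm{Cat})\simeq \mathrm{StrMon}(\mathcal{N}ec,\mathcal{W})^{op}.$$
   Context: Necklaces. $\mathrm{SSet}_{*,*}$ is the category of bipointed simplicial sets; $\Delta^n$ is bipointed by $0$ and $n$; the wedge $K_{a,b}\vee L_{c,d}$ glues $b$ to $c$ and is bipointed by $a,d$. A necklace is $\Delta^{n_1}\vee\dots\vee\Delta^{n_k}$ with $k\ge 0$, $n_i>0$ ($\Delta^0$ if $k=0$). $\mathcal{N}ec\subseteq \mathrm{SSet}_{*,*}$ is the full subcategory of necklaces, monoidal under $\vee$ with unit $\Delta^0$. Let $\mathbf{\Delta}$ be the simplex category and $\mathbf{\Delta}_f$ its subcategory with all objects $[n]$, $n\geq 0$, and the morphisms $f:[m]\to[n]$ with $f(0)=0$, $f(m)=n$. Equivalently, a necklace is a pair $(T,p)$ with $\{0,p\}\subseteq T\subseteq[p]$ (with $\Delta^n=(\{0,n\},n)$), and a morphism $(T,p)\to(U,q)$ is a morphism $f:[p]\to[q]$ of $\mathbf{\Delta}_f$ with $U\subseteq f(T)$. Conventions. $\mathcal{W}\mathrm{Cat}$ is the category of small $\mathcal{W}$-enriched categories and $\mathcal{W}$-functors; compositions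 are written $\mathcal{C}(A,B)\otimes\mathcal{C}(B,C)\to\mathcal{C}(A,C)$. $\mathrm{StrMon}(\mathcal{N}ec,\mathcal{W})$ is the category of strong monoidal functors and monoidal natural transformations. $0$ denotes an initial object of $\mathcal{W}$. The functor $\Phi$. For $D:\mathcal{N}ec\to\mathcal{W}$ strong monoidal, $\Phi(D)^n$ is the $\mathcal{W}$-category with object set $[n]$ and $\Phi(D)^n(i,j)=D(\Delta^{j-i})$ if $i\le j$, and $0$ if $i>j$. For $i\le k\le j$ the composition is $D(\Delta^{k-i})\otimes D(\Delta^{j-k})\simeq D(\Delta^{k-i}\vee\Delta^{j-k})\to D(\Delta^{j-i})$ (induced by the necklace map with underlying map $\mathrm{id}_{[j-i]}$), and identities are given by $I\simeq D(\Delta^0)$. For $f:[m]\to[n]$ in $\mathbf{\Delta}$, $\Phi(D)(f)$ is $f$ on objects and $D(f_{i,j}):D(\Delta^{j-i})\to D(\Delta^{f(j)-f(i)})$ on hom-objects ($i\le j$), where $f_{i,j}(k)=f(k+i)-f(i)$. For a monoidal natural transformation $\alpha$, $\Phi(\alpha)^n$ is the identity on objects and $\alpha_{\Delta^{j-i}}$ on hom-objects for $i\le j$ (and $\mathrm{id}_0$ for $i>j$). Necklicial nerves. A diagram $\mathbb{D}:\mathbf{\Delta}\to\mathcal{W}\mathrm{Cat}$ induces a right-adjoint functor $N^{\mathbb{D}}:\mathcal{W}\mathrm{Cat}\to\mathrm{SSet}$, $N^{\mathbb{D}}(\mathcal{C})_n=\mathcal{W}\mathrm{Cat}(\mathbb{D}(n),\mathcal{C})$;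 this gives an equivalence between $\mathrm{Fun}(\mathbf{\Delta},\mathcal{W}\mathrm{Cat})^{op}$ and the category of right-adjoint functors $\mathcal{W}\mathrm{Cat}\to\mathrm{SSet}$ with natural transformations. $N^{\mathbb{D}}$ is called necklicial if $\mathbb{D}\simeq\Phi(D)$ for some strong monoidal $D:\mathcal{N}ec\to\mathcal{W}$. $\mathrm{Nerve}_{\mathcal{N}ec}(\mathcal{W}\mathrm{Cat})$ is the full subcategory, of the category of right-adjoint functors $\mathcal{W}\mathrm{Cat}\to\mathrm{SSet}$, spanned by all necklicial nerves. *)

theory Defs
  imports "HOL-Library.FuncSet" "HOL-Library.Equipollence"
begin

section \<open>Smallness\<close>

text \<open>
  The cardinal of a fixed type \<open>'u\<close> plays the role of the universe: a set, of whatever element type,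
  is small if it has strictly fewer elements than \<open>'u\<close>.  This cardinal is only required to be
  uncountable and regular.  If it is moreover a strong limit, the small sets are those of a
  Grothendieck universe.
\<close>

definition small :: "'u itself \<Rightarrow> 'x set \<Rightarrow> bool" where
  "small u X \<longleftrightarrow> X \<prec> (UNIV :: 'u set)"

definition regular_universe :: "'u itself \<Rightarrow> bool" where
  "regular_universe u \<longleftrightarrow>
     (UNIV :: nat set) \<prec> (UNIV :: 'u set) \<and>
     (\<forall>(I :: 'u set) (B :: 'u \<Rightarrow> 'u set).
        small u I \<longrightarrow> (\<forall>i\<in>I. small u (B i)) \<longrightarrow> small u (\<Union>i\<in>I. B i))"

text \<open>
  Elements of small object sets are taken from this type (equipotent to \<open>'u\<close> when \<open>'u\<close> is infinite),
  so that the ordinal \<open>[n]\<close> is available as the set \<open>Inl ` {..n}\<close>.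
\<close>

type_synonym 'u pt = "nat + 'u"


section \<open>Categories, functors, natural transformations\<close>

text \<open>
  Hom-sets need not be disjoint, so operations on arrows carry the objects as arguments:
  \<open>Comp C X Y Z g f\<close> is the composite of \<open>f : X \<rightarrow> Y\<close> and \<open>g : Y \<rightarrow> Z\<close>.
\<close>

record ('o, 'a) cat =
  Ob :: "'o set"
  Hom :: "'o \<Rightarrow> 'o \<Rightarrow> 'a set"
  Ident :: "'o \<Rightarrow> 'a"
  Comp :: "'o \<Rightarrow> 'o \<Rightarrow> 'o \<Rightarrow> 'a \<Rightarrow> 'a \<Rightarrow> 'a"

definition category :: "('o, 'a, 'z) cat_scheme \<Rightarrow> bool" where
  "category C \<longleftrightarrow>
     (\<forall>X\<in>Ob C. Ident C X \<in> Hom C X X) \<and>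
     (\<forall>X\<in>Ob C. \<forall>Y\<in>Ob C. \<forall>Z\<in>Ob C. \<forall>f\<in>Hom C X Y. \<forall>g\<in>Hom C Y Z.
        Comp C X Y Z g f \<in> Hom C X Z) \<and>
     (\<forall>X\<in>Ob C. \<forall>Y\<in>Ob C. \<forall>f\<in>Hom C X Y.
        Comp C X X Y f (Ident C X) = f \<and> Comp C X Y Y (Ident C Y) f = f) \<and>
     (\<forall>X\<in>Ob C. \<forall>Y\<in>Ob C. \<forall>Z\<in>Ob C. \<forall>V\<in>Ob C.
        \<forall>f\<in>Hom C X Y. \<forall>g\<in>Hom C Y Z. \<forall>h\<in>Hom C Z V.
          Comp C X Z V h (Comp C X Y Z g f) = Comp C X Y V (Comp C Y Z V h g) f)"

definition iso_arr :: "('o, 'a, 'z) cat_scheme \<Rightarrow> 'o \<Rightarrow> 'o \<Rightarrow> 'a \<Rightarrow> bool" where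
  "iso_arr C X Y f \<longleftrightarrow> f \<in> Hom C X Y \<and>
     (\<exists>g\<in>Hom C Y X. Comp C X Y X g f = Ident C X \<and> Comp C Y X Y f g = Ident C Y)"

definition isomorphic :: "('o, 'a, 'z) cat_scheme \<Rightarrow> 'o \<Rightarrow> 'o \<Rightarrow> bool" where
  "isomorphic C X Y \<longleftrightarrow> (\<exists>f. iso_arr C X Y f)"

definition op_cat :: "('o, 'a, 'z) cat_scheme \<Rightarrow> ('o, 'a) cat" where
  "op_cat C = \<lparr>Ob = Ob C, Hom = (\<lambda>X Y. Hom C Y X), Ident = Ident C,
               Comp = (\<lambda>X Y Z g f. Comp C Z Y X f g)\<rparr>"

definition full_subcat :: "('o, 'a) cat \<Rightarrow> ('o \<Rightarrow> bool) \<Rightarrow> ('o, 'a) cat" where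
  "full_subcat C P = C\<lparr>Ob := {X \<in> Ob C. P X}\<rparr>"

record ('o1, 'a1, 'o2, 'a2) ftor =
  fob :: "'o1 \<Rightarrow> 'o2"
  far :: "'o1 \<Rightarrow> 'o1 \<Rightarrow> 'a1 \<Rightarrow> 'a2"

text \<open>
  Functors (and below also transformations, enriched categories and enriched functors) take the
  value \<open>undefined\<close> outside their domain, so that HOL equality is the intended equality.
\<close>

definition is_functor ::
  "('o1, 'a1, 'z1) cat_scheme \<Rightarrow> ('o2, 'a2, 'z2) cat_scheme \<Rightarrow>
   ('o1, 'a1, 'o2, 'a2, 'z) ftor_scheme \<Rightarrow> bool" where
  "is_functor C D F \<longleftrightarrow> category C \<and> category D \<and>
     fob F \<in> Ob C \<rightarrow>\<^sub>E Ob D \<and>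
     (\<forall>X Y f. \<not> (X \<in> Ob C \<and> Y \<in> Ob C \<and> f \<in> Hom C X Y) \<longrightarrow> far F X Y f = undefined) \<and>
     (\<forall>X\<in>Ob C. \<forall>Y\<in>Ob C. \<forall>f\<in>Hom C X Y. far F X Y f \<in> Hom D (fob F X) (fob F Y)) \<and>
     (\<forall>X\<in>Ob C. far F X X (Ident C X) = Ident D (fob F X)) \<and>
     (\<forall>X\<in>Ob C. \<forall>Y\<in>Ob C. \<forall>Z\<in>Ob C. \<forall>f\<in>Hom C X Y. \<forall>g\<in>Hom C Y Z.
        far F X Z (Comp C X Y Z g f) =
          Comp D (fob F X) (fob F Y) (fob F Z) (far F Y Z g) (far F X Y f))"

definition mk_ftor ::
  "('o1, 'a1, 'z) cat_scheme \<Rightarrow> ('o1 \<Rightarrow> 'o2) \<Rightarrow> ('o1 \<Rightarrow> 'o1 \<Rightarrow> 'a1 \<Rightarrow> 'a2) \<Rightarrow>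
   ('o1, 'a1, 'o2, 'a2) ftor" where
  "mk_ftor C fo fa =
     \<lparr>fob = (\<lambda>X\<in>Ob C. fo X),
      far = (\<lambda>X Y f. if X \<in> Ob C \<and> Y \<in> Ob C \<and> f \<in> Hom C X Y then fa X Y f else undefined)\<rparr>"

definition id_ftor :: "('o, 'a, 'z) cat_scheme \<Rightarrow> ('o, 'a, 'o, 'a) ftor" where
  "id_ftor C = mk_ftor C (\<lambda>X. X) (\<lambda>X Y f. f)"

definition comp_ftor ::
  "('o1, 'a1, 'z) cat_scheme \<Rightarrow> ('o2, 'a2, 'o3, 'a3, 'z2) ftor_scheme \<Rightarrow>
   ('o1, 'a1, 'o2, 'a2, 'z1) ftor_scheme \<Rightarrow> ('o1, 'a1, 'o3, 'a3) ftor" where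
  "comp_ftor C G F =
     mk_ftor C (\<lambda>X. fob G (fob F X)) (\<lambda>X Y f. far G (fob F X) (fob F Y) (far F X Y f))"

definition nat_trans ::
  "('o1, 'a1, 'z1) cat_scheme \<Rightarrow> ('o2, 'a2, 'z2) cat_scheme \<Rightarrow>
   ('o1, 'a1, 'o2, 'a2, 'z3) ftor_scheme \<Rightarrow> ('o1, 'a1, 'o2, 'a2, 'z4) ftor_scheme \<Rightarrow>
   ('o1 \<Rightarrow> 'a2) \<Rightarrow> bool" where
  "nat_trans C D F G t \<longleftrightarrow>
     t \<in> extensional (Ob C) \<and>
     (\<forall>X\<in>Ob C. t X \<in> Hom D (fob F X) (fob G X)) \<and>
     (\<forall>X\<in>Ob C. \<forall>Y\<in>Ob C. \<forall>f\<in>Hom C X Y.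
        Comp D (fob F X) (fob F Y) (fob G Y) (t Y) (far F X Y f) =
        Comp D (fob F X) (fob G X) (fob G Y) (far G X Y f) (t X))"

definition Fun ::
  "('o1, 'a1, 'z1) cat_scheme \<Rightarrow> ('o2, 'a2, 'z2) cat_scheme \<Rightarrow>
   (('o1, 'a1, 'o2, 'a2) ftor, 'o1 \<Rightarrow> 'a2) cat" where
  "Fun C D =
     \<lparr>Ob = {F. is_functor C D F},
      Hom = (\<lambda>F G. {t. nat_trans C D F G t}),
      Ident = (\<lambda>F. \<lambda>X\<in>Ob C. Ident D (fob F X)),
      Comp = (\<lambda>F G H s t. \<lambda>X\<in>Ob C. Comp D (fob F X) (fob G X) (fob H X) (s X) (t X))\<rparr>"

definition fully_faithful ::
  "('o1, 'a1, 'z1) cat_scheme \<Rightarrow> ('o2, 'a2, 'z2) cat_scheme \<Rightarrow>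
   ('o1, 'a1, 'o2, 'a2) ftor \<Rightarrow> bool" where
  "fully_faithful C D F \<longleftrightarrow> is_functor C D F \<and>
     (\<forall>X\<in>Ob C. \<forall>Y\<in>Ob C. bij_betw (far F X Y) (Hom C X Y) (Hom D (fob F X) (fob F Y)))"

definition equivalent_categories :: "('o1, 'a1) cat \<Rightarrow> ('o2, 'a2) cat \<Rightarrow> bool" where
  "equivalent_categories C D \<longleftrightarrow>
     (\<exists>(F :: ('o1, 'a1, 'o2, 'a2) ftor) (G :: ('o2, 'a2, 'o1, 'a1) ftor).
        is_functor C D F \<and> is_functor D C G \<and>
        isomorphic (Fun C C) (comp_ftor C G F) (id_ftor C) \<and>
        isomorphic (Fun D D) (comp_ftor D F G) (id_ftor D))"

definition right_adjoint ::
  "('o1, 'a1) cat \<Rightarrow> ('o2, 'a2) cat \<Rightarrow> ('o1, 'a1, 'o2, 'a2) ftor \<Rightarrow> bool" where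
  "right_adjoint C D R \<longleftrightarrow> is_functor C D R \<and>
     (\<exists>(L :: ('o2, 'a2, 'o1, 'a1) ftor) unit counit. is_functor D C L \<and>
        nat_trans D D (id_ftor D) (comp_ftor D R L) unit \<and>
        nat_trans C C (comp_ftor C L R) (id_ftor C) counit \<and>
        (\<forall>X\<in>Ob D. Comp C (fob L X) (fob L (fob R (fob L X))) (fob L X)
            (counit (fob L X)) (far L X (fob R (fob L X)) (unit X)) = Ident C (fob L X)) \<and>
        (\<forall>Y\<in>Ob C. Comp D (fob R Y) (fob R (fob L (fob R Y))) (fob R Y)
            (far R (fob L (fob R Y)) Y (counit Y)) (unit (fob R Y)) = Ident D (fob R Y)))"


section \<open>Colimits\<close>

definition initial :: "('o, 'a, 'z) cat_scheme \<Rightarrow> 'o \<Rightarrow> bool" where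
  "initial C z \<longleftrightarrow> z \<in> Ob C \<and> (\<forall>X\<in>Ob C. \<exists>!f. f \<in> Hom C z X)"

definition the_arr :: "('o, 'a, 'z) cat_scheme \<Rightarrow> 'o \<Rightarrow> 'o \<Rightarrow> 'a" where
  "the_arr C X Y = (THE f. f \<in> Hom C X Y)"

definition cocone ::
  "('j, 'k, 'z1) cat_scheme \<Rightarrow> ('o, 'a, 'z2) cat_scheme \<Rightarrow> ('j, 'k, 'o, 'a, 'z3) ftor_scheme \<Rightarrow>
   'o \<Rightarrow> ('j \<Rightarrow> 'a) \<Rightarrow> bool" where
  "cocone J C F c l \<longleftrightarrow> c \<in> Ob C \<and> (\<forall>j\<in>Ob J. l j \<in> Hom C (fob F j) c) \<and>
     (\<forall>j\<in>Ob J. \<forall>k\<in>Ob J. \<forall>f\<in>Hom J j k. Comp C (fob F j) (fob F k) c (l k) (far F j k f) = l j)"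

definition is_colimit ::
  "('j, 'k, 'z1) cat_scheme \<Rightarrow> ('o, 'a, 'z2) cat_scheme \<Rightarrow> ('j, 'k, 'o, 'a, 'z3) ftor_scheme \<Rightarrow>
   'o \<Rightarrow> ('j \<Rightarrow> 'a) \<Rightarrow> bool" where
  "is_colimit J C F c l \<longleftrightarrow> cocone J C F c l \<and>
     (\<forall>d m. cocone J C F d m \<longrightarrow>
        (\<exists>!h. h \<in> Hom C c d \<and> (\<forall>j\<in>Ob J. Comp C (fob F j) c d h (l j) = m j)))"

definition locally_small :: "'u itself \<Rightarrow> ('o, 'a, 'z) cat_scheme \<Rightarrow> bool" where
  "locally_small u C \<longleftrightarrow> (\<forall>X\<in>Ob C. \<forall>Y\<in>Ob C. small u (Hom C X Y))"

definition small_category :: "'u itself \<Rightarrow> ('o, 'a, 'z) cat_scheme \<Rightarrow> bool" where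
  "small_category u C \<longleftrightarrow> category C \<and> small u (Ob C) \<and> locally_small u C"

text \<open>
  Every small category is isomorphic to one whose objects and arrows are of type \<open>'u\<close>, so it
  suffices to index diagrams by the latter.
\<close>

definition cocomplete :: "'u itself \<Rightarrow> ('o, 'a, 'z) cat_scheme \<Rightarrow> bool" where
  "cocomplete u C \<longleftrightarrow>
     (\<forall>(J :: ('u, 'u) cat) (F :: ('u, 'u, 'o, 'a) ftor).
        small_category u J \<longrightarrow> is_functor J C F \<longrightarrow> (\<exists>c l. is_colimit J C F c l))"

definition preserves_colimits ::
  "'u itself \<Rightarrow> ('o1, 'a1, 'z1) cat_scheme \<Rightarrow> ('o2, 'a2, 'z2) cat_scheme \<Rightarrow>
   ('o1, 'a1, 'o2, 'a2) ftor \<Rightarrow> bool" where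
  "preserves_colimits u C D H \<longleftrightarrow>
     (\<forall>(J :: ('u, 'u) cat) (F :: ('u, 'u, 'o1, 'a1) ftor) c l.
        small_category u J \<longrightarrow> is_functor J C F \<longrightarrow> is_colimit J C F c l \<longrightarrow>
        is_colimit J D (comp_ftor J H F) (fob H c) (\<lambda>j. far H (fob F j) c (l j)))"


section \<open>Monoidal categories\<close>

text \<open>
  \<open>TensA W X X' Y Y' f g\<close> is the tensor product of \<open>f : X \<rightarrow> X'\<close> and \<open>g : Y \<rightarrow> Y'\<close>; the
  associator goes from \<open>(X \<otimes> Y) \<otimes> Z\<close> to \<open>X \<otimes> (Y \<otimes> Z)\<close>.
\<close>

record ('o, 'a) moncat = "('o, 'a) cat" +
  TensO :: "'o \<Rightarrow> 'o \<Rightarrow> 'o"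
  TensA :: "'o \<Rightarrow> 'o \<Rightarrow> 'o \<Rightarrow> 'o \<Rightarrow> 'a \<Rightarrow> 'a \<Rightarrow> 'a"
  Unit :: "'o"
  Assoc :: "'o \<Rightarrow> 'o \<Rightarrow> 'o \<Rightarrow> 'a"
  LUnit :: "'o \<Rightarrow> 'a"
  RUnit :: "'o \<Rightarrow> 'a"

definition monoidal_category :: "('o, 'a) moncat \<Rightarrow> bool" where
  "monoidal_category W \<longleftrightarrow> category W \<and>
     (let T = TensO W; TA = TensA W; I = Unit W; a = Assoc W; l = LUnit W; r = RUnit W;
          i = Ident W
      in
       I \<in> Ob W \<and>
       (\<forall>X\<in>Ob W. \<forall>Y\<in>Ob W. T X Y \<in> Ob W) \<and>
       (\<forall>X\<in>Ob W. \<forall>X'\<in>Ob W. \<forall>Y\<in>Ob W. \<forall>Y'\<in>Ob W. \<forall>f\<in>Hom W X X'. \<forall>g\<in>Hom W Y Y'.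
          TA X X' Y Y' f g \<in> Hom W (T X Y) (T X' Y')) \<and>
       (\<forall>X\<in>Ob W. \<forall>Y\<in>Ob W. TA X X Y Y (i X) (i Y) = i (T X Y)) \<and>
       (\<forall>X\<in>Ob W. \<forall>X'\<in>Ob W. \<forall>X''\<in>Ob W. \<forall>Y\<in>Ob W. \<forall>Y'\<in>Ob W. \<forall>Y''\<in>Ob W.
          \<forall>f\<in>Hom W X X'. \<forall>f'\<in>Hom W X' X''. \<forall>g\<in>Hom W Y Y'. \<forall>g'\<in>Hom W Y' Y''.
            TA X X'' Y Y'' (Comp W X X' X'' f' f) (Comp W Y Y' Y'' g' g) =
            Comp W (T X Y) (T X' Y') (T X'' Y'') (TA X' X'' Y' Y'' f' g') (TA X X' Y Y' f g)) \<and>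
       (\<forall>X\<in>Ob W. \<forall>Y\<in>Ob W. \<forall>Z\<in>Ob W. iso_arr W (T (T X Y) Z) (T X (T Y Z)) (a X Y Z)) \<and>
       (\<forall>X\<in>Ob W. iso_arr W (T I X) X (l X)) \<and>
       (\<forall>X\<in>Ob W. iso_arr W (T X I) X (r X)) \<and>
       (\<forall>X\<in>Ob W. \<forall>X'\<in>Ob W. \<forall>Y\<in>Ob W. \<forall>Y'\<in>Ob W. \<forall>Z\<in>Ob W. \<forall>Z'\<in>Ob W.
          \<forall>f\<in>Hom W X X'. \<forall>g\<in>Hom W Y Y'. \<forall>h\<in>Hom W Z Z'.
            Comp W (T (T X Y) Z) (T (T X' Y') Z') (T X' (T Y' Z'))
              (a X' Y' Z') (TA (T X Y) (T X' Y') Z Z' (TA X X' Y Y' f g) h) =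
            Comp W (T (T X Y) Z) (T X (T Y Z)) (T X' (T Y' Z'))
              (TA X X' (T Y Z) (T Y' Z') f (TA Y Y' Z Z' g h)) (a X Y Z)) \<and>
       (\<forall>X\<in>Ob W. \<forall>Y\<in>Ob W. \<forall>f\<in>Hom W X Y.
          Comp W (T I X) (T I Y) Y (l Y) (TA I I X Y (i I) f) = Comp W (T I X) X Y f (l X)) \<and>
       (\<forall>X\<in>Ob W. \<forall>Y\<in>Ob W. \<forall>f\<in>Hom W X Y.
          Comp W (T X I) (T Y I) Y (r Y) (TA X Y I I f (i I)) = Comp W (T X I) X Y f (r X)) \<and>
       (\<forall>X\<in>Ob W. \<forall>Y\<in>Ob W. \<forall>Z\<in>Ob W. \<forall>V\<in>Ob W.
          Comp W (T (T (T X Y) Z) V) (T (T X Y) (T Z V)) (T X (T Y (T Z V)))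
            (a X Y (T Z V)) (a (T X Y) Z V) =
          Comp W (T (T (T X Y) Z) V) (T X (T (T Y Z) V)) (T X (T Y (T Z V)))
            (TA X X (T (T Y Z) V) (T Y (T Z V)) (i X) (a Y Z V))
            (Comp W (T (T (T X Y) Z) V) (T (T X (T Y Z)) V) (T X (T (T Y Z) V))
              (a X (T Y Z) V)
              (TA (T (T X Y) Z) (T X (T Y Z)) V V (a X Y Z) (i V)))) \<and>
       (\<forall>X\<in>Ob W. \<forall>Y\<in>Ob W.
          Comp W (T (T X I) Y) (T X (T I Y)) (T X Y)
            (TA X X (T I Y) Y (i X) (l Y)) (a X I Y) =
          TA (T X I) X Y Y (r X) (i Y)))"

definition tensor_left :: "('o, 'a) moncat \<Rightarrow> 'o \<Rightarrow> ('o, 'a, 'o, 'a) ftor" where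
  "tensor_left W X = mk_ftor W (\<lambda>Y. TensO W X Y) (\<lambda>Y Z f. TensA W X X Y Z (Ident W X) f)"

definition tensor_right :: "('o, 'a) moncat \<Rightarrow> 'o \<Rightarrow> ('o, 'a, 'o, 'a) ftor" where
  "tensor_right W X = mk_ftor W (\<lambda>Y. TensO W Y X) (\<lambda>Y Z f. TensA W Y Z X X f (Ident W X))"

definition tensor_preserves_colimits :: "'u itself \<Rightarrow> ('o, 'a) moncat \<Rightarrow> bool" where
  "tensor_preserves_colimits u W \<longleftrightarrow>
     (\<forall>X\<in>Ob W. preserves_colimits u W W (tensor_left W X) \<and>
               preserves_colimits u W W (tensor_right W X))"

text \<open>A strong monoidal functor comes with \<open>Mu X Y : F X \<otimes> F Y \<rightarrow> F (X \<otimes> Y)\<close> and \<open>Eps : I \<rightarrow> F I\<close>.\<close>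

record ('o1, 'a1, 'o2, 'a2) mftor = "('o1, 'a1, 'o2, 'a2) ftor" +
  Mu :: "'o1 \<Rightarrow> 'o1 \<Rightarrow> 'a2"
  Eps :: "'a2"

definition strong_monoidal ::
  "('o1, 'a1) moncat \<Rightarrow> ('o2, 'a2) moncat \<Rightarrow> ('o1, 'a1, 'o2, 'a2) mftor \<Rightarrow> bool" where
  "strong_monoidal V W F \<longleftrightarrow> monoidal_category V \<and> monoidal_category W \<and> is_functor V W F \<and>
     (let T = TensO W; TA = TensA W; I = Unit W; i = Ident W; T' = TensO V; I' = Unit V;
          f = fob F
      in
       (\<forall>X Y. \<not> (X \<in> Ob V \<and> Y \<in> Ob V) \<longrightarrow> Mu F X Y = undefined) \<and>
       (\<forall>X\<in>Ob V. \<forall>Y\<in>Ob V. iso_arr W (T (f X) (f Y)) (f (T' X Y)) (Mu F X Y)) \<and>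
       iso_arr W I (f I') (Eps F) \<and>
       (\<forall>X\<in>Ob V. \<forall>X'\<in>Ob V. \<forall>Y\<in>Ob V. \<forall>Y'\<in>Ob V. \<forall>g\<in>Hom V X X'. \<forall>h\<in>Hom V Y Y'.
          Comp W (T (f X) (f Y)) (T (f X') (f Y')) (f (T' X' Y'))
            (Mu F X' Y') (TA (f X) (f X') (f Y) (f Y') (far F X X' g) (far F Y Y' h)) =
          Comp W (T (f X) (f Y)) (f (T' X Y)) (f (T' X' Y'))
            (far F (T' X Y) (T' X' Y') (TensA V X X' Y Y' g h)) (Mu F X Y)) \<and>
       (\<forall>X\<in>Ob V. \<forall>Y\<in>Ob V. \<forall>Z\<in>Ob V.
          Comp W (T (T (f X) (f Y)) (f Z)) (f (T' (T' X Y) Z)) (f (T' X (T' Y Z)))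
            (far F (T' (T' X Y) Z) (T' X (T' Y Z)) (Assoc V X Y Z))
            (Comp W (T (T (f X) (f Y)) (f Z)) (T (f (T' X Y)) (f Z)) (f (T' (T' X Y) Z))
              (Mu F (T' X Y) Z)
              (TA (T (f X) (f Y)) (f (T' X Y)) (f Z) (f Z) (Mu F X Y) (i (f Z)))) =
          Comp W (T (T (f X) (f Y)) (f Z)) (T (f X) (T (f Y) (f Z))) (f (T' X (T' Y Z)))
            (Comp W (T (f X) (T (f Y) (f Z))) (T (f X) (f (T' Y Z))) (f (T' X (T' Y Z)))
              (Mu F X (T' Y Z))
              (TA (f X) (f X) (T (f Y) (f Z)) (f (T' Y Z)) (i (f X)) (Mu F Y Z)))
            (Assoc W (f X) (f Y) (f Z))) \<and>
       (\<forall>X\<in>Ob V.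
          Comp W (T I (f X)) (f (T' I' X)) (f X)
            (far F (T' I' X) X (LUnit V X))
            (Comp W (T I (f X)) (T (f I') (f X)) (f (T' I' X))
              (Mu F I' X) (TA I (f I') (f X) (f X) (Eps F) (i (f X)))) =
          LUnit W (f X)) \<and>
       (\<forall>X\<in>Ob V.
          Comp W (T (f X) I) (f (T' X I')) (f X)
            (far F (T' X I') X (RUnit V X))
            (Comp W (T (f X) I) (T (f X) (f I')) (f (T' X I'))
              (Mu F X I') (TA (f X) (f X) I (f I') (i (f X)) (Eps F))) =
          RUnit W (f X)))"

definition monoidal_nat_trans ::
  "('o1, 'a1) moncat \<Rightarrow> ('o2, 'a2) moncat \<Rightarrow> ('o1, 'a1, 'o2, 'a2) mftor \<Rightarrow>
   ('o1, 'a1, 'o2, 'a2) mftor \<Rightarrow> ('o1 \<Rightarrow> 'a2) \<Rightarrow> bool" where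
  "monoidal_nat_trans V W F G t \<longleftrightarrow> nat_trans V W F G t \<and>
     (\<forall>X\<in>Ob V. \<forall>Y\<in>Ob V.
        Comp W (TensO W (fob F X) (fob F Y)) (fob F (TensO V X Y)) (fob G (TensO V X Y))
          (t (TensO V X Y)) (Mu F X Y) =
        Comp W (TensO W (fob F X) (fob F Y)) (TensO W (fob G X) (fob G Y)) (fob G (TensO V X Y))
          (Mu G X Y) (TensA W (fob F X) (fob G X) (fob F Y) (fob G Y) (t X) (t Y))) \<and>
     Comp W (Unit W) (fob F (Unit V)) (fob G (Unit V)) (t (Unit V)) (Eps F) = Eps G"

definition StrMon ::
  "('o1, 'a1) moncat \<Rightarrow> ('o2, 'a2) moncat \<Rightarrow>
   (('o1, 'a1, 'o2, 'a2) mftor, 'o1 \<Rightarrow> 'a2) cat" where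
  "StrMon V W =
     \<lparr>Ob = {F. strong_monoidal V W F},
      Hom = (\<lambda>F G. {t. monoidal_nat_trans V W F G t}),
      Ident = (\<lambda>F. \<lambda>X\<in>Ob V. Ident W (fob F X)),
      Comp = (\<lambda>F G H s t. \<lambda>X\<in>Ob V. Comp W (fob F X) (fob G X) (fob H X) (s X) (t X))\<rparr>"


section \<open>Enriched categories\<close>

text \<open>\<open>wComp C x y z\<close> is the composition \<open>C(x,y) \<otimes> C(y,z) \<rightarrow> C(x,z)\<close>.\<close>

record ('v, 'o, 'a) wcat =
  wOb :: "'v set"
  wHom :: "'v \<Rightarrow> 'v \<Rightarrow> 'o"
  wComp :: "'v \<Rightarrow> 'v \<Rightarrow> 'v \<Rightarrow> 'a"
  wId :: "'v \<Rightarrow> 'a"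

definition is_wcat :: "('o, 'a) moncat \<Rightarrow> ('v, 'o, 'a) wcat \<Rightarrow> bool" where
  "is_wcat W C \<longleftrightarrow>
     (let T = TensO W; TA = TensA W; I = Unit W; i = Ident W; V = wOb C; h = wHom C; M = wComp C
      in
       (\<forall>x y. \<not> (x \<in> V \<and> y \<in> V) \<longrightarrow> h x y = undefined) \<and>
       (\<forall>x y z. \<not> (x \<in> V \<and> y \<in> V \<and> z \<in> V) \<longrightarrow> M x y z = undefined) \<and>
       wId C \<in> extensional V \<and>
       (\<forall>x\<in>V. \<forall>y\<in>V. h x y \<in> Ob W) \<and>
       (\<forall>x\<in>V. \<forall>y\<in>V. \<forall>z\<in>V. M x y z \<in> Hom W (T (h x y) (h y z)) (h x z)) \<and>
       (\<forall>x\<in>V. wId C x \<in> Hom W I (h x x)) \<and>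
       (\<forall>x\<in>V. \<forall>y\<in>V. \<forall>z\<in>V. \<forall>w\<in>V.
          Comp W (T (T (h x y) (h y z)) (h z w)) (T (h x z) (h z w)) (h x w)
            (M x z w)
            (TA (T (h x y) (h y z)) (h x z) (h z w) (h z w) (M x y z) (i (h z w))) =
          Comp W (T (T (h x y) (h y z)) (h z w)) (T (h x y) (T (h y z) (h z w))) (h x w)
            (Comp W (T (h x y) (T (h y z) (h z w))) (T (h x y) (h y w)) (h x w)
              (M x y w)
              (TA (h x y) (h x y) (T (h y z) (h z w)) (h y w) (i (h x y)) (M y z w)))
            (Assoc W (h x y) (h y z) (h z w))) \<and>
       (\<forall>x\<in>V. \<forall>y\<in>V.
          Comp W (T I (h x y)) (T (h x x) (h x y)) (h x y)
            (M x x y) (TA I (h x x) (h x y) (h x y) (wId C x) (i (h x y))) =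
          LUnit W (h x y)) \<and>
       (\<forall>x\<in>V. \<forall>y\<in>V.
          Comp W (T (h x y) I) (T (h x y) (h y y)) (h x y)
            (M x y y) (TA (h x y) (h x y) I (h y y) (i (h x y)) (wId C y)) =
          RUnit W (h x y)))"

record ('v, 'a) wfun =
  wfO :: "'v \<Rightarrow> 'v"
  wfH :: "'v \<Rightarrow> 'v \<Rightarrow> 'a"

definition is_wfunctor ::
  "('o, 'a) moncat \<Rightarrow> ('v, 'o, 'a) wcat \<Rightarrow> ('v, 'o, 'a) wcat \<Rightarrow> ('v, 'a) wfun \<Rightarrow> bool" where
  "is_wfunctor W C D F \<longleftrightarrow>
     (let T = TensO W; V = wOb C; h = wHom C; k = wHom D; f = wfO F; fh = wfH F
      in
       f \<in> V \<rightarrow>\<^sub>E wOb D \<and>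
       (\<forall>x y. \<not> (x \<in> V \<and> y \<in> V) \<longrightarrow> fh x y = undefined) \<and>
       (\<forall>x\<in>V. \<forall>y\<in>V. fh x y \<in> Hom W (h x y) (k (f x) (f y))) \<and>
       (\<forall>x\<in>V. \<forall>y\<in>V. \<forall>z\<in>V.
          Comp W (T (h x y) (h y z)) (h x z) (k (f x) (f z)) (fh x z) (wComp C x y z) =
          Comp W (T (h x y) (h y z)) (T (k (f x) (f y)) (k (f y) (f z))) (k (f x) (f z))
            (wComp D (f x) (f y) (f z))
            (TensA W (h x y) (k (f x) (f y)) (h y z) (k (f y) (f z)) (fh x y) (fh y z))) \<and>
       (\<forall>x\<in>V. Comp W (Unit W) (h x x) (k (f x) (f x)) (fh x x) (wId C x) = wId D (f x)))"

definition id_wfun :: "('o, 'a) moncat \<Rightarrow> ('v, 'o, 'a) wcat \<Rightarrow> ('v, 'a) wfun" where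
  "id_wfun W C =
     \<lparr>wfO = (\<lambda>x\<in>wOb C. x),
      wfH = (\<lambda>x y. if x \<in> wOb C \<and> y \<in> wOb C then Ident W (wHom C x y) else undefined)\<rparr>"

definition comp_wfun ::
  "('o, 'a) moncat \<Rightarrow> ('v, 'o, 'a) wcat \<Rightarrow> ('v, 'o, 'a) wcat \<Rightarrow> ('v, 'o, 'a) wcat \<Rightarrow>
   ('v, 'a) wfun \<Rightarrow> ('v, 'a) wfun \<Rightarrow> ('v, 'a) wfun" where
  "comp_wfun W C D E G F =
     \<lparr>wfO = (\<lambda>x\<in>wOb C. wfO G (wfO F x)),
      wfH = (\<lambda>x y. if x \<in> wOb C \<and> y \<in> wOb C then
               Comp W (wHom C x y) (wHom D (wfO F x) (wfO F y))
                 (wHom E (wfO G (wfO F x)) (wfO G (wfO F y)))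
                 (wfH G (wfO F x) (wfO F y)) (wfH F x y)
             else undefined)\<rparr>"

definition WCat ::
  "'u itself \<Rightarrow> ('o, 'a) moncat \<Rightarrow> (('u pt, 'o, 'a) wcat, ('u pt, 'a) wfun) cat" where
  "WCat u W =
     \<lparr>Ob = {C. is_wcat W C \<and> small u (wOb C)},
      Hom = (\<lambda>C D. {F. is_wfunctor W C D F}),
      Ident = id_wfun W,
      Comp = comp_wfun W\<rparr>"


section \<open>The simplex category, simplicial sets, necklaces\<close>

text \<open>The ordinal \<open>[n]\<close> is represented by the number \<open>n\<close>.\<close>

definition Delta :: "(nat, nat \<Rightarrow> nat) cat" where
  "Delta =
     \<lparr>Ob = UNIV,
      Hom = (\<lambda>m n. {f \<in> {..m} \<rightarrow>\<^sub>E {..n}. mono_on {..m} f}),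
      Ident = (\<lambda>n. \<lambda>k\<in>{..n}. k),
      Comp = (\<lambda>m n p g f. compose {..m} g f)\<rparr>"

text \<open>Small sets with elements of type \<open>'x\<close>, and simplicial objects therein.\<close>

definition SetCat :: "'u itself \<Rightarrow> ('x set, 'x \<Rightarrow> 'x) cat" where
  "SetCat u =
     \<lparr>Ob = {X. small u X},
      Hom = (\<lambda>X Y. X \<rightarrow>\<^sub>E Y),
      Ident = (\<lambda>X. \<lambda>x\<in>X. x),
      Comp = (\<lambda>X Y Z g f. compose X g f)\<rparr>"

type_synonym 'x sset = "(nat, nat \<Rightarrow> nat, 'x set, 'x \<Rightarrow> 'x) ftor"

definition SSet :: "'u itself \<Rightarrow> ('x sset, nat \<Rightarrow> 'x \<Rightarrow> 'x) cat" where
  "SSet u = Fun (op_cat Delta) (SetCat u)"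

definition Delta_f_Hom :: "nat \<Rightarrow> nat \<Rightarrow> (nat \<Rightarrow> nat) set" where
  "Delta_f_Hom m n = {f \<in> Hom Delta m n. f 0 = 0 \<and> f m = n}"

text \<open>
  A necklace is a pair \<open>(T, p)\<close> with \<open>{0, p} \<subseteq> T \<subseteq> [p]\<close>: the necklace with \<open>p + 1\<close> vertices and set
  of joints (including the two basepoints) \<open>T\<close>.  The wedge places the second necklace after the
  first one.
\<close>

type_synonym necklace = "nat set \<times> nat"

definition simplex :: "nat \<Rightarrow> necklace" where
  "simplex n = ({0, n}, n)"

definition wedge :: "necklace \<Rightarrow> necklace \<Rightarrow> necklace" where
  "wedge A B = (fst A \<union> (\<lambda>k. snd A + k) ` fst B, snd A + snd B)"

definition wedge_map :: "necklace \<Rightarrow> necklace \<Rightarrow> necklace \<Rightarrow> necklace \<Rightarrow>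
    (nat \<Rightarrow> nat) \<Rightarrow> (nat \<Rightarrow> nat) \<Rightarrow> nat \<Rightarrow> nat" where
  "wedge_map A A' B B' f g =
     (\<lambda>k\<in>{..snd A + snd B}. if k \<le> snd A then f k else snd A' + g (k - snd A))"

text \<open>
  The wedge is strictly associative and unital in this presentation, so all coherence
  isomorphisms are identities.
\<close>

definition Nec :: "(necklace, nat \<Rightarrow> nat) moncat" where
  "Nec =
     \<lparr>Ob = {(T, p). {0, p} \<subseteq> T \<and> T \<subseteq> {..p}},
      Hom = (\<lambda>(T, p) (U, q). {f \<in> Delta_f_Hom p q. U \<subseteq> f ` T}),
      Ident = (\<lambda>(T, p). Ident Delta p),
      Comp = (\<lambda>(T, p) (U, q) (V, r). Comp Delta p q r),
      TensO = wedge,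
      TensA = wedge_map,
      Unit = simplex 0,
      Assoc = (\<lambda>A B C. Ident Delta (snd A + snd B + snd C)),
      LUnit = (\<lambda>A. Ident Delta (snd A)),
      RUnit = (\<lambda>A. Ident Delta (snd A))\<rparr>"


section \<open>The functor from strong monoidal functors to diagrams of enriched categories\<close>

text \<open>
  Throughout, \<open>z\<close> is the chosen initial object of \<open>W\<close>, and the vertex \<open>i\<close> of \<open>[n]\<close> is the object
  \<open>Inl i\<close>.
\<close>

definition Phi_Hom ::
  "'o \<Rightarrow> (necklace, nat \<Rightarrow> nat, 'o, 'a) mftor \<Rightarrow> nat \<Rightarrow> nat \<Rightarrow> 'o" where
  "Phi_Hom z D i j = (if i \<le> j then fob D (simplex (j - i)) else z)"

text \<open>
  Unless \<open>i \<le> k \<le> j\<close>, the domain of the composition is a tensor product with an initial factor,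
  hence is itself initial, and there is only one possible composition.
\<close>

definition Phi_Comp ::
  "('o, 'a) moncat \<Rightarrow> 'o \<Rightarrow> (necklace, nat \<Rightarrow> nat, 'o, 'a) mftor \<Rightarrow> nat \<Rightarrow> nat \<Rightarrow> nat \<Rightarrow> 'a" where
  "Phi_Comp W z D i k j =
     (if i \<le> k \<and> k \<le> j then
        Comp W (TensO W (fob D (simplex (k - i))) (fob D (simplex (j - k))))
          (fob D (wedge (simplex (k - i)) (simplex (j - k)))) (fob D (simplex (j - i)))
          (far D (wedge (simplex (k - i)) (simplex (j - k))) (simplex (j - i)) (Ident Delta (j - i)))
          (Mu D (simplex (k - i)) (simplex (j - k)))
      else the_arr W (TensO W (Phi_Hom z D i k) (Phi_Hom z D k j)) (Phi_Hom z D i j))"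

definition Phi_ob ::
  "('o, 'a) moncat \<Rightarrow> 'o \<Rightarrow> (necklace, nat \<Rightarrow> nat, 'o, 'a) mftor \<Rightarrow> nat \<Rightarrow>
   ('u pt, 'o, 'a) wcat" where
  "Phi_ob W z D n =
     (let V = Inl ` {..n} in
      \<lparr>wOb = V,
       wHom = (\<lambda>x y. if x \<in> V \<and> y \<in> V then Phi_Hom z D (projl x) (projl y) else undefined),
       wComp = (\<lambda>x y v. if x \<in> V \<and> y \<in> V \<and> v \<in> V
                  then Phi_Comp W z D (projl x) (projl y) (projl v) else undefined),
       wId = (\<lambda>x\<in>V. Eps D)\<rparr>)"

definition Phi_ar ::
  "('o, 'a) moncat \<Rightarrow> 'o \<Rightarrow> (necklace, nat \<Rightarrow> nat, 'o, 'a) mftor \<Rightarrow> nat \<Rightarrow> nat \<Rightarrow>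
   (nat \<Rightarrow> nat) \<Rightarrow> ('u pt, 'a) wfun" where
  "Phi_ar W z D m n f =
     (let V = Inl ` {..m} in
      \<lparr>wfO = (\<lambda>x\<in>V. Inl (f (projl x))),
       wfH = (\<lambda>x y. if x \<in> V \<and> y \<in> V then
                (let i = projl x; j = projl y in
                 if i \<le> j then far D (simplex (j - i)) (simplex (f j - f i))
                                 (\<lambda>k\<in>{..j - i}. f (k + i) - f i)
                 else the_arr W z (Phi_Hom z D (f i) (f j)))
              else undefined)\<rparr>)"

definition Phi_diagram ::
  "('o, 'a) moncat \<Rightarrow> 'o \<Rightarrow> (necklace, nat \<Rightarrow> nat, 'o, 'a) mftor \<Rightarrow>
   (nat, nat \<Rightarrow> nat, ('u pt, 'o, 'a) wcat, ('u pt, 'a) wfun) ftor" where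
  "Phi_diagram W z D = mk_ftor Delta (Phi_ob W z D) (Phi_ar W z D)"

definition Phi_nat ::
  "('o, 'a) moncat \<Rightarrow> 'o \<Rightarrow> (necklace \<Rightarrow> 'a) \<Rightarrow> nat \<Rightarrow> ('u pt, 'a) wfun" where
  "Phi_nat W z t n =
     (let V = Inl ` {..n} in
      \<lparr>wfO = (\<lambda>x\<in>V. x),
       wfH = (\<lambda>x y. if x \<in> V \<and> y \<in> V then
                (let i = projl x; j = projl y in
                 if i \<le> j then t (simplex (j - i)) else Ident W z)
              else undefined)\<rparr>)"

definition Phi ::
  "'u itself \<Rightarrow> ('o, 'a) moncat \<Rightarrow> 'o \<Rightarrow>
   ((necklace, nat \<Rightarrow> nat, 'o, 'a) mftor, necklace \<Rightarrow> 'a,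
    (nat, nat \<Rightarrow> nat, ('u pt, 'o, 'a) wcat, ('u pt, 'a) wfun) ftor, nat \<Rightarrow> ('u pt, 'a) wfun) ftor"
  where
  "Phi u W z = mk_ftor (StrMon Nec W) (Phi_diagram W z) (\<lambda>D E t. Phi_nat W z t)"


section \<open>Necklicial nerves\<close>

text \<open>
  Simplices of a nerve are enriched functors, hence the element type of the simplicial sets.
\<close>

type_synonym ('u, 'o, 'a) nerve_functor =
  "(('u pt, 'o, 'a) wcat, ('u pt, 'a) wfun,
    ('u pt, 'a) wfun sset, nat \<Rightarrow> ('u pt, 'a) wfun \<Rightarrow> ('u pt, 'a) wfun) ftor"

definition nerve ::
  "'u itself \<Rightarrow> ('o, 'a) moncat \<Rightarrow>
   (nat, nat \<Rightarrow> nat, ('u pt, 'o, 'a) wcat, ('u pt, 'a) wfun) ftor \<Rightarrow>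
   ('u, 'o, 'a) nerve_functor" where
  "nerve u W DD =
     mk_ftor (WCat u W)
       (\<lambda>C. mk_ftor (op_cat Delta)
          (\<lambda>n. Hom (WCat u W) (fob DD n) C)
          (\<lambda>n m f. \<lambda>x\<in>Hom (WCat u W) (fob DD n) C.
             Comp (WCat u W) (fob DD m) (fob DD n) C x (far DD m n f)))
       (\<lambda>C C' G. \<lambda>n. \<lambda>x\<in>Hom (WCat u W) (fob DD n) C.
          Comp (WCat u W) (fob DD n) C C' G x)"

definition RightAdjoints ::
  "'u itself \<Rightarrow> ('o, 'a) moncat \<Rightarrow>
   (('u, 'o, 'a) nerve_functor,
    ('u pt, 'o, 'a) wcat \<Rightarrow> nat \<Rightarrow> ('u pt, 'a) wfun \<Rightarrow> ('u pt, 'a) wfun) cat" where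
  "RightAdjoints u W =
     full_subcat (Fun (WCat u W) (SSet u)) (right_adjoint (WCat u W) (SSet u))"

definition necklicial ::
  "'u itself \<Rightarrow> ('o, 'a) moncat \<Rightarrow> 'o \<Rightarrow> ('u, 'o, 'a) nerve_functor \<Rightarrow> bool" where
  "necklicial u W z R \<longleftrightarrow>
     (\<exists>DD\<in>Ob (Fun Delta (WCat u W)). R = nerve u W DD \<and>
        (\<exists>D\<in>Ob (StrMon Nec W). isomorphic (Fun Delta (WCat u W)) DD (fob (Phi u W z) D)))"

definition NerveNec ::
  "'u itself \<Rightarrow> ('o, 'a) moncat \<Rightarrow> 'o \<Rightarrow>
   (('u, 'o, 'a) nerve_functor,
    ('u pt, 'o, 'a) wcat \<Rightarrow> nat \<Rightarrow> ('u pt, 'a) wfun \<Rightarrow> ('u pt, 'a) wfun) cat" where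
  "NerveNec u W z = full_subcat (RightAdjoints u W) (necklicial u W z)"

end

theory Submission
  imports Defs
begin

text \<open>
  The construction \<open>\<Phi>(D)\<close> makes sense for every necklace \<open>A\<close>, not only for simplices: \<open>Psi W z D A\<close> has
  the vertices of \<open>A\<close> as objects and the value of \<open>D\<close> at the sub-necklace between \<open>i\<close> and \<open>j\<close> as
  hom-object.  As \<open>D\<close> is strong monoidal, this enriched category is glued from its beads, that is,
  enriched functors from it to \<open>C\<close> are the simplicial maps from \<open>A\<close> to the nerve of \<open>C\<close>.  A natural
  transformation \<open>\<Phi>(D) \<rightarrow> \<Phi>(E)\<close> therefore extends uniquely to all necklaces, and its action on the
  hom-object between the endpoints of \<open>A\<close> is the component at \<open>A\<close> of the monoidal transformation
  sought.

  For the equivalence, the nerve of \<open>\<Phi>(D)\<close> has a left adjoint: it sends a simplicial set \<open>X\<close> to the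
  enriched category on the vertices of \<open>X\<close> whose hom-object from \<open>a\<close> to \<open>b\<close> is the colimit of \<open>D\<close> over
  the necklaces in \<open>X\<close> from \<open>a\<close> to \<open>b\<close>.  Concatenation of necklaces gives the composition, since the
  tensor product preserves colimits, and gluing along necklaces gives the universal property.  By
  the Yoneda lemma the nerve is fully faithful in the cosimplicial object, hence so is the functor
  sending \<open>D\<close> to the nerve of \<open>\<Phi>(D)\<close>.
\<close>

section \<open>Categories and functors\<close>

text \<open>The hom-objects of \<open>Phi\<close> at i > j are initial, and a tensor product with an
  initial factor is again initial. Every equation whose source contains a backward hom-object
  therefore holds by uniqueness, and only chains i \<le> k \<le> j carry content. Along such a chain
  the composition of \<open>Psi\<close> is \<open>mu\<close> followed by D of the vertex identity
  that forgets the joint k. If k is a joint already, nothing is forgotten and the composition is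
  invertible; this is why the beads determine an enriched functor. Inclusions of sub-necklaces move
  the basepoints. Naturality is therefore set up for all simplicial maps between necklaces
  (\<open>nmaps\<close>), while D acts on their bipointed restrictions \<open>seg\<close>. Being a
  right adjoint is part of membership in \<open>NerveNec\<close>, so a left adjoint must be
  exhibited for every D; the colimits over necklaces take the place of a cocompleteness theorem for
  enriched categories. The universe is only regular, so that the smallness of the sets of simplices
  of a nerve rests on the finiteness of [n].\<close>

context
  fixes C :: "('o, 'a, 'z) cat_scheme"
  assumes C: "category C"
begin

lemma category_Ident: "X \<in> Ob C \<Longrightarrow> Ident C X \<in> Hom C X X"
  using C unfolding category_def by blast

lemma category_Comp:
  "\<lbrakk>f \<in> Hom C X Y; g \<in> Hom C Y Z; X \<in> Ob C; Y \<in> Ob C; Z \<in> Ob C\<rbrakk> \<Longrightarrow> Comp C X Y Z g f \<in> Hom C X Z"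
  using C unfolding category_def by blast

lemma category_Comp_Ident:
  "\<lbrakk>f \<in> Hom C X Y; X \<in> Ob C; Y \<in> Ob C\<rbrakk> \<Longrightarrow> Comp C X X Y f (Ident C X) = f"
  using C unfolding category_def by blast

lemma category_Ident_Comp:
  "\<lbrakk>f \<in> Hom C X Y; X \<in> Ob C; Y \<in> Ob C\<rbrakk> \<Longrightarrow> Comp C X Y Y (Ident C Y) f = f"
  using C unfolding category_def by blast

lemma category_assoc:
  "\<lbrakk>f \<in> Hom C X Y; g \<in> Hom C Y Z; h \<in> Hom C Z V; X \<in> Ob C; Y \<in> Ob C; Z \<in> Ob C; V \<in> Ob C\<rbrakk> \<Longrightarrow>
     Comp C X Y V (Comp C Y Z V h g) f = Comp C X Z V h (Comp C X Y Z g f)"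
  using C unfolding category_def by metis

lemmas category_simps =
  category_Ident category_Comp category_Comp_Ident category_Ident_Comp category_assoc

lemma iso_arrE:
  assumes "iso_arr C X Y f"
  obtains g where "f \<in> Hom C X Y" "g \<in> Hom C Y X"
    "Comp C X Y X g f = Ident C X" "Comp C Y X Y f g = Ident C Y"
  using assms unfolding iso_arr_def by blast

lemma iso_arr_cancel_left:
  assumes "iso_arr C Y Z e" "f \<in> Hom C X Y" "g \<in> Hom C X Y"
    and "X \<in> Ob C" "Y \<in> Ob C" "Z \<in> Ob C"
    and eq: "Comp C X Y Z e f = Comp C X Y Z e g"
  shows "f = g"
proof -
  obtain e' where e: "e \<in> Hom C Y Z" "e' \<in> Hom C Z Y" "Comp C Y Z Y e' e = Ident C Y"
    by (rule iso_arrE[OF assms(1)]) blast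
  have "Comp C X Y Y (Comp C Y Z Y e' e) f = Comp C X Y Y (Comp C Y Z Y e' e) g"
    using assms e(1,2) eq by (simp add: category_assoc)
  then show ?thesis using assms e by (simp add: category_Ident_Comp)
qed

lemma category_op_cat: "category (op_cat C)"
  unfolding category_def by (auto simp: op_cat_def category_simps)

end

lemma op_cat_simps [simp]:
  "Ob (op_cat C) = Ob C" "Hom (op_cat C) X Y = Hom C Y X" "Ident (op_cat C) = Ident C"
  "Comp (op_cat C) X Y Z g f = Comp C Z Y X f g"
  by (simp_all add: op_cat_def)

lemma full_subcat_simps [simp]:
  "Ob (full_subcat C P) = {X \<in> Ob C. P X}" "Hom (full_subcat C P) = Hom C"
  "Ident (full_subcat C P) = Ident C" "Comp (full_subcat C P) = Comp C"
  by (simp_all add: full_subcat_def)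

lemma category_full_subcat: "category C \<Longrightarrow> category (full_subcat C P)"
  unfolding category_def by simp

context
  fixes C :: "('o1, 'a1, 'z1) cat_scheme" and D :: "('o2, 'a2, 'z2) cat_scheme"
    and F :: "('o1, 'a1, 'o2, 'a2, 'z) ftor_scheme"
  assumes F: "is_functor C D F"
begin

lemma functor_dom: "category C" and functor_cod: "category D"
  using F unfolding is_functor_def by blast+

lemma functor_ob: "X \<in> Ob C \<Longrightarrow> fob F X \<in> Ob D"
  using F unfolding is_functor_def by blast

lemma functor_ar: "\<lbrakk>f \<in> Hom C X Y; X \<in> Ob C; Y \<in> Ob C\<rbrakk> \<Longrightarrow> far F X Y f \<in> Hom D (fob F X) (fob F Y)"
  using F unfolding is_functor_def by blast

lemma functor_Ident: "X \<in> Ob C \<Longrightarrow> far F X X (Ident C X) = Ident D (fob F X)"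
  using F unfolding is_functor_def by blast

lemma functor_Comp:
  "\<lbrakk>f \<in> Hom C X Y; g \<in> Hom C Y Z; X \<in> Ob C; Y \<in> Ob C; Z \<in> Ob C\<rbrakk> \<Longrightarrow>
     far F X Z (Comp C X Y Z g f) =
       Comp D (fob F X) (fob F Y) (fob F Z) (far F Y Z g) (far F X Y f)"
  using F unfolding is_functor_def by blast

lemma functor_undef:
  "X \<notin> Ob C \<Longrightarrow> fob F X = undefined"
  "\<not> (X \<in> Ob C \<and> Y \<in> Ob C \<and> f \<in> Hom C X Y) \<Longrightarrow> far F X Y f = undefined"
  using F unfolding is_functor_def by (auto simp: PiE_def extensional_def)

end

lemmas functor_simps = functor_ob functor_ar functor_Ident functor_Comp

lemma mk_ftor_simps:
  "X \<in> Ob C \<Longrightarrow> fob (mk_ftor C fo fa) X = fo X"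
  "\<lbrakk>X \<in> Ob C; Y \<in> Ob C; f \<in> Hom C X Y\<rbrakk> \<Longrightarrow> far (mk_ftor C fo fa) X Y f = fa X Y f"
  by (simp_all add: mk_ftor_def)

lemma is_functor_mk_ftor:
  assumes "category C" "category D"
    and "\<And>X. X \<in> Ob C \<Longrightarrow> fo X \<in> Ob D"
    and "\<And>X Y f. \<lbrakk>X \<in> Ob C; Y \<in> Ob C; f \<in> Hom C X Y\<rbrakk> \<Longrightarrow> fa X Y f \<in> Hom D (fo X) (fo Y)"
    and "\<And>X. X \<in> Ob C \<Longrightarrow> fa X X (Ident C X) = Ident D (fo X)"
    and "\<And>X Y Z f g. \<lbrakk>X \<in> Ob C; Y \<in> Ob C; Z \<in> Ob C; f \<in> Hom C X Y; g \<in> Hom C Y Z\<rbrakk> \<Longrightarrow>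
          fa X Z (Comp C X Y Z g f) = Comp D (fo X) (fo Y) (fo Z) (fa Y Z g) (fa X Y f)"
  shows "is_functor C D (mk_ftor C fo fa)"
  unfolding is_functor_def
  using assms category_Ident[OF assms(1)] category_Comp[OF assms(1)]
  by (auto simp: mk_ftor_def)

text \<open>Both functors are \<open>undefined\<close> off C, so agreement on C decides equality;
  the codomain categories D and D' may differ.\<close>

lemma ftor_eqI:
  assumes "is_functor C D (F :: ('o1, 'a1, 'o2, 'a2) ftor)" "is_functor C D' G"
    and "\<And>X. X \<in> Ob C \<Longrightarrow> fob F X = fob G X"
    and "\<And>X Y f. \<lbrakk>X \<in> Ob C; Y \<in> Ob C; f \<in> Hom C X Y\<rbrakk> \<Longrightarrow> far F X Y f = far G X Y f"
  shows "F = G"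
proof -
  have "fob F = fob G"
  proof
    fix X show "fob F X = fob G X"
      using assms(3) functor_undef(1)[OF assms(1)] functor_undef(1)[OF assms(2)]
      by (cases "X \<in> Ob C") auto
  qed
  moreover have "far F = far G"
  proof (intro ext)
    fix X Y f show "far F X Y f = far G X Y f"
      using assms(4) functor_undef(2)[OF assms(1)] functor_undef(2)[OF assms(2)]
      by (cases "X \<in> Ob C \<and> Y \<in> Ob C \<and> f \<in> Hom C X Y") auto
  qed
  ultimately show ?thesis by (cases F; cases G) simp
qed

lemma is_functor_comp:
  assumes "is_functor C D F" "is_functor D E G"
  shows "is_functor C E (comp_ftor C G F)"
  unfolding comp_ftor_def
  using functor_dom[OF assms(1)] functor_cod[OF assms(2)]
    functor_simps[OF assms(1)] functor_simps[OF assms(2)]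
  by (intro is_functor_mk_ftor) simp_all

lemma is_functor_id: "category C \<Longrightarrow> is_functor C C (id_ftor C)"
  unfolding id_ftor_def by (rule is_functor_mk_ftor) auto

lemma comp_ftor_simps:
  "X \<in> Ob C \<Longrightarrow> fob (comp_ftor C G F) X = fob G (fob F X)"
  "\<lbrakk>X \<in> Ob C; Y \<in> Ob C; f \<in> Hom C X Y\<rbrakk> \<Longrightarrow>
     far (comp_ftor C G F) X Y f = far G (fob F X) (fob F Y) (far F X Y f)"
  by (simp_all add: comp_ftor_def mk_ftor_simps)

lemma id_ftor_simps:
  "X \<in> Ob C \<Longrightarrow> fob (id_ftor C) X = X"
  "\<lbrakk>X \<in> Ob C; Y \<in> Ob C; f \<in> Hom C X Y\<rbrakk> \<Longrightarrow> far (id_ftor C) X Y f = f"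
  by (simp_all add: id_ftor_def mk_ftor_simps)

lemma nat_transD:
  assumes "nat_trans C D F G t"
  shows "t \<in> extensional (Ob C)"
    and "X \<in> Ob C \<Longrightarrow> t X \<in> Hom D (fob F X) (fob G X)"
    and "\<lbrakk>X \<in> Ob C; Y \<in> Ob C; f \<in> Hom C X Y\<rbrakk> \<Longrightarrow>
          Comp D (fob F X) (fob F Y) (fob G Y) (t Y) (far F X Y f) =
          Comp D (fob F X) (fob G X) (fob G Y) (far G X Y f) (t X)"
  using assms unfolding nat_trans_def by blast+

lemma Fun_simps [simp]:
  "Ob (Fun C D) = {F. is_functor C D F}"
  "Hom (Fun C D) F G = {t. nat_trans C D F G t}"
  "Ident (Fun C D) F = (\<lambda>X\<in>Ob C. Ident D (fob F X))"
  "Comp (Fun C D) F G H s t = (\<lambda>X\<in>Ob C. Comp D (fob F X) (fob G X) (fob H X) (s X) (t X))"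
  by (simp_all add: Fun_def)

lemma nat_trans_Ident:
  assumes F: "is_functor C D F"
  shows "nat_trans C D F F (\<lambda>X\<in>Ob C. Ident D (fob F X))"
  using functor_simps[OF F] category_simps[OF functor_cod[OF F]]
  by (auto simp: nat_trans_def)

lemma nat_trans_Comp:
  assumes F: "is_functor C D F" and G: "is_functor C D G" and H: "is_functor C D H"
    and t: "nat_trans C D F G t" and s: "nat_trans C D G H s"
  shows "nat_trans C D F H (\<lambda>X\<in>Ob C. Comp D (fob F X) (fob G X) (fob H X) (s X) (t X))"
proof -
  note D = functor_cod[OF F]
  note rules = functor_ob[OF F] functor_ob[OF G] functor_ob[OF H]
    functor_ar[OF F] functor_ar[OF G] functor_ar[OF H] nat_transD(2)[OF t] nat_transD(2)[OF s]
  have "Comp D (fob F X) (fob F Y) (fob H Y)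
          (Comp D (fob F Y) (fob G Y) (fob H Y) (s Y) (t Y)) (far F X Y f) =
        Comp D (fob F X) (fob H X) (fob H Y) (far H X Y f)
          (Comp D (fob F X) (fob G X) (fob H X) (s X) (t X))"
    if "X \<in> Ob C" "Y \<in> Ob C" "f \<in> Hom C X Y" for X Y f
  proof -
    have "Comp D (fob F X) (fob F Y) (fob H Y)
          (Comp D (fob F Y) (fob G Y) (fob H Y) (s Y) (t Y)) (far F X Y f) =
        Comp D (fob F X) (fob G X) (fob H Y)
          (Comp D (fob G X) (fob G Y) (fob H Y) (s Y) (far G X Y f)) (t X)"
      using that rules nat_transD(3)[OF t that] by (simp add: category_assoc[OF D])
    then show ?thesis
      using that rules by (simp add: nat_transD(3)[OF s that] category_assoc[OF D])
  qed
  then show ?thesis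
    unfolding nat_trans_def using rules category_Comp[OF D] by simp
qed

lemma category_Fun:
  assumes "category C" "category D"
  shows "category (Fun C D)"
proof -
  have ext: "t = (\<lambda>X\<in>Ob C. t X)" if "nat_trans C D F G t" for F G t
    using nat_transD(1)[OF that] by (simp add: extensional_restrict)
  show ?thesis
    unfolding category_def
  proof (intro conjI ballI)
    fix F G t assume "F \<in> Ob (Fun C D)" "G \<in> Ob (Fun C D)" "t \<in> Hom (Fun C D) F G"
    then have F: "is_functor C D F" and G: "is_functor C D G" and t: "nat_trans C D F G t"
      by auto
    note r = functor_ob[OF F] functor_ob[OF G] nat_transD(2)[OF t]
    show "Comp (Fun C D) F F G t (Ident (Fun C D) F) = t"
      by (subst (2) ext[OF t])
        (auto simp: fun_eq_iff restrict_def r category_Comp_Ident[OF assms(2)])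
    show "Comp (Fun C D) F G G (Ident (Fun C D) G) t = t"
      by (subst (2) ext[OF t])
        (auto simp: fun_eq_iff restrict_def r category_Ident_Comp[OF assms(2)])
  next
    fix F G H K t s r
    assume "F \<in> Ob (Fun C D)" "G \<in> Ob (Fun C D)" "H \<in> Ob (Fun C D)" "K \<in> Ob (Fun C D)"
      "t \<in> Hom (Fun C D) F G" "s \<in> Hom (Fun C D) G H" "r \<in> Hom (Fun C D) H K"
    then have F: "is_functor C D F" and G: "is_functor C D G" and H: "is_functor C D H"
      and K: "is_functor C D K"
      and n: "nat_trans C D F G t" "nat_trans C D G H s" "nat_trans C D H K r"
      by auto
    then show "Comp (Fun C D) F H K r (Comp (Fun C D) F G H s t) =
       Comp (Fun C D) F G K (Comp (Fun C D) G H K r s) t"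
      using functor_ob[OF F] functor_ob[OF G] functor_ob[OF H] functor_ob[OF K]
        n[THEN nat_transD(2)]
      by (auto simp: fun_eq_iff restrict_def category_assoc[OF assms(2)])
  qed (auto intro: nat_trans_Ident nat_trans_Comp)
qed

lemma iso_arr_FunI:
  assumes F: "is_functor C D F" and G: "is_functor C D G" and t: "nat_trans C D F G t"
    and iso: "\<And>X. X \<in> Ob C \<Longrightarrow> iso_arr D (fob F X) (fob G X) (t X)"
  shows "iso_arr (Fun C D) F G t"
proof -
  note D = functor_cod[OF F]
  have "\<forall>X\<in>Ob C. \<exists>g. g \<in> Hom D (fob G X) (fob F X) \<and>
      Comp D (fob F X) (fob G X) (fob F X) g (t X) = Ident D (fob F X) \<and>
      Comp D (fob G X) (fob F X) (fob G X) (t X) g = Ident D (fob G X)"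
    using iso unfolding iso_arr_def by blast
  then obtain g where g: "\<And>X. X \<in> Ob C \<Longrightarrow> g X \<in> Hom D (fob G X) (fob F X)"
      "\<And>X. X \<in> Ob C \<Longrightarrow> Comp D (fob F X) (fob G X) (fob F X) (g X) (t X) = Ident D (fob F X)"
      "\<And>X. X \<in> Ob C \<Longrightarrow> Comp D (fob G X) (fob F X) (fob G X) (t X) (g X) = Ident D (fob G X)"
    by metis
  note r = functor_ob[OF F] functor_ob[OF G] functor_ar[OF F] functor_ar[OF G]
    nat_transD(2)[OF t] g(1)
  have "nat_trans C D G F (\<lambda>X\<in>Ob C. g X)"
    unfolding nat_trans_def
  proof (intro conjI ballI)
    fix X Y f assume h: "X \<in> Ob C" "Y \<in> Ob C" "f \<in> Hom C X Y"
    \<comment> \<open>Both paths round the naturality square of the inverses become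
      \<open>far G X Y f\<close> after composition with \<open>t Y\<close>, which is cancelled at
      the end.\<close>
    let ?l = "Comp D (fob G X) (fob G Y) (fob F Y) (g Y) (far G X Y f)"
    let ?r = "Comp D (fob G X) (fob F X) (fob F Y) (far F X Y f) (g X)"
    have "Comp D (fob G X) (fob F Y) (fob G Y) (t Y) ?l = far G X Y f"
      using h r by (simp flip: category_assoc[OF D] add: g(3) category_Ident_Comp[OF D])
    moreover have "Comp D (fob G X) (fob F Y) (fob G Y) (t Y) ?r =
        Comp D (fob G X) (fob F X) (fob G Y) (Comp D (fob F X) (fob F Y) (fob G Y) (t Y)
          (far F X Y f)) (g X)"
      using h r by (simp add: category_assoc[OF D])
    then have "Comp D (fob G X) (fob F Y) (fob G Y) (t Y) ?r = far G X Y f"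
      using h r by (simp add: nat_transD(3)[OF t h] category_assoc[OF D] g(3) category_Comp_Ident[OF
        D])
    ultimately have "?l = ?r"
      using iso_arr_cancel_left[OF D iso[OF h(2)], of ?l "fob G X" ?r] h r
      by (simp add: category_Comp[OF D])
    then show "Comp D (fob G X) (fob G Y) (fob F Y) (restrict g (Ob C) Y) (far G X Y f) =
       Comp D (fob G X) (fob F X) (fob F Y) (far F X Y f) (restrict g (Ob C) X)"
      using h by simp
  qed (use g in auto)
  then show ?thesis
    unfolding iso_arr_def using t g(2,3)
    by (auto simp: restrict_def fun_eq_iff intro!: exI[of _ "\<lambda>X\<in>Ob C. g X"])
qed

section \<open>Equivalences and adjunctions\<close>

text \<open>Fullness lifts the inverse of the image to an arrow back, and faithfulness pulls the two
  inverse laws back to C.\<close>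

lemma fully_faithful_reflects_iso:
  assumes ff: "fully_faithful C D F" and X: "X \<in> Ob C" "Y \<in> Ob C" and u: "u \<in> Hom C X Y"
    and iso: "iso_arr D (fob F X) (fob F Y) (far F X Y u)"
  shows "iso_arr C X Y u"
proof -
  have F: "is_functor C D F" and
    bij: "\<And>X Y. \<lbrakk>X \<in> Ob C; Y \<in> Ob C\<rbrakk> \<Longrightarrow> bij_betw (far F X Y) (Hom C X Y) (Hom D (fob F X) (fob F Y))"
    using ff unfolding fully_faithful_def by blast+
  note C = functor_dom[OF F]
  obtain v' where v': "v' \<in> Hom D (fob F Y) (fob F X)"
    "Comp D (fob F X) (fob F Y) (fob F X) v' (far F X Y u) = Ident D (fob F X)"
    "Comp D (fob F Y) (fob F X) (fob F Y) (far F X Y u) v' = Ident D (fob F Y)"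
    using iso unfolding iso_arr_def by blast
  obtain v where v: "v \<in> Hom C Y X" "far F Y X v = v'"
    using v'(1) bij_betw_imp_surj_on[OF bij[OF X(2,1)]] by (metis imageE)
  note F_inj = bij[THEN bij_betw_imp_inj_on, THEN inj_onD]
  have "Comp C X Y X v u = Ident C X"
    by (rule F_inj[OF X(1,1)])
      (use v v'(2) X u in \<open>simp_all add: category_simps[OF C] functor_simps[OF F]\<close>)
  moreover have "Comp C Y X Y u v = Ident C Y"
    by (rule F_inj[OF X(2,2)])
      (use v v'(3) X u in \<open>simp_all add: category_simps[OF C] functor_simps[OF F]\<close>)
  ultimately show ?thesis using u v unfolding iso_arr_def by blast
qed

text \<open>The quasi-inverse picks for each Y an object \<open>g Y\<close> with an isomorphism
  \<open>e Y\<close> from its image to Y. The conclusion is oriented for its use, where D is the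
  category of nerves and C the opposite of the category of strong monoidal functors.\<close>

theorem fully_faithful_essentially_surjective_equivalence:
  fixes C :: "('o1, 'a1) cat" and D :: "('o2, 'a2) cat" and F :: "('o1, 'a1, 'o2, 'a2) ftor"
  assumes ff: "fully_faithful C D F"
    and eso: "\<And>Y. Y \<in> Ob D \<Longrightarrow> \<exists>X\<in>Ob C. isomorphic D (fob F X) Y"
  shows "equivalent_categories D C"
proof -
  have F: "is_functor C D F" and
    bij: "\<And>X Y. \<lbrakk>X \<in> Ob C; Y \<in> Ob C\<rbrakk> \<Longrightarrow> bij_betw (far F X Y) (Hom C X Y) (Hom D (fob F X) (fob F Y))"
    using ff unfolding fully_faithful_def by blast+
  note C = functor_dom[OF F] and D = functor_cod[OF F]
  note F_inj = bij[THEN bij_betw_imp_inj_on, THEN inj_onD]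
  obtain g e where g: "\<And>Y. Y \<in> Ob D \<Longrightarrow> g Y \<in> Ob C"
    and e: "\<And>Y. Y \<in> Ob D \<Longrightarrow> iso_arr D (fob F (g Y)) Y (e Y)"
    using eso unfolding isomorphic_def by metis
  have eH: "e Y \<in> Hom D (fob F (g Y)) Y" if "Y \<in> Ob D" for Y
    using e[OF that] unfolding iso_arr_def by blast
  have ex: "\<exists>f. f \<in> Hom C (g Y) (g Y') \<and>
      Comp D (fob F (g Y)) (fob F (g Y')) Y' (e Y') (far F (g Y) (g Y') f) =
      Comp D (fob F (g Y)) Y Y' h (e Y)"
    if "Y \<in> Ob D" "Y' \<in> Ob D" "h \<in> Hom D Y Y'" for Y Y' h
  proof -
    obtain e' where e': "e' \<in> Hom D Y' (fob F (g Y'))" "Comp D Y' (fob F (g Y')) Y' (e Y') e' =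
      Ident D Y'"
      using e[OF \<open>Y' \<in> Ob D\<close>] unfolding iso_arr_def by blast
    let ?k = "Comp D (fob F (g Y)) Y' (fob F (g Y')) e' (Comp D (fob F (g Y)) Y Y' h (e Y))"
    have "?k \<in> Hom D (fob F (g Y)) (fob F (g Y'))"
      using that e' eH g functor_ob[OF F] by (simp add: category_Comp[OF D])
    then have "?k \<in> far F (g Y) (g Y') ` Hom C (g Y) (g Y')"
      by (simp only: bij_betw_imp_surj_on[OF bij[OF g[OF that(1)] g[OF that(2)]]])
    then obtain f where f: "f \<in> Hom C (g Y) (g Y')" "far F (g Y) (g Y') f = ?k"
      by (elim imageE) simp
    have "Comp D (fob F (g Y)) (fob F (g Y')) Y' (e Y') ?k = Comp D (fob F (g Y)) Y Y' h (e Y)"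
      using that e' eH g functor_ob[OF F]
      by (simp flip: category_assoc[OF D] add: category_Comp[OF D] category_Ident_Comp[OF D])
    with f show ?thesis by auto
  qed
  \<comment> \<open>The arrow h conjugated by the isomorphisms \<open>e\<close> and lifted through
    F. Uniqueness of the lift (\<open>ga_unique\<close>) yields functoriality of G.\<close>
  define ga where "ga Y Y' h = (SOME f. f \<in> Hom C (g Y) (g Y') \<and>
      Comp D (fob F (g Y)) (fob F (g Y')) Y' (e Y') (far F (g Y) (g Y') f) =
      Comp D (fob F (g Y)) Y Y' h (e Y))" for Y Y' h
  have ga: "ga Y Y' h \<in> Hom C (g Y) (g Y')"
      "Comp D (fob F (g Y)) (fob F (g Y')) Y' (e Y') (far F (g Y) (g Y') (ga Y Y' h)) =
      Comp D (fob F (g Y)) Y Y' h (e Y)"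
    if "Y \<in> Ob D" "Y' \<in> Ob D" "h \<in> Hom D Y Y'" for Y Y' h
    using someI_ex[OF ex[OF that]] unfolding ga_def by blast+
  have ga_unique: "f = ga Y Y' h"
    if h: "Y \<in> Ob D" "Y' \<in> Ob D" "h \<in> Hom D Y Y'" and f: "f \<in> Hom C (g Y) (g Y')"
      and eq: "Comp D (fob F (g Y)) (fob F (g Y')) Y' (e Y') (far F (g Y) (g Y') f) =
      Comp D (fob F (g Y)) Y Y' h (e Y)" for Y Y' h f
  proof (rule F_inj[OF g[OF h(1)] g[OF h(2)] _ f ga(1)[OF h]])
    show "far F (g Y) (g Y') f = far F (g Y) (g Y') (ga Y Y' h)"
    proof (rule iso_arr_cancel_left[OF D e[OF h(2)]])
      show "Comp D (fob F (g Y)) (fob F (g Y')) Y' (e Y') (far F (g Y) (g Y') f) =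
        Comp D (fob F (g Y)) (fob F (g Y')) Y' (e Y') (far F (g Y) (g Y') (ga Y Y' h))"
        by (simp only: eq ga(2)[OF h])
    qed (use f h ga(1)[OF h] in \<open>simp_all add: g functor_simps[OF F]\<close>)
  qed
  define G where "G = mk_ftor D g ga"
  have G: "is_functor D C G"
    unfolding G_def
  proof (rule is_functor_mk_ftor[OF D C])
    fix Y assume "Y \<in> Ob D"
    then show "ga Y Y (Ident D Y) = Ident C (g Y)"
      using g eH by (intro ga_unique[symmetric]) (simp_all add: category_simps[OF C]
        category_simps[OF D] functor_simps[OF F])
  next
    fix X Y Z f f' assume h: "X \<in> Ob D" "Y \<in> Ob D" "Z \<in> Ob D" "f \<in> Hom D X Y" "f' \<in> Hom D Y Z"
    let ?x = "fob F (g X)" and ?y = "fob F (g Y)" and ?z = "fob F (g Z)"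
    note r = g[OF h(1)] g[OF h(2)] g[OF h(3)] ga(1)[OF h(1,2,4)] ga(1)[OF h(2,3,5)]
      eH[OF h(1)] eH[OF h(2)] eH[OF h(3)] h
    have "Comp D ?x ?z Z (e Z) (far F (g X) (g Z) (Comp C (g X) (g Y) (g Z) (ga Y Z f')
      (ga X Y f))) =
      Comp D ?x ?y Z (Comp D ?y ?z Z (e Z) (far F (g Y) (g Z) (ga Y Z f'))) (far F (g X) (g Y)
        (ga X Y f))"
      using r by (simp add: functor_simps[OF F] category_assoc[OF D])
    also have "\<dots> = Comp D ?x Y Z f' (Comp D ?x ?y Y (e Y) (far F (g X) (g Y) (ga X Y f)))"
      using r by (simp add: ga(2) functor_simps[OF F] category_assoc[OF D])
    also have "\<dots> = Comp D ?x X Z (Comp D X Y Z f' f) (e X)"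
      using r by (simp add: ga(2) functor_simps[OF F] category_assoc[OF D])
    finally show "ga X Z (Comp D X Y Z f' f) = Comp C (g X) (g Y) (g Z) (ga Y Z f') (ga X Y f)"
      using r by (intro ga_unique[symmetric]) (simp_all add: category_Comp[OF C] category_Comp[OF
        D])
  qed (use g ga in auto)
  have G_simps: "\<And>Y. Y \<in> Ob D \<Longrightarrow> fob G Y = g Y"
    "\<And>X Y f. \<lbrakk>X \<in> Ob D; Y \<in> Ob D; f \<in> Hom D X Y\<rbrakk> \<Longrightarrow> far G X Y f = ga X Y f"
    by (simp_all add: G_def mk_ftor_simps)
  have FG: "is_functor D D (comp_ftor D F G)" and GF: "is_functor C C (comp_ftor C G F)"
    using is_functor_comp[OF G F] is_functor_comp[OF F G] .
  have "nat_trans D D (comp_ftor D F G) (id_ftor D) (\<lambda>Y\<in>Ob D. e Y)"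
    unfolding nat_trans_def using eH g ga
    by (auto simp: comp_ftor_simps id_ftor_simps G_simps)
  then have isoD: "isomorphic (Fun D D) (comp_ftor D F G) (id_ftor D)"
    unfolding isomorphic_def using e FG is_functor_id[OF D]
    by (intro exI iso_arr_FunI) (auto simp: comp_ftor_simps id_ftor_simps G_simps)
  \<comment> \<open>The isomorphism \<open>e\<close> at F X lies between two images of F, so it
    lifts to C; the lifts form the comparison of the composite on C with the identity.\<close>
  have "\<exists>u. u \<in> Hom C (g (fob F X)) X \<and> far F (g (fob F X)) X u = e (fob F X)" if "X \<in> Ob C" for X
    using bij_betw_imp_surj_on[OF bij[OF g that, of "fob F X"]] eH[of "fob F X"] that functor_ob[OF
      F]
    by (metis imageE)
  then obtain u where u: "\<And>X. X \<in> Ob C \<Longrightarrow> u X \<in> Hom C (g (fob F X)) X"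
    "\<And>X. X \<in> Ob C \<Longrightarrow> far F (g (fob F X)) X (u X) = e (fob F X)"
    by metis
  have "nat_trans C C (comp_ftor C G F) (id_ftor C) (\<lambda>X\<in>Ob C. u X)"
    unfolding nat_trans_def
  proof (intro conjI ballI)
    fix X Y f assume h: "X \<in> Ob C" "Y \<in> Ob C" "f \<in> Hom C X Y"
    let ?k = "ga (fob F X) (fob F Y) (far F X Y f)"
    have k: "?k \<in> Hom C (g (fob F X)) (g (fob F Y))"
      using h by (intro ga functor_simps[OF F])
    have "Comp C (g (fob F X)) (g (fob F Y)) Y (u Y) ?k = Comp C (g (fob F X)) X Y f (u X)"
    proof (rule F_inj[of "g (fob F X)" Y])
      show "far F (g (fob F X)) Y (Comp C (g (fob F X)) (g (fob F Y)) Y (u Y) ?k) =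
        far F (g (fob F X)) Y (Comp C (g (fob F X)) X Y f (u X))"
        using h u k g by (simp add: functor_simps[OF F] ga(2))
    qed (use h u k g in \<open>simp_all add: functor_simps[OF F] category_simps[OF C]\<close>)
    then show "Comp C (fob (comp_ftor C G F) X) (fob (comp_ftor C G F) Y) (fob (id_ftor C) Y)
        (restrict u (Ob C) Y) (far (comp_ftor C G F) X Y f) =
       Comp C (fob (comp_ftor C G F) X) (fob (id_ftor C) X) (fob (id_ftor C) Y)
        (far (id_ftor C) X Y f) (restrict u (Ob C) X)"
      using h by (simp add: comp_ftor_simps id_ftor_simps G_simps functor_simps[OF F])
  qed (use u in \<open>auto simp: comp_ftor_simps id_ftor_simps G_simps functor_simps[OF F]\<close>)
  moreover have "iso_arr C (g (fob F X)) X (u X)" if "X \<in> Ob C" for X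
    using that u e functor_ob[OF F] g by (intro fully_faithful_reflects_iso[OF ff]) simp_all
  ultimately have isoC: "isomorphic (Fun C C) (comp_ftor C G F) (id_ftor C)"
    unfolding isomorphic_def using GF is_functor_id[OF C]
    by (intro exI[of _ "\<lambda>X\<in>Ob C. u X"] iso_arr_FunI)
      (auto simp: comp_ftor_simps id_ftor_simps G_simps functor_ob[OF F])
  show ?thesis
    unfolding equivalent_categories_def using F G isoC isoD by blast
qed

text \<open>A universal arrow from each object of D determines the left adjoint. The equations
  between arrows of C, from functoriality of L to naturality of the counit, are compared after
  composition with the universal arrows y, which is faithful by \<open>uniq\<close>.\<close>

theorem right_adjointI:
  fixes C :: "('o1, 'a1) cat" and D :: "('o2, 'a2) cat" and R :: "('o1, 'a1, 'o2, 'a2) ftor"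
  assumes R: "is_functor C D R"
    and univ: "\<And>X. X \<in> Ob D \<Longrightarrow> \<exists>A\<in>Ob C. \<exists>y\<in>Hom D X (fob R A). \<forall>B\<in>Ob C. \<forall>h\<in>Hom D X (fob R B).
      \<exists>!k. k \<in> Hom C A B \<and> Comp D X (fob R A) (fob R B) (far R A B k) y = h"
  shows "right_adjoint C D R"
proof -
  note C = functor_dom[OF R] and D = functor_cod[OF R]
  obtain l y where l: "\<And>X. X \<in> Ob D \<Longrightarrow> l X \<in> Ob C"
    and y: "\<And>X. X \<in> Ob D \<Longrightarrow> y X \<in> Hom D X (fob R (l X))"
    and ex: "\<And>X B h. \<lbrakk>X \<in> Ob D; B \<in> Ob C; h \<in> Hom D X (fob R B)\<rbrakk> \<Longrightarrow>
      \<exists>!k. k \<in> Hom C (l X) B \<and> Comp D X (fob R (l X)) (fob R B) (far R (l X) B k) (y X) = h"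
    using univ by metis
  define m where "m X B h =
    (THE k. k \<in> Hom C (l X) B \<and> Comp D X (fob R (l X)) (fob R B) (far R (l X) B k) (y X) = h)"
      for X B h
  have m: "m X B h \<in> Hom C (l X) B"
    "Comp D X (fob R (l X)) (fob R B) (far R (l X) B (m X B h)) (y X) = h"
    if "X \<in> Ob D" "B \<in> Ob C" "h \<in> Hom D X (fob R B)" for X B h
    using theI'[OF ex[OF that]] unfolding m_def by blast+
  have uniq: "k = k'"
    if "X \<in> Ob D" "B \<in> Ob C" "k \<in> Hom C (l X) B" "k' \<in> Hom C (l X) B"
      "Comp D X (fob R (l X)) (fob R B) (far R (l X) B k) (y X) =
       Comp D X (fob R (l X)) (fob R B) (far R (l X) B k') (y X)" for X B k k'
    using ex[OF that(1,2), of "Comp D X (fob R (l X)) (fob R B) (far R (l X) B k) (y X)"] that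
      y l functor_simps[OF R] category_Comp[OF D]
    by metis
  note r = l y functor_simps[OF R] category_simps[OF D] category_simps[OF C]
  define la where "la X X' f = m X (l X') (Comp D X X' (fob R (l X')) (y X') f)" for X X' f
  have la: "la X X' f \<in> Hom C (l X) (l X')"
    "Comp D X (fob R (l X)) (fob R (l X')) (far R (l X) (l X') (la X X' f)) (y X) =
     Comp D X X' (fob R (l X')) (y X') f"
    if "X \<in> Ob D" "X' \<in> Ob D" "f \<in> Hom D X X'" for X X' f
    using m[of X "l X'" "Comp D X X' (fob R (l X')) (y X') f"] that by (simp_all add: la_def r)
  define L where "L = mk_ftor D l la"
  have L: "is_functor D C L"
    unfolding L_def
  proof (rule is_functor_mk_ftor[OF D C])
    fix X assume "X \<in> Ob D"
    then show "la X X (Ident D X) = Ident C (l X)"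
      using la[of X X "Ident D X"] by (intro uniq[of X "l X"]) (simp_all add: r)
  next
    fix X Y Z f g assume h: "X \<in> Ob D" "Y \<in> Ob D" "Z \<in> Ob D" "f \<in> Hom D X Y" "g \<in> Hom D Y Z"
    have "Comp D X (fob R (l X)) (fob R (l Z))
        (Comp D (fob R (l X)) (fob R (l Y)) (fob R (l Z)) (far R (l Y) (l Z) (la Y Z g))
          (far R (l X) (l Y) (la X Y f))) (y X) =
      Comp D X Y (fob R (l Z)) (Comp D Y (fob R (l Y)) (fob R (l Z)) (far R (l Y) (l Z) (la Y Z g))
        (y Y)) f"
      using h la[OF h(1,2,4)] la(1)[OF h(2,3,5)] by (simp add: r)
    then show "la X Z (Comp D X Y Z g f) = Comp C (l X) (l Y) (l Z) (la Y Z g) (la X Y f)"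
      using h la[OF h(1,2,4)] la[OF h(2,3,5)] la[of X Z "Comp D X Y Z g f"]
      by (intro uniq[of X "l Z"]) (simp_all add: r)
  qed (use l la in auto)
  have L_simps: "\<And>X. X \<in> Ob D \<Longrightarrow> fob L X = l X"
    "\<And>X Y f. \<lbrakk>X \<in> Ob D; Y \<in> Ob D; f \<in> Hom D X Y\<rbrakk> \<Longrightarrow> far L X Y f = la X Y f"
    by (simp_all add: L_def mk_ftor_simps)
  \<comment> \<open>The counit at B is the transpose of the identity of R B, so one triangle law is
    contained in its construction.\<close>
  define c where "c B = m (fob R B) B (Ident D (fob R B))" for B
  have c: "c B \<in> Hom C (l (fob R B)) B"
    "Comp D (fob R B) (fob R (l (fob R B))) (fob R B) (far R (l (fob R B)) B (c B)) (y (fob R B)) =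
      Ident D (fob R B)"
    if "B \<in> Ob C" for B
    using m[of "fob R B" B "Ident D (fob R B)"] that by (simp_all add: c_def r)
  have unit: "nat_trans D D (id_ftor D) (comp_ftor D R L) (\<lambda>X\<in>Ob D. y X)"
    unfolding nat_trans_def using la y
    by (auto simp: id_ftor_simps comp_ftor_simps L_simps)
  have c_nat: "Comp C (l (fob R A)) (l (fob R B)) B (c B) (la (fob R A) (fob R B) (far R A B f)) =
      Comp C (l (fob R A)) A B f (c A)"
    if h: "A \<in> Ob C" "B \<in> Ob C" "f \<in> Hom C A B" for A B f
  proof (rule uniq[of "fob R A" B])
    let ?a = "fob R (l (fob R A))" and ?b = "fob R (l (fob R B))"
    let ?f = "far R A B f"
    have k: "la (fob R A) (fob R B) ?f \<in> Hom C (l (fob R A)) (l (fob R B))"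
      "Comp D (fob R A) ?a ?b (far R (l (fob R A)) (l (fob R B)) (la (fob R A) (fob R B) ?f))
        (y (fob R A)) =
       Comp D (fob R A) (fob R B) ?b (y (fob R B)) ?f"
      using la[of "fob R A" "fob R B" ?f] h by (simp_all add: r)
    have "Comp D (fob R A) ?a (fob R B)
        (far R (l (fob R A)) B (Comp C (l (fob R A)) (l (fob R B)) B (c B)
          (la (fob R A) (fob R B) ?f))) (y (fob R A)) =
      Comp D (fob R A) (fob R B) (fob R B) (Comp D (fob R B) ?b (fob R B) (far R (l (fob R B)) B
        (c B)) (y (fob R B))) ?f"
      using h k c(1)[OF h(1)] c(1)[OF h(2)] by (simp add: r)
    also have "\<dots> = ?f" using h by (simp add: c r)
    also have "?f = Comp D (fob R A) ?a (fob R B)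
        (far R (l (fob R A)) B (Comp C (l (fob R A)) A B f (c A))) (y (fob R A))"
      using h c[OF h(1)] by (simp add: r)
    finally show "Comp D (fob R A) ?a (fob R B)
        (far R (l (fob R A)) B (Comp C (l (fob R A)) (l (fob R B)) B (c B)
          (la (fob R A) (fob R B) ?f))) (y (fob R A)) =
      Comp D (fob R A) ?a (fob R B)
        (far R (l (fob R A)) B (Comp C (l (fob R A)) A B f (c A))) (y (fob R A))" .
  qed (use h c la in \<open>simp_all add: r\<close>)
  have counit: "nat_trans C C (comp_ftor C L R) (id_ftor C) (\<lambda>B\<in>Ob C. c B)"
    unfolding nat_trans_def using c c_nat
    by (auto simp: id_ftor_simps comp_ftor_simps L_simps functor_simps[OF R])
  have tri: "Comp C (l X) (l (fob R (l X))) (l X) (c (l X)) (la X (fob R (l X)) (y X)) =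
    Ident C (l X)"
    if h: "X \<in> Ob D" for X
  proof (rule uniq[of X "l X"])
    have k: "la X (fob R (l X)) (y X) \<in> Hom C (l X) (l (fob R (l X)))"
      "Comp D X (fob R (l X)) (fob R (l (fob R (l X)))) (far R (l X) (l (fob R (l X)))
        (la X (fob R (l X)) (y X))) (y X) =
       Comp D X (fob R (l X)) (fob R (l (fob R (l X)))) (y (fob R (l X))) (y X)"
      using la[of X "fob R (l X)" "y X"] h by (simp_all add: r)
    have "Comp D X (fob R (l X)) (fob R (l X)) (far R (l X) (l X)
        (Comp C (l X) (l (fob R (l X))) (l X) (c (l X)) (la X (fob R (l X)) (y X)))) (y X) =
      Comp D X (fob R (l X)) (fob R (l X))
        (Comp D (fob R (l X)) (fob R (l (fob R (l X)))) (fob R (l X)) (far R (l (fob R (l X))) (l X)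
          (c (l X))) (y (fob R (l X)))) (y X)"
      using h k c(1)[of "l X"] by (simp add: r)
    also have "\<dots> = y X" using h by (simp add: c r)
    also have "\<dots> = Comp D X (fob R (l X)) (fob R (l X)) (far R (l X) (l X) (Ident C (l X))) (y X)"
      using h by (simp add: r)
    finally show "Comp D X (fob R (l X)) (fob R (l X)) (far R (l X) (l X)
        (Comp C (l X) (l (fob R (l X))) (l X) (c (l X)) (la X (fob R (l X)) (y X)))) (y X) =
      Comp D X (fob R (l X)) (fob R (l X)) (far R (l X) (l X) (Ident C (l X))) (y X)" .
  qed (use h c la in \<open>simp_all add: r\<close>)
  show ?thesis
    unfolding right_adjoint_def
    by (intro conjI R exI[of _ L] exI[of _ "\<lambda>X\<in>Ob D. y X"] exI[of _ "\<lambda>B\<in>Ob C.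
      c B"] L unit counit ballI)
      (simp_all add: L_simps r tri c)
qed

section \<open>Nerves of cosimplicial objects\<close>

lemma Delta_simps [simp]:
  "Ob Delta = UNIV"
  "f \<in> Hom Delta m n \<longleftrightarrow> f \<in> {..m} \<rightarrow>\<^sub>E {..n} \<and> mono_on {..m} f"
  "Ident Delta n = (\<lambda>k\<in>{..n}. k)"
  "Comp Delta m n p g f = compose {..m} g f"
  by (simp_all add: Delta_def)

lemma category_Delta: "category Delta"
  unfolding category_def
  by (auto simp: compose_def restrict_def fun_eq_iff PiE_def extensional_def Pi_iff monotone_on_def)

lemma SetCat_simps [simp]:
  "Ob (SetCat u) = {X. small u X}"
  "Hom (SetCat u) X Y = (X \<rightarrow>\<^sub>E Y)"
  "Ident (SetCat u) X = (\<lambda>x\<in>X. x)"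
  "Comp (SetCat u) X Y Z g f = compose X g f"
  by (simp_all add: SetCat_def)

lemma category_SetCat: "category (SetCat u)"
  unfolding category_def
  by (auto simp: compose_def restrict_def fun_eq_iff PiE_def extensional_def Pi_iff)

lemma category_SSet: "category (SSet u)"
  unfolding SSet_def by (intro category_Fun category_op_cat category_Delta category_SetCat)

text \<open>The nerve is formed in an arbitrary category in place of \<open>WCat\<close>, because
  the Yoneda argument below is one about plain categories.\<close>

definition nerve_ob ::
  "('o, 'a) cat \<Rightarrow> (nat, nat \<Rightarrow> nat, 'o, 'a) ftor \<Rightarrow> 'o \<Rightarrow> 'a sset" where
  "nerve_ob V DD C = mk_ftor (op_cat Delta)
          (\<lambda>n. Hom V (fob DD n) C)
          (\<lambda>n m f. \<lambda>x\<in>Hom V (fob DD n) C. Comp V (fob DD m) (fob DD n) C x (far DD m n f))"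

definition nerve_of ::
  "('o, 'a) cat \<Rightarrow> (nat, nat \<Rightarrow> nat, 'o, 'a) ftor \<Rightarrow> ('o, 'a, 'a sset, nat \<Rightarrow> 'a \<Rightarrow> 'a) ftor" where
  "nerve_of V DD = mk_ftor V (nerve_ob V DD)
       (\<lambda>C C' G. \<lambda>n. \<lambda>x\<in>Hom V (fob DD n) C. Comp V (fob DD n) C C' G x)"

lemma nerve_eq: "nerve u W DD = nerve_of (WCat u W) DD"
  by (simp add: nerve_def nerve_of_def nerve_ob_def[abs_def])

text \<open>A transformation from DD to EE acts by precomposition, from the nerve of EE to the nerve
  of DD. This reversal is the source of the opposite category in the equivalence.\<close>

definition nerve_nat ::
  "('o, 'a) cat \<Rightarrow> (nat, nat \<Rightarrow> nat, 'o, 'a) ftor \<Rightarrow> (nat, nat \<Rightarrow> nat, 'o, 'a) ftor \<Rightarrow>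
   (nat \<Rightarrow> 'a) \<Rightarrow> 'o \<Rightarrow> nat \<Rightarrow> 'a \<Rightarrow> 'a" where
  "nerve_nat V DD EE t = (\<lambda>C\<in>Ob V. \<lambda>n. \<lambda>x\<in>Hom V (fob EE n) C.
    Comp V (fob DD n) (fob EE n) C x (t n))"

lemma nerve_ob_simps [simp]:
  "fob (nerve_ob V DD C) n = Hom V (fob DD n) C"
  "f \<in> Hom Delta m n \<Longrightarrow> far (nerve_ob V DD C) n m f =
     (\<lambda>x\<in>Hom V (fob DD n) C. Comp V (fob DD m) (fob DD n) C x (far DD m n f))"
  by (simp_all add: nerve_ob_def mk_ftor_def)

lemma nerve_of_simps:
  "C \<in> Ob V \<Longrightarrow> fob (nerve_of V DD) C = nerve_ob V DD C"
  "\<lbrakk>C \<in> Ob V; C' \<in> Ob V; G \<in> Hom V C C'\<rbrakk> \<Longrightarrow> far (nerve_of V DD) C C' G =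
     (\<lambda>n. \<lambda>x\<in>Hom V (fob DD n) C. Comp V (fob DD n) C C' G x)"
  by (simp_all add: nerve_of_def mk_ftor_simps)

context
  fixes V :: "('o, 'a) cat" and u :: "'u itself"
  assumes V: "category V"
begin

text \<open>
  Smallness is only required of the hom-sets out of the diagram: as the universe need not be a
    strong
  limit, \<open>WCat u W\<close> need not be locally small.
\<close>

lemma is_functor_nerve_ob:
  assumes DD: "is_functor Delta V DD" and C: "C \<in> Ob V" and small: "\<And>n.
    small u (Hom V (fob DD n) C)"
  shows "is_functor (op_cat Delta) (SetCat u) (nerve_ob V DD C)"
  unfolding nerve_ob_def
proof (rule is_functor_mk_ftor[OF category_op_cat[OF category_Delta] category_SetCat])
  note D = functor_ob[OF DD, simplified] functor_ar[OF DD, simplified]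
  show "Hom V (fob DD n) C \<in> Ob (SetCat u)" if "n \<in> Ob (op_cat Delta)" for n
    using small by simp
  show "(\<lambda>x\<in>Hom V (fob DD n) C. Comp V (fob DD m) (fob DD n) C x (far DD m n f))
      \<in> Hom (SetCat u) (Hom V (fob DD n) C) (Hom V (fob DD m) C)"
    if "f \<in> Hom (op_cat Delta) n m" for n m f
    using that D C by (auto intro!: category_Comp[OF V])
  show "(\<lambda>x\<in>Hom V (fob DD n) C. Comp V (fob DD n) (fob DD n) C x
    (far DD n n (Ident (op_cat Delta) n))) =
      Ident (SetCat u) (Hom V (fob DD n) C)" for n
    using functor_Ident[OF DD, of n] D C by (auto simp: category_Comp_Ident[OF V] fun_eq_iff
      restrict_def)
  show "(\<lambda>x\<in>Hom V (fob DD n) C. Comp V (fob DD p) (fob DD n) C x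
    (far DD p n (Comp (op_cat Delta) n m p g f))) =
      Comp (SetCat u) (Hom V (fob DD n) C) (Hom V (fob DD m) C) (Hom V (fob DD p) C)
       (\<lambda>x\<in>Hom V (fob DD m) C. Comp V (fob DD p) (fob DD m) C x (far DD p m g))
       (\<lambda>x\<in>Hom V (fob DD n) C. Comp V (fob DD m) (fob DD n) C x (far DD m n f))"
    if "f \<in> Hom (op_cat Delta) n m" "g \<in> Hom (op_cat Delta) m p" for n m p f g
    using functor_Comp[OF DD, of g p m f n] that D C
    by (auto simp: category_assoc[OF V] category_Comp[OF V] fun_eq_iff restrict_def compose_def)
qed

lemma is_functor_nerve_of:
  assumes DD: "is_functor Delta V DD" and small: "\<And>n C. C \<in> Ob V \<Longrightarrow> small u (Hom V (fob DD n) C)"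
  shows "is_functor V (SSet u) (nerve_of V DD)"
  unfolding nerve_of_def
proof (rule is_functor_mk_ftor[OF V category_SSet])
  note D = functor_ob[OF DD, simplified] functor_ar[OF DD, simplified]
  show "nerve_ob V DD C \<in> Ob (SSet u)" if "C \<in> Ob V" for C
    using is_functor_nerve_ob[OF DD that small[OF that]] by (simp add: SSet_def)
  show "(\<lambda>n. \<lambda>x\<in>Hom V (fob DD n) X. Comp V (fob DD n) X Y f x) \<in> Hom (SSet u) (nerve_ob V DD X)
    (nerve_ob V DD Y)"
    if "X \<in> Ob V" "Y \<in> Ob V" "f \<in> Hom V X Y" for X Y f
    unfolding SSet_def Fun_simps nat_trans_def mem_Collect_eq
  proof (intro conjI ballI)
    fix m n h assume "h \<in> Hom (op_cat Delta) m n"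
    then have h: "h \<in> Hom Delta n m" by simp
    show "Comp (SetCat u) (fob (nerve_ob V DD X) m) (fob (nerve_ob V DD X) n)
      (fob (nerve_ob V DD Y) n)
        (\<lambda>x\<in>Hom V (fob DD n) X. Comp V (fob DD n) X Y f x) (far (nerve_ob V DD X) m n h) =
      Comp (SetCat u) (fob (nerve_ob V DD X) m) (fob (nerve_ob V DD Y) m) (fob (nerve_ob V DD Y) n)
        (far (nerve_ob V DD Y) m n h) (\<lambda>x\<in>Hom V (fob DD m) X. Comp V (fob DD m) X Y f x)"
      unfolding nerve_ob_simps(2)[OF h]
      using that D functor_ar[OF DD h] by (auto simp: fun_eq_iff compose_def category_Comp[OF V]
        category_assoc[OF V])
  qed (use that D in \<open>auto simp: extensional_def intro!: category_Comp[OF V]\<close>)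
  show "(\<lambda>n. \<lambda>x\<in>Hom V (fob DD n) X. Comp V (fob DD n) X X (Ident V X) x) =
    Ident (SSet u) (nerve_ob V DD X)"
    if "X \<in> Ob V" for X
    using that D by (auto simp: SSet_def fun_eq_iff restrict_def category_Ident_Comp[OF V])
  show "(\<lambda>n. \<lambda>x\<in>Hom V (fob DD n) X. Comp V (fob DD n) X Z (Comp V X Y Z g f) x) =
      Comp (SSet u) (nerve_ob V DD X) (nerve_ob V DD Y) (nerve_ob V DD Z)
       (\<lambda>n. \<lambda>x\<in>Hom V (fob DD n) Y. Comp V (fob DD n) Y Z g x)
       (\<lambda>n. \<lambda>x\<in>Hom V (fob DD n) X. Comp V (fob DD n) X Y f x)"
    if "X \<in> Ob V" "Y \<in> Ob V" "Z \<in> Ob V" "f \<in> Hom V X Y" "g \<in> Hom V Y Z" for X Y Z f g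
    using that D by (auto simp: SSet_def fun_eq_iff restrict_def compose_def category_assoc[OF V]
      category_Comp[OF V])
qed

lemma nat_trans_nerve_nat:
  assumes DD: "is_functor Delta V DD" and EE: "is_functor Delta V EE"
    and t: "nat_trans Delta V DD EE t"
  shows "nat_trans V (SSet u) (nerve_of V EE) (nerve_of V DD) (nerve_nat V DD EE t)"
  unfolding nat_trans_def
proof (intro conjI ballI)
  note r = functor_ob[OF DD, simplified] functor_ob[OF EE, simplified] nat_transD(2)[OF t,
    simplified]
  show "nerve_nat V DD EE t \<in> extensional (Ob V)" by (simp add: nerve_nat_def)
  show "nerve_nat V DD EE t C \<in> Hom (SSet u) (fob (nerve_of V EE) C) (fob (nerve_of V DD) C)"
    if C: "C \<in> Ob V" for C
    unfolding SSet_def Fun_simps nat_trans_def mem_Collect_eq nerve_of_simps[OF C]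
  proof (intro conjI ballI)
    fix m n h assume "h \<in> Hom (op_cat Delta) m n"
    then have h: "h \<in> Hom Delta n m" by simp
    show "Comp (SetCat u) (fob (nerve_ob V EE C) m) (fob (nerve_ob V EE C) n)
      (fob (nerve_ob V DD C) n)
        (nerve_nat V DD EE t C n) (far (nerve_ob V EE C) m n h) =
      Comp (SetCat u) (fob (nerve_ob V EE C) m) (fob (nerve_ob V DD C) m) (fob (nerve_ob V DD C) n)
        (far (nerve_ob V DD C) m n h) (nerve_nat V DD EE t C m)"
      unfolding nerve_ob_simps(2)[OF h]
      using C r functor_ar[OF DD h] functor_ar[OF EE h] nat_transD(3)[OF t _ _ h, simplified]
      by (auto simp: nerve_nat_def fun_eq_iff compose_def category_Comp[OF V] category_assoc[OF V])
  qed (use C r in \<open>auto simp: nerve_nat_def extensional_def intro!: category_Comp[OF V]\<close>)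
  show "Comp (SSet u) (fob (nerve_of V EE) X) (fob (nerve_of V EE) Y) (fob (nerve_of V DD) Y)
      (nerve_nat V DD EE t Y) (far (nerve_of V EE) X Y f) =
     Comp (SSet u) (fob (nerve_of V EE) X) (fob (nerve_of V DD) X) (fob (nerve_of V DD) Y)
      (far (nerve_of V DD) X Y f) (nerve_nat V DD EE t X)"
    if "X \<in> Ob V" "Y \<in> Ob V" "f \<in> Hom V X Y" for X Y f
    using that r
    by (auto simp: SSet_def nerve_of_simps nerve_nat_def fun_eq_iff compose_def category_Comp[OF V]
      category_assoc[OF V])
qed

text \<open>Yoneda in each degree: naturality in C recovers s from its values \<open>t n\<close> on
  the identities of the objects of EE, and naturality in n makes these values a transformation of
  diagrams.\<close>

lemma nerve_nat_unique:
  assumes DD: "is_functor Delta V DD" and EE: "is_functor Delta V EE"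
    and s: "nat_trans V (SSet u) (nerve_of V EE) (nerve_of V DD) s"
  shows "\<exists>t. nat_trans Delta V DD EE t \<and> s = nerve_nat V DD EE t"
proof -
  note r = functor_ob[OF DD, simplified] functor_ob[OF EE, simplified]
  have s1: "nat_trans (op_cat Delta) (SetCat u) (nerve_ob V EE C) (nerve_ob V DD C) (s C)"
    if "C \<in> Ob V" for C
    using nat_transD(2)[OF s that] that by (simp add: SSet_def nerve_of_simps)
  have s2: "s C n \<in> Hom V (fob EE n) C \<rightarrow>\<^sub>E Hom V (fob DD n) C" if "C \<in> Ob V" for C n
    using nat_transD(2)[OF s1[OF that], of n] by simp
  have nat1: "s C' n (Comp V (fob EE n) C C' g x) = Comp V (fob DD n) C C' g (s C n x)"
    if "C \<in> Ob V" "C' \<in> Ob V" "g \<in> Hom V C C'" "x \<in> Hom V (fob EE n) C" for C C' g n x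
    using nat_transD(3)[OF s that(1-3)] that s2[OF that(1), of n]
    by (auto simp: SSet_def nerve_of_simps fun_eq_iff compose_def dest!: spec[of _ n] spec[of _ x])
  have nat2: "s C m (Comp V (fob EE m) (fob EE n) C x (far EE m n h)) =
      Comp V (fob DD m) (fob DD n) C (s C n x) (far DD m n h)"
    if "C \<in> Ob V" "h \<in> Hom Delta m n" "x \<in> Hom V (fob EE n) C" for C h m n x
    using nat_transD(3)[OF s1[OF that(1)], of n m h] that s2[OF that(1), of n]
    unfolding nerve_ob_simps(2)[OF that(2)]
    by (auto simp: fun_eq_iff compose_def dest!: spec[of _ x])
  define t where "t n = s (fob EE n) n (Ident V (fob EE n))" for n
  have t: "t n \<in> Hom V (fob DD n) (fob EE n)" for n
    using s2[of "fob EE n" n] r category_Ident[OF V, of "fob EE n"] unfolding t_def by blast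
  have st: "s C n x = Comp V (fob DD n) (fob EE n) C x (t n)"
    if "C \<in> Ob V" "x \<in> Hom V (fob EE n) C" for C n x
    using nat1[of "fob EE n" C x "Ident V (fob EE n)" n] that r
    by (simp add: category_Ident[OF V] category_Comp_Ident[OF V] t_def)
  have "nat_trans Delta V DD EE t"
    unfolding nat_trans_def
  proof (intro conjI ballI)
    fix m n f assume f: "f \<in> Hom Delta m n"
    have "Comp V (fob DD m) (fob DD n) (fob EE n) (t n) (far DD m n f) =
      s (fob EE n) m (far EE m n f)"
      using nat2[of "fob EE n" f m n "Ident V (fob EE n)"] f r functor_ar[OF EE f]
      by (simp add: t_def category_Ident[OF V] category_Ident_Comp[OF V])
    then show "Comp V (fob DD m) (fob DD n) (fob EE n) (t n) (far DD m n f) =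
       Comp V (fob DD m) (fob EE m) (fob EE n) (far EE m n f) (t m)"
      using st[of "fob EE n" "far EE m n f" m] r functor_ar[OF EE f] by simp
  qed (use t in \<open>auto simp: extensional_def\<close>)
  moreover have "s = nerve_nat V DD EE t"
  proof (intro ext)
    fix C n x
    show "s C n x = nerve_nat V DD EE t C n x"
    proof (cases "C \<in> Ob V")
      case True
      then show ?thesis
        using st[OF True] s2[OF True, of n]
        by (cases "x \<in> Hom V (fob EE n) C") (auto simp: nerve_nat_def PiE_def extensional_def)
    next
      case False
      then show ?thesis using nat_transD(1)[OF s] by (simp add: nerve_nat_def extensional_def)
    qed
  qed
  ultimately show ?thesis by blast
qed

lemma nerve_nat_inj:
  assumes EE: "is_functor Delta V EE"
    and t: "nat_trans Delta V DD EE t" and t': "nat_trans Delta V DD EE t'"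
    and DD: "is_functor Delta V DD"
    and eq: "nerve_nat V DD EE t = nerve_nat V DD EE t'"
  shows "t = t'"
proof
  fix n
  have "nerve_nat V DD EE t (fob EE n) n (Ident V (fob EE n)) =
    nerve_nat V DD EE t' (fob EE n) n (Ident V (fob EE n))"
    using eq by simp
  then show "t n = t' n"
    using functor_ob[OF EE, of n] functor_ob[OF DD, of n] nat_transD(2)[OF t, of n] nat_transD(2)[OF
      t', of n]
    by (simp add: nerve_nat_def category_Ident[OF V] category_Ident_Comp[OF V])
qed

lemma bij_betw_nerve_nat:
  assumes DD: "is_functor Delta V DD" and EE: "is_functor Delta V EE"
  shows "bij_betw (nerve_nat V EE DD) {t. nat_trans Delta V EE DD t}
      {s. nat_trans V (SSet u) (nerve_of V DD) (nerve_of V EE) s}"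
    unfolding bij_betw_def inj_on_def
  using nerve_nat_inj[OF DD _ _ EE] nat_trans_nerve_nat[OF EE DD] nerve_nat_unique[OF EE DD]
    by (auto simp: image_iff)

lemma nerve_nat_Ident:
  assumes DD: "is_functor Delta V DD"
  shows "nerve_nat V DD DD (Ident (Fun Delta V) DD) = Ident (Fun V (SSet u)) (nerve_of V DD)"
  using functor_ob[OF DD]
  by (auto simp: nerve_nat_def SSet_def nerve_of_simps fun_eq_iff restrict_def
    category_Comp_Ident[OF V])

lemma nerve_nat_Comp:
  assumes h: "is_functor Delta V DD" "is_functor Delta V EE" "is_functor Delta V FF"
      "nat_trans Delta V EE DD t" "nat_trans Delta V FF EE s"
  shows "nerve_nat V FF DD (Comp (Fun Delta V) FF EE DD t s) =
       Comp (Fun V (SSet u)) (nerve_of V DD) (nerve_of V EE) (nerve_of V FF) (nerve_nat V FF EE s)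
         (nerve_nat V EE DD t)"
  using functor_ob[OF h(1)] functor_ob[OF h(2)] functor_ob[OF h(3)] nat_transD(2)[OF h(4)]
    nat_transD(2)[OF h(5)]
  by (auto simp: nerve_nat_def SSet_def nerve_of_simps fun_eq_iff restrict_def compose_def
          category_assoc[OF V] category_Comp[OF V])

end

section \<open>Monoidal categories\<close>

text \<open>
  Arrows are tagged with their domain and codomain, so that composites and tensor products need no
  object arguments.
\<close>

abbreviation dm :: "'o \<times> 'a \<times> 'o \<Rightarrow> 'o" where "dm \<equiv> fst"
abbreviation md :: "'o \<times> 'a \<times> 'o \<Rightarrow> 'a" where "md t \<equiv> fst (snd t)"
abbreviation cd :: "'o \<times> 'a \<times> 'o \<Rightarrow> 'o" where "cd t \<equiv> snd (snd t)"

locale monoidal =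
  fixes W :: "('o, 'a) moncat"
  assumes W: "monoidal_category W"
begin

lemma catW: "category W"
  using W unfolding monoidal_category_def by blast

lemmas monoidal_conjuncts = W[unfolded monoidal_category_def Let_def, THEN conjunct2]
lemmas monoidal_Unit = monoidal_conjuncts[THEN conjunct1, rule_format]
lemmas monoidal_TensO = monoidal_conjuncts[THEN conjunct2, THEN conjunct1, rule_format]
lemmas monoidal_TensA = monoidal_conjuncts[THEN conjunct2, THEN conjunct2, THEN conjunct1,
  rule_format]
lemmas monoidal_Ident = monoidal_conjuncts[THEN conjunct2, THEN conjunct2, THEN conjunct2, THEN
  conjunct1, rule_format]
lemmas monoidal_interchange = monoidal_conjuncts[THEN conjunct2, THEN conjunct2, THEN conjunct2,
  THEN conjunct2, THEN conjunct1, rule_format]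
lemmas monoidal_Assoc = monoidal_conjuncts[THEN conjunct2, THEN conjunct2, THEN conjunct2, THEN
  conjunct2, THEN conjunct2, THEN conjunct1, rule_format]
lemmas monoidal_LUnit = monoidal_conjuncts[THEN conjunct2, THEN conjunct2, THEN conjunct2, THEN
  conjunct2, THEN conjunct2, THEN conjunct2, THEN conjunct1, rule_format]
lemmas monoidal_RUnit = monoidal_conjuncts[THEN conjunct2, THEN conjunct2, THEN conjunct2, THEN
  conjunct2, THEN conjunct2, THEN conjunct2, THEN conjunct2, THEN conjunct1, rule_format]
lemmas monoidal_Assoc_nat = monoidal_conjuncts[THEN conjunct2, THEN conjunct2, THEN conjunct2, THEN
  conjunct2, THEN conjunct2, THEN conjunct2, THEN conjunct2, THEN conjunct2, THEN conjunct1,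
  rule_format]
lemmas monoidal_LUnit_nat = monoidal_conjuncts[THEN conjunct2, THEN conjunct2, THEN conjunct2, THEN
  conjunct2, THEN conjunct2, THEN conjunct2, THEN conjunct2, THEN conjunct2, THEN conjunct2, THEN
  conjunct1, rule_format]
lemmas monoidal_RUnit_nat = monoidal_conjuncts[THEN conjunct2, THEN conjunct2, THEN conjunct2, THEN
  conjunct2, THEN conjunct2, THEN conjunct2, THEN conjunct2, THEN conjunct2, THEN conjunct2, THEN
  conjunct2, THEN conjunct1, rule_format]

definition ar :: "'o \<times> 'a \<times> 'o \<Rightarrow> bool" where
  "ar t \<longleftrightarrow> dm t \<in> Ob W \<and> cd t \<in> Ob W \<and> md t \<in> Hom W (dm t) (cd t)"

definition cmp :: "'o \<times> 'a \<times> 'o \<Rightarrow> 'o \<times> 'a \<times> 'o \<Rightarrow> 'o \<times> 'a \<times> 'o"  (infixr "\<cdot>" 70) where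
  "g \<cdot> f = (dm f, Comp W (dm f) (cd f) (cd g) (md g) (md f), cd g)"

abbreviation tob :: "'o \<Rightarrow> 'o \<Rightarrow> 'o"  (infixr "\<odot>" 75) where
  "X \<odot> Y \<equiv> TensO W X Y"

definition tns :: "'o \<times> 'a \<times> 'o \<Rightarrow> 'o \<times> 'a \<times> 'o \<Rightarrow> 'o \<times> 'a \<times> 'o"  (infixr "\<otimes>" 75) where
  "f \<otimes> g = (dm f \<odot> dm g, TensA W (dm f) (cd f) (dm g) (cd g) (md f) (md g), cd f \<odot> cd g)"

definition idt :: "'o \<Rightarrow> 'o \<times> 'a \<times> 'o" where
  "idt X = (X, Ident W X, X)"

definition asc :: "'o \<Rightarrow> 'o \<Rightarrow> 'o \<Rightarrow> 'o \<times> 'a \<times> 'o" where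
  "asc X Y Z = ((X \<odot> Y) \<odot> Z, Assoc W X Y Z, X \<odot> (Y \<odot> Z))"

definition lun :: "'o \<Rightarrow> 'o \<times> 'a \<times> 'o" where
  "lun X = (Unit W \<odot> X, LUnit W X, X)"

definition run :: "'o \<Rightarrow> 'o \<times> 'a \<times> 'o" where
  "run X = (X \<odot> Unit W, RUnit W X, X)"

lemma tag_simps [simp]:
  "dm (g \<cdot> f) = dm f" "cd (g \<cdot> f) = cd g"
  "dm (f \<otimes> g) = dm f \<odot> dm g" "cd (f \<otimes> g) = cd f \<odot> cd g"
  "dm (idt X) = X" "cd (idt X) = X"
  "dm (asc X Y Z) = (X \<odot> Y) \<odot> Z" "cd (asc X Y Z) = X \<odot> (Y \<odot> Z)"
  "dm (lun X) = Unit W \<odot> X" "cd (lun X) = X"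
  "dm (run X) = X \<odot> Unit W" "cd (run X) = X"
  by (simp_all add: cmp_def tns_def idt_def asc_def lun_def run_def)

lemma ar_Ob: "ar f \<Longrightarrow> dm f \<in> Ob W" "ar f \<Longrightarrow> cd f \<in> Ob W"
  by (simp_all add: ar_def)

lemma ar_triple: "ar (X, f, Y) \<longleftrightarrow> X \<in> Ob W \<and> Y \<in> Ob W \<and> f \<in> Hom W X Y"
  by (auto simp: ar_def)

lemma Ob_simps [simp]:
  "Unit W \<in> Ob W" "X \<in> Ob W \<Longrightarrow> Y \<in> Ob W \<Longrightarrow> X \<odot> Y \<in> Ob W"
  by (rule monoidal_Unit, rule monoidal_TensO)

lemma ar_cmp [simp]: "\<lbrakk>ar f; ar g; cd f = dm g\<rbrakk> \<Longrightarrow> ar (g \<cdot> f)"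
  by (simp add: ar_def cmp_def category_Comp[OF catW])

lemma ar_tns [simp]: "\<lbrakk>ar f; ar g\<rbrakk> \<Longrightarrow> ar (f \<otimes> g)"
  by (simp add: ar_def tns_def monoidal_TensA)

lemma ar_idt [simp]: "X \<in> Ob W \<Longrightarrow> ar (idt X)"
  by (auto simp: ar_def idt_def category_Ident[OF catW])

lemma cmp_assoc [simp]:
  "\<lbrakk>ar f; ar g; ar h; cd f = dm g; cd g = dm h\<rbrakk> \<Longrightarrow> (h \<cdot> g) \<cdot> f = h \<cdot> (g \<cdot> f)"
  by (auto simp: ar_def cmp_def category_assoc[OF catW])

lemma cmp_idt [simp]: "\<lbrakk>ar f; dm f = X\<rbrakk> \<Longrightarrow> f \<cdot> idt X = f" "\<lbrakk>ar f; cd f = X\<rbrakk> \<Longrightarrow> idt X \<cdot> f = f"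
  by (auto simp: ar_def cmp_def idt_def category_Comp_Ident[OF catW] category_Ident_Comp[OF catW]
    prod_eq_iff)

lemma tns_idt [simp]: "\<lbrakk>X \<in> Ob W; Y \<in> Ob W\<rbrakk> \<Longrightarrow> idt X \<otimes> idt Y = idt (X \<odot> Y)"
  by (simp add: idt_def tns_def monoidal_Ident)

declare ar_Ob [simp]

lemma interchange:
  "\<lbrakk>ar f; ar f'; ar g; ar g'; cd f = dm f'; cd g = dm g'\<rbrakk> \<Longrightarrow>
    (f' \<otimes> g') \<cdot> (f \<otimes> g) = (f' \<cdot> f) \<otimes> (g' \<cdot> g)"
  unfolding ar_def cmp_def tns_def
  by (simp add: monoidal_interchange)

text \<open>Since \<open>cmp_assoc\<close> nests composites to the right, two adjacent tensor
  products usually come with a tail x. This variant merges them in that position.\<close>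

lemma interchange_reassoc:
  assumes "ar f" "ar f'" "ar g" "ar g'" "cd f = dm f'" "cd g = dm g'" "ar x" "cd x = dm f \<odot> dm g"
  shows "(f' \<otimes> g') \<cdot> ((f \<otimes> g) \<cdot> x) = ((f' \<cdot> f) \<otimes> (g' \<cdot> g)) \<cdot> x"
proof -
  have "(f' \<otimes> g') \<cdot> ((f \<otimes> g) \<cdot> x) = ((f' \<otimes> g') \<cdot> (f \<otimes> g)) \<cdot> x"
    using assms by simp
  then show ?thesis using assms by (simp only: interchange)
qed

lemmas fuse = interchange interchange_reassoc

definition tiso :: "'o \<times> 'a \<times> 'o \<Rightarrow> bool" where
  "tiso f \<longleftrightarrow> ar f \<and> (\<exists>g. ar g \<and> dm g = cd f \<and> cd g = dm f \<and> g \<cdot> f = idt (dm f) \<and> f \<cdot> g = idt (cd f))"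

text \<open>Inverses are needed as terms, for instance in the recursion \<open>extend\<close>, and
  not only as existence statements.\<close>

definition tinv :: "'o \<times> 'a \<times> 'o \<Rightarrow> 'o \<times> 'a \<times> 'o" where
  "tinv f = (SOME g. ar g \<and> dm g = cd f \<and> cd g = dm f \<and> g \<cdot> f = idt (dm f) \<and> f \<cdot> g = idt (cd f))"

lemma tinv_simps [simp]:
  assumes "tiso f"
  shows "ar (tinv f)" "dm (tinv f) = cd f" "cd (tinv f) = dm f" "tinv f \<cdot> f = idt (dm f)" "f \<cdot>
    tinv f = idt (cd f)"
proof -
  from assms have "\<exists>g. ar g \<and> dm g = cd f \<and> cd g = dm f \<and> g \<cdot> f = idt (dm f) \<and> f \<cdot> g = idt (cd f)"
    by (simp add: tiso_def)
  from someI_ex[OF this]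
  show "ar (tinv f)" "dm (tinv f) = cd f" "cd (tinv f) = dm f" "tinv f \<cdot> f = idt (dm f)" "f \<cdot>
    tinv f = idt (cd f)"
    unfolding tinv_def by blast+
qed

lemma isoI: "\<lbrakk>ar f; ar g; dm g = cd f; cd g = dm f; g \<cdot> f = idt (dm f); f \<cdot> g = idt (cd f)\<rbrakk> \<Longrightarrow>
  tiso f"
  unfolding tiso_def by blast

lemma iso_ar [simp]: "tiso f \<Longrightarrow> ar f"
  by (simp add: tiso_def)

lemma iso_arr_iso: "iso_arr W X Y f \<Longrightarrow> X \<in> Ob W \<Longrightarrow> Y \<in> Ob W \<Longrightarrow> tiso (X, f, Y)"
  unfolding iso_arr_def by (auto intro!: isoI[where g = "(Y, g, X)"
    for g] simp: ar_def cmp_def idt_def simp del: ar_Ob)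

lemma iso_tns: "\<lbrakk>tiso f; tiso g\<rbrakk> \<Longrightarrow> tiso (f \<otimes> g)"
  by (rule isoI[where g = "tinv f \<otimes> tinv g"]) (simp_all add: fuse)

lemma iso_idt: "X \<in> Ob W \<Longrightarrow> tiso (idt X)"
  by (rule isoI[where g = "idt X"]) simp_all

text \<open>Cancels on the source side. It is applied to \<open>mu\<close> at a joint, possibly
  tensored with an identity, to reduce a claim on a long hom-object to claims on its pieces.\<close>

lemma iso_cancel:
  assumes "tiso e" "ar f" "ar g" "dm f = cd e" "dm g = cd e" "f \<cdot> e = g \<cdot> e"
  shows "f = g"
proof -
  have "(f \<cdot> e) \<cdot> tinv e = (g \<cdot> e) \<cdot> tinv e" using assms(6) by (simp only:)
  then show ?thesis using assms(1-5) by simp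
qed

lemma coherence_iso:
  "\<lbrakk>X \<in> Ob W; Y \<in> Ob W; Z \<in> Ob W\<rbrakk> \<Longrightarrow> tiso (asc X Y Z)"
  "X \<in> Ob W \<Longrightarrow> tiso (lun X)" "X \<in> Ob W \<Longrightarrow> tiso (run X)"
  unfolding asc_def lun_def run_def
  by (simp_all add: iso_arr_iso monoidal_Assoc monoidal_LUnit monoidal_RUnit)

lemma coherence_ar [simp]:
  "\<lbrakk>X \<in> Ob W; Y \<in> Ob W; Z \<in> Ob W\<rbrakk> \<Longrightarrow> ar (asc X Y Z)"
  "X \<in> Ob W \<Longrightarrow> ar (lun X)" "X \<in> Ob W \<Longrightarrow> ar (run X)"
  by (simp_all add: coherence_iso)

lemma asc_natural:
  "\<lbrakk>ar f; ar g; ar h; X = cd f; Y = cd g; Z = cd h\<rbrakk> \<Longrightarrow>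
    asc X Y Z \<cdot> ((f \<otimes> g) \<otimes> h) = (f \<otimes> (g \<otimes> h)) \<cdot> asc (dm f) (dm g) (dm h)"
  unfolding ar_def cmp_def tns_def asc_def
  by (simp add: monoidal_Assoc_nat)

lemma lun_natural: "\<lbrakk>ar f; X = cd f\<rbrakk> \<Longrightarrow> lun X \<cdot> (idt (Unit W) \<otimes> f) = f \<cdot> lun (dm f)"
  unfolding ar_def cmp_def tns_def lun_def idt_def
  by (simp add: monoidal_LUnit_nat)

lemma run_natural: "\<lbrakk>ar f; X = cd f\<rbrakk> \<Longrightarrow> run X \<cdot> (f \<otimes> idt (Unit W)) = f \<cdot> run (dm f)"
  unfolding ar_def cmp_def tns_def run_def idt_def
  by (simp add: monoidal_RUnit_nat)

text \<open>This settles every equation whose source has a backward hom-object as a tensor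
  factor.\<close>

lemma initial_unique:
  "\<lbrakk>initial W (dm f); ar f; ar g; dm f = dm g; cd f = cd g\<rbrakk> \<Longrightarrow> f = g"
  unfolding initial_def ar_def by (cases f, cases g) (auto)

lemma initial_the_arr: "\<lbrakk>initial W X; Y \<in> Ob W\<rbrakk> \<Longrightarrow> the_arr W X Y \<in> Hom W X Y"
  unfolding initial_def the_arr_def by (metis theI')

section \<open>Enriched categories\<close>

definition cmpW :: "('v, 'o, 'a) wcat \<Rightarrow> 'v \<Rightarrow> 'v \<Rightarrow> 'v \<Rightarrow> 'o \<times> 'a \<times> 'o" where
  "cmpW C x y z = (wHom C x y \<odot> wHom C y z, wComp C x y z, wHom C x z)"

definition idW :: "('v, 'o, 'a) wcat \<Rightarrow> 'v \<Rightarrow> 'o \<times> 'a \<times> 'o" where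
  "idW C x = (Unit W, wId C x, wHom C x x)"

definition homW :: "('v, 'o, 'a) wcat \<Rightarrow> ('v, 'o, 'a) wcat \<Rightarrow> ('v, 'a) wfun \<Rightarrow> 'v \<Rightarrow> 'v \<Rightarrow>
  'o \<times> 'a \<times> 'o" where
  "homW C D F x y = (wHom C x y, wfH F x y, wHom D (wfO F x) (wfO F y))"

lemma tagW_simps [simp]:
  "dm (cmpW C x y z) = wHom C x y \<odot> wHom C y z" "cd (cmpW C x y z) = wHom C x z"
  "dm (idW C x) = Unit W" "cd (idW C x) = wHom C x x"
  "dm (homW C D F x y) = wHom C x y" "cd (homW C D F x y) = wHom D (wfO F x) (wfO F y)"
  by (simp_all add: cmpW_def idW_def homW_def)

lemma is_wcatI:
  assumes "\<And>x y. \<not> (x \<in> wOb C \<and> y \<in> wOb C) \<Longrightarrow> wHom C x y = undefined"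
    and "\<And>x y z. \<not> (x \<in> wOb C \<and> y \<in> wOb C \<and> z \<in> wOb C) \<Longrightarrow> wComp C x y z = undefined"
    and "wId C \<in> extensional (wOb C)"
    and "\<And>x y. \<lbrakk>x \<in> wOb C; y \<in> wOb C\<rbrakk> \<Longrightarrow> wHom C x y \<in> Ob W"
    and "\<And>x y z. \<lbrakk>x \<in> wOb C; y \<in> wOb C; z \<in> wOb C\<rbrakk> \<Longrightarrow> ar (cmpW C x y z)"
    and "\<And>x. x \<in> wOb C \<Longrightarrow> ar (idW C x)"
    and "\<And>x y z w. \<lbrakk>x \<in> wOb C; y \<in> wOb C; z \<in> wOb C; w \<in> wOb C\<rbrakk> \<Longrightarrow>
      cmpW C x z w \<cdot> (cmpW C x y z \<otimes> idt (wHom C z w)) =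
      cmpW C x y w \<cdot> ((idt (wHom C x y) \<otimes> cmpW C y z w) \<cdot>
        asc (wHom C x y) (wHom C y z) (wHom C z w))"
    and "\<And>x y. \<lbrakk>x \<in> wOb C; y \<in> wOb C\<rbrakk> \<Longrightarrow>
      cmpW C x x y \<cdot> (idW C x \<otimes> idt (wHom C x y)) = lun (wHom C x y)"
    and "\<And>x y. \<lbrakk>x \<in> wOb C; y \<in> wOb C\<rbrakk> \<Longrightarrow>
      cmpW C x y y \<cdot> (idt (wHom C x y) \<otimes> idW C y) = run (wHom C x y)"
  shows "is_wcat W C"
proof -
  \<comment> \<open>The definition of \<open>is_wcat\<close> brackets the composite in front of the
    associator, whereas the tagged form is nested to the right.\<close>
  have "\<And>x y z w. \<lbrakk>x \<in> wOb C; y \<in> wOb C; z \<in> wOb C; w \<in> wOb C\<rbrakk> \<Longrightarrow>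
      cmpW C x z w \<cdot> (cmpW C x y z \<otimes> idt (wHom C z w)) =
      (cmpW C x y w \<cdot> (idt (wHom C x y) \<otimes> cmpW C y z w)) \<cdot>
        asc (wHom C x y) (wHom C y z) (wHom C z w)"
    using assms(4,5,7) by (subst cmp_assoc) simp_all
  then show ?thesis
    unfolding is_wcat_def Let_def
    using assms(1-6,8,9)
    by (simp add: cmpW_def idW_def ar_def idt_def tns_def cmp_def asc_def lun_def run_def
      del: ar_Ob)
qed

context
  fixes C :: "('v, 'o, 'a) wcat"
  assumes C: "is_wcat W C"
begin

lemmas wcat_conjuncts = C[unfolded is_wcat_def Let_def]
lemmas wcat_Hom = wcat_conjuncts[THEN conjunct2, THEN conjunct2, THEN conjunct2, THEN conjunct1,
  rule_format]
lemmas wcat_Comp = wcat_conjuncts[THEN conjunct2, THEN conjunct2, THEN conjunct2, THEN conjunct2,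
  THEN conjunct1, rule_format]
lemmas wcat_Id = wcat_conjuncts[THEN conjunct2, THEN conjunct2, THEN conjunct2, THEN conjunct2, THEN
  conjunct2, THEN conjunct1, rule_format]
lemmas wcat_assoc_raw = wcat_conjuncts[THEN conjunct2, THEN conjunct2, THEN conjunct2, THEN
  conjunct2, THEN conjunct2, THEN conjunct2, THEN conjunct1, rule_format]

lemma wHom_Ob [simp]: "\<lbrakk>x \<in> wOb C; y \<in> wOb C\<rbrakk> \<Longrightarrow> wHom C x y \<in> Ob W"
  by (rule wcat_Hom)

lemma ar_cmpW [simp]: "\<lbrakk>x \<in> wOb C; y \<in> wOb C; z \<in> wOb C\<rbrakk> \<Longrightarrow> ar (cmpW C x y z)"
  unfolding cmpW_def ar_def by (simp add: wcat_Comp)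

lemma ar_idW [simp]: "x \<in> wOb C \<Longrightarrow> ar (idW C x)"
  unfolding idW_def ar_def by (simp add: wcat_Id)

lemma wcat_assoc:
  assumes "x \<in> wOb C" "y \<in> wOb C" "z \<in> wOb C" "w \<in> wOb C"
  shows "cmpW C x z w \<cdot> (cmpW C x y z \<otimes> idt (wHom C z w)) =
      cmpW C x y w \<cdot> ((idt (wHom C x y) \<otimes> cmpW C y z w) \<cdot>
        asc (wHom C x y) (wHom C y z) (wHom C z w))"
proof -
  have "cmpW C x z w \<cdot> (cmpW C x y z \<otimes> idt (wHom C z w)) =
      (cmpW C x y w \<cdot> (idt (wHom C x y) \<otimes> cmpW C y z w)) \<cdot>
        asc (wHom C x y) (wHom C y z) (wHom C z w)"
    using assms unfolding cmpW_def asc_def cmp_def tns_def idt_def by (simp add: wcat_assoc_raw)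
  then show ?thesis using assms by simp
qed

end

lemma is_wfunctorI:
  assumes "wfO F \<in> wOb C \<rightarrow>\<^sub>E wOb D"
    and "\<And>x y. \<not> (x \<in> wOb C \<and> y \<in> wOb C) \<Longrightarrow> wfH F x y = undefined"
    and "\<And>x y. \<lbrakk>x \<in> wOb C; y \<in> wOb C\<rbrakk> \<Longrightarrow> ar (homW C D F x y)"
    and "\<And>x y z. \<lbrakk>x \<in> wOb C; y \<in> wOb C; z \<in> wOb C\<rbrakk> \<Longrightarrow>
      homW C D F x z \<cdot> cmpW C x y z =
      cmpW D (wfO F x) (wfO F y) (wfO F z) \<cdot> (homW C D F x y \<otimes> homW C D F y z)"
    and "\<And>x. x \<in> wOb C \<Longrightarrow> homW C D F x x \<cdot> idW C x = idW D (wfO F x)"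
  shows "is_wfunctor W C D F"
  unfolding is_wfunctor_def Let_def using assms
  by (simp add: cmpW_def idW_def homW_def ar_def tns_def cmp_def del: ar_Ob)

context
  fixes C D :: "('v, 'o, 'a) wcat" and F
  assumes F: "is_wfunctor W C D F"
begin

lemmas wfunctor_conjuncts = F[unfolded is_wfunctor_def Let_def]
lemmas wfunctor_Hom = wfunctor_conjuncts[THEN conjunct2, THEN conjunct2, THEN conjunct1,
  rule_format]
lemmas wfunctor_Comp = wfunctor_conjuncts[THEN conjunct2, THEN conjunct2, THEN conjunct2, THEN
  conjunct1, rule_format]
lemmas wfunctor_Id = wfunctor_conjuncts[THEN conjunct2, THEN conjunct2, THEN conjunct2, THEN
  conjunct2, rule_format]

lemma wfO_ext: "wfO F \<in> wOb C \<rightarrow>\<^sub>E wOb D"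
  using F unfolding is_wfunctor_def Let_def by blast

lemma wfO_Ob [simp]: "x \<in> wOb C \<Longrightarrow> wfO F x \<in> wOb D"
  using wfO_ext by blast

lemma wfH_undef: "\<not> (x \<in> wOb C \<and> y \<in> wOb C) \<Longrightarrow> wfH F x y = undefined"
  using F unfolding is_wfunctor_def Let_def by blast

lemma ar_homW [simp]:
  "\<lbrakk>is_wcat W C; is_wcat W D; x \<in> wOb C; y \<in> wOb C\<rbrakk> \<Longrightarrow> ar (homW C D F x y)"
  unfolding homW_def ar_def by (simp add: wfunctor_Hom)

lemma homW_cmpW:
  "\<lbrakk>x \<in> wOb C; y \<in> wOb C; z \<in> wOb C\<rbrakk> \<Longrightarrow> homW C D F x z \<cdot> cmpW C x y z =
      cmpW D (wfO F x) (wfO F y) (wfO F z) \<cdot> (homW C D F x y \<otimes> homW C D F y z)"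
  unfolding homW_def cmpW_def cmp_def tns_def by (simp add: wfunctor_Comp)

lemma homW_idW: "x \<in> wOb C \<Longrightarrow> homW C D F x x \<cdot> idW C x = idW D (wfO F x)"
  unfolding homW_def idW_def cmp_def tns_def by (simp add: wfunctor_Id)

end

lemma wfun_eqI:
  fixes F G :: "('v, 'a) wfun"
  assumes F: "is_wfunctor W C D F" and G: "is_wfunctor W C D' G"
    and "\<And>x. x \<in> wOb C \<Longrightarrow> wfO F x = wfO G x"
    and "\<And>x y. \<lbrakk>x \<in> wOb C; y \<in> wOb C\<rbrakk> \<Longrightarrow> wfH F x y = wfH G x y"
  shows "F = G"
proof -
  have "wfO F = wfO G" using assms(3) wfO_ext[OF F] wfO_ext[OF G]
    by (auto intro!: extensionalityI[of _ "wOb C"] simp: PiE_def)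
  moreover have "wfH F = wfH G"
    using assms(4) wfH_undef[OF F] wfH_undef[OF G] by (intro ext) metis
  ultimately show ?thesis by (cases F; cases G) simp
qed

lemma wfO_comp_wfun [simp]: "x \<in> wOb C \<Longrightarrow> wfO (comp_wfun W C D E G F) x = wfO G (wfO F x)"
  by (simp add: comp_wfun_def)

lemma homW_comp_wfun:
  "\<lbrakk>x \<in> wOb C; y \<in> wOb C\<rbrakk> \<Longrightarrow> homW C E (comp_wfun W C D E G F) x y =
     homW D E G (wfO F x) (wfO F y) \<cdot> homW C D F x y"
  by (simp add: homW_def comp_wfun_def cmp_def)

lemma homW_eq_wfH: "homW C D F x y = homW C D' G x y \<Longrightarrow> wfH F x y = wfH G x y"
  by (simp add: homW_def)

lemma is_wfunctor_comp:
  assumes "is_wcat W C" "is_wcat W D" "is_wcat W E" and F: "is_wfunctor W C D F"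
    and G: "is_wfunctor W D E G"
  shows "is_wfunctor W C E (comp_wfun W C D E G F)"
proof (rule is_wfunctorI)
  show "wfO (comp_wfun W C D E G F) \<in> wOb C \<rightarrow>\<^sub>E wOb E"
    using wfO_ext[OF F] wfO_ext[OF G] by (auto simp: comp_wfun_def)
  fix x assume x: "x \<in> wOb C"
  note r = assms(1-3) F G
  have "homW D E G (wfO F x) (wfO F x) \<cdot> (homW C D F x x \<cdot> idW C x) = idW E (wfO G (wfO F x))"
    using x r by (simp add: homW_idW)
  then show "homW C E (comp_wfun W C D E G F) x x \<cdot> idW C x = idW E (wfO (comp_wfun W C D E G F) x)"
    using x r by (simp add: homW_comp_wfun)
next
  fix x y z assume xyz: "x \<in> wOb C" "y \<in> wOb C" "z \<in> wOb C"
  note r = xyz assms(1-3) F G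
  have "homW D E G (wfO F x) (wfO F z) \<cdot> (homW C D F x z \<cdot> cmpW C x y z) =
    (homW D E G (wfO F x) (wfO F z) \<cdot> cmpW D (wfO F x) (wfO F y) (wfO F z)) \<cdot> (homW C D F x y \<otimes>
      homW C D F y z)"
    using r by (simp add: homW_cmpW[OF F])
  then show "homW C E (comp_wfun W C D E G F) x z \<cdot> cmpW C x y z =
       cmpW E (wfO (comp_wfun W C D E G F) x) (wfO (comp_wfun W C D E G F) y)
         (wfO (comp_wfun W C D E G F) z) \<cdot>
       (homW C E (comp_wfun W C D E G F) x y \<otimes> homW C E (comp_wfun W C D E G F) y z)"
    using r by (simp add: homW_comp_wfun homW_cmpW[OF G] fuse)
qed (use assms in \<open>auto simp: comp_wfun_def homW_comp_wfun[unfolded comp_wfun_def]\<close>)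

lemma homW_id_wfun: "\<lbrakk>x \<in> wOb C; y \<in> wOb C\<rbrakk> \<Longrightarrow> homW C C (id_wfun W C) x y = idt (wHom C x y)"
  by (simp add: homW_def idt_def id_wfun_def)

lemma wfO_id_wfun [simp]: "x \<in> wOb C \<Longrightarrow> wfO (id_wfun W C) x = x"
  by (simp add: id_wfun_def)

lemma is_wfunctor_id: "is_wcat W C \<Longrightarrow> is_wfunctor W C C (id_wfun W C)"
  by (rule is_wfunctorI)
    (auto simp: homW_id_wfun, auto simp: id_wfun_def)

lemma WCat_simps [simp]:
  "Ob (WCat u W) = {C. is_wcat W C \<and> small u (wOb C)}"
  "Hom (WCat u W) C D = {F. is_wfunctor W C D F}"
  "Ident (WCat u W) = id_wfun W"
  "Comp (WCat u W) = comp_wfun W"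
  by (simp_all add: WCat_def)

lemma comp_wfun_id:
  assumes "is_wcat W C" "is_wcat W D" and F: "is_wfunctor W C D F"
  shows "comp_wfun W C C D F (id_wfun W C) = F" "comp_wfun W C D D (id_wfun W D) F = F"
proof -
  note [simp] = wfO_Ob[OF F] ar_homW[OF F assms(1,2)]
  show "comp_wfun W C C D F (id_wfun W C) = F"
    by (rule wfun_eqI[OF is_wfunctor_comp[OF assms(1,1,2) is_wfunctor_id F] F])
      (auto intro!: homW_eq_wfH[of C D _ _ _ D] simp: homW_comp_wfun homW_id_wfun assms)
  show "comp_wfun W C D D (id_wfun W D) F = F"
    by (rule wfun_eqI[OF is_wfunctor_comp[OF assms(1,2,2) F is_wfunctor_id] F])
      (auto intro!: homW_eq_wfH[of C D _ _ _ D] simp: homW_comp_wfun homW_id_wfun assms)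
qed

lemma comp_wfun_assoc:
  assumes "is_wcat W A" "is_wcat W B" "is_wcat W C" "is_wcat W D"
    and F: "is_wfunctor W A B F" and G: "is_wfunctor W B C G" and H: "is_wfunctor W C D H"
  shows "comp_wfun W A B D (comp_wfun W B C D H G) F = comp_wfun W A C D H (comp_wfun W A B C G F)"
proof (rule wfun_eqI)
  show "is_wfunctor W A D (comp_wfun W A B D (comp_wfun W B C D H G) F)"
    "is_wfunctor W A D (comp_wfun W A C D H (comp_wfun W A B C G F))"
    by (intro is_wfunctor_comp assms)+
  show "wfH (comp_wfun W A B D (comp_wfun W B C D H G) F) x y =
           wfH (comp_wfun W A C D H (comp_wfun W A B C G F)) x y" if "x \<in> wOb A" "y \<in> wOb A" for x y
    by (rule homW_eq_wfH[of A D _ _ _ D]) (use that assms in \<open>simp add: homW_comp_wfun\<close>)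
qed (use assms in simp)

lemma category_WCat: "category (WCat u W)"
  unfolding category_def WCat_simps
  by (auto simp: is_wfunctor_id is_wfunctor_comp comp_wfun_id comp_wfun_assoc)

end

section \<open>Necklaces and their sub-necklaces\<close>

lemma Ob_Nec: "A \<in> Ob Nec \<longleftrightarrow> 0 \<in> fst A \<and> snd A \<in> fst A \<and> fst A \<subseteq> {..snd A}"
  and Hom_Nec: "f \<in> Hom Nec A B \<longleftrightarrow>
    f \<in> Hom Delta (snd A) (snd B) \<and> f 0 = 0 \<and> f (snd A) = snd B \<and> fst B \<subseteq> f ` fst A"
  by (auto simp: Nec_def Delta_f_Hom_def split: prod.splits)

lemma Nec_simps [simp]:
  "Ident Nec A = Ident Delta (snd A)"
  "Comp Nec A B C g f = compose {..snd A} g f"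
  "TensO Nec = wedge" "TensA Nec = wedge_map" "Unit Nec = simplex 0"
  "Assoc Nec A B C = Ident Delta (snd A + snd B + snd C)"
  "LUnit Nec A = Ident Delta (snd A)" "RUnit Nec A = Ident Delta (snd A)"
  by (auto simp: Nec_def split: prod.splits)

context
  notes [simp] = Ob_Nec Hom_Nec
begin

lemma snd_simplex [simp]: "snd (simplex n) = n"
  by (simp add: simplex_def)

lemma snd_wedge [simp]: "snd (wedge A B) = snd A + snd B"
  by (simp add: wedge_def)

lemma simplex_Ob: "simplex n \<in> Ob Nec"
  by (auto simp: simplex_def)

lemma wedge_assoc: "wedge (wedge A B) C = wedge A (wedge B C)"
  by (simp add: wedge_def image_Un image_image Un_assoc add.assoc)

lemma wedge_unit: "A \<in> Ob Nec \<Longrightarrow> wedge (simplex 0) A = A" "A \<in> Ob Nec \<Longrightarrow> wedge A (simplex 0) = A"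
  by (auto simp: wedge_def simplex_def prod_eq_iff)

lemma wedge_Ob: "A \<in> Ob Nec \<Longrightarrow> B \<in> Ob Nec \<Longrightarrow> wedge A B \<in> Ob Nec"
  by (force simp: wedge_def)

text \<open>The vertices i and j may lie inside beads of A; they are added as joints by hand so that
  the stretch between them is a necklace.\<close>

definition restr :: "necklace \<Rightarrow> nat \<Rightarrow> nat \<Rightarrow> necklace" where
  "restr A i j = ({0, j - i} \<union> (\<lambda>t. t - i) ` (fst A \<inter> {i..j}), j - i)"

text \<open>This is the map \<open>f_{i,j}\<close> of the definition of \<open>Phi\<close>: f on the
  stretch from i to j in vertices relative to the starting points, and hence endpoint
  preserving.\<close>

definition seg :: "(nat \<Rightarrow> nat) \<Rightarrow> nat \<Rightarrow> nat \<Rightarrow> nat \<Rightarrow> nat" where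
  "seg f i j = (\<lambda>k\<in>{..j - i}. f (k + i) - f i)"

text \<open>
  All simplicial maps between two necklaces, not only the bipointed ones: a joint of \<open>B\<close> in the
    range
  of the endpoints must be hit by a joint of \<open>A\<close>, so that every bead of \<open>A\<close> lands in a bead of \<open>B\<close>.
\<close>

definition nmaps :: "necklace \<Rightarrow> necklace \<Rightarrow> (nat \<Rightarrow> nat) set" where
  "nmaps A B = {f. A \<in> Ob Nec \<and> B \<in> Ob Nec \<and> f \<in> Hom Delta (snd A) (snd B) \<and>
     (\<forall>u\<in>fst B. f 0 \<le> u \<longrightarrow> u \<le> f (snd A) \<longrightarrow> u \<in> f ` fst A)}"

lemma nmapsD:
  assumes "f \<in> nmaps A B"
  shows "f \<in> Hom Delta (snd A) (snd B)"
    and "i \<le> snd A \<Longrightarrow> f i \<le> snd B" and "\<lbrakk>i \<le> j; j \<le> snd A\<rbrakk> \<Longrightarrow> f i \<le> f j"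
    and "\<lbrakk>u \<in> fst B; f 0 \<le> u; u \<le> f (snd A)\<rbrakk> \<Longrightarrow> u \<in> f ` fst A"
    and "A \<in> Ob Nec" "B \<in> Ob Nec" "a \<in> fst A \<Longrightarrow> a \<le> snd A" "b \<in> fst B \<Longrightarrow> b \<le> snd B"
  using assms unfolding nmaps_def by (auto simp: monotone_on_def)

lemma Hom_Nec_nmaps:
  assumes "A \<in> Ob Nec" "B \<in> Ob Nec"
  shows "f \<in> Hom Nec A B \<longleftrightarrow> f \<in> nmaps A B \<and> f 0 = 0 \<and> f (snd A) = snd B"
  using assms unfolding nmaps_def by auto

lemma nmaps_id: "Ident Delta (snd A) \<in> nmaps A A" if "A \<in> Ob Nec"
  using that by (auto simp: nmaps_def monotone_on_def)

lemma compose_Hom_Delta: "\<lbrakk>f \<in> Hom Delta m n; g \<in> Hom Delta n p\<rbrakk> \<Longrightarrow>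
  compose {..m} g f \<in> Hom Delta m p"
  using category_Comp[OF category_Delta, of f m n g p] by simp

lemma nmaps_comp:
  assumes f: "f \<in> nmaps A B" and g: "g \<in> nmaps B C"
  shows "compose {..snd A} g f \<in> nmaps A C"
proof -
  note A = nmapsD(5)[OF f]
  have main: "u \<in> (\<lambda>x. g (f x)) ` fst A" if u: "u \<in> fst C" "g (f 0) \<le> u" "u \<le> g (f (snd A))" for u
  proof -
    have "g 0 \<le> u" "u \<le> g (snd B)"
      using u nmapsD(3)[OF g, of 0 "f 0"] nmapsD(3)[OF g, of "f (snd A)" "snd B"]
        nmapsD(2)[OF f] by (meson le_trans le0 order_refl)+
    then obtain b where b: "b \<in> fst B" "u = g b" using nmapsD(4)[OF g u(1)] by blast
    have bf: "f 0 \<le> snd B" "f (snd A) \<le> snd B" using nmapsD(2)[OF f] by auto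
    show ?thesis
    proof (cases "f 0 \<le> b \<and> b \<le> f (snd A)")
      case True
      then show ?thesis using nmapsD(4)[OF f b(1)] b(2) by blast
    next
      \<comment> \<open>By monotonicity a joint b of B outside the range of f is sent by g to an end
        value of the composite, and the endpoints of A are joints that hit it.\<close>
      case False
      then have "u = g (f 0) \<or> u = g (f (snd A))"
        using u b bf nmapsD(3)[OF g, of b "f 0"] nmapsD(3)[OF g, of "f (snd A)" b] nmapsD(7)[OF g
          b(1)]
        by (cases "f 0 \<le> b") auto
      then show ?thesis using A by auto
    qed
  qed
  have "u \<in> compose {..snd A} g f ` fst A" if "u \<in> fst C" "g (f 0) \<le> u" "u \<le> g (f (snd A))" for u
  proof -
    from main[OF that] obtain a where "a \<in> fst A" "u = g (f a)" by blast
    then show ?thesis using A by (intro image_eqI[of _ _ a]) (auto simp: compose_def)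
  qed
  then show ?thesis
    unfolding nmaps_def mem_Collect_eq
    using compose_Hom_Delta[OF nmapsD(1)[OF f] nmapsD(1)[OF g]]
      by (simp add: compose_def nmapsD(5)[OF f, simplified] nmapsD(6)[OF g, simplified])
qed

lemma restr_Ob: "i \<le> j \<Longrightarrow> restr A i j \<in> Ob Nec"
  by (auto simp: restr_def)

lemma snd_restr [simp]: "snd (restr A i j) = j - i"
  by (simp add: restr_def)

lemma restr_full: "A \<in> Ob Nec \<Longrightarrow> restr A 0 (snd A) = A"
  by (auto simp: restr_def prod_eq_iff)

lemma restr_point: "restr A i i = simplex 0"
  by (auto simp: restr_def simplex_def)

lemma restr_simplex: "\<lbrakk>i \<le> j; j \<le> n\<rbrakk> \<Longrightarrow> restr (simplex n) i j = simplex (j - i)"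
  by (auto simp: restr_def simplex_def)

lemma restr_wedge_left:
  assumes "A \<in> Ob Nec" "B \<in> Ob Nec" "i \<le> j" "j \<le> snd A"
  shows "restr (wedge A B) i j = restr A i j"
proof -
  have "fst (wedge A B) \<inter> {i..j} = fst A \<inter> {i..j}"
  proof -
    \<comment> \<open>A joint of B at offset x lies in the stretch only if x = 0, where it is the
      glued vertex.\<close>
    have "snd A + x \<in> fst A" if "snd A + x \<le> j" for x using that assms by (cases x) auto
    then show ?thesis using assms by (auto simp: wedge_def)
  qed
  then show ?thesis by (simp add: restr_def)
qed

lemma restr_wedge_right:
  assumes "A \<in> Ob Nec" "B \<in> Ob Nec" "i \<le> j" "j \<le> snd B"
  shows "restr (wedge A B) (snd A + i) (snd A + j) = restr B i j"
proof -
  have "fst (wedge A B) \<inter> {snd A + i..snd A + j} = (\<lambda>k. snd A + k) ` (fst B \<inter> {i..j})"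
    using assms by (force simp: wedge_def)
  then show ?thesis by (simp add: restr_def image_image)
qed

text \<open>Cutting at a joint loses nothing. This equality makes the composition of
  \<open>Psi\<close> invertible at joints.\<close>

lemma restr_wedge_joint:
  assumes "k \<in> fst A" "i \<le> k" "k \<le> j"
  shows "wedge (restr A i k) (restr A k j) = restr A i j"
proof -
  have "fst A \<inter> {i..j} = (fst A \<inter> {i..k}) \<union> (fst A \<inter> {k..j})" using assms by auto
  moreover have "(\<lambda>x. (k - i) + x) ` (\<lambda>t. t - k) ` (fst A \<inter> {k..j}) =
    (\<lambda>t. t - i) ` (fst A \<inter> {k..j})"
    unfolding image_image using assms by (intro image_cong) auto
  moreover have "k - i \<in> (\<lambda>t. t - i) ` (fst A \<inter> {i..k})" using assms by auto
  ultimately show ?thesis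
    using assms by (auto simp: restr_def wedge_def image_Un)
qed

text \<open>A necklace map may forget joints of its source but cannot create joints in its target.
  Cutting at k adds k as a joint, so the vertex identity is a map in this direction; D of it enters
  the composition of \<open>Psi\<close>.\<close>

lemma restr_wedge_sub: "\<lbrakk>i \<le> k; k \<le> j\<rbrakk> \<Longrightarrow> Ident Delta (j - i) \<in> Hom Nec (wedge (restr A i k)
  (restr A k j)) (restr A i j)"
proof -
  assume ikj: "i \<le> k" "k \<le> j"
  have "fst (restr A i j) \<subseteq> fst (wedge (restr A i k) (restr A k j))"
  proof
    fix u assume "u \<in> fst (restr A i j)"
    then consider "u = 0" | "u = j - i" | t where "t \<in> fst A" "i \<le> t" "t \<le> j" "u = t - i"
      by (auto simp: restr_def)
    then show "u \<in> fst (wedge (restr A i k) (restr A k j))"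
    proof cases
      case (3 t)
      show ?thesis
      proof (cases "t \<le> k")
        case True
        then show ?thesis using 3 by (auto simp: restr_def wedge_def)
      next
        case False
        then have "u = (k - i) + (t - k)" "t - k \<in> fst (restr A k j)" using 3 ikj
          by (auto simp: restr_def)
        then show ?thesis unfolding wedge_def by simp
      qed
    next
      case 2
      then have "u = (k - i) + (j - k)" "j - k \<in> fst (restr A k j)" using ikj
        by (auto simp: restr_def)
      then show ?thesis unfolding wedge_def by simp
    qed (auto simp: restr_def wedge_def)
  qed
  moreover have "fst (restr A i j) \<subseteq> {..j - i}" using restr_Ob[of i j A] ikj by simp
  ultimately have "fst (restr A i j) \<subseteq> (\<lambda>k\<in>{..j - i}. k) ` fst (wedge (restr A i k) (restr A k j))"
    by (force simp: image_iff)
  then show ?thesis using ikj by (auto simp: monotone_on_def)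
qed

lemma seg_Hom:
  assumes f: "f \<in> nmaps A B" and ij: "i \<le> j" "j \<le> snd A"
  shows "seg f i j \<in> Hom Nec (restr A i j) (restr B (f i) (f j))"
proof -
  have mono: "f a \<le> f b" if "a \<le> b" "b \<le> j" for a b
    using that ij nmapsD(3)[OF f] by simp
  have "fst (restr B (f i) (f j)) \<subseteq> seg f i j ` fst (restr A i j)"
  proof
    fix u assume "u \<in> fst (restr B (f i) (f j))"
    then consider "u = 0" | "u = f j - f i" | v where "v \<in> fst B" "f i \<le> v" "v \<le> f j" "u = v - f i"
      by (auto simp: restr_def)
    then show "u \<in> seg f i j ` fst (restr A i j)"
    proof cases
      case 1
      then show ?thesis by (intro image_eqI[of _ _ 0]) (auto simp: seg_def restr_def)
    next
      case 2
      then show ?thesis using ij by (intro image_eqI[of _ _ "j - i"]) (auto simp: seg_def restr_def)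
    next
      case (3 v)
      have "f 0 \<le> v" "v \<le> f (snd A)"
        using 3 mono[of 0 i] ij nmapsD(3)[OF f, of j "snd A"] by auto
      then obtain t where t: "t \<in> fst A" "v = f t" using nmapsD(4)[OF f 3(1)] by blast
      \<comment> \<open>A joint of A outside the stretch is harmless: by monotonicity its image v is
        then f i or f j, which the endpoints of the restricted necklace hit.\<close>
      consider "t < i" | "i \<le> t" "t \<le> j" | "j < t" by linarith
      then show ?thesis
      proof cases
        case 1
        then have "u = 0" using mono[of t i] t 3 ij by simp
        then show ?thesis by (intro image_eqI[of _ _ 0]) (auto simp: seg_def restr_def)
      next
        case 2
        then show ?thesis using t 3
          by (intro image_eqI[of _ _ "t - i"]) (auto simp: seg_def restr_def)
      next
        case 3
        then have "u = f j - f i" using t \<open>v \<le> f j\<close> \<open>u = v - f i\<close> nmapsD(3)[OF f, of j t]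
          nmapsD(7)[OF f t(1)] by simp
        then show ?thesis using ij by (intro image_eqI[of _ _ "j - i"]) (auto simp: seg_def
          restr_def)
      qed
    qed
  qed
  moreover have "seg f i j \<in> Hom Delta (j - i) (f j - f i)"
    using mono ij by (auto simp: seg_def monotone_on_def intro!: diff_le_mono mono)
  ultimately show ?thesis
    using ij by (simp add: seg_def)
qed

lemma seg_compose:
  assumes "f \<in> nmaps A B" "i \<le> j" "j \<le> snd A"
  shows "compose {..j - i} (seg g (f i) (f j)) (seg f i j) = seg (compose {..snd A} g f) i j"
proof
  fix k
  have "f i \<le> f (k + i)" "f (k + i) \<le> f j" if "k \<le> j - i"
    using nmapsD(3)[OF assms(1)] assms that by auto
  then show "compose {..j - i} (seg g (f i) (f j)) (seg f i j) k =
    seg (compose {..snd A} g f) i j k"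
    using assms by (auto simp: compose_def seg_def)
qed

lemma seg_id: "\<lbrakk>i \<le> j; j \<le> n\<rbrakk> \<Longrightarrow> seg (Ident Delta n) i j = Ident Delta (j - i)"
  by (auto simp: seg_def fun_eq_iff)

lemma seg_full: "\<lbrakk>f \<in> Hom Nec A B\<rbrakk> \<Longrightarrow> seg f 0 (snd A) = f"
  by (auto simp: seg_def fun_eq_iff PiE_def extensional_def)

end

lemmas [simp] = simplex_Ob restr_Ob wedge_Ob

section \<open>Enriched categories from strong monoidal functors\<close>

definition Psi_Hom ::
  "'o \<Rightarrow> (necklace, nat \<Rightarrow> nat, 'o, 'a) mftor \<Rightarrow> necklace \<Rightarrow> nat \<Rightarrow> nat \<Rightarrow> 'o" where
  "Psi_Hom z D A i j = (if i \<le> j then fob D (restr A i j) else z)"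

definition Psi_Comp ::
  "('o, 'a) moncat \<Rightarrow> 'o \<Rightarrow> (necklace, nat \<Rightarrow> nat, 'o, 'a) mftor \<Rightarrow> necklace \<Rightarrow> nat \<Rightarrow> nat \<Rightarrow> nat \<Rightarrow>
    'a" where
  "Psi_Comp W z D A i k j =
     (if i \<le> k \<and> k \<le> j then
        Comp W (TensO W (fob D (restr A i k)) (fob D (restr A k j)))
          (fob D (wedge (restr A i k) (restr A k j))) (fob D (restr A i j))
          (far D (wedge (restr A i k) (restr A k j)) (restr A i j) (Ident Delta (j - i)))
          (Mu D (restr A i k) (restr A k j))
      else the_arr W (TensO W (Psi_Hom z D A i k) (Psi_Hom z D A k j)) (Psi_Hom z D A i j))"

text \<open>
  \<open>Phi_ob\<close> extended from simplices to necklaces.  Enriched functors from it to \<open>C\<close> are the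
    simplicial
  maps from the necklace to the nerve of \<open>C\<close>, see \<open>simplex_family_extension\<close> below.
\<close>

definition Psi ::
  "('o, 'a) moncat \<Rightarrow> 'o \<Rightarrow> (necklace, nat \<Rightarrow> nat, 'o, 'a) mftor \<Rightarrow> necklace \<Rightarrow>
   ('u pt, 'o, 'a) wcat" where
  "Psi W z D A =
     (let V = Inl ` {..snd A} in
      \<lparr>wOb = V,
       wHom = (\<lambda>x y. if x \<in> V \<and> y \<in> V then Psi_Hom z D A (projl x) (projl y) else undefined),
       wComp = (\<lambda>x y v. if x \<in> V \<and> y \<in> V \<and> v \<in> V
                  then Psi_Comp W z D A (projl x) (projl y) (projl v) else undefined),
       wId = (\<lambda>x\<in>V. Eps D)\<rparr>)"

lemma Phi_ob_Psi: "Phi_ob W z D n = Psi W z D (simplex n)"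
  by (auto simp: Phi_ob_def Psi_def Let_def fun_eq_iff Phi_Hom_def Psi_Hom_def Phi_Comp_def
    Psi_Comp_def
      restr_simplex)

text \<open>Common constructor for all enriched functors out of \<open>Psi\<close>: only the forward
  hom-objects carry data, as an arrow out of the initial object z is forced.\<close>

definition mk_wfun ::
  "('o, 'a) moncat \<Rightarrow> 'o \<Rightarrow> ('u pt, 'o, 'a) wcat \<Rightarrow> nat \<Rightarrow> (nat \<Rightarrow> 'u pt) \<Rightarrow> (nat \<Rightarrow> nat \<Rightarrow> 'o \<times> 'a \<times> 'o) \<Rightarrow>
   ('u pt, 'a) wfun" where
  "mk_wfun W z C n vx t =
     (let V = Inl ` {..n} in
      \<lparr>wfO = (\<lambda>x\<in>V. vx (projl x)),
       wfH = (\<lambda>x y. if x \<in> V \<and> y \<in> V then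
                (let i = projl x; j = projl y in
                 if i \<le> j then md (t i j) else the_arr W z (wHom C (vx i) (vx j)))
              else undefined)\<rparr>)"

lemma Psi_simps [simp]:
  "wOb (Psi W z D A) = Inl ` {..snd A}"
  "\<lbrakk>i \<le> snd A; j \<le> snd A\<rbrakk> \<Longrightarrow> wHom (Psi W z D A) (Inl i) (Inl j) =
    (if i \<le> j then fob D (restr A i j) else z)"
  by (auto simp: Psi_def Let_def Psi_Hom_def)

text \<open>Identities stay folded from here on, because \<open>DA_id\<close> and the composition of
  \<open>Psi\<close> are stated with \<open>Ident Delta\<close>.\<close>

declare Delta_simps(3) [simp del]

text \<open>Isolates what full faithfulness draws from the hypotheses on W: an initial object that
  is absorbed by the tensor product, which is the case of the empty colimit.\<close>

locale monoidal_initial = monoidal W for W :: "('o, 'a) moncat" +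
  fixes z :: 'o
  assumes z: "initial W z"
    and tensor_initial: "\<And>X Y. \<lbrakk>initial W Y; X \<in> Ob W\<rbrakk> \<Longrightarrow> initial W (X \<odot> Y)"
      "\<And>X Y. \<lbrakk>initial W Y; X \<in> Ob W\<rbrakk> \<Longrightarrow> initial W (Y \<odot> X)"
begin

lemma z_Ob [simp]: "z \<in> Ob W"
  using z by (simp add: initial_def)

definition DA :: "(necklace, nat \<Rightarrow> nat, 'o, 'a) mftor \<Rightarrow> necklace \<Rightarrow> necklace \<Rightarrow> (nat \<Rightarrow> nat) \<Rightarrow>
  'o \<times> 'a \<times> 'o" where
  "DA D A B f = (fob D A, far D A B f, fob D B)"

definition mu :: "(necklace, nat \<Rightarrow> nat, 'o, 'a) mftor \<Rightarrow> necklace \<Rightarrow> necklace \<Rightarrow> 'o \<times> 'a \<times> 'o" where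
  "mu D A B = (fob D A \<odot> fob D B, Mu D A B, fob D (wedge A B))"

definition ep :: "(necklace, nat \<Rightarrow> nat, 'o, 'a) mftor \<Rightarrow> 'o \<times> 'a \<times> 'o" where
  "ep D = (Unit W, Eps D, fob D (simplex 0))"

lemma tagD_simps [simp]:
  "dm (DA D A B f) = fob D A" "cd (DA D A B f) = fob D B"
  "dm (mu D A B) = fob D A \<odot> fob D B" "cd (mu D A B) = fob D (wedge A B)"
  "dm (ep D) = Unit W" "cd (ep D) = fob D (simplex 0)"
  by (simp_all add: DA_def mu_def ep_def)

context
  fixes D :: "(necklace, nat \<Rightarrow> nat, 'o, 'a) mftor"
  assumes D: "strong_monoidal Nec W D"
begin

lemma functor_D: "is_functor Nec W D"
  using D unfolding strong_monoidal_def by (elim conjE)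

lemmas strong_conjuncts = D[unfolded strong_monoidal_def Let_def, THEN conjunct2, THEN conjunct2,
  THEN conjunct2]
lemmas strong_Mu = strong_conjuncts[THEN conjunct2, THEN conjunct1, rule_format]
lemmas strong_Eps = strong_conjuncts[THEN conjunct2, THEN conjunct2, THEN conjunct1, rule_format]
lemmas strong_nat = strong_conjuncts[THEN conjunct2, THEN conjunct2, THEN conjunct2, THEN conjunct1,
  rule_format]
lemmas strong_assoc = strong_conjuncts[THEN conjunct2, THEN conjunct2, THEN conjunct2, THEN
  conjunct2, THEN conjunct1, rule_format]
lemmas strong_lunit = strong_conjuncts[THEN conjunct2, THEN conjunct2, THEN conjunct2, THEN
  conjunct2, THEN conjunct2, THEN conjunct1, rule_format]
lemmas strong_runit = strong_conjuncts[THEN conjunct2, THEN conjunct2, THEN conjunct2, THEN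
  conjunct2, THEN conjunct2, THEN conjunct2, rule_format]

lemma D_Ob [simp]: "A \<in> Ob Nec \<Longrightarrow> fob D A \<in> Ob W"
  by (rule functor_ob[OF functor_D])

lemma ar_DA [simp]: "\<lbrakk>f \<in> Hom Nec A B; A \<in> Ob Nec; B \<in> Ob Nec\<rbrakk> \<Longrightarrow> ar (DA D A B f)"
  by (simp add: DA_def ar_triple functor_simps[OF functor_D])

lemma mu_iso [simp]: "\<lbrakk>A \<in> Ob Nec; B \<in> Ob Nec\<rbrakk> \<Longrightarrow> tiso (mu D A B)"
  using strong_Mu[of A B] wedge_Ob[of A B]
  by (simp add: mu_def iso_arr_iso)

lemma ep_iso [simp]: "tiso (ep D)"
  using strong_Eps by (simp add: ep_def iso_arr_iso)

lemma DA_id [simp]: "A \<in> Ob Nec \<Longrightarrow> DA D A A (Ident Delta (snd A)) = idt (fob D A)"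
  using functor_Ident[OF functor_D, of A] by (simp add: DA_def idt_def)

lemma DA_comp:
  "\<lbrakk>f \<in> Hom Nec A B; g \<in> Hom Nec B C; A \<in> Ob Nec; B \<in> Ob Nec; C \<in> Ob Nec\<rbrakk> \<Longrightarrow>
    DA D B C g \<cdot> DA D A B f = DA D A C (compose {..snd A} g f)"
  using functor_Comp[OF functor_D, of f A B g C] by (simp add: DA_def cmp_def)

lemma mu_natural:
  assumes "f \<in> Hom Nec A A'" "g \<in> Hom Nec B B'" "A \<in> Ob Nec" "A' \<in> Ob Nec" "B \<in> Ob Nec"
    "B' \<in> Ob Nec"
  shows "mu D A' B' \<cdot> (DA D A A' f \<otimes> DA D B B' g) =
    DA D (wedge A B) (wedge A' B') (wedge_map A A' B B' f g) \<cdot> mu D A B"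
  using strong_nat[of A A' B B' f g] assms by (simp add: DA_def cmp_def tns_def mu_def)

lemma wedge_map_Hom:
  "\<lbrakk>f \<in> Hom Nec A A'; g \<in> Hom Nec B B'; A \<in> Ob Nec; A' \<in> Ob Nec; B \<in> Ob Nec; B' \<in> Ob Nec\<rbrakk> \<Longrightarrow>
    wedge_map A A' B B' f g \<in> Hom Nec (wedge A B) (wedge A' B')"
  using D monoidal.monoidal_TensA[OF monoidal.intro, of Nec A A' B B' f g]
  by (simp add: strong_monoidal_def)

text \<open>The wedge is strictly associative, so D of the associator of \<open>Nec\<close> is an
  identity and drops out of the coherence square of D.\<close>

lemma mu_assoc:
  assumes "A \<in> Ob Nec" "B \<in> Ob Nec" "C \<in> Ob Nec"
  shows "mu D (wedge A B) C \<cdot> (mu D A B \<otimes> idt (fob D C)) =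
    mu D A (wedge B C) \<cdot> ((idt (fob D A) \<otimes> mu D B C) \<cdot> asc (fob D A) (fob D B) (fob D C))"
proof -
  have "DA D (wedge (wedge A B) C) (wedge A (wedge B C)) (Ident Delta (snd A + snd B + snd C)) \<cdot>
      (mu D (wedge A B) C \<cdot> (mu D A B \<otimes> idt (fob D C))) =
    (mu D A (wedge B C) \<cdot> (idt (fob D A) \<otimes> mu D B C)) \<cdot> asc (fob D A) (fob D B) (fob D C)"
    using strong_assoc[of A B C] assms by (simp add: DA_def cmp_def tns_def mu_def idt_def asc_def)
  moreover have "DA D (wedge (wedge A B) C) (wedge A (wedge B C))
    (Ident Delta (snd A + snd B + snd C)) =
      idt (fob D (wedge A (wedge B C)))"
    using DA_id[of "wedge A (wedge B C)"] assms by (simp add: wedge_assoc add.assoc)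
  ultimately show ?thesis
    using assms by (simp add: wedge_assoc)
qed

lemma mu_unit:
  assumes A: "A \<in> Ob Nec"
  shows "mu D (simplex 0) A \<cdot> (ep D \<otimes> idt (fob D A)) = lun (fob D A)"
    and "mu D A (simplex 0) \<cdot> (idt (fob D A) \<otimes> ep D) = run (fob D A)"
proof -
  have "DA D A A (Ident Delta (snd A)) \<cdot> (mu D (simplex 0) A \<cdot> (ep D \<otimes> idt (fob D A))) =
    lun (fob D A)"
    using strong_lunit[OF A] wedge_unit[OF A]
    by (simp add: DA_def cmp_def tns_def mu_def idt_def lun_def ep_def)
  then show "mu D (simplex 0) A \<cdot> (ep D \<otimes> idt (fob D A)) = lun (fob D A)"
    using A wedge_unit[OF A] by simp
  have "DA D A A (Ident Delta (snd A)) \<cdot> (mu D A (simplex 0) \<cdot> (idt (fob D A) \<otimes> ep D)) =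
    run (fob D A)"
    using strong_runit[OF A] wedge_unit[OF A]
    by (simp add: DA_def cmp_def tns_def mu_def idt_def run_def ep_def)
  then show "mu D A (simplex 0) \<cdot> (idt (fob D A) \<otimes> ep D) = run (fob D A)"
    using A wedge_unit[OF A] by simp
qed

lemma Psi_cmpW:
  assumes "i \<le> k" "k \<le> j" "j \<le> snd A"
  shows "cmpW (Psi W z D A) (Inl i) (Inl k) (Inl j) =
    DA D (wedge (restr A i k) (restr A k j)) (restr A i j) (Ident Delta (j - i)) \<cdot>
      mu D (restr A i k) (restr A k j)"
  using assms
  by (simp add: cmpW_def DA_def mu_def cmp_def) (simp add: Psi_def Let_def Psi_Comp_def)

lemma Psi_idW: "i \<le> snd A \<Longrightarrow> idW (Psi W z D A) (Inl i) = ep D"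
  by (simp add: idW_def ep_def restr_point) (simp add: Psi_def Let_def)

lemma restr_wedge_sub' [simp]:
  "\<lbrakk>i \<le> k; k \<le> j\<rbrakk> \<Longrightarrow> ar (DA D (wedge (restr A i k) (restr A k j)) (restr A i j)
    (Ident Delta (j - i)))"
  using restr_wedge_sub[of i k j A]
  by (intro ar_DA) auto

text \<open>Outside i \<le> k \<le> j the composition is the unique arrow out of an initial object;
  the nested case split locates the initial tensor factor.\<close>

lemma ar_Psi_cmpW:
  assumes "i \<le> snd A" "k \<le> snd A" "j \<le> snd A"
  shows "ar (cmpW (Psi W z D A) (Inl i) (Inl k) (Inl j))"
proof (cases "i \<le> k \<and> k \<le> j")
  case True
  then show ?thesis using assms by (simp add: Psi_cmpW restr_Ob wedge_Ob)
next
  case False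
  let ?h = "wHom (Psi W z D A)"
  have "initial W (?h (Inl i) (Inl k) \<odot> ?h (Inl k) (Inl j))"
  proof (cases "i \<le> k")
    case True
    then show ?thesis using False assms by (simp add: tensor_initial(1) z)
  next
    case False
    then show ?thesis using assms by (simp add: tensor_initial(2) z)
  qed
  moreover have "?h (Inl i) (Inl j) \<in> Ob W"
    using assms by (simp add: restr_Ob)
  ultimately show ?thesis
    using False assms initial_the_arr[of "?h (Inl i) (Inl k) \<odot> ?h (Inl k) (Inl j)"
      "?h (Inl i) (Inl j)"]
    by (simp add: cmpW_def ar_triple initial_def) (auto simp add: Psi_def Psi_Comp_def Let_def
      Psi_Hom_def)
qed

text \<open>Both bracketings become the iterated \<open>mu\<close> onto the triple wedge, compared
  by \<open>mu_assoc\<close>, followed by D of the vertex identity from the triple wedge to the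
  stretch from i to l.\<close>

lemma Psi_cmpW_assoc:
  assumes "i \<le> k" "k \<le> j" "j \<le> l" "l \<le> snd A"
  shows "cmpW (Psi W z D A :: ('u pt, 'o, 'a) wcat) (Inl i) (Inl j) (Inl l) \<cdot>
      (cmpW (Psi W z D A :: ('u pt, 'o, 'a) wcat) (Inl i) (Inl k) (Inl j) \<otimes>
        idt (fob D (restr A j l))) =
    cmpW (Psi W z D A :: ('u pt, 'o, 'a) wcat) (Inl i) (Inl k) (Inl l) \<cdot>
      ((idt (fob D (restr A i k)) \<otimes> cmpW (Psi W z D A :: ('u pt, 'o, 'a) wcat) (Inl k) (Inl j)
        (Inl l)) \<cdot>
       asc (fob D (restr A i k)) (fob D (restr A k j)) (fob D (restr A j l)))"
    (is "cmpW ?P _ _ _ \<cdot> _ = _")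
proof -
  let ?A = "restr A i k" and ?B = "restr A k j" and ?C = "restr A j l"
  let ?AB = "restr A i j" and ?BC = "restr A k l" and ?T = "restr A i l"
  let ?id = "Ident Delta"
  note le = assms
  have ob: "?A \<in> Ob Nec" "?B \<in> Ob Nec" "?C \<in> Ob Nec" "?AB \<in> Ob Nec" "?BC \<in> Ob Nec" "?T \<in> Ob Nec"
    using le by (simp_all add: restr_Ob)
  note ob' = ob wedge_Ob[OF ob(1,2)] wedge_Ob[OF ob(2,3)] wedge_Ob[OF ob(4,3)] wedge_Ob[OF ob(1,5)]
    wedge_Ob[OF wedge_Ob[OF ob(1,2)] ob(3)] wedge_Ob[OF ob(1) wedge_Ob[OF ob(2,3)]]
  have h1: "?id (j - i) \<in> Hom Nec (wedge ?A ?B) ?AB"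
    and h2: "?id (l - k) \<in> Hom Nec (wedge ?B ?C) ?BC"
    and h3: "?id (l - i) \<in> Hom Nec (wedge ?AB ?C) ?T"
      and h4: "?id (l - i) \<in> Hom Nec (wedge ?A ?BC) ?T"
    using restr_wedge_sub[of i k j A] restr_wedge_sub[of k j l A] restr_wedge_sub[of i j l A]
      restr_wedge_sub[of i k l A] le by (simp_all only:)
  have i1: "?id (l - j) \<in> Hom Nec ?C ?C" and i2: "?id (k - i) \<in> Hom Nec ?A ?A"
    using category_Ident[OF functor_dom[OF functor_D] ob(3)] category_Ident[OF functor_dom[OF
      functor_D] ob(1)]
    by (simp_all only: Nec_simps snd_restr)
  \<comment> \<open>Wedging vertex identities gives a vertex identity again, so
    \<open>mu_natural\<close> moves the maps that forget a joint past \<open>mu\<close> without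
    changing their form.\<close>
  have wm1: "wedge_map (wedge ?A ?B) ?AB ?C ?C (?id (j - i)) (?id (l - j)) = ?id (l - i)"
    and wm2: "wedge_map ?A ?A (wedge ?B ?C) ?BC (?id (k - i)) (?id (l - k)) = ?id (l - i)"
    using le by (auto simp: wedge_map_def fun_eq_iff Delta_simps(3))
  have h5: "?id (l - i) \<in> Hom Nec (wedge (wedge ?A ?B) ?C) (wedge ?AB ?C)"
    "?id (l - i) \<in> Hom Nec (wedge ?A (wedge ?B ?C)) (wedge ?A ?BC)"
    using wedge_map_Hom[OF h1 i1 ob'(7) ob(4) ob(3) ob(3)] wedge_map_Hom[OF i2 h2 ob(1) ob(1) ob'(8)
      ob(5)]
    unfolding wm1 wm2 .
  have comp: "compose {..l - i} (?id (l - i)) (?id (l - i)) = ?id (l - i)"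
    by (auto simp: compose_def Delta_simps(3) fun_eq_iff)
  note DAcomp = DA_comp[OF h5(1) h3] DA_comp[OF h5(2) h4]
  have ids: "idt (fob D ?C) = DA D ?C ?C (?id (l - j))" "idt (fob D ?A) = DA D ?A ?A (?id (k - i))"
    using DA_id[OF ob(3)] DA_id[OF ob(1)] by simp_all
  have "cmpW ?P (Inl i) (Inl j) (Inl l) \<cdot> (cmpW ?P (Inl i) (Inl k) (Inl j) \<otimes> idt (fob D ?C)) =
     DA D (wedge ?AB ?C) ?T (?id (l - i)) \<cdot> (mu D ?AB ?C \<cdot> ((DA D (wedge ?A ?B) ?AB (?id (j - i)) \<cdot>
       mu D ?A ?B) \<otimes> idt (fob D ?C)))"
    using le ob' h1 h3 by (simp add: Psi_cmpW)
  also have "(DA D (wedge ?A ?B) ?AB (?id (j - i)) \<cdot> mu D ?A ?B) \<otimes> idt (fob D ?C) =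
      (DA D (wedge ?A ?B) ?AB (?id (j - i)) \<otimes> DA D ?C ?C (?id (l - j))) \<cdot>
        (mu D ?A ?B \<otimes> idt (fob D ?C))"
    unfolding ids(1)[symmetric] using ob' h1 by (simp add: fuse)
  also have "mu D ?AB ?C \<cdot> \<dots> = (mu D ?AB ?C \<cdot> (DA D (wedge ?A ?B) ?AB (?id (j - i)) \<otimes>
    DA D ?C ?C (?id (l - j)))) \<cdot> (mu D ?A ?B \<otimes> idt (fob D ?C))"
    using ob' h1 i1 by simp
  also have "\<dots> = DA D (wedge (wedge ?A ?B) ?C) (wedge ?AB ?C) (?id (l - i)) \<cdot>
    (mu D (wedge ?A ?B) ?C \<cdot> (mu D ?A ?B \<otimes> idt (fob D ?C)))"
    unfolding mu_natural[OF h1 i1 ob'(7) ob(4) ob(3) ob(3)] wm1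
    using ob' h5 by simp
  also have "mu D (wedge ?A ?B) ?C \<cdot> (mu D ?A ?B \<otimes> idt (fob D ?C)) =
    mu D ?A (wedge ?B ?C) \<cdot> ((idt (fob D ?A) \<otimes> mu D ?B ?C) \<cdot> asc (fob D ?A) (fob D ?B) (fob D ?C))"
    by (rule mu_assoc[OF ob(1-3)])
  finally have L: "cmpW ?P (Inl i) (Inl j) (Inl l) \<cdot> (cmpW ?P (Inl i) (Inl k) (Inl j) \<otimes>
    idt (fob D ?C)) =
     (DA D (wedge ?AB ?C) ?T (?id (l - i)) \<cdot> DA D (wedge (wedge ?A ?B) ?C) (wedge ?AB ?C)
       (?id (l - i))) \<cdot>
     (mu D ?A (wedge ?B ?C) \<cdot> ((idt (fob D ?A) \<otimes> mu D ?B ?C) \<cdot>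
       asc (fob D ?A) (fob D ?B) (fob D ?C)))"
    using ob' h3 h5 by (simp add: wedge_assoc)
  have "cmpW ?P (Inl i) (Inl k) (Inl l) \<cdot> (idt (fob D ?A) \<otimes> cmpW ?P (Inl k) (Inl j) (Inl l)) =
     DA D (wedge ?A ?BC) ?T (?id (l - i)) \<cdot> (mu D ?A ?BC \<cdot> (idt (fob D ?A) \<otimes>
       (DA D (wedge ?B ?C) ?BC (?id (l - k)) \<cdot> mu D ?B ?C)))"
    using le ob' h2 h4 by (simp add: Psi_cmpW)
  also have "idt (fob D ?A) \<otimes> (DA D (wedge ?B ?C) ?BC (?id (l - k)) \<cdot> mu D ?B ?C) =
      (DA D ?A ?A (?id (k - i)) \<otimes> DA D (wedge ?B ?C) ?BC (?id (l - k))) \<cdot> (idt (fob D ?A) \<otimes>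
        mu D ?B ?C)"
    unfolding ids(2)[symmetric] using ob' h2 by (simp add: fuse)
  also have "mu D ?A ?BC \<cdot> \<dots> = (mu D ?A ?BC \<cdot> (DA D ?A ?A (?id (k - i)) \<otimes>
    DA D (wedge ?B ?C) ?BC (?id (l - k)))) \<cdot> (idt (fob D ?A) \<otimes> mu D ?B ?C)"
    using ob' h2 i2 by simp
  also have "\<dots> = DA D (wedge ?A (wedge ?B ?C)) (wedge ?A ?BC) (?id (l - i)) \<cdot>
    (mu D ?A (wedge ?B ?C) \<cdot> (idt (fob D ?A) \<otimes> mu D ?B ?C))"
    unfolding mu_natural[OF i2 h2 ob(1) ob(1) ob'(8) ob(5)] wm2
    using ob' h5 by simp
  finally have R0: "cmpW ?P (Inl i) (Inl k) (Inl l) \<cdot> (idt (fob D ?A) \<otimes>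
    cmpW ?P (Inl k) (Inl j) (Inl l)) =
     DA D (wedge ?A ?BC) ?T (?id (l - i)) \<cdot> (DA D (wedge ?A (wedge ?B ?C)) (wedge ?A ?BC)
       (?id (l - i)) \<cdot>
      (mu D ?A (wedge ?B ?C) \<cdot> (idt (fob D ?A) \<otimes> mu D ?B ?C)))" .
  have R: "(cmpW ?P (Inl i) (Inl k) (Inl l) \<cdot> (idt (fob D ?A) \<otimes> cmpW ?P (Inl k) (Inl j) (Inl l))) \<cdot>
       asc (fob D ?A) (fob D ?B) (fob D ?C) =
     (DA D (wedge ?A ?BC) ?T (?id (l - i)) \<cdot> DA D (wedge ?A (wedge ?B ?C)) (wedge ?A ?BC)
       (?id (l - i))) \<cdot>
     (mu D ?A (wedge ?B ?C) \<cdot> ((idt (fob D ?A) \<otimes> mu D ?B ?C) \<cdot>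
       asc (fob D ?A) (fob D ?B) (fob D ?C)))"
    unfolding R0 using ob' h4 h5 by simp
  \<comment> \<open>The order in which k and j are forgotten does not show: both composites have the
    identity on vertices as underlying map.\<close>
  have E: "(DA D (wedge ?AB ?C) ?T (?id (l - i)) \<cdot>
    DA D (wedge (wedge ?A ?B) ?C) (wedge ?AB ?C) (?id (l - i))) =
    (DA D (wedge ?A ?BC) ?T (?id (l - i)) \<cdot> DA D (wedge ?A (wedge ?B ?C)) (wedge ?A ?BC)
      (?id (l - i)))"
    using DAcomp ob' le comp by (simp add: wedge_assoc)
  show ?thesis
    using L[unfolded E, folded R] ob' le by (simp add: ar_Psi_cmpW)
qed

lemma is_wcat_Psi: "is_wcat W (Psi W z D A :: ('u pt, 'o, 'a) wcat)" (is "is_wcat W ?P")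
proof (rule is_wcatI)
  show "wHom ?P x y \<in> Ob W" if "x \<in> wOb ?P" "y \<in> wOb ?P" for x y
    using that by (auto simp: restr_Ob)
  show "ar (cmpW ?P x y v)" if "x \<in> wOb ?P" "y \<in> wOb ?P" "v \<in> wOb ?P" for x y v
    using that by (auto intro: ar_Psi_cmpW)
  show "ar (idW ?P x)" if "x \<in> wOb ?P" for x
    using that by (auto simp: Psi_idW)
next
  fix x y v w
  assume "x \<in> wOb ?P" "y \<in> wOb ?P" "v \<in> wOb ?P" "w \<in> wOb ?P"
  then obtain i k j l where ikjl: "i \<le> snd A" "k \<le> snd A" "j \<le> snd A" "l \<le> snd A"
    and eq: "x = Inl i" "y = Inl k" "v = Inl j" "w = Inl l" by auto
  have hom: "wHom ?P (Inl i) (Inl j) \<in> Ob W" if "i \<le> snd A" "j \<le> snd A" for i j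
    using that by (simp add: restr_Ob)
  show "cmpW ?P x v w \<cdot> (cmpW ?P x y v \<otimes> idt (wHom ?P v w)) =
       cmpW ?P x y w \<cdot> ((idt (wHom ?P x y) \<otimes> cmpW ?P y v w) \<cdot>
       asc (wHom ?P x y) (wHom ?P y v) (wHom ?P v w))"
  proof (cases "i \<le> k \<and> k \<le> j \<and> j \<le> l")
    case True
    then show ?thesis using Psi_cmpW_assoc[of i k j l A] ikjl by (simp add: eq)
  next
    case False
    \<comment> \<open>A chain that is not increasing contains a backward hom-object, so the triple
      tensor product is initial.\<close>
    then have "wHom ?P x y = z \<or> wHom ?P y v = z \<or> wHom ?P v w = z"
      using ikjl eq by auto
    then have "initial W ((wHom ?P x y \<odot> wHom ?P y v) \<odot> wHom ?P v w)"
      using hom ikjl unfolding eq by (auto simp: tensor_initial z simp del: Psi_simps)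
    then show ?thesis
      using hom ikjl unfolding eq
      by (intro initial_unique) (simp_all add: ar_Psi_cmpW del: Psi_simps)
  qed
next
  fix x y assume "x \<in> wOb ?P" "y \<in> wOb ?P"
  then obtain i j where ij: "i \<le> snd A" "j \<le> snd A" and eq: "x = Inl i" "y = Inl j" by auto
  have hom: "wHom ?P (Inl i) (Inl j) \<in> Ob W" if "i \<le> snd A" "j \<le> snd A" for i j
    using that by (simp add: restr_Ob)
  note id = Psi_idW[OF ij(1)] Psi_idW[OF ij(2)]
  show "cmpW ?P x x y \<cdot> (idW ?P x \<otimes> idt (wHom ?P x y)) = lun (wHom ?P x y)"
  proof (cases "i \<le> j")
    case True
    have R: "restr A i j \<in> Ob Nec" using True by (rule restr_Ob)
    show ?thesis
      using True ij R mu_unit(1)[OF R] DA_id[OF R]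
      by (simp add: eq Psi_idW Psi_cmpW restr_point wedge_unit)
  next
    case False
    have [simp]: "fob D (restr A i i) = fob D (simplex 0)" "ar (ep D)"
      by (simp_all add: restr_point)
    have c: "ar (cmpW ?P (Inl i) (Inl i) (Inl j))" using ij ar_Psi_cmpW by blast
    show ?thesis
      unfolding eq id using False ij z c
      by (intro initial_unique) (simp_all add: tensor_initial)
  qed
  show "cmpW ?P x y y \<cdot> (idt (wHom ?P x y) \<otimes> idW ?P y) = run (wHom ?P x y)"
  proof (cases "i \<le> j")
    case True
    have R: "restr A i j \<in> Ob Nec" using True by (rule restr_Ob)
    show ?thesis
      using True ij R mu_unit(2)[OF R] DA_id[OF R]
      by (simp add: eq Psi_idW Psi_cmpW restr_point wedge_unit)
  next
    case False
    have [simp]: "fob D (restr A j j) = fob D (simplex 0)" "ar (ep D)"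
      by (simp_all add: restr_point)
    have c: "ar (cmpW ?P (Inl i) (Inl j) (Inl j))" using ij ar_Psi_cmpW by blast
    show ?thesis
      unfolding eq id using False ij z c
      by (intro initial_unique) (simp_all add: tensor_initial)
  qed
qed (auto simp: Psi_def Let_def)

end

end

section \<open>Enriched functors out of necklaces\<close>

text \<open>For i \<le> j this says that i and j lie in a common bead. Joints at i or j themselves
  are allowed, and the case i = j is included.\<close>

definition bead :: "necklace \<Rightarrow> nat \<Rightarrow> nat \<Rightarrow> bool" where
  "bead A i j \<longleftrightarrow> \<not> (\<exists>t\<in>fst A. i < t \<and> t < j)"

text \<open>Meaningful only if \<open>bead A i j\<close> fails. The least joint is taken so that the
  stretch up to it is a bead and recursion continues on the right-hand rest alone.\<close>

definition joint :: "necklace \<Rightarrow> nat \<Rightarrow> nat \<Rightarrow> nat" where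
  "joint A i j = (LEAST t. t \<in> fst A \<and> i < t \<and> t < j)"

lemma joint:
  assumes "\<not> bead A i j"
  shows "joint A i j \<in> fst A" "i < joint A i j" "joint A i j < j" "bead A i (joint A i j)"
    "\<lbrakk>t \<in> fst A; i < t; t < j\<rbrakk> \<Longrightarrow> joint A i j \<le> t"
proof -
  have ex: "\<exists>t. t \<in> fst A \<and> i < t \<and> t < j" using assms by (auto simp: bead_def)
  show *: "joint A i j \<in> fst A" "i < joint A i j" "joint A i j < j"
    using LeastI_ex[OF ex] unfolding joint_def by auto
  show le: "joint A i j \<le> t" if "t \<in> fst A" "i < t" "t < j" for t
    using that unfolding joint_def by (intro Least_le) auto
  show "bead A i (joint A i j)" using le * unfolding bead_def by (meson leD less_trans)
qed

text \<open>Shrinking a stretch around its first joint does not change the first joint. In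
  \<open>extend_comp\<close> this lets the recursion equation be used for the subintervals of a
  stretch.\<close>

lemma joint_eq:
  assumes "\<not> bead A i j" "i' \<le> j'" "i' < joint A i j" "joint A i j < j'" "i \<le> i'" "j' \<le> j"
  shows "\<not> bead A i' j'" "joint A i' j' = joint A i j"
proof -
  note t = joint[OF assms(1)]
  show nb: "\<not> bead A i' j'" using t assms unfolding bead_def by blast
  show "joint A i' j' = joint A i j"
    using joint[OF nb] t assms by (intro antisym) auto
qed

text \<open>Inside a bead the stretches are simplices, so there \<open>Psi\<close> has the same
  hom-objects as the enriched category of a simplex.\<close>

lemma restr_bead: "\<lbrakk>bead A i j; i \<le> j\<rbrakk> \<Longrightarrow> restr A i j = simplex (j - i)"
  by (auto simp: restr_def simplex_def bead_def)

lemma bead_sub: "\<lbrakk>bead A i j; i \<le> i'; j' \<le> j\<rbrakk> \<Longrightarrow> bead A i' j'"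
  unfolding bead_def by (meson le_less_trans less_le_trans)

context monoidal_initial
begin

text \<open>
  Splits off the first bead.  At a joint the composition of \<open>Psi\<close> is the structure isomorphism \<open>mu\<close>,
    so
  this is the only possible value.
\<close>

function extend where
  "extend D A C vx x i j = (if bead A i j then x i j else
     cmpW C (vx i) (vx (joint A i j)) (vx j) \<cdot>
       ((x i (joint A i j) \<otimes> extend D A C vx x (joint A i j) j) \<cdot>
        tinv (mu D (restr A i (joint A i j)) (restr A (joint A i j) j))))"
  by pat_completeness auto
termination
  by (relation "measure (\<lambda>(D, A, C, vx, x, i, j). j - i)") (auto, frule joint(2), drule joint(3),
    simp)

declare extend.simps [simp del]

context
  fixes D :: "(necklace, nat \<Rightarrow> nat, 'o, 'a) mftor"
  assumes D: "strong_monoidal Nec W D"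
begin

lemmas [simp] = D_Ob[OF D] ar_DA[OF D] mu_iso[OF D] ep_iso[OF D] DA_id[OF D] restr_wedge_sub'[OF D]
lemmas wcat_Psi [simp] = is_wcat_Psi[OF D]

text \<open>Composition is tested only for i \<le> k \<le> j, since any other composite starts at a
  tensor product with the factor z and is covered by initiality.\<close>

lemma mk_wfun:
  fixes C :: "('u pt, 'o, 'a) wcat"
  assumes C: "is_wcat W C" and vx: "\<And>i. i \<le> snd A \<Longrightarrow> vx i \<in> wOb C"
    and t: "\<And>i j. \<lbrakk>i \<le> j; j \<le> snd A\<rbrakk> \<Longrightarrow> ar (t i j)"
      "\<And>i j. \<lbrakk>i \<le> j; j \<le> snd A\<rbrakk> \<Longrightarrow> dm (t i j) = fob D (restr A i j)"
      "\<And>i j. \<lbrakk>i \<le> j; j \<le> snd A\<rbrakk> \<Longrightarrow> cd (t i j) = wHom C (vx i) (vx j)"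
    and comp: "\<And>i k j. \<lbrakk>i \<le> k; k \<le> j; j \<le> snd A\<rbrakk> \<Longrightarrow>
      t i j \<cdot> cmpW (Psi W z D A :: ('u pt, 'o, 'a) wcat) (Inl i) (Inl k) (Inl j) =
        cmpW C (vx i) (vx k) (vx j) \<cdot> (t i k \<otimes> t k j)"
    and unit: "\<And>i. i \<le> snd A \<Longrightarrow> t i i \<cdot> ep D = idW C (vx i)"
  shows "is_wfunctor W (Psi W z D A) C (mk_wfun W z C (snd A) vx t)" (is "is_wfunctor W ?P C ?F")
    and "i \<le> snd A \<Longrightarrow> wfO (mk_wfun W z C (snd A) vx t) (Inl i) = vx i"
    and "\<lbrakk>i \<le> j; j \<le> snd A\<rbrakk> \<Longrightarrow>
      homW (Psi W z D A :: ('u pt, 'o, 'a) wcat) C (mk_wfun W z C (snd A) vx t) (Inl i) (Inl j) =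
        t i j"
proof -
  have o: "wfO ?F (Inl i) = vx i" if "i \<le> snd A" for i
    using that by (simp add: mk_wfun_def Let_def)
  show "i \<le> snd A \<Longrightarrow> wfO ?F (Inl i) = vx i" by (rule o)
  have h: "homW ?P C ?F (Inl i) (Inl j) = t i j" if "i \<le> j" "j \<le> snd A" for i j
    using that t[OF that] o[of i] o[of j] by (simp add: homW_def prod_eq_iff) (simp add: mk_wfun_def
      Let_def)
  show "\<lbrakk>i \<le> j; j \<le> snd A\<rbrakk> \<Longrightarrow> homW ?P C ?F (Inl i) (Inl j) = t i j" by (rule h)
  have ar: "ar (homW ?P C ?F (Inl i) (Inl j))" if "i \<le> snd A" "j \<le> snd A" for i j
  proof (cases "i \<le> j")
    case True
    then show ?thesis using that by (simp add: h t)
  next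
    case False
    then have "homW ?P C ?F (Inl i) (Inl j) = (z, the_arr W z (wHom C (vx i) (vx j)), wHom C (vx i)
      (vx j))"
      using that by (simp add: homW_def o) (simp add: mk_wfun_def Let_def)
    then show ?thesis using that initial_the_arr[OF z] C vx by (simp add: ar_triple)
  qed
  have hom: "wHom ?P (Inl i) (Inl j) \<in> Ob W" if "i \<le> snd A" "j \<le> snd A" for i j
    using that by (simp add: wHom_Ob)
  show "is_wfunctor W ?P C ?F"
  proof (rule is_wfunctorI)
    show "wfO ?F \<in> wOb ?P \<rightarrow>\<^sub>E wOb C" using vx by (auto simp: mk_wfun_def Let_def)
    show "wfH ?F x y = undefined" if "\<not> (x \<in> wOb ?P \<and> y \<in> wOb ?P)" for x y
      using that by (auto simp: mk_wfun_def Let_def)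
    show "ar (homW ?P C ?F x y)" if "x \<in> wOb ?P" "y \<in> wOb ?P" for x y using that ar by auto
    show "homW ?P C ?F x x \<cdot> idW ?P x = idW C (wfO ?F x)" if "x \<in> wOb ?P" for x
      using that by (auto simp: h o unit Psi_idW[OF D])
    fix x y v assume "x \<in> wOb ?P" "y \<in> wOb ?P" "v \<in> wOb ?P"
    then obtain i k j where le: "i \<le> snd A" "k \<le> snd A" "j \<le> snd A" and eq: "x = Inl i" "y =
      Inl k" "v = Inl j"
      by auto
    show "homW ?P C ?F x v \<cdot> cmpW ?P x y v = cmpW C (wfO ?F x) (wfO ?F y) (wfO ?F v) \<cdot>
      (homW ?P C ?F x y \<otimes> homW ?P C ?F y v)"
    proof (cases "i \<le> k \<and> k \<le> j")
      case True
      then show ?thesis using le by (simp add: eq o h comp)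
    next
      case False
      have "initial W (wHom ?P (Inl i) (Inl k) \<odot> wHom ?P (Inl k) (Inl j))"
      proof (cases "i \<le> k")
        case True
        then show ?thesis using False le by (simp add: tensor_initial(1) z)
      next
        case False
        then show ?thesis using le by (simp add: tensor_initial(2) z)
      qed
      then show ?thesis unfolding eq using le C hom
        by (intro initial_unique) (simp_all add: ar o vx ar_Psi_cmpW[OF D] del: Psi_simps(2))
    qed
  qed
qed

lemma Psi_wfun_eqI:
  fixes C :: "('u pt, 'o, 'a) wcat"
  assumes C: "is_wcat W C" and F: "is_wfunctor W (Psi W z D A) C F"
    and G: "is_wfunctor W (Psi W z D A) C G"
    and o: "\<And>i. i \<le> snd A \<Longrightarrow> wfO F (Inl i) = wfO G (Inl i)"
    and h: "\<And>i j. \<lbrakk>i \<le> j; j \<le> snd A\<rbrakk> \<Longrightarrow> homW (Psi W z D A :: ('u pt, 'o, 'a) wcat) C F (Inl i)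
      (Inl j) = homW (Psi W z D A :: ('u pt, 'o, 'a) wcat) C G (Inl i) (Inl j)"
  shows "F = G"
proof (rule wfun_eqI[OF F G])
  let ?P = "Psi W z D A :: ('u pt, 'o, 'a) wcat"
  fix x y assume "x \<in> wOb ?P" "y \<in> wOb ?P"
  then obtain i j where ij: "i \<le> snd A" "j \<le> snd A" and eq: "x = Inl i" "y = Inl j" by auto
  have "homW ?P C F x y = homW ?P C G x y"
  proof (cases "i \<le> j")
    case True
    then show ?thesis using h ij eq by simp
  next
    case False
    then show ?thesis unfolding eq using ij z ar_homW[OF F _ C] ar_homW[OF G _ C]
      by (intro initial_unique) (simp_all add: o)
  qed
  then show "wfH F x y = wfH G x y" by (rule homW_eq_wfH)
qed (use o in auto)

text \<open>At a joint there is nothing to forget, so D of the vertex identity is an identity and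
  only the isomorphism \<open>mu\<close> remains.\<close>

lemma Psi_cmpW_joint:
  assumes "k \<in> fst A" "i \<le> k" "k \<le> j" "j \<le> snd A"
  shows "cmpW (Psi W z D A) (Inl i) (Inl k) (Inl j) = mu D (restr A i k) (restr A k j)"
    and "wedge (restr A i k) (restr A k j) = restr A i j"
  using assms restr_wedge_joint[OF assms(1-3)] DA_id[OF D, of "restr A i j"]
    by (simp_all add: Psi_cmpW[OF D])

lemma extend_ar:
  fixes C :: "('u pt, 'o, 'a) wcat"
  assumes C: "is_wcat W C" and vx: "\<And>i. i \<le> snd A \<Longrightarrow> vx i \<in> wOb C"
    and x: "\<And>i j. \<lbrakk>i \<le> j; j \<le> snd A; bead A i j\<rbrakk> \<Longrightarrow> ar (x i j)"
      "\<And>i j. \<lbrakk>i \<le> j; j \<le> snd A; bead A i j\<rbrakk> \<Longrightarrow> dm (x i j) = fob D (restr A i j)"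
      "\<And>i j. \<lbrakk>i \<le> j; j \<le> snd A; bead A i j\<rbrakk> \<Longrightarrow> cd (x i j) = wHom C (vx i) (vx j)"
  shows "\<lbrakk>i \<le> j; j \<le> snd A\<rbrakk> \<Longrightarrow>
    ar (extend D A C vx x i j) \<and> dm (extend D A C vx x i j) = fob D (restr A i j) \<and>
      cd (extend D A C vx x i j) = wHom C (vx i) (vx j)"
proof (induction "j - i" arbitrary: i rule: less_induct)
  case less
  show ?case
  proof (cases "bead A i j")
    case True
    then show ?thesis using less.prems x by (simp add: extend.simps)
  next
    case False
    let ?t = "joint A i j"
    note t = joint[OF False]
    have IH: "ar (extend D A C vx x ?t j)" "dm (extend D A C vx x ?t j) = fob D (restr A ?t j)"
      "cd (extend D A C vx x ?t j) = wHom C (vx ?t) (vx j)"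
      using less.hyps[of ?t] less.prems t by auto
    have "wedge (restr A i ?t) (restr A ?t j) = restr A i j"
      using t by (intro restr_wedge_joint) auto
    then show ?thesis
      unfolding extend.simps[of D A C vx x i j] using False t less.prems x[OF _ _ t(4)] IH C vx
        by simp
  qed
qed

text \<open>At the first joint the composition of \<open>Psi\<close> is the \<open>mu\<close> whose
  inverse occurs in \<open>extend\<close>, and the two cancel.\<close>

lemma extend_unfold:
  fixes C :: "('u pt, 'o, 'a) wcat"
  assumes C: "is_wcat W C" and vx: "\<And>i. i \<le> snd A \<Longrightarrow> vx i \<in> wOb C"
    and x: "\<And>i j. \<lbrakk>i \<le> j; j \<le> snd A; bead A i j\<rbrakk> \<Longrightarrow> ar (x i j)"
      "\<And>i j. \<lbrakk>i \<le> j; j \<le> snd A; bead A i j\<rbrakk> \<Longrightarrow> dm (x i j) = fob D (restr A i j)"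
      "\<And>i j. \<lbrakk>i \<le> j; j \<le> snd A; bead A i j\<rbrakk> \<Longrightarrow> cd (x i j) = wHom C (vx i) (vx j)"
    and nb: "\<not> bead A i j" and ij: "i \<le> j" "j \<le> snd A"
  shows "extend D A C vx x i j \<cdot> cmpW (Psi W z D A :: ('u pt, 'o, 'a) wcat) (Inl i)
    (Inl (joint A i j)) (Inl j) =
    cmpW C (vx i) (vx (joint A i j)) (vx j) \<cdot> (extend D A C vx x i (joint A i j) \<otimes>
      extend D A C vx x (joint A i j) j)"
proof -
  let ?t = "joint A i j"
  note t = joint[OF nb]
  have e: "extend D A C vx x i ?t = x i ?t" using t(4) by (simp add: extend.simps)
  have m: "cmpW (Psi W z D A :: ('u pt, 'o, 'a) wcat) (Inl i) (Inl ?t) (Inl j) =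
    mu D (restr A i ?t) (restr A ?t j)"
    using t ij by (intro Psi_cmpW_joint) auto
  have "\<And>i j. \<lbrakk>i \<le> j; j \<le> snd A\<rbrakk> \<Longrightarrow>
    ar (extend D A C vx x i j) \<and> dm (extend D A C vx x i j) = fob D (restr A i j) \<and>
      cd (extend D A C vx x i j) = wHom C (vx i) (vx j)"
    by (rule extend_ar[OF C]) (use vx x in auto)
  from this[of ?t j] show ?thesis
    unfolding m e extend.simps[of D A C vx x i j] using nb t ij x[OF _ _ t(4)] C vx by simp
qed

text \<open>
  If \<open>k\<close> lies beyond the first joint \<open>t\<close>, associativity on both sides reduces the claim from \<open>i, k,
    j\<close> to
  \<open>t, k, j\<close>; if it lies before \<open>t\<close>, the claim reduces to the hypothesis on the bead from \<open>i\<close> to \<open>t\<close>.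
\<close>

lemma extend_comp:
  fixes C :: "('u pt, 'o, 'a) wcat"
  assumes C: "is_wcat W C" and vx: "\<And>i. i \<le> snd A \<Longrightarrow> vx i \<in> wOb C"
    and x: "\<And>i j. \<lbrakk>i \<le> j; j \<le> snd A; bead A i j\<rbrakk> \<Longrightarrow> ar (x i j)"
      "\<And>i j. \<lbrakk>i \<le> j; j \<le> snd A; bead A i j\<rbrakk> \<Longrightarrow> dm (x i j) = fob D (restr A i j)"
      "\<And>i j. \<lbrakk>i \<le> j; j \<le> snd A; bead A i j\<rbrakk> \<Longrightarrow> cd (x i j) = wHom C (vx i) (vx j)"
    and comp: "\<And>i k j. \<lbrakk>i \<le> k; k \<le> j; j \<le> snd A; bead A i j\<rbrakk> \<Longrightarrow>
      x i j \<cdot> cmpW (Psi W z D A :: ('u pt, 'o, 'a) wcat) (Inl i) (Inl k) (Inl j) =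
        cmpW C (vx i) (vx k) (vx j) \<cdot> (x i k \<otimes> x k j)"
  shows "\<lbrakk>i \<le> k; k \<le> j; j \<le> snd A\<rbrakk> \<Longrightarrow>
    extend D A C vx x i j \<cdot> cmpW (Psi W z D A :: ('u pt, 'o, 'a) wcat) (Inl i) (Inl k) (Inl j) =
    cmpW C (vx i) (vx k) (vx j) \<cdot> (extend D A C vx x i k \<otimes> extend D A C vx x k j)"
proof (induction "j - i" arbitrary: i rule: less_induct)
  case less
  let ?P = "Psi W z D A :: ('u pt, 'o, 'a) wcat"
  let ?c = "\<lambda>i k j. cmpW ?P (Inl i) (Inl k) (Inl j)" and ?M = "\<lambda>i k j. cmpW C (vx i) (vx k) (vx j)"
  let ?e = "extend D A C vx x"
  have e: "ar (?e i j)" "dm (?e i j) = fob D (restr A i j)" "cd (?e i j) = wHom C (vx i) (vx j)"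
    if "i \<le> j" "j \<le> snd A" for i j
    using that extend_ar[OF C, of A vx x i j] vx x by auto
  have car: "ar (?c i k j)" if "i \<le> k" "k \<le> j" "j \<le> snd A" for i k j using that
    by (simp add: ar_Psi_cmpW[OF D])
  have Mar: "ar (?M i k j)" if "i \<le> k" "k \<le> j" "j \<le> snd A" for i k j using that C vx by simp
  have unf: "?e i j \<cdot> ?c i (joint A i j) j = ?M i (joint A i j) j \<cdot> (?e i (joint A i j) \<otimes>
    ?e (joint A i j) j)"
    if "\<not> bead A i j" "i \<le> j" "j \<le> snd A" for i j
    using extend_unfold[OF C, of A vx x i j] vx x that by blast
  have Massoc: "?M i j l \<cdot> (?M i k j \<otimes> idt (wHom C (vx j) (vx l))) =
      ?M i k l \<cdot> ((idt (wHom C (vx i) (vx k)) \<otimes> ?M k j l) \<cdot>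
        asc (wHom C (vx i) (vx k)) (wHom C (vx k) (vx j)) (wHom C (vx j) (vx l)))"
    if "i \<le> k" "k \<le> j" "j \<le> l" "l \<le> snd A" for i k j l
    using that wcat_assoc[OF C, of "vx i" "vx k" "vx j" "vx l"] vx by simp
  have Passoc: "?c i j l \<cdot> (?c i k j \<otimes> idt (fob D (restr A j l))) =
      ?c i k l \<cdot> ((idt (fob D (restr A i k)) \<otimes> ?c k j l) \<cdot>
        asc (fob D (restr A i k)) (fob D (restr A k j)) (fob D (restr A j l)))"
    if "i \<le> k" "k \<le> j" "j \<le> l" "l \<le> snd A" for i k j l
    by (rule Psi_cmpW_assoc[OF D that])
  note ikj = less.prems
  show ?case
  proof (cases "bead A i j")
    case True
    then show ?thesis using ikj comp bead_sub[OF True, of i k] bead_sub[OF True, of k j]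
      by (simp add: extend.simps)
  next
    case nb: False
    define t where "t = joint A i j"
    note t = joint[OF nb, folded t_def]
    consider "k = t" | "t < k" | "k < t" by linarith
    then show ?thesis
    proof cases
      case 1
      then show ?thesis using unf[OF nb] ikj by (simp add: t_def)
    next
      case 2
      have itk: "?e i k \<cdot> ?c i t k = ?M i t k \<cdot> (?e i t \<otimes> ?e t k)"
        using joint_eq[OF nb, of i k] unf[of i k] 2 ikj t by (simp add: t_def)
      have IH: "?e t j \<cdot> ?c t k j = ?M t k j \<cdot> (?e t k \<otimes> ?e k j)"
        using less.hyps[of t] 2 ikj t by auto
      \<comment> \<open>As t is a joint, this composition is invertible. The claim is compared after
        precomposing with it, where the associativity laws of \<open>Psi\<close> and C
        apply.\<close>
      have iso: "tiso (?c i t k)" "tiso (?c i t k \<otimes> idt (fob D (restr A k j)))"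
        using t ikj 2 by (auto intro!: iso_tns iso_idt simp: Psi_cmpW_joint(1)[OF t(1)])
      let ?a = "asc (fob D (restr A i t)) (fob D (restr A t k)) (fob D (restr A k j))"
      let ?b = "asc (wHom C (vx i) (vx t)) (wHom C (vx t) (vx k)) (wHom C (vx k) (vx j))"
      note le = ikj 2 t(1-3)
      note r = e car Mar vx C less_imp_le
      have "(?e i j \<cdot> ?c i k j) \<cdot> (?c i t k \<otimes> idt (fob D (restr A k j))) =
          ?e i j \<cdot> (?c i k j \<cdot> (?c i t k \<otimes> idt (fob D (restr A k j))))"
        using le by (simp add: r)
      also have "\<dots> = ?e i j \<cdot> (?c i t j \<cdot> ((idt (fob D (restr A i t)) \<otimes> ?c t k j) \<cdot> ?a))"
        using le by (simp only: Passoc less_imp_le)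
      also have "\<dots> = (?e i j \<cdot> ?c i t j) \<cdot> ((idt (fob D (restr A i t)) \<otimes> ?c t k j) \<cdot> ?a)"
        using le by (simp add: r)
      also have "\<dots> = (?M i t j \<cdot> (?e i t \<otimes> ?e t j)) \<cdot> ((idt (fob D (restr A i t)) \<otimes> ?c t k j) \<cdot> ?a)"
        using unf[OF nb] le by (simp add: t_def)
      also have "\<dots> = ?M i t j \<cdot> ((?e i t \<otimes> (?e t j \<cdot> ?c t k j)) \<cdot> ?a)"
        using le by (simp add: r fuse)
      also have "\<dots> = ?M i t j \<cdot> ((?e i t \<otimes> (?M t k j \<cdot> (?e t k \<otimes> ?e k j))) \<cdot> ?a)"
        by (simp only: IH)
      also have "\<dots> = ?M i t j \<cdot> ((idt (wHom C (vx i) (vx t)) \<otimes> ?M t k j) \<cdot>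
        ((?e i t \<otimes> (?e t k \<otimes> ?e k j)) \<cdot> ?a))"
        using le by (simp add: r fuse)
      also have "(?e i t \<otimes> (?e t k \<otimes> ?e k j)) \<cdot> ?a = ?b \<cdot> ((?e i t \<otimes> ?e t k) \<otimes> ?e k j)"
        using le by (subst asc_natural) (simp_all add: r)
      also have "?M i t j \<cdot> ((idt (wHom C (vx i) (vx t)) \<otimes> ?M t k j) \<cdot>
        (?b \<cdot> ((?e i t \<otimes> ?e t k) \<otimes> ?e k j))) =
        (?M i t j \<cdot> ((idt (wHom C (vx i) (vx t)) \<otimes> ?M t k j) \<cdot> ?b)) \<cdot> ((?e i t \<otimes> ?e t k) \<otimes> ?e k j)"
        using le by (simp add: r)
      also have "\<dots> = (?M i k j \<cdot> (?M i t k \<otimes> idt (wHom C (vx k) (vx j)))) \<cdot> ((?e i t \<otimes> ?e t k) \<otimes>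
        ?e k j)"
        using le by (simp only: Massoc less_imp_le)
      also have "\<dots> = ?M i k j \<cdot> ((?M i t k \<cdot> (?e i t \<otimes> ?e t k)) \<otimes> ?e k j)"
        using le by (simp add: r fuse)
      also have "\<dots> = ?M i k j \<cdot> ((?e i k \<cdot> ?c i t k) \<otimes> ?e k j)"
        by (simp only: itk)
      also have "\<dots> = (?M i k j \<cdot> (?e i k \<otimes> ?e k j)) \<cdot> (?c i t k \<otimes> idt (fob D (restr A k j)))"
        using le by (simp add: r fuse)
      finally show ?thesis
        by (rule iso_cancel[OF iso(2), rotated -1]) (use le in \<open>simp_all add: r\<close>)
    next
      case 3
      have kj: "?e k j \<cdot> ?c k t j = ?M k t j \<cdot> (?e k t \<otimes> ?e t j)"
        using joint_eq[OF nb, of k j] unf[of k j] 3 ikj t by (simp add: t_def)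
      have it: "?e i t \<cdot> ?c i k t = ?M i k t \<cdot> (?e i k \<otimes> ?e k t)"
        using comp[of i k t] bead_sub[OF t(4), of i k] bead_sub[OF t(4), of k t] t 3 ikj
          by (simp add: extend.simps)
      let ?a = "asc (fob D (restr A i k)) (fob D (restr A k t)) (fob D (restr A t j))"
      let ?b = "asc (wHom C (vx i) (vx k)) (wHom C (vx k) (vx t)) (wHom C (vx t) (vx j))"
      have iso: "tiso (?c k t j)" "tiso (idt (fob D (restr A i k)) \<otimes> ?c k t j)"
        using t ikj 3 by (auto intro!: iso_tns iso_idt simp: Psi_cmpW_joint(1)[OF t(1)])
      \<comment> \<open>Here the joint splits the second factor, so the associator stands between
        the claim and the law \<open>Passoc\<close> and has to be cancelled as well.\<close>
      have isoa: "tiso ?a" using ikj 3 t by (intro coherence_iso) auto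
      note le = ikj 3 t(1-3)
      note r = e car Mar vx C less_imp_le
      have "((?e i j \<cdot> ?c i k j) \<cdot> (idt (fob D (restr A i k)) \<otimes> ?c k t j)) \<cdot> ?a =
          ?e i j \<cdot> (?c i k j \<cdot> ((idt (fob D (restr A i k)) \<otimes> ?c k t j) \<cdot> ?a))"
        using le by (simp add: r)
      also have "\<dots> = ?e i j \<cdot> (?c i t j \<cdot> (?c i k t \<otimes> idt (fob D (restr A t j))))"
        using le by (simp only: Passoc less_imp_le)
      also have "\<dots> = (?e i j \<cdot> ?c i t j) \<cdot> (?c i k t \<otimes> idt (fob D (restr A t j)))"
        using le by (simp add: r)
      also have "\<dots> = (?M i t j \<cdot> (?e i t \<otimes> ?e t j)) \<cdot> (?c i k t \<otimes> idt (fob D (restr A t j)))"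
        using unf[OF nb] le by (simp add: t_def)
      also have "\<dots> = ?M i t j \<cdot> ((?e i t \<cdot> ?c i k t) \<otimes> ?e t j)"
        using le by (simp add: r fuse)
      also have "\<dots> = ?M i t j \<cdot> ((?M i k t \<cdot> (?e i k \<otimes> ?e k t)) \<otimes> ?e t j)"
        by (simp only: it)
      also have "\<dots> = (?M i t j \<cdot> (?M i k t \<otimes> idt (wHom C (vx t) (vx j)))) \<cdot> ((?e i k \<otimes> ?e k t) \<otimes>
        ?e t j)"
        using le by (simp add: r fuse)
      also have "\<dots> = (?M i k j \<cdot> ((idt (wHom C (vx i) (vx k)) \<otimes> ?M k t j) \<cdot> ?b)) \<cdot>
        ((?e i k \<otimes> ?e k t) \<otimes> ?e t j)"
        using le by (simp only: Massoc less_imp_le)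
      also have "\<dots> = ?M i k j \<cdot> ((idt (wHom C (vx i) (vx k)) \<otimes> ?M k t j) \<cdot>
        (?b \<cdot> ((?e i k \<otimes> ?e k t) \<otimes> ?e t j)))"
        using le by (simp add: r)
      also have "?b \<cdot> ((?e i k \<otimes> ?e k t) \<otimes> ?e t j) = (?e i k \<otimes> (?e k t \<otimes> ?e t j)) \<cdot> ?a"
        using le by (subst asc_natural) (simp_all add: r)
      also have "?M i k j \<cdot> ((idt (wHom C (vx i) (vx k)) \<otimes> ?M k t j) \<cdot>
        ((?e i k \<otimes> (?e k t \<otimes> ?e t j)) \<cdot> ?a)) =
          ?M i k j \<cdot> ((?e i k \<otimes> (?M k t j \<cdot> (?e k t \<otimes> ?e t j))) \<cdot> ?a)"
        using le by (simp add: r fuse)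
      also have "\<dots> = ?M i k j \<cdot> ((?e i k \<otimes> (?e k j \<cdot> ?c k t j)) \<cdot> ?a)"
        by (simp only: kj)
      also have "\<dots> = ((?M i k j \<cdot> (?e i k \<otimes> ?e k j)) \<cdot> (idt (fob D (restr A i k)) \<otimes> ?c k t j)) \<cdot> ?a"
        using le by (simp add: r fuse)
      finally have "(?e i j \<cdot> ?c i k j) \<cdot> (idt (fob D (restr A i k)) \<otimes> ?c k t j) =
          (?M i k j \<cdot> (?e i k \<otimes> ?e k j)) \<cdot> (idt (fob D (restr A i k)) \<otimes> ?c k t j)"
        by (rule iso_cancel[OF isoa, rotated -1]) (use le in \<open>simp_all add: r\<close>)
      then show ?thesis
        by (rule iso_cancel[OF iso(2), rotated -1]) (use le in \<open>simp_all add: r\<close>)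
    qed
  qed
qed

text \<open>Compatibility with composition inside the beads suffices, as \<open>extend_comp\<close>
  propagates it across the joints.\<close>

lemma bead_extension_ex:
  fixes C :: "('u pt, 'o, 'a) wcat"
  assumes C: "is_wcat W C" and vx: "\<And>i. i \<le> snd A \<Longrightarrow> vx i \<in> wOb C"
    and x: "\<And>i j. \<lbrakk>i \<le> j; j \<le> snd A; bead A i j\<rbrakk> \<Longrightarrow> ar (x i j)"
      "\<And>i j. \<lbrakk>i \<le> j; j \<le> snd A; bead A i j\<rbrakk> \<Longrightarrow> dm (x i j) = fob D (restr A i j)"
      "\<And>i j. \<lbrakk>i \<le> j; j \<le> snd A; bead A i j\<rbrakk> \<Longrightarrow> cd (x i j) = wHom C (vx i) (vx j)"
    and comp: "\<And>i k j. \<lbrakk>i \<le> k; k \<le> j; j \<le> snd A; bead A i j\<rbrakk> \<Longrightarrow>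
      x i j \<cdot> cmpW (Psi W z D A :: ('u pt, 'o, 'a) wcat) (Inl i) (Inl k) (Inl j) =
        cmpW C (vx i) (vx k) (vx j) \<cdot> (x i k \<otimes> x k j)"
    and unit: "\<And>i. i \<le> snd A \<Longrightarrow> x i i \<cdot> ep D = idW C (vx i)"
  obtains F where "is_wfunctor W (Psi W z D A) C F" "\<And>i. i \<le> snd A \<Longrightarrow> wfO F (Inl i) = vx i"
    "\<And>i j. \<lbrakk>i \<le> j; j \<le> snd A; bead A i j\<rbrakk> \<Longrightarrow> homW (Psi W z D A :: ('u pt, 'o, 'a) wcat) C F (Inl i)
      (Inl j) = x i j"
proof -
  let ?e = "extend D A C vx x"
  have e: "ar (?e i j)" "dm (?e i j) = fob D (restr A i j)" "cd (?e i j) = wHom C (vx i) (vx j)"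
    if "i \<le> j" "j \<le> snd A" for i j
    using that extend_ar[OF C, of A vx x i j] vx x by auto
  have bd: "?e i j = x i j" if "bead A i j" for i j using that by (simp add: extend.simps)
  have comp': "?e i j \<cdot> cmpW (Psi W z D A :: ('u pt, 'o, 'a) wcat) (Inl i) (Inl k) (Inl j) =
    cmpW C (vx i) (vx k) (vx j) \<cdot> (?e i k \<otimes> ?e k j)" if "i \<le> k" "k \<le> j" "j \<le> snd A" for i k j
    using extend_comp[OF C vx x comp that] .
  have unit': "?e i i \<cdot> ep D = idW C (vx i)" if "i \<le> snd A" for i
    using unit[OF that] by (simp add: bd bead_def)
  note F = mk_wfun[OF C vx e comp' unit']
  show thesis
    by (rule that[of "mk_wfun W z C (snd A) vx ?e"]) (simp_all add: F bd)
qed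

text \<open>Across a joint the composition of \<open>Psi\<close> is an isomorphism, so functoriality
  expresses the action on a long hom-object through the first bead and a shorter rest; induction on
  the length leaves the beads.\<close>

lemma bead_extension_unique:
  fixes C :: "('u pt, 'o, 'a) wcat"
  assumes C: "is_wcat W C" and F: "is_wfunctor W (Psi W z D A) C F"
    and G: "is_wfunctor W (Psi W z D A) C G"
    and o: "\<And>i. i \<le> snd A \<Longrightarrow> wfO F (Inl i) = wfO G (Inl i)"
    and h: "\<And>i j. \<lbrakk>i \<le> j; j \<le> snd A; bead A i j\<rbrakk> \<Longrightarrow>
      homW (Psi W z D A :: ('u pt, 'o, 'a) wcat) C F (Inl i) (Inl j) =
        homW (Psi W z D A :: ('u pt, 'o, 'a) wcat) C G (Inl i) (Inl j)"
  shows "F = G"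
proof (rule Psi_wfun_eqI[OF C F G o])
  let ?P = "Psi W z D A :: ('u pt, 'o, 'a) wcat"
  show "homW ?P C F (Inl i) (Inl j) = homW ?P C G (Inl i) (Inl j)" if "i \<le> j" "j \<le> snd A" for i j
    using that
  proof (induction "j - i" arbitrary: i rule: less_induct)
    case less
    show ?case
    proof (cases "bead A i j")
      case True
      then show ?thesis using h less.prems by blast
    next
      case False
      define t where "t = joint A i j"
      note t = joint[OF False, folded t_def]
      have "homW ?P C F (Inl i) (Inl j) \<cdot> cmpW ?P (Inl i) (Inl t) (Inl j) =
        homW ?P C G (Inl i) (Inl j) \<cdot> cmpW ?P (Inl i) (Inl t) (Inl j)"
        using less.hyps[of t] less.prems t h[of i t] o[of i] o[of j] o[of t]
        by (simp add: homW_cmpW[OF F] homW_cmpW[OF G])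
      then show ?thesis
        by (rule iso_cancel[rotated -1])
          (use t less.prems ar_homW[OF F _ C] ar_homW[OF G _ C] o[of i] o[of j] in \<open>simp_all
            add: Psi_cmpW_joint[OF t(1)]\<close>)
    qed
  qed
qed

end

end

section \<open>Functoriality and the extension theorem\<close>

text \<open>Inclusion of n + 1 consecutive vertices starting at i: the way in which sub-necklaces,
  and simplices inside a bead, sit in a necklace.\<close>

definition shift :: "nat \<Rightarrow> nat \<Rightarrow> nat \<Rightarrow> nat" where
  "shift n i = (\<lambda>k\<in>{..n}. k + i)"

lemma shift_Hom: "n + i \<le> m \<Longrightarrow> shift n i \<in> Hom Delta n m"
  by (auto simp: shift_def monotone_on_def)

lemma shift_apply [simp]: "k \<le> n \<Longrightarrow> shift n i k = k + i"
  by (simp add: shift_def)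

text \<open>A simplex has no inner joints, so it must land in one bead. Thus
  \<open>nmaps (simplex n) A\<close> is the set of n-simplices of A seen as a simplicial
  set.\<close>

lemma nmaps_simplex: "f \<in> nmaps (simplex m) A \<longleftrightarrow>
    A \<in> Ob Nec \<and> f \<in> Hom Delta m (snd A) \<and> bead A (f 0) (f m)"
proof -
  have "(\<forall>u\<in>fst A. f 0 \<le> u \<longrightarrow> u \<le> f m \<longrightarrow> u \<in> f ` {0, m}) \<longleftrightarrow> bead A (f 0) (f m)"
    unfolding bead_def by (auto simp: le_less)
  then show ?thesis unfolding nmaps_def by (auto simp: simplex_Ob) (auto simp: simplex_def)
qed

lemma nmaps_simplices: "nmaps (simplex m) (simplex n) = Hom Delta m n"
  unfolding set_eq_iff nmaps_simplex by (auto simp: simplex_Ob) (metis atMost_iff bead_def fst_conv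
    insert_iff less_le_not_le
      not_less_zero order_refl PiE_mem simplex_def singletonD)

lemma bead_shift: "\<lbrakk>A \<in> Ob Nec; bead A i j; i \<le> j; j \<le> snd A\<rbrakk> \<Longrightarrow>
  shift (j - i) i \<in> nmaps (simplex (j - i)) A"
  using shift_Hom[of "j - i" i "snd A"] by (simp add: nmaps_simplex del: Delta_simps(2))

lemma nmaps_point: "\<lbrakk>A \<in> Ob Nec; i \<le> snd A\<rbrakk> \<Longrightarrow> shift 0 i \<in> nmaps (simplex 0) A"
  using shift_Hom[of 0 i "snd A"] by (simp add: nmaps_simplex del: Delta_simps(2))
    (simp add: shift_def bead_def)

lemma seg_shift: "\<lbrakk>b \<le> n\<rbrakk> \<Longrightarrow> seg (shift n i) a b = Ident Delta (b - a)"
  by (auto simp: seg_def shift_def fun_eq_iff Delta_simps(3))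

text \<open>Naturality of the stretch inclusions. It factors any simplex of a necklace into the
  endpoint preserving part \<open>seg\<close> and a stretch inside a bead.\<close>

lemma compose_shift:
  "\<lbrakk>f \<in> Hom Delta m n; a \<le> b; b \<le> m\<rbrakk> \<Longrightarrow> compose {..b - a} (shift (f b - f a) (f a)) (seg f a b) =
    compose {..b - a} f (shift (b - a) a)"
proof
  fix x
  assume "f \<in> Hom Delta m n" "a \<le> b" "b \<le> m"
  then have "f (x + a) \<le> f b" "f a \<le> f (x + a)" if "x \<le> b - a"
    using that by (auto simp: monotone_on_def)
  then show "compose {..b - a} (shift (f b - f a) (f a)) (seg f a b) x =
    compose {..b - a} f (shift (b - a) a) x"
    by (auto simp: compose_def seg_def)
qed

lemma seg_Delta: "\<lbrakk>f \<in> Hom Delta m n; a \<le> b; b \<le> m\<rbrakk> \<Longrightarrow> seg f a b \<in> Hom Delta (b - a) (f b - f a)"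
  by (auto simp: seg_def monotone_on_def intro!: diff_le_mono)

lemma seg_0: "f \<in> Hom Delta n m \<Longrightarrow> f 0 = 0 \<Longrightarrow> seg f 0 n = f"
  by (auto simp: seg_def fun_eq_iff PiE_def extensional_def)

context monoidal_initial
begin

text \<open>D accepts only bipointed maps, whereas f need not preserve endpoints; on the hom-object
  from i to j it acts through its restriction \<open>seg f i j\<close>.\<close>

definition Psi_ar ::
  "(necklace, nat \<Rightarrow> nat, 'o, 'a) mftor \<Rightarrow> necklace \<Rightarrow> necklace \<Rightarrow> (nat \<Rightarrow> nat) \<Rightarrow> ('u pt, 'a) wfun" where
  "Psi_ar D A B f = mk_wfun W z (Psi W z D B) (snd A) (\<lambda>i. Inl (f i))
     (\<lambda>i j. DA D (restr A i j) (restr B (f i) (f j)) (seg f i j))"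

context
  fixes D :: "(necklace, nat \<Rightarrow> nat, 'o, 'a) mftor"
  assumes D: "strong_monoidal Nec W D"
begin

lemmas [simp] = D_Ob[OF D] ar_DA[OF D] mu_iso[OF D] ep_iso[OF D] DA_id[OF D] restr_wedge_sub'[OF D]
  is_wcat_Psi[OF D]

lemma Psi_ar:
  assumes f: "f \<in> nmaps A B"
  shows "is_wfunctor W (Psi W z D A) (Psi W z D B) (Psi_ar D A B f :: ('u pt, 'a) wfun)"
    and "i \<le> snd A \<Longrightarrow> wfO (Psi_ar D A B f :: ('u pt, 'a) wfun) (Inl i) = Inl (f i)"
    and "\<lbrakk>i \<le> j; j \<le> snd A\<rbrakk> \<Longrightarrow>
      homW (Psi W z D A) (Psi W z D B) (Psi_ar D A B f :: ('u pt, 'a) wfun) (Inl i) (Inl j) =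
      DA D (restr A i j) (restr B (f i) (f j)) (seg f i j)"
proof -
  let ?P = "Psi W z D A :: ('u pt, 'o, 'a) wcat" and ?Q = "Psi W z D B :: ('u pt, 'o, 'a) wcat"
  let ?t = "\<lambda>i j. DA D (restr A i j) (restr B (f i) (f j)) (seg f i j)"
  have le: "f i \<le> f j" "f j \<le> snd B" if "i \<le> j" "j \<le> snd A" for i j
    using nmapsD(2,3)[OF f] that by auto
  have ar: "ar (?t i j)" if "i \<le> j" "j \<le> snd A" for i j
    using seg_Hom[OF f that] le that by simp
  have comp: "?t i j \<cdot> cmpW ?P (Inl i) (Inl k) (Inl j) =
    cmpW ?Q (Inl (f i)) (Inl (f k)) (Inl (f j)) \<cdot> (?t i k \<otimes> ?t k j)"
    if ikj: "i \<le> k" "k \<le> j" "j \<le> snd A" for i k j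
  proof -
    let ?A = "restr A i k" and ?B = "restr A k j" and ?A' = "restr B (f i) (f k)"
      and ?B' = "restr B (f k) (f j)"
    note fle = le[of i k] le[of k j] ikj
    have s: "seg f i k \<in> Hom Nec ?A ?A'" "seg f k j \<in> Hom Nec ?B ?B'" "seg f i j \<in> Hom Nec
      (restr A i j) (restr B (f i) (f j))"
      using seg_Hom[OF f] ikj by auto
    have w: "wedge_map ?A ?A' ?B ?B' (seg f i k) (seg f k j) \<in> Hom Nec (wedge ?A ?B)
      (wedge ?A' ?B')"
      using wedge_map_Hom[OF D s(1,2)] fle by simp
    have "?t i j \<cdot> cmpW ?P (Inl i) (Inl k) (Inl j) =
      (DA D (restr A i j) (restr B (f i) (f j)) (seg f i j) \<cdot>
        DA D (wedge ?A ?B) (restr A i j) (Ident Delta (j - i))) \<cdot> mu D ?A ?B"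
      using fle s by (simp add: Psi_cmpW[OF D])
    also have "DA D (restr A i j) (restr B (f i) (f j)) (seg f i j) \<cdot>
      DA D (wedge ?A ?B) (restr A i j) (Ident Delta (j - i)) =
      DA D (wedge ?A ?B) (restr B (f i) (f j)) (compose {..snd (wedge ?A ?B)} (seg f i j)
        (Ident Delta (j - i)))"
      using fle s restr_wedge_sub[of i k j A] by (intro DA_comp[OF D]) auto
    \<comment> \<open>Both sides send x to f (x + i) - f i. Beyond k - i the right side is a sum of
      two truncated differences, which telescopes because f is monotone.\<close>
    also have "compose {..snd (wedge ?A ?B)} (seg f i j) (Ident Delta (j - i)) =
        compose {..snd (wedge ?A ?B)} (Ident Delta (f j - f i)) (wedge_map ?A ?A' ?B ?B' (seg f i k)
          (seg f k j))"
    proof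
      fix x
      have "f i \<le> f (x + i)" "f (x + i) \<le> f j" if "x \<le> j - i" using le that ikj by auto
      moreover have "f k \<le> f (x + i)" if "x \<le> j - i" "\<not> x \<le> k - i" using le[of k "x + i"] that ikj
        by auto
      ultimately show "compose {..snd (wedge ?A ?B)} (seg f i j) (Ident Delta (j - i)) x =
        compose {..snd (wedge ?A ?B)} (Ident Delta (f j - f i)) (wedge_map ?A ?A' ?B ?B' (seg f i k)
          (seg f k j)) x"
        using fle by (auto simp: compose_def seg_def wedge_map_def Delta_simps(3))
    qed
    also have "DA D (wedge ?A ?B) (restr B (f i) (f j)) \<dots> =
      DA D (wedge ?A' ?B') (restr B (f i) (f j)) (Ident Delta (f j - f i)) \<cdot>
      DA D (wedge ?A ?B) (wedge ?A' ?B') (wedge_map ?A ?A' ?B ?B' (seg f i k) (seg f k j))"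
      using fle w restr_wedge_sub[of "f i" "f k" "f j" B] by (intro DA_comp[OF D, symmetric]) auto
    also have "\<dots> \<cdot> mu D ?A ?B = DA D (wedge ?A' ?B') (restr B (f i) (f j))
      (Ident Delta (f j - f i)) \<cdot>
      (DA D (wedge ?A ?B) (wedge ?A' ?B') (wedge_map ?A ?A' ?B ?B' (seg f i k) (seg f k j)) \<cdot>
        mu D ?A ?B)"
      using fle w by simp
    also have "\<dots> = DA D (wedge ?A' ?B') (restr B (f i) (f j)) (Ident Delta (f j - f i)) \<cdot>
      (mu D ?A' ?B' \<cdot> (?t i k \<otimes> ?t k j))"
      using fle by (subst mu_natural[OF D s(1,2)]) simp_all
    finally show ?thesis using fle s by (simp add: Psi_cmpW[OF D])
  qed
  have unit: "?t i i \<cdot> ep D = idW ?Q (Inl (f i))" if "i \<le> snd A" for i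
  proof -
    have "seg f i i = Ident Delta 0" by (auto simp: seg_def fun_eq_iff Delta_simps(3))
    moreover have "DA D (simplex 0) (simplex 0) (Ident Delta 0) = idt (fob D (simplex 0))"
      using DA_id[OF D, of "simplex 0"] by simp
    ultimately show ?thesis using le[of i i] that by (simp add: restr_point Psi_idW[OF D])
  qed
  have hom: "wHom ?Q (Inl (f i)) (Inl (f j)) = fob D (restr B (f i) (f j))" if "i \<le> j" "j \<le> snd A"
    for i j
    using le[OF that] by simp
  have vx: "Inl (f i) \<in> wOb ?Q" if "i \<le> snd A" for i using le[of i i] that by simp
  have tc: "cd (?t i j) = wHom ?Q (Inl (f i)) (Inl (f j))" if "i \<le> j" "j \<le> snd A" for i j
    using hom[OF that] by simp
  note mk = mk_wfun[OF D is_wcat_Psi[OF D, of B], where A = A and vx = "\<lambda>i. Inl (f i)"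
    and t = ?t, OF vx ar _ tc comp unit, folded Psi_ar_def]
  show "is_wfunctor W ?P ?Q (Psi_ar D A B f)" by (rule mk) simp_all
  show "i \<le> snd A \<Longrightarrow> wfO (Psi_ar D A B f :: ('u pt, 'a) wfun) (Inl i) = Inl (f i)"
    by (rule mk) simp_all
  show "\<lbrakk>i \<le> j; j \<le> snd A\<rbrakk> \<Longrightarrow> homW ?P ?Q (Psi_ar D A B f) (Inl i) (Inl j) = ?t i j"
    by (rule mk) simp_all
qed

lemma Psi_ar_comp:
  assumes f: "f \<in> nmaps A B" and g: "g \<in> nmaps B C"
  shows "comp_wfun W (Psi W z D A) (Psi W z D B) (Psi W z D C) (Psi_ar D B C g) (Psi_ar D A B f) =
    (Psi_ar D A C (compose {..snd A} g f) :: ('u pt, 'a) wfun)"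
proof -
  note F = Psi_ar[OF f] and G = Psi_ar[OF g] and GF = Psi_ar[OF nmaps_comp[OF f g]]
  have [simp]: "compose {..snd A} g f i = g (f i)" if "i \<le> snd A" for i
    using that by (simp add: compose_def)
  have le: "f i \<le> f j" "f j \<le> snd B" "g (f i) \<le> g (f j)" if "i \<le> j" "j \<le> snd A" for i j
    using nmapsD(2,3)[OF f] nmapsD(3)[OF g] that by auto
  show ?thesis
  proof (rule Psi_wfun_eqI[OF D])
    fix i j assume ij: "i \<le> j" "j \<le> snd A"
    have "DA D (restr B (f i) (f j)) (restr C (g (f i)) (g (f j))) (seg g (f i) (f j)) \<cdot>
        DA D (restr A i j) (restr B (f i) (f j)) (seg f i j) =
        DA D (restr A i j) (restr C (g (f i)) (g (f j))) (compose {..j - i} (seg g (f i) (f j))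
          (seg f i j))"
      using ij le[OF ij] seg_Hom[OF f ij] seg_Hom[OF g] by (subst DA_comp[OF D]) auto
    then show "homW (Psi W z D A) (Psi W z D C) (comp_wfun W (Psi W z D A) (Psi W z D B)
      (Psi W z D C) (Psi_ar D B C g) (Psi_ar D A B f)) (Inl i) (Inl j) =
       homW (Psi W z D A) (Psi W z D C) (Psi_ar D A C (compose {..snd A} g f)) (Inl i)
         (Inl j :: 'u pt)"
      using ij le[OF ij] by (simp add: homW_comp_wfun F(2,3) G(3) GF(3) seg_compose[OF f])
  qed (use le in \<open>auto intro!: is_wfunctor_comp F G GF simp: F(2) G(2) GF(2)\<close>)
qed

lemma Psi_ar_id: "A \<in> Ob Nec \<Longrightarrow> Psi_ar D A A (Ident Delta (snd A)) =
  (id_wfun W (Psi W z D A) :: ('u pt, 'a) wfun)"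
proof -
  assume A: "A \<in> Ob Nec"
  note F = Psi_ar[OF nmaps_id[OF A]]
  have [simp]: "Ident Delta n i = i" if "i \<le> n" for n i using that by (simp add: Delta_simps(3))
  have "DA D (restr A i j) (restr A i j) (Ident Delta (j - i)) = idt (fob D (restr A i j))"
    if "i \<le> j" for i j
    using DA_id[OF D, of "restr A i j"] that by simp
  then show ?thesis
    by (intro Psi_wfun_eqI[OF D _ F(1)]) (auto simp: F(2,3) is_wfunctor_id homW_id_wfun seg_id)
qed

lemma Phi_ar_Psi:
  assumes f: "f \<in> Hom Delta m n"
  shows "Phi_ar W z D m n f = (Psi_ar D (simplex m) (simplex n) f :: ('u pt, 'a) wfun)"
proof -
  have le: "f i \<le> n" if "i \<le> m" for i using f that by auto
  have mono: "f i \<le> f j" if "i \<le> j" "j \<le> m" for i j using f that by (auto simp: monotone_on_def)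
  show ?thesis
    unfolding Phi_ar_def Psi_ar_def mk_wfun_def Let_def
    using le mono by (auto simp: fun_eq_iff DA_def restr_simplex seg_def Phi_Hom_def
      intro!: arg_cong[where f = "far D _ _"])
qed

end

text \<open>These are the simplicial maps from A to the nerve of C along \<open>Phi(D)\<close>,
  written out on the simplices of A.\<close>

definition simplex_family ::
  "(necklace, nat \<Rightarrow> nat, 'o, 'a) mftor \<Rightarrow> necklace \<Rightarrow> ('u pt, 'o, 'a) wcat \<Rightarrow> (nat \<Rightarrow> (nat \<Rightarrow> nat) \<Rightarrow>
    ('u pt, 'a) wfun) \<Rightarrow> bool" where
  "simplex_family D A C y \<longleftrightarrow>
     (\<forall>n. \<forall>g\<in>nmaps (simplex n) A. is_wfunctor W (Psi W z D (simplex n)) C (y n g) \<and>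
       (\<forall>m. \<forall>h\<in>Hom Delta m n. y m (compose {..m} g h) =
         comp_wfun W (Psi W z D (simplex m)) (Psi W z D (simplex n)) C (y n g) (Psi_ar D (simplex m)
           (simplex n) h)))"

context
  fixes D :: "(necklace, nat \<Rightarrow> nat, 'o, 'a) mftor" and A :: necklace and C :: "('u pt, 'o, 'a) wcat"
    and y :: "nat \<Rightarrow> (nat \<Rightarrow> nat) \<Rightarrow> ('u pt, 'a) wfun"
  assumes D: "strong_monoidal Nec W D" and A: "A \<in> Ob Nec" and C: "is_wcat W C"
    and y: "simplex_family D A C y"
begin

lemmas [simp] = D_Ob[OF D] ar_DA[OF D] mu_iso[OF D] ep_iso[OF D] DA_id[OF D] restr_wedge_sub'[OF D]
  is_wcat_Psi[OF D]

abbreviation PsiD where "PsiD \<equiv> Psi W z D :: necklace \<Rightarrow> ('u pt, 'o, 'a) wcat"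

lemma family_wfun: "g \<in> nmaps (simplex n) A \<Longrightarrow> is_wfunctor W (PsiD (simplex n)) C (y n g)"
  using y unfolding simplex_family_def by blast

lemma family_compat: "\<lbrakk>g \<in> nmaps (simplex n) A; h \<in> Hom Delta m n\<rbrakk> \<Longrightarrow> y m (compose {..m} g h) =
    comp_wfun W (PsiD (simplex m)) (PsiD (simplex n)) C (y n g) (Psi_ar D (simplex m)
      (simplex n) h)"
  using y unfolding simplex_family_def by blast

lemma family_wfO: "\<lbrakk>g \<in> nmaps (simplex n) A; h \<in> Hom Delta m n; i \<le> m\<rbrakk> \<Longrightarrow>
    wfO (y m (compose {..m} g h)) (Inl i) = wfO (y n g) (Inl (h i))"
  using Psi_ar(2)[OF D, of h "simplex m" "simplex n" i, where 'u = 'u]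
    by (simp add: family_compat nmaps_simplices)

lemma family_homW:
  assumes g: "g \<in> nmaps (simplex n) A" and h: "h \<in> Hom Delta m n" and ij: "i \<le> j" "j \<le> m"
  shows "homW (PsiD (simplex m)) C (y m (compose {..m} g h)) (Inl i) (Inl j) =
    homW (PsiD (simplex n)) C (y n g) (Inl (h i)) (Inl (h j)) \<cdot>
      DA D (simplex (j - i)) (simplex (h j - h i)) (seg h i j)"
proof -
  have h': "h \<in> nmaps (simplex m) (simplex n)" using h by (simp add: nmaps_simplices)
  have le: "h i \<le> h j" "h j \<le> n" using h ij by (auto simp: monotone_on_def)
  show ?thesis
    using ij le Psi_ar(2)[OF D h', of i, where 'u = 'u] Psi_ar(2)[OF D h', of j, where 'u = 'u]
      Psi_ar(3)[OF D h', of i j, where 'u = 'u]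
    by (simp add: family_compat[OF g h] homW_comp_wfun restr_simplex)
qed

text \<open>\<open>fam_e i j\<close> is meaningful only if no joint lies strictly between \<open>i\<close> and \<open>j\<close>.\<close>

abbreviation "fam_v i \<equiv> wfO (y 0 (shift 0 i)) (Inl 0)"
abbreviation "fam_e i j \<equiv> homW (PsiD (simplex (j - i))) C (y (j - i) (shift (j - i) i)) (Inl 0)
  (Inl (j - i))"

lemma fam_v:
  assumes g: "g \<in> nmaps (simplex n) A" and "a \<le> n"
  shows "wfO (y n g) (Inl a) = fam_v (g a)"
proof -
  have "compose {..0} g (shift 0 a) = shift 0 (g a)" using assms
    by (auto simp: compose_def shift_def fun_eq_iff)
  then show ?thesis using family_wfO[OF g shift_Hom[of 0 a n], of 0] assms by (simp add: shift_def)
qed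

text \<open>By \<open>compose_shift\<close> the restriction of g to the stretch from a to b factors
  through a stretch inclusion into a bead, so a compatible family is determined by its values on
  such inclusions.\<close>

lemma fam_e:
  assumes g: "g \<in> nmaps (simplex n) A" and ab: "a \<le> b" "b \<le> n"
  shows "homW (PsiD (simplex n)) C (y n g) (Inl a) (Inl b) =
    fam_e (g a) (g b) \<cdot> DA D (simplex (b - a)) (simplex (g b - g a)) (seg g a b)"
proof -
  have h: "shift (b - a) a \<in> Hom Delta (b - a) n" using ab shift_Hom by simp
  have g': "g \<in> Hom Delta n (snd A)" "bead A (g 0) (g n)" using g by (auto simp: nmaps_simplex)
  have le: "g a \<le> g b" "g b \<le> snd A" "g 0 \<le> g a" "g b \<le> g n"
    using nmapsD(2,3)[OF g] ab by auto
  have s: "shift (g b - g a) (g a) \<in> nmaps (simplex (g b - g a)) A"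
    using le by (intro bead_shift A bead_sub[OF g'(2)])
  have sg: "seg g a b \<in> Hom Delta (b - a) (g b - g a)" using seg_Delta[OF g'(1)] ab by simp
  have "homW (PsiD (simplex n)) C (y n g) (Inl a) (Inl b) =
    homW (PsiD (simplex (b - a))) C (y (b - a) (compose {..b - a} g (shift (b - a) a))) (Inl 0)
      (Inl (b - a))"
    using family_homW[OF g h, of 0 "b - a"] ab DA_id[OF D, of "simplex (b - a)"]
      ar_homW[OF family_wfun[OF g], of "Inl a" "Inl b"] C
    by (simp add: seg_shift restr_simplex)
  also have "compose {..b - a} g (shift (b - a) a) =
    compose {..b - a} (shift (g b - g a) (g a)) (seg g a b)"
    using compose_shift[OF g'(1)] ab by simp
  also have "homW (PsiD (simplex (b - a))) C (y (b - a) (compose {..b - a} (shift (g b - g a) (g a))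
    (seg g a b))) (Inl 0) (Inl (b - a)) =
     fam_e (g a) (g b) \<cdot> DA D (simplex (b - a)) (simplex (g b - g a)) (seg g a b)"
    using family_homW[OF s sg, of 0 "b - a"] ab seg_0[OF sg] by (simp add: seg_def)
  finally show ?thesis .
qed

text \<open>The values on vertices and on stretches inside beads form data as in
  \<open>bead_extension_ex\<close>; by \<open>fam_v\<close> and \<open>fam_e\<close> the glued
  functor then restricts to y on every simplex.\<close>

theorem simplex_family_extension:
  obtains F where "is_wfunctor W (PsiD A) C F"
    and "\<And>n g. g \<in> nmaps (simplex n) A \<Longrightarrow> comp_wfun W (PsiD (simplex n)) (PsiD A) C F
      (Psi_ar D (simplex n) A g) = y n g"
proof -
  have pt: "shift 0 i \<in> nmaps (simplex 0) A" if "i \<le> snd A" for i using nmaps_point[OF A that] .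
  have v: "fam_v i \<in> wOb C" if "i \<le> snd A" for i
    using wfO_Ob[OF family_wfun[OF pt[OF that]]] by simp
  have sh: "shift (j - i) i \<in> nmaps (simplex (j - i)) A" if "i \<le> j" "j \<le> snd A" "bead A i j" for i j
    using bead_shift[OF A that(3,1,2)] .
  have sv: "wfO (y (j - i) (shift (j - i) i)) (Inl a) = fam_v (a + i)"
    if "i \<le> j" "j \<le> snd A" "bead A i j" "a \<le> j - i" for i j a
    using fam_v[OF sh[OF that(1-3)] that(4)] that(4) by (simp add: shift_def)
  have se: "homW (PsiD (simplex (j - i))) C (y (j - i) (shift (j - i) i)) (Inl a) (Inl b) =
    fam_e (a + i) (b + i)"
    if "i \<le> j" "j \<le> snd A" "bead A i j" "a \<le> b" "b \<le> j - i" for i j a b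
  proof -
    have s: "shift (b - a) (a + i) \<in> nmaps (simplex (b - a)) A"
      using that sh[of "a + i" "b + i"] bead_sub[OF that(3), of "a + i" "b + i"] by simp
    have "ar (fam_e (a + i) (b + i))"
      using that ar_homW[OF family_wfun[OF s], of "Inl 0" "Inl (b - a)"] C by simp
    then show ?thesis
      using fam_e[OF sh[OF that(1-3)] that(4,5)] that DA_id[OF D, of "simplex (b - a)"]
      by (simp add: seg_shift restr_simplex)
  qed
  have e1: "ar (fam_e i j)" if "i \<le> j" "j \<le> snd A" "bead A i j" for i j
    using ar_homW[OF family_wfun[OF sh[OF that]], of "Inl 0" "Inl (j - i)"] C by simp
  have e2: "dm (fam_e i j) = fob D (restr A i j)" if "i \<le> j" "j \<le> snd A" "bead A i j" for i j
    using that by (simp add: restr_bead restr_simplex)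
  have e3: "cd (fam_e i j) = wHom C (fam_v i) (fam_v j)" if "i \<le> j" "j \<le> snd A" "bead A i j" for i j
    using sv[OF that, of 0] sv[OF that, of "j - i"] that by simp
  have comp: "fam_e i j \<cdot> cmpW (PsiD A) (Inl i) (Inl k) (Inl j) =
    cmpW C (fam_v i) (fam_v k) (fam_v j) \<cdot> (fam_e i k \<otimes> fam_e k j)"
    if "i \<le> k" "k \<le> j" "j \<le> snd A" "bead A i j" for i k j
  proof -
    have ij: "i \<le> j" using that by simp
    note F = family_wfun[OF sh[OF ij that(3,4)]]
    have b: "bead A i k" "bead A k j" using bead_sub[OF that(4)] that by auto
    \<comment> \<open>Inside a bead the composition at A is that of a simplex, so compatibility is
      inherited from the enriched functor that y assigns to this simplex.\<close>
    have "cmpW (PsiD A) (Inl i) (Inl k) (Inl j) =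
      cmpW (PsiD (simplex (j - i))) (Inl 0) (Inl (k - i)) (Inl (j - i))"
      using that b ij by (simp add: Psi_cmpW[OF D] restr_bead restr_simplex)
    then show ?thesis
      using homW_cmpW[OF F, of "Inl 0" "Inl (k - i)" "Inl (j - i)"] that ij
        sv[OF ij that(3,4), of 0] sv[OF ij that(3,4), of "k - i"] sv[OF ij that(3,4), of "j - i"]
        se[OF ij that(3,4), of 0 "k - i"] se[OF ij that(3,4), of "k - i" "j - i"]
      by simp
  qed
  have unit: "fam_e i i \<cdot> ep D = idW C (fam_v i)" if "i \<le> snd A" for i
    using homW_idW[OF family_wfun[OF pt[OF that]], of "Inl 0"] by (simp add: Psi_idW[OF D])
  obtain F where F: "is_wfunctor W (PsiD A) C F" and o: "\<And>i. i \<le> snd A \<Longrightarrow> wfO F (Inl i) = fam_v i"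
    and h: "\<And>i j. \<lbrakk>i \<le> j; j \<le> snd A; bead A i j\<rbrakk> \<Longrightarrow> homW (PsiD A) C F (Inl i) (Inl j) = fam_e i j"
    by (rule bead_extension_ex[OF D C, where A = A and vx = fam_v
      and x = fam_e, OF v e1 e2 e3 comp unit]) auto
  show thesis
  proof (rule that[OF F])
    fix n g assume g: "g \<in> nmaps (simplex n) A"
    note G = Psi_ar[OF D g, where 'u = 'u]
    have b: "bead A (g 0) (g n)" using g by (simp add: nmaps_simplex)
    show "comp_wfun W (PsiD (simplex n)) (PsiD A) C F (Psi_ar D (simplex n) A g) = y n g"
    proof (rule Psi_wfun_eqI[OF D C is_wfunctor_comp[OF _ _ C G(1) F] family_wfun[OF g]])
      show "wfO (comp_wfun W (PsiD (simplex n)) (PsiD A) C F (Psi_ar D (simplex n) A g)) (Inl i) =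
        wfO (y n g) (Inl i)"
        if "i \<le> snd (simplex n)" for i
        using that nmapsD(2)[OF g, of i] by (simp add: G o fam_v[OF g])
      show "homW (PsiD (simplex n)) C (comp_wfun W (PsiD (simplex n)) (PsiD A) C F
        (Psi_ar D (simplex n) A g)) (Inl i) (Inl j) =
         homW (PsiD (simplex n)) C (y n g) (Inl i) (Inl j)" if "i \<le> j" "j \<le> snd (simplex n)" for i j
      proof -
        have le: "g i \<le> g j" "g j \<le> snd A" "g 0 \<le> g i" "g j \<le> g n" using nmapsD(2,3)[OF g] that
          by auto
        have bb: "bead A (g i) (g j)" using bead_sub[OF b] le by simp
        show ?thesis
          using that le bb by (simp add: homW_comp_wfun G h fam_e[OF g] restr_simplex restr_bead)
      qed
    qed simp_all
  qed
qed

end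

text \<open>The vertices and the stretches inside beads are among the simplices of A, and by
  \<open>bead_extension_unique\<close> they detect equality.\<close>

theorem simplex_family_unique:
  fixes C :: "('u pt, 'o, 'a) wcat"
  assumes D: "strong_monoidal Nec W D" and A: "A \<in> Ob Nec" and C: "is_wcat W C"
    and F: "is_wfunctor W (Psi W z D A) C F" and G: "is_wfunctor W (Psi W z D A) C G"
    and eq: "\<And>n g. g \<in> nmaps (simplex n) A \<Longrightarrow>
      comp_wfun W (Psi W z D (simplex n)) (Psi W z D A) C F (Psi_ar D (simplex n) A g) =
      comp_wfun W (Psi W z D (simplex n)) (Psi W z D A) C G (Psi_ar D (simplex n) A g)"
  shows "F = G"
proof (rule bead_extension_unique[OF D C F G])
  let ?P = "Psi W z D :: necklace \<Rightarrow> ('u pt, 'o, 'a) wcat"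
  note [simp] = is_wcat_Psi[OF D]
  show o: "wfO F (Inl i) = wfO G (Inl i)" if "i \<le> snd A" for i
  proof -
    note g = nmaps_point[OF A that]
    have "wfO (comp_wfun W (?P (simplex 0)) (?P A) C F (Psi_ar D (simplex 0) A (shift 0 i)))
      (Inl 0) =
      wfO (comp_wfun W (?P (simplex 0)) (?P A) C G (Psi_ar D (simplex 0) A (shift 0 i))) (Inl 0)"
      by (simp only: eq[OF g])
    then show ?thesis using Psi_ar(2)[OF D g, of 0, where 'u = 'u] by (simp add: shift_def)
  qed
  show "homW (?P A) C F (Inl i) (Inl j) = homW (?P A) C G (Inl i) (Inl j)"
    if "i \<le> j" "j \<le> snd A" "bead A i j" for i j
  proof -
    note g = bead_shift[OF A that(3,1,2)]
    have "homW (?P (simplex (j - i))) C (comp_wfun W (?P (simplex (j - i))) (?P A) C F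
      (Psi_ar D (simplex (j - i)) A (shift (j - i) i))) (Inl 0) (Inl (j - i)) =
      homW (?P (simplex (j - i))) C (comp_wfun W (?P (simplex (j - i))) (?P A) C G
        (Psi_ar D (simplex (j - i)) A (shift (j - i) i))) (Inl 0) (Inl (j - i))"
      by (simp only: eq[OF g])
    then show ?thesis
      using Psi_ar(2)[OF D g, of 0, where 'u = 'u] Psi_ar(2)[OF D g, of "j - i", where 'u = 'u]
        Psi_ar(3)[OF D g, of 0 "j - i", where 'u = 'u] that DA_id[OF D, of "simplex (j - i)"]
        ar_homW[OF F _ C, of "Inl i" "Inl j"] ar_homW[OF G _ C, of "Inl i" "Inl j"]
      by (simp add: homW_comp_wfun seg_shift restr_simplex restr_bead)
  qed
qed

end

section \<open>Full faithfulness of \<open>\<Phi>\<close>\<close>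

text \<open>The typical map of \<open>nmaps\<close> that moves the basepoints. Naturality along it
  compares a sub-necklace with the whole necklace.\<close>

lemma nmaps_restr:
  assumes "A \<in> Ob Nec" "i \<le> j" "j \<le> snd A"
  shows "shift (j - i) i \<in> nmaps (restr A i j) A"
proof -
  have "u \<in> shift (j - i) i ` fst (restr A i j)" if "u \<in> fst A" "i \<le> u" "u \<le> j" for u
    using that assms by (intro image_eqI[of _ _ "u - i"]) (auto simp: restr_def)
  then show ?thesis
    using assms shift_Hom[of "j - i" i "snd A"] by (simp add: nmaps_def)
qed

context monoidal_initial
begin

definition nt :: "(necklace, nat \<Rightarrow> nat, 'o, 'a) mftor \<Rightarrow> (necklace, nat \<Rightarrow> nat, 'o, 'a) mftor \<Rightarrow>
  (necklace \<Rightarrow> 'a) \<Rightarrow>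
    necklace \<Rightarrow> 'o \<times> 'a \<times> 'o" where
  "nt D E t A = (fob D A, t A, fob E A)"

lemma nt_simps [simp]: "dm (nt D E t A) = fob D A" "cd (nt D E t A) = fob E A"
  by (simp_all add: nt_def)

definition Psi_nat ::
  "(necklace, nat \<Rightarrow> nat, 'o, 'a) mftor \<Rightarrow> (necklace, nat \<Rightarrow> nat, 'o, 'a) mftor \<Rightarrow> (necklace \<Rightarrow> 'a) \<Rightarrow>
    necklace \<Rightarrow> ('u pt, 'a) wfun" where
  "Psi_nat D E t A = mk_wfun W z (Psi W z E A) (snd A) Inl (\<lambda>i j. nt D E t (restr A i j))"

text \<open>Reconciles the identity of z, which \<open>Phi_nat\<close> prescribes on backward
  hom-objects, with the unique arrow supplied by \<open>mk_wfun\<close>.\<close>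

lemma the_arr_z: "the_arr W z z = Ident W z"
  using z initial_the_arr[OF z z_Ob] category_Ident[OF catW z_Ob] unfolding initial_def by blast

lemma Phi_nat_Psi: "Phi_nat W z t n = Psi_nat D E t (simplex n)"
  by (auto simp: Phi_nat_def Psi_nat_def mk_wfun_def Let_def nt_def restr_simplex fun_eq_iff
    the_arr_z)

context
  fixes D E :: "(necklace, nat \<Rightarrow> nat, 'o, 'a) mftor"
  assumes D: "strong_monoidal Nec W D" and E: "strong_monoidal Nec W E"
begin

lemmas [simp] = D_Ob[OF D] ar_DA[OF D] mu_iso[OF D] ep_iso[OF D] DA_id[OF D] restr_wedge_sub'[OF D]
  is_wcat_Psi[OF D]
  D_Ob[OF E] ar_DA[OF E] mu_iso[OF E] ep_iso[OF E] DA_id[OF E] restr_wedge_sub'[OF E] is_wcat_Psi[OF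
    E]

lemma monoidal_nat_transI:
  assumes ext: "t \<in> extensional (Ob Nec)" and ar: "\<And>A. A \<in> Ob Nec \<Longrightarrow> ar (nt D E t A)"
    and nat: "\<And>A B f. \<lbrakk>A \<in> Ob Nec; B \<in> Ob Nec; f \<in> Hom Nec A B\<rbrakk> \<Longrightarrow> nt D E t B \<cdot> DA D A B f =
      DA E A B f \<cdot> nt D E t A"
    and mon: "\<And>A B. \<lbrakk>A \<in> Ob Nec; B \<in> Ob Nec\<rbrakk> \<Longrightarrow> nt D E t (wedge A B) \<cdot> mu D A B = mu E A B \<cdot>
      (nt D E t A \<otimes> nt D E t B)"
    and unit: "nt D E t (simplex 0) \<cdot> ep D = ep E"
  shows "monoidal_nat_trans Nec W D E t"
  unfolding monoidal_nat_trans_def nat_trans_def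
  using assms by (auto simp: nt_def ar_triple cmp_def tns_def DA_def mu_def ep_def)

context
  fixes t
  assumes t: "monoidal_nat_trans Nec W D E t"
begin

lemma nt_natural_trans: "nat_trans Nec W D E t"
  using t unfolding monoidal_nat_trans_def by blast

lemma ar_nt [simp]: "A \<in> Ob Nec \<Longrightarrow> ar (nt D E t A)"
  using nat_transD(2)[OF nt_natural_trans, of A] by (simp add: nt_def ar_triple)

lemma nt_natural: "\<lbrakk>A \<in> Ob Nec; B \<in> Ob Nec; f \<in> Hom Nec A B\<rbrakk> \<Longrightarrow> nt D E t B \<cdot> DA D A B f =
  DA E A B f \<cdot> nt D E t A"
  using nat_transD(3)[OF nt_natural_trans, of A B f] by (simp add: nt_def cmp_def DA_def)

lemma nt_mu: "\<lbrakk>A \<in> Ob Nec; B \<in> Ob Nec\<rbrakk> \<Longrightarrow> nt D E t (wedge A B) \<cdot> mu D A B = mu E A B \<cdot>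
  (nt D E t A \<otimes> nt D E t B)"
  using t unfolding monoidal_nat_trans_def by (auto simp: nt_def cmp_def tns_def mu_def)

lemma nt_ep: "nt D E t (simplex 0) \<cdot> ep D = ep E"
  using t unfolding monoidal_nat_trans_def by (auto simp: nt_def cmp_def ep_def)

text \<open>The composition of \<open>Psi\<close> is \<open>mu\<close> followed by D of a vertex
  identity. Monoidality of t commutes it with the former, naturality with the latter.\<close>

lemma Psi_nat:
  shows "is_wfunctor W (Psi W z D A) (Psi W z E A) (Psi_nat D E t A :: ('u pt, 'a) wfun)"
    and "i \<le> snd A \<Longrightarrow> wfO (Psi_nat D E t A :: ('u pt, 'a) wfun) (Inl i) = Inl i"
    and "\<lbrakk>i \<le> j; j \<le> snd A\<rbrakk> \<Longrightarrow>
      homW (Psi W z D A) (Psi W z E A) (Psi_nat D E t A :: ('u pt, 'a) wfun) (Inl i) (Inl j) =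
        nt D E t (restr A i j)"
proof -
  let ?P = "Psi W z D A :: ('u pt, 'o, 'a) wcat" and ?Q = "Psi W z E A :: ('u pt, 'o, 'a) wcat"
  have comp: "nt D E t (restr A i j) \<cdot> cmpW ?P (Inl i) (Inl k) (Inl j) =
    cmpW ?Q (Inl i) (Inl k) (Inl j) \<cdot> (nt D E t (restr A i k) \<otimes> nt D E t (restr A k j))"
    if "i \<le> k" "k \<le> j" "j \<le> snd A" for i k j
  proof -
    let ?A = "restr A i k" and ?B = "restr A k j"
    have "nt D E t (restr A i j) \<cdot> cmpW ?P (Inl i) (Inl k) (Inl j) =
      (nt D E t (restr A i j) \<cdot> DA D (wedge ?A ?B) (restr A i j) (Ident Delta (j - i))) \<cdot>
        mu D ?A ?B"
      using that by (simp add: Psi_cmpW[OF D])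
    also have "\<dots> = (DA E (wedge ?A ?B) (restr A i j) (Ident Delta (j - i)) \<cdot>
      nt D E t (wedge ?A ?B)) \<cdot> mu D ?A ?B"
      using that restr_wedge_sub[of i k j A] by (subst nt_natural) simp_all
    also have "\<dots> = DA E (wedge ?A ?B) (restr A i j) (Ident Delta (j - i)) \<cdot>
      (nt D E t (wedge ?A ?B) \<cdot> mu D ?A ?B)"
      using that by simp
    also have "\<dots> = DA E (wedge ?A ?B) (restr A i j) (Ident Delta (j - i)) \<cdot>
      (mu E ?A ?B \<cdot> (nt D E t ?A \<otimes> nt D E t ?B))"
      using that by (simp add: nt_mu)
    finally show ?thesis using that by (simp add: Psi_cmpW[OF E])
  qed
  have vx: "Inl i \<in> wOb ?Q" if "i \<le> snd A" for i using that by simp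
  have ar: "ar (nt D E t (restr A i j))" if "i \<le> j" "j \<le> snd A" for i j using that by simp
  have cd: "cd (nt D E t (restr A i j)) = wHom ?Q (Inl i) (Inl j)" if "i \<le> j" "j \<le> snd A" for i j
    using that by simp
  have unit: "nt D E t (restr A i i) \<cdot> ep D = idW ?Q (Inl i)" if "i \<le> snd A" for i
    using that by (simp add: restr_point nt_ep Psi_idW[OF E])
  note mk = mk_wfun[OF D is_wcat_Psi[OF E, of A], where A = A and vx = Inl and t = "\<lambda>i j.
    nt D E t (restr A i j)",
      OF vx ar _ cd comp unit, folded Psi_nat_def]
  show "is_wfunctor W ?P ?Q (Psi_nat D E t A)" by (rule mk) simp_all
  show "i \<le> snd A \<Longrightarrow> wfO (Psi_nat D E t A :: ('u pt, 'a) wfun) (Inl i) = Inl i" by (rule mk) simp_all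
  show "\<lbrakk>i \<le> j; j \<le> snd A\<rbrakk> \<Longrightarrow> homW ?P ?Q (Psi_nat D E t A) (Inl i) (Inl j) = nt D E t (restr A i j)"
    by (rule mk) simp_all
qed

lemma Psi_nat_natural:
  assumes f: "f \<in> nmaps A B"
  shows "comp_wfun W (Psi W z D A) (Psi W z D B) (Psi W z E B) (Psi_nat D E t B) (Psi_ar D A B f) =
    (comp_wfun W (Psi W z D A) (Psi W z E A) (Psi W z E B) (Psi_ar E A B f)
      (Psi_nat D E t A) :: ('u pt, 'a) wfun)"
proof -
  note F = Psi_ar[OF D f] and G = Psi_ar[OF E f]
  have le: "f i \<le> f j" "f j \<le> snd B" if "i \<le> j" "j \<le> snd A" for i j
    using nmapsD(2,3)[OF f] that by auto
  have le': "f i \<le> snd B" if "i \<le> snd A" for i using nmapsD(2)[OF f that] .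
  show ?thesis
  proof (rule Psi_wfun_eqI[OF D])
    show "homW (Psi W z D A) (Psi W z E B) (comp_wfun W (Psi W z D A) (Psi W z D B) (Psi W z E B)
      (Psi_nat D E t B) (Psi_ar D A B f)) (Inl i) (Inl j) =
       homW (Psi W z D A) (Psi W z E B) (comp_wfun W (Psi W z D A) (Psi W z E A) (Psi W z E B)
         (Psi_ar E A B f) (Psi_nat D E t A)) (Inl i) (Inl j :: 'u pt)"
      if "i \<le> j" "j \<le> snd A" for i j
      using that le[OF that] seg_Hom[OF f that]
        by (simp add: homW_comp_wfun F(2,3) G(3) Psi_nat(2,3) nt_natural)
  qed (use le' in \<open>auto intro!: is_wfunctor_comp F G Psi_nat(1) simp: F(2) G(2) Psi_nat(2)\<close>)
qed

end

text \<open>The component at A is the action of \<open>Psi_nat\<close> between the endpoints of A,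
  and an enriched functor out of \<open>Psi\<close> is determined by its restrictions to
  simplices.\<close>

lemma Phi_nat_inject:
  assumes t: "monoidal_nat_trans Nec W D E t" and t': "monoidal_nat_trans Nec W D E t'"
    and eq: "\<And>n. Phi_nat W z t n = (Phi_nat W z t' n :: ('u pt, 'a) wfun)"
  shows "t = t'"
proof
  fix A
  show "t A = t' A"
  proof (cases "A \<in> Ob Nec")
    case True
    have eq': "Psi_nat D E t (simplex n) = (Psi_nat D E t' (simplex n) :: ('u pt, 'a) wfun)" for n
      using eq[of n] by (simp add: Phi_nat_Psi[of _ _ D E])
    have "Psi_nat D E t A = (Psi_nat D E t' A :: ('u pt, 'a) wfun)"
      by (rule simplex_family_unique[OF D True _ Psi_nat(1)[OF t] Psi_nat(1)[OF t']])
        (simp_all add: Psi_nat_natural[OF t] Psi_nat_natural[OF t'] eq')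
    then have "nt D E t (restr A 0 (snd A)) = nt D E t' (restr A 0 (snd A))"
      using Psi_nat(3)[OF t, of 0 "snd A" A, where 'u = 'u] Psi_nat(3)[OF t', of 0 "snd A" A, where
        'u = 'u] by simp
    then show ?thesis using restr_full[OF True] by (simp add: nt_def)
  next
    case False
    then show ?thesis
      using nat_transD(1)[OF nt_natural_trans[OF t]] nat_transD(1)[OF nt_natural_trans[OF t']]
      by (metis extensional_arb)
  qed
qed

text \<open>
  Composing \<open>s\<close> with the simplices of a necklace \<open>A\<close> gives a simplicial map from \<open>A\<close> to the nerve of
  \<open>Psi W z E A\<close>, hence an enriched functor \<open>S A\<close> out of \<open>Psi W z D A\<close>.  Its action on the hom-object
  between the endpoints is the component at \<open>A\<close>; naturality comes from uniqueness.
\<close>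

lemma Phi_nat_surject:
  fixes s :: "nat \<Rightarrow> ('u pt, 'a) wfun"
  assumes s: "\<And>n. is_wfunctor W (Psi W z D (simplex n)) (Psi W z E (simplex n)) (s n)"
    and nat: "\<And>m n h. h \<in> Hom Delta m n \<Longrightarrow>
      comp_wfun W (Psi W z D (simplex m)) (Psi W z D (simplex n)) (Psi W z E (simplex n)) (s n)
        (Psi_ar D (simplex m) (simplex n) h) =
      comp_wfun W (Psi W z D (simplex m)) (Psi W z E (simplex m)) (Psi W z E (simplex n))
        (Psi_ar E (simplex m) (simplex n) h) (s m)"
  shows "\<exists>t. monoidal_nat_trans Nec W D E t \<and> (\<forall>n. Phi_nat W z t n = s n)"
proof -
  let ?P = "Psi W z D :: necklace \<Rightarrow> ('u pt, 'o, 'a) wcat" and ?Q = "Psi W z E :: necklace \<Rightarrow>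
    ('u pt, 'o, 'a) wcat"
  let ?y = "\<lambda>A n g. comp_wfun W (?P (simplex n)) (?Q (simplex n)) (?Q A) (Psi_ar E (simplex n) A g)
    (s n)"
  have fam: "simplex_family D A (?Q A) (?y A)" if A: "A \<in> Ob Nec" for A
    unfolding simplex_family_def
  proof (intro allI ballI conjI)
    fix n g assume g: "g \<in> nmaps (simplex n) A"
    note G = Psi_ar(1)[OF E g, where 'u = 'u]
    show "is_wfunctor W (?P (simplex n)) (?Q A) (?y A n g)"
      by (intro is_wfunctor_comp s G) simp_all
    fix m h assume h: "h \<in> Hom Delta m n"
    then have h': "h \<in> nmaps (simplex m) (simplex n)" by (simp add: nmaps_simplices)
    note H = Psi_ar(1)[OF E h', where 'u = 'u] and H' = Psi_ar(1)[OF D h', where 'u = 'u]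
    have "?y A m (compose {..m} g h) = comp_wfun W (?P (simplex m)) (?Q (simplex m)) (?Q A)
      (comp_wfun W (?Q (simplex m)) (?Q (simplex n)) (?Q A) (Psi_ar E (simplex n) A g)
        (Psi_ar E (simplex m) (simplex n) h)) (s m)"
      using Psi_ar_comp[OF E h' g, where 'u = 'u] by simp
    also have "\<dots> = comp_wfun W (?P (simplex m)) (?Q (simplex n)) (?Q A) (Psi_ar E (simplex n) A g)
      (comp_wfun W (?P (simplex m)) (?Q (simplex m)) (?Q (simplex n)) (Psi_ar E (simplex m)
        (simplex n) h) (s m))"
      by (rule comp_wfun_assoc[OF _ _ _ _ s H G]) simp_all
    also have "\<dots> = comp_wfun W (?P (simplex m)) (?P (simplex n)) (?Q A) (?y A n g)
      (Psi_ar D (simplex m) (simplex n) h)"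
      unfolding nat[OF h, symmetric] by (rule comp_wfun_assoc[OF _ _ _ _ H' s G, symmetric])
        simp_all
    finally show "?y A m (compose {..m} g h) =
      comp_wfun W (?P (simplex m)) (?P (simplex n)) (?Q A) (?y A n g) (Psi_ar D (simplex m)
        (simplex n) h)" .
  qed
  have "\<exists>F. is_wfunctor W (?P A) (?Q A) F \<and>
    (\<forall>n. \<forall>g\<in>nmaps (simplex n) A. comp_wfun W (?P (simplex n)) (?P A) (?Q A) F
      (Psi_ar D (simplex n) A g) = ?y A n g)"
    if A: "A \<in> Ob Nec" for A
    by (rule simplex_family_extension[OF D A is_wcat_Psi[OF E] fam[OF A]]) blast
  then obtain S where S: "\<And>A. A \<in> Ob Nec \<Longrightarrow> is_wfunctor W (?P A) (?Q A) (S A)"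
    and Sy: "\<And>A n g. \<lbrakk>A \<in> Ob Nec; g \<in> nmaps (simplex n) A\<rbrakk> \<Longrightarrow>
      comp_wfun W (?P (simplex n)) (?P A) (?Q A) (S A) (Psi_ar D (simplex n) A g) = ?y A n g"
    by metis
  \<comment> \<open>Stated for all of \<open>nmaps\<close>, since vertices and sub-necklaces are in
    general reached only by maps that move the basepoints.\<close>
  have Snat: "comp_wfun W (?P A) (?P B) (?Q B) (S B) (Psi_ar D A B f) =
    comp_wfun W (?P A) (?Q A) (?Q B) (Psi_ar E A B f) (S A)"
    if A: "A \<in> Ob Nec" and B: "B \<in> Ob Nec" and f: "f \<in> nmaps A B" for A B f
  proof (rule simplex_family_unique[OF D A is_wcat_Psi[OF E]])
    note F = Psi_ar(1)[OF D f, where 'u = 'u] and F' = Psi_ar(1)[OF E f, where 'u = 'u]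
    show "is_wfunctor W (?P A) (?Q B) (comp_wfun W (?P A) (?P B) (?Q B) (S B) (Psi_ar D A B f))"
      "is_wfunctor W (?P A) (?Q B) (comp_wfun W (?P A) (?Q A) (?Q B) (Psi_ar E A B f) (S A))"
      by (intro is_wfunctor_comp F F' S A B; simp)+
    fix n g assume g: "g \<in> nmaps (simplex n) A"
    note G = Psi_ar(1)[OF D g, where 'u = 'u] and G' = Psi_ar(1)[OF E g, where 'u = 'u]
    have "comp_wfun W (?P (simplex n)) (?P A) (?Q B) (comp_wfun W (?P A) (?P B) (?Q B) (S B)
      (Psi_ar D A B f)) (Psi_ar D (simplex n) A g) =
      comp_wfun W (?P (simplex n)) (?P B) (?Q B) (S B) (comp_wfun W (?P (simplex n)) (?P A) (?P B)
        (Psi_ar D A B f) (Psi_ar D (simplex n) A g))"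
      by (rule comp_wfun_assoc[OF _ _ _ _ G F S[OF B]]) simp_all
    also have "\<dots> = ?y B n (compose {..n} f g)"
      using Psi_ar_comp[OF D g f, where 'u = 'u] Sy[OF B nmaps_comp[OF g f]] by simp
    also have "\<dots> = comp_wfun W (?P (simplex n)) (?Q (simplex n)) (?Q B)
      (comp_wfun W (?Q (simplex n)) (?Q A) (?Q B) (Psi_ar E A B f) (Psi_ar E (simplex n) A g))
        (s n)"
      using Psi_ar_comp[OF E g f, where 'u = 'u] by simp
    also have "\<dots> = comp_wfun W (?P (simplex n)) (?Q A) (?Q B) (Psi_ar E A B f) (?y A n g)"
      by (rule comp_wfun_assoc[OF _ _ _ _ s G' F']) simp_all
    also have "\<dots> = comp_wfun W (?P (simplex n)) (?P A) (?Q B) (comp_wfun W (?P A) (?Q A) (?Q B)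
      (Psi_ar E A B f) (S A)) (Psi_ar D (simplex n) A g)"
      unfolding Sy[OF A g, symmetric] by (rule comp_wfun_assoc[OF _ _ _ _ G S[OF A] F', symmetric])
        simp_all
    finally show "comp_wfun W (?P (simplex n)) (?P A) (?Q B) (comp_wfun W (?P A) (?P B) (?Q B) (S B)
      (Psi_ar D A B f)) (Psi_ar D (simplex n) A g) =
      comp_wfun W (?P (simplex n)) (?P A) (?Q B) (comp_wfun W (?P A) (?Q A) (?Q B) (Psi_ar E A B f)
        (S A)) (Psi_ar D (simplex n) A g)" .
  qed
  have So: "wfO (S A) (Inl i) = Inl i" if A: "A \<in> Ob Nec" and i: "i \<le> snd A" for A i
  proof -
    note f = nmaps_point[OF A i]
    \<comment> \<open>A point has a single object; naturality along the inclusion of a vertex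
      carries this over to A.\<close>
    have "wfO (S (simplex 0)) (Inl 0) = Inl 0"
      using wfO_Ob[OF S, of "simplex 0" "Inl 0"] by simp
    then show ?thesis
      using arg_cong[OF Snat[OF _ A f], of "\<lambda>F. wfO F (Inl 0)"]
        Psi_ar(2)[OF D f, of 0, where 'u = 'u] Psi_ar(2)[OF E f, of 0, where 'u = 'u] by simp
  qed
  have Sh: "homW (?P B) (?Q B) (S B) (Inl (f i)) (Inl (f j)) \<cdot>
    DA D (restr A i j) (restr B (f i) (f j)) (seg f i j) =
      DA E (restr A i j) (restr B (f i) (f j)) (seg f i j) \<cdot>
        homW (?P A) (?Q A) (S A) (Inl i) (Inl j)"
    if A: "A \<in> Ob Nec" and B: "B \<in> Ob Nec" and f: "f \<in> nmaps A B" and ij: "i \<le> j" "j \<le> snd A"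
      for A B f i j
    using arg_cong[OF Snat[OF A B f], of "\<lambda>F. homW (?P A) (?Q B) F (Inl i) (Inl j)"] ij So[OF A, of
      i] So[OF A, of j]
      Psi_ar(2)[OF D f, of i, where 'u = 'u] Psi_ar(2)[OF D f, of j, where 'u = 'u]
      Psi_ar(2)[OF E f, of i, where 'u = 'u] Psi_ar(2)[OF E f, of j, where 'u = 'u]
      Psi_ar(3)[OF D f ij, where 'u = 'u] Psi_ar(3)[OF E f ij, where 'u = 'u]
    by (simp add: homW_comp_wfun)
  define t where "t = (\<lambda>A\<in>Ob Nec. md (homW (?P A) (?Q A) (S A) (Inl 0) (Inl (snd A))))"
  have nt: "nt D E t A = homW (?P A) (?Q A) (S A) (Inl 0) (Inl (snd A))" if A: "A \<in> Ob Nec" for A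
    using A So[OF A, of 0] So[OF A, of "snd A"] restr_full[OF A]
      by (simp add: nt_def t_def homW_def)
  \<comment> \<open>Naturality along the inclusion of a sub-necklace turns the action on an inner
    hom-object into an action between endpoints, where t is read off.\<close>
  have Snt: "homW (?P A) (?Q A) (S A) (Inl i) (Inl j) = nt D E t (restr A i j)"
    if A: "A \<in> Ob Nec" and ij: "i \<le> j" "j \<le> snd A" for A i j
  proof -
    have R: "restr A i j \<in> Ob Nec" using ij by simp
    have id: "DA D (restr A i j) (restr A i j) (Ident Delta (j - i)) = idt (fob D (restr A i j))"
      "DA E (restr A i j) (restr A i j) (Ident Delta (j - i)) = idt (fob E (restr A i j))"
      using DA_id[OF D R] DA_id[OF E R] by simp_all
    show ?thesis
      using Sh[OF R A nmaps_restr[OF A ij], of 0 "j - i"] ij nt[OF R] restr_full[OF R] id So[OF A,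
        of i] So[OF A, of j]
        So[OF R, of 0] So[OF R, of "j - i"] ar_homW[OF S[OF A], of "Inl i" "Inl j"] ar_homW[OF S[OF
          R], of "Inl 0" "Inl (j - i)"]
      by (simp add: seg_shift)
  qed
  have mono: "monoidal_nat_trans Nec W D E t"
  proof (rule monoidal_nat_transI)
    show "t \<in> extensional (Ob Nec)" by (simp add: t_def)
    show "ar (nt D E t A)" if A: "A \<in> Ob Nec" for A
      using ar_homW[OF S[OF A], of "Inl 0" "Inl (snd A)"] by (simp add: nt[OF A])
    show "nt D E t B \<cdot> DA D A B f = DA E A B f \<cdot> nt D E t A" if A: "A \<in> Ob Nec" and B: "B \<in> Ob Nec"
      and f: "f \<in> Hom Nec A B" for A B f
      using Sh[OF A B, of f 0 "snd A"] f restr_full[OF A] restr_full[OF B] seg_full[OF f] nt[OF A]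
        nt[OF B]
      by (simp add: Hom_Nec_nmaps[OF A B])
    show "nt D E t (wedge A B) \<cdot> mu D A B = mu E A B \<cdot> (nt D E t A \<otimes> nt D E t B)" if A: "A \<in> Ob Nec"
      and B: "B \<in> Ob Nec" for A B
    proof -
      have AB: "wedge A B \<in> Ob Nec" using A B by simp
      have r: "restr (wedge A B) 0 (snd A) = A" "restr (wedge A B) (snd A) (snd A + snd B) = B"
        using restr_wedge_left[OF A B, of 0 "snd A"] restr_wedge_right[OF A B, of 0 "snd B"]
          restr_full[OF A] restr_full[OF B] by simp_all
      \<comment> \<open>The glued vertex is a joint, so the compositions there are the maps
        \<open>mu\<close> of D and E, and functoriality of S on the wedge becomes monoidality of
        t.\<close>
      have j: "snd A \<in> fst (wedge A B)" using A by (simp add: wedge_def Ob_Nec)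
      have c: "cmpW (?P (wedge A B)) (Inl 0) (Inl (snd A)) (Inl (snd A + snd B)) = mu D A B"
        "cmpW (?Q (wedge A B)) (Inl 0) (Inl (snd A)) (Inl (snd A + snd B)) = mu E A B"
        using Psi_cmpW_joint(1)[OF D j, of 0 "snd A + snd B", where 'b = 'u] Psi_cmpW_joint(1)[OF E
          j, of 0 "snd A + snd B", where 'b = 'u] r by simp_all
      show ?thesis
        using homW_cmpW[OF S[OF AB], of "Inl 0" "Inl (snd A)" "Inl (snd A + snd B)"] nt[OF AB]
          Snt[OF AB, of 0 "snd A"] Snt[OF AB, of "snd A" "snd A + snd B"]
          So[OF AB, of 0] So[OF AB, of "snd A"] So[OF AB, of "snd A + snd B"] r c
        by simp
    qed
    show "nt D E t (simplex 0) \<cdot> ep D = ep E"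
      using homW_idW[OF S[of "simplex 0"], of "Inl 0"] nt[of "simplex 0"] So[of "simplex 0" 0]
      by (simp add: Psi_idW[OF D] Psi_idW[OF E])
  qed
  have "Phi_nat W z t n = s n" for n
  proof -
    have idn: "Ident Delta n \<in> nmaps (simplex n) (simplex n)" using nmaps_id[of "simplex n"] by simp
    \<comment> \<open>The identity is itself a simplex of \<open>simplex n\<close>, so the defining
      property of S recovers s.\<close>
    have "S (simplex n) = s n"
      using Sy[OF _ idn] Psi_ar_id[OF D, of "simplex n", where 'u = 'u] Psi_ar_id[OF E, of
        "simplex n", where 'u = 'u]
        comp_wfun_id(1)[OF _ _ S[of "simplex n"]] comp_wfun_id(2)[OF _ _ s[of n]] by simp
    moreover have "Psi_nat D E t (simplex n) = S (simplex n)"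
      by (rule Psi_wfun_eqI[OF D _ Psi_nat(1)[OF mono] S]) (simp_all add: Psi_nat(2,3)[OF mono] So
        Snt)
    ultimately show ?thesis by (simp add: Phi_nat_Psi[of t n D E])
  qed
  with mono show ?thesis by blast
qed

end

section \<open>\<open>Phi\<close> as a functor into diagrams of enriched categories\<close>

lemma Phi_diagram_simps:
  assumes D: "strong_monoidal Nec W D"
  shows "fob (Phi_diagram W z D) n = Psi W z D (simplex n)"
    and "h \<in> Hom Delta m n \<Longrightarrow> far (Phi_diagram W z D) m n h = Psi_ar D (simplex m) (simplex n) h"
  unfolding Phi_diagram_def
  by (simp_all add: mk_ftor_simps Phi_ob_Psi Phi_ar_Psi[OF D] del: Delta_simps(2))

lemma StrMon_simps [simp]:
  "Ob (StrMon Nec W) = {F. strong_monoidal Nec W F}"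
  "Hom (StrMon Nec W) F G = {t. monoidal_nat_trans Nec W F G t}"
  "Ident (StrMon Nec W) F = (\<lambda>X\<in>Ob Nec. Ident W (fob F X))"
  "Comp (StrMon Nec W) F G H s t = (\<lambda>X\<in>Ob Nec. Comp W (fob F X) (fob G X) (fob H X) (s X) (t X))"
  by (simp_all add: StrMon_def)

lemma nt_id: "A \<in> Ob Nec \<Longrightarrow> nt D D (\<lambda>X\<in>Ob Nec. Ident W (fob D X)) A = idt (fob D A)"
  by (simp add: nt_def idt_def)

lemma nt_comp: "A \<in> Ob Nec \<Longrightarrow>
  nt D F (\<lambda>X\<in>Ob Nec. Comp W (fob D X) (fob E X) (fob F X) (s X) (t X)) A = nt E F s A \<cdot> nt D E t A"
  by (simp add: nt_def cmp_def)

lemma monoidal_nat_trans_id: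
  assumes D: "strong_monoidal Nec W D"
  shows "monoidal_nat_trans Nec W D D (\<lambda>X\<in>Ob Nec. Ident W (fob D X))"
  using D_Ob[OF D] ar_DA[OF D] mu_iso[OF D] ep_iso[OF D]
  by (intro monoidal_nat_transI[OF D D]) (simp_all add: nt_id)

lemma monoidal_nat_trans_comp:
  assumes D: "strong_monoidal Nec W D" and E: "strong_monoidal Nec W E"
    and F: "strong_monoidal Nec W F"
    and t: "monoidal_nat_trans Nec W D E t" and s: "monoidal_nat_trans Nec W E F s"
  shows "monoidal_nat_trans Nec W D F (\<lambda>X\<in>Ob Nec. Comp W (fob D X) (fob E X) (fob F X) (s X) (t X))"
proof (rule monoidal_nat_transI[OF D F])
  note [simp] = D_Ob[OF D] ar_DA[OF D] mu_iso[OF D] ep_iso[OF D] D_Ob[OF E] ar_DA[OF E] mu_iso[OF E]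
    ep_iso[OF E]
    D_Ob[OF F] ar_DA[OF F] mu_iso[OF F] ep_iso[OF F] ar_nt[OF D E t] ar_nt[OF E F s]
  let ?r = "\<lambda>X\<in>Ob Nec. Comp W (fob D X) (fob E X) (fob F X) (s X) (t X)"
  show "nt D F ?r B \<cdot> DA D A B f = DA F A B f \<cdot> nt D F ?r A" if A: "A \<in> Ob Nec" and B: "B \<in> Ob Nec"
    and f: "f \<in> Hom Nec A B" for A B f
  proof -
    have "nt D F ?r B \<cdot> DA D A B f = (nt E F s B \<cdot> DA E A B f) \<cdot> nt D E t A"
      using A B f by (simp add: nt_comp nt_natural[OF D E t])
    then show ?thesis using A B f by (simp add: nt_comp nt_natural[OF E F s])
  qed
  show "nt D F ?r (wedge A B) \<cdot> mu D A B = mu F A B \<cdot> (nt D F ?r A \<otimes> nt D F ?r B)"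
    if A: "A \<in> Ob Nec" and B: "B \<in> Ob Nec" for A B
  proof -
    have "nt D F ?r (wedge A B) \<cdot> mu D A B = (nt E F s (wedge A B) \<cdot> mu E A B) \<cdot>
      (nt D E t A \<otimes> nt D E t B)"
      using A B by (simp add: nt_comp nt_mu[OF D E t])
    then show ?thesis using A B by (simp add: nt_comp nt_mu[OF E F s] fuse)
  qed
qed (use ar_nt[OF D E t] ar_nt[OF E F s] ep_iso[OF D] in \<open>simp_all add: nt_comp nt_ep[OF D E t]
  nt_ep[OF E F s]\<close>)

lemma category_StrMon: "category (StrMon Nec W)"
proof -
  have tr: "nat_trans Nec W D E t" if "monoidal_nat_trans Nec W D E t" for D E t
    using that unfolding monoidal_nat_trans_def by blast
  show ?thesis
    unfolding category_def
  proof (intro conjI ballI)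
    fix D E t assume "D \<in> Ob (StrMon Nec W)" "E \<in> Ob (StrMon Nec W)" "t \<in> Hom (StrMon Nec W) D E"
    then have D: "strong_monoidal Nec W D" and E: "strong_monoidal Nec W E"
      and t: "nat_trans Nec W D E t" using tr by auto
    note r = D_Ob[OF D] D_Ob[OF E] nat_transD(2)[OF t]
    show "Comp (StrMon Nec W) D D E t (Ident (StrMon Nec W) D) = t"
      using nat_transD(1)[OF t] by (auto simp: fun_eq_iff r category_Comp_Ident[OF catW]
        extensional_def)
    show "Comp (StrMon Nec W) D E E (Ident (StrMon Nec W) E) t = t"
      using nat_transD(1)[OF t] by (auto simp: fun_eq_iff r category_Ident_Comp[OF catW]
        extensional_def)
  next
    fix D E F G t s r
    assume "D \<in> Ob (StrMon Nec W)" "E \<in> Ob (StrMon Nec W)" "F \<in> Ob (StrMon Nec W)"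
      "G \<in> Ob (StrMon Nec W)"
      "t \<in> Hom (StrMon Nec W) D E" "s \<in> Hom (StrMon Nec W) E F" "r \<in> Hom (StrMon Nec W) F G"
    then have h: "strong_monoidal Nec W D" "strong_monoidal Nec W E" "strong_monoidal Nec W F"
      "strong_monoidal Nec W G"
      "nat_trans Nec W D E t" "nat_trans Nec W E F s" "nat_trans Nec W F G r" using tr by auto
    then show "Comp (StrMon Nec W) D F G r (Comp (StrMon Nec W) D E F s t) =
       Comp (StrMon Nec W) D E G (Comp (StrMon Nec W) E F G r s) t"
      using h(1-4)[THEN D_Ob] h(5-7)[THEN nat_transD(2)]
      by (auto simp: fun_eq_iff category_assoc[OF catW])
  qed (auto intro: monoidal_nat_trans_id monoidal_nat_trans_comp)
qed

context
  fixes u :: "'u itself"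
  assumes finite_small: "\<And>X :: 'u pt set. finite X \<Longrightarrow> small u X"
begin

lemma is_functor_Phi_diagram:
  assumes D: "strong_monoidal Nec W D"
  shows "is_functor Delta (WCat u W) (Phi_diagram W z D)"
  unfolding Phi_diagram_def
proof (rule is_functor_mk_ftor[OF category_Delta category_WCat])
  note [simp] = is_wcat_Psi[OF D]
  show "Phi_ob W z D n \<in> Ob (WCat u W)" for n
    by (simp add: Phi_ob_Psi finite_small)
  show "Phi_ar W z D m n f \<in> Hom (WCat u W) (Phi_ob W z D m) (Phi_ob W z D n)"
    if "f \<in> Hom Delta m n" for m n f
    using Psi_ar(1)[OF D, of f "simplex m" "simplex n", where 'u = 'u] that
    by (simp add: Phi_ob_Psi Phi_ar_Psi[OF D] nmaps_simplices)
  show "Phi_ar W z D n n (Ident Delta n) = Ident (WCat u W) (Phi_ob W z D n)" for n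
    using Psi_ar_id[OF D, of "simplex n", where 'u = 'u] category_Ident[OF category_Delta, of n]
    by (simp add: Phi_ob_Psi Phi_ar_Psi[OF D] del: Delta_simps(2))
  show "Phi_ar W z D m p (Comp Delta m n p g f) =
    Comp (WCat u W) (Phi_ob W z D m) (Phi_ob W z D n) (Phi_ob W z D p) (Phi_ar W z D n p g)
      (Phi_ar W z D m n f)"
    if "f \<in> Hom Delta m n" "g \<in> Hom Delta n p" for m n p f g
    using Psi_ar_comp[OF D, of f "simplex m" "simplex n" g "simplex p", where 'u = 'u] that
      compose_Hom_Delta[OF that]
    by (simp add: Phi_ob_Psi Phi_ar_Psi[OF D] nmaps_simplices del: Delta_simps(2))
qed

lemma nat_trans_Phi_nat:
  assumes D: "strong_monoidal Nec W D" and E: "strong_monoidal Nec W E"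
    and t: "monoidal_nat_trans Nec W D E t"
  shows "nat_trans Delta (WCat u W) (Phi_diagram W z D) (Phi_diagram W z E) (Phi_nat W z t)"
  unfolding nat_trans_def
proof (intro conjI ballI)
  show "Phi_nat W z t n \<in> Hom (WCat u W) (fob (Phi_diagram W z D) n) (fob (Phi_diagram W z E) n)"
    for n
    using Psi_nat(1)[OF D E t, of "simplex n", where 'u = 'u]
    by (simp add: Phi_diagram_simps[OF D] Phi_diagram_simps[OF E] Phi_nat_Psi[of _ _ D E])
  show "Comp (WCat u W) (fob (Phi_diagram W z D) m) (fob (Phi_diagram W z D) n)
    (fob (Phi_diagram W z E) n)
       (Phi_nat W z t n) (far (Phi_diagram W z D) m n h) =
     Comp (WCat u W) (fob (Phi_diagram W z D) m) (fob (Phi_diagram W z E) m)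
       (fob (Phi_diagram W z E) n)
       (far (Phi_diagram W z E) m n h) (Phi_nat W z t m)" if "h \<in> Hom Delta m n" for m n h
    using Psi_nat_natural[OF D E t, of h "simplex m" "simplex n", where 'u = 'u] that
    by (simp add: Phi_diagram_simps[OF D] Phi_diagram_simps[OF E] Phi_nat_Psi[of _ _ D E]
      nmaps_simplices del: Delta_simps(2))
qed (simp add: extensional_def)

theorem fully_faithful_Phi: "fully_faithful (StrMon Nec W) (Fun Delta (WCat u W)) (Phi u W z)"
  unfolding fully_faithful_def
proof (intro conjI ballI)
  show "is_functor (StrMon Nec W) (Fun Delta (WCat u W)) (Phi u W z)"
    unfolding Phi_def
  proof (rule is_functor_mk_ftor[OF category_StrMon category_Fun[OF category_Delta category_WCat]])
    fix D assume "D \<in> Ob (StrMon Nec W)"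
    then have D: "strong_monoidal Nec W D" by simp
    note [simp] = is_wcat_Psi[OF D]
    note id = monoidal_nat_trans_id[OF D]
    show "Phi_nat W z (Ident (StrMon Nec W) D) = Ident (Fun Delta (WCat u W)) (Phi_diagram W z D)"
    proof
      fix n
      have "Psi_nat D D (\<lambda>X\<in>Ob Nec. Ident W (fob D X)) (simplex n) =
        id_wfun W (Psi W z D (simplex n) :: ('u pt, 'o, 'a) wcat)"
        by (rule Psi_wfun_eqI[OF D _ Psi_nat(1)[OF D D id] is_wfunctor_id])
          (simp_all add: Psi_nat(2,3)[OF D D id] homW_id_wfun nt_id)
      then show "Phi_nat W z (Ident (StrMon Nec W) D) n =
        Ident (Fun Delta (WCat u W)) (Phi_diagram W z D) n"
        by (simp add: Phi_nat_Psi[of _ _ D D] Phi_diagram_simps[OF D])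
    qed
  next
    fix D E F t s assume "D \<in> Ob (StrMon Nec W)" "E \<in> Ob (StrMon Nec W)" "F \<in> Ob (StrMon Nec W)"
      "t \<in> Hom (StrMon Nec W) D E" "s \<in> Hom (StrMon Nec W) E F"
    then have D: "strong_monoidal Nec W D" and E: "strong_monoidal Nec W E"
      and F: "strong_monoidal Nec W F"
      and t: "monoidal_nat_trans Nec W D E t" and s: "monoidal_nat_trans Nec W E F s" by auto
    note [simp] = is_wcat_Psi[OF D] is_wcat_Psi[OF E] is_wcat_Psi[OF F]
    let ?r = "\<lambda>X\<in>Ob Nec. Comp W (fob D X) (fob E X) (fob F X) (s X) (t X)"
    note st = monoidal_nat_trans_comp[OF D E F t s]
    show "Phi_nat W z (Comp (StrMon Nec W) D E F s t) =
      Comp (Fun Delta (WCat u W)) (Phi_diagram W z D) (Phi_diagram W z E) (Phi_diagram W z F)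
        (Phi_nat W z s) (Phi_nat W z t)"
    proof
      fix n
      have "Psi_nat D F ?r (simplex n) = comp_wfun W (Psi W z D (simplex n)) (Psi W z E (simplex n))
        (Psi W z F (simplex n) :: ('u pt, 'o, 'a) wcat)
        (Psi_nat E F s (simplex n)) (Psi_nat D E t (simplex n))"
        by (rule Psi_wfun_eqI[OF D _ Psi_nat(1)[OF D F st] is_wfunctor_comp[OF _ _ _ Psi_nat(1)[OF D
          E t] Psi_nat(1)[OF E F s]]])
          (simp_all add: Psi_nat(2,3)[OF D E t] Psi_nat(2,3)[OF E F s] Psi_nat(2,3)[OF D F st]
            homW_comp_wfun nt_comp)
      then show "Phi_nat W z (Comp (StrMon Nec W) D E F s t) n =
        Comp (Fun Delta (WCat u W)) (Phi_diagram W z D) (Phi_diagram W z E) (Phi_diagram W z F)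
          (Phi_nat W z s) (Phi_nat W z t) n"
        by (simp add: Phi_nat_Psi[of ?r _ D F] Phi_nat_Psi[of s _ E F] Phi_nat_Psi[of t _ D E]
            Phi_diagram_simps[OF D] Phi_diagram_simps[OF E] Phi_diagram_simps[OF F])
    qed
  qed (auto simp: is_functor_Phi_diagram nat_trans_Phi_nat)
next
  fix D E assume "D \<in> Ob (StrMon Nec W)" "E \<in> Ob (StrMon Nec W)"
  then have D: "strong_monoidal Nec W D" and E: "strong_monoidal Nec W E" by auto
  have "bij_betw (Phi_nat W z) {t. monoidal_nat_trans Nec W D E t} {s.
    nat_trans Delta (WCat u W) (Phi_diagram W z D) (Phi_diagram W z E) s}"
    unfolding bij_betw_def
  proof (intro conjI equalityI subsetI)
    show "inj_on (Phi_nat W z :: _ \<Rightarrow> _ \<Rightarrow> ('u pt, 'a) wfun) {t. monoidal_nat_trans Nec W D E t}"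
      by (rule inj_onI) (auto intro: Phi_nat_inject[OF D E, where 'u = 'u])
    fix s assume "s \<in> {s. nat_trans Delta (WCat u W) (Phi_diagram W z D) (Phi_diagram W z E) s}"
    then have s: "nat_trans Delta (WCat u W) (Phi_diagram W z D) (Phi_diagram W z E) s" by simp
    have "\<exists>t. monoidal_nat_trans Nec W D E t \<and> (\<forall>n. Phi_nat W z t n = s n)"
    proof (rule Phi_nat_surject[OF D E])
      show "is_wfunctor W (Psi W z D (simplex n)) (Psi W z E (simplex n)) (s n)" for n
        using nat_transD(2)[OF s, of n] by (simp add: Phi_diagram_simps[OF D] Phi_diagram_simps[OF
          E])
      show "comp_wfun W (Psi W z D (simplex m)) (Psi W z D (simplex n)) (Psi W z E (simplex n))
        (s n) (Psi_ar D (simplex m) (simplex n) h) =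
        comp_wfun W (Psi W z D (simplex m)) (Psi W z E (simplex m)) (Psi W z E (simplex n))
          (Psi_ar E (simplex m) (simplex n) h) (s m)"
        if "h \<in> Hom Delta m n" for m n h
        using nat_transD(3)[OF s _ _ that] that
          by (simp add: Phi_diagram_simps[OF D] Phi_diagram_simps[OF E] del: Delta_simps(2))
    qed
    then show "s \<in> Phi_nat W z ` {t. monoidal_nat_trans Nec W D E t}"
      by (auto simp: fun_eq_iff image_iff)
  qed (auto simp: nat_trans_Phi_nat[OF D E])
  then show "bij_betw (far (Phi u W z) D E) (Hom (StrMon Nec W) D E)
      (Hom (Fun Delta (WCat u W)) (fob (Phi u W z) D) (fob (Phi u W z) E))"
    using D E by (subst bij_betw_cong[where g = "Phi_nat W z"]) (simp_all add: Phi_def mk_ftor_def)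
qed

end

end

section \<open>Small sets and colimits\<close>

context
  fixes u :: "'u itself"
  assumes U: "regular_universe u"
begin

section \<open>Closure properties of small sets\<close>

lemma small_lepoll: "\<lbrakk>Y \<lesssim> X; small u X\<rbrakk> \<Longrightarrow> small u Y"
  unfolding small_def by (rule lesspoll_trans1)

lemma small_inj: "\<lbrakk>inj_on f Y; f ` Y \<subseteq> X; small u X\<rbrakk> \<Longrightarrow> small u Y"
  using small_lepoll unfolding lepoll_def by blast

lemma small_image: "small u X \<Longrightarrow> small u (f ` X)"
  using small_lepoll[OF image_lepoll] .

lemma small_nat: "small u (UNIV :: nat set)"
  using U unfolding regular_universe_def small_def by blast

lemma infinite_universe: "infinite (UNIV :: 'u set)"
  using small_nat unfolding small_def
  by (metis infinite_UNIV_nat lepoll_iff_leqpoll finite_lepoll_infinite infinite_super lepoll_def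
    finite_imageD finite_subset top_greatest)

lemma small_finite: "finite X \<Longrightarrow> small u X"
  unfolding small_def by (rule finite_lesspoll_infinite[OF infinite_universe])

lemma small_embedding:
  assumes "small u X"
  obtains e :: "'x \<Rightarrow> 'u" where "inj_on e X"
  using assms unfolding small_def lesspoll_def lepoll_def by blast

text \<open>Regularity speaks of subsets of the universe type, so the index set and the fibres are
  embedded there, and a pairing function on this infinite type keeps the fibres apart.\<close>

lemma small_Sigma:
  fixes I :: "'i set" and B :: "'i \<Rightarrow> 'b set"
  assumes I: "small u I" and B: "\<And>i. i \<in> I \<Longrightarrow> small u (B i)"
  shows "small u (Sigma I B)"
proof -
  obtain p :: "'u \<times> 'u \<Rightarrow> 'u" where p: "inj p"
    using card_of_Times_same_infinite[OF infinite_universe] unfolding card_of_ordIso[symmetric]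
    by (auto simp: bij_betw_def)
  obtain e :: "'i \<Rightarrow> 'u" where e: "inj_on e I" using small_embedding[OF I] .
  have "\<forall>i\<in>I. \<exists>d :: 'b \<Rightarrow> 'u. inj_on d (B i)" using small_embedding[OF B] by metis
  then obtain d :: "'i \<Rightarrow> 'b \<Rightarrow> 'u" where d: "\<And>i. i \<in> I \<Longrightarrow> inj_on (d i) (B i)" by metis
  define B' where "B' k = (\<lambda>b. p (k, d (inv_into I e k) b)) ` B (inv_into I e k)" for k
  have "small u (B' k)" if "k \<in> e ` I" for k
    unfolding B'_def by (intro small_image B inv_into_into that)
  then have "small u (\<Union>k\<in>e ` I. B' k)"
    using U small_image[OF I, of e] unfolding regular_universe_def by blast
  moreover have "inj_on (\<lambda>(i, b). p (e i, d i b)) (Sigma I B)"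
    using d by (auto intro!: inj_onI dest!: injD[OF p] inj_onD[OF e] inj_onD)
  moreover have "(\<lambda>(i, b). p (e i, d i b)) ` Sigma I B \<subseteq> (\<Union>k\<in>e ` I. B' k)"
    using e by (auto simp: B'_def)
  ultimately show ?thesis using small_inj by blast
qed

lemma small_UN: "\<lbrakk>small u I; \<And>i. i \<in> I \<Longrightarrow> small u (B i)\<rbrakk> \<Longrightarrow> small u (\<Union>i\<in>I. B i)"
  using small_image[OF small_Sigma, of I B snd] by (simp add: snd_image_Sigma)

text \<open>Restricted to finite index sets, because a regular universe that is not a strong limit
  need not be closed under infinite products.\<close>

lemma small_PiE: "\<lbrakk>finite I; \<And>i. i \<in> I \<Longrightarrow> small u (B i)\<rbrakk> \<Longrightarrow> small u (Pi\<^sub>E I B)"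
proof (induction I rule: finite_induct)
  case empty
  then show ?case by (simp add: small_finite)
next
  case (insert i I)
  then have "small u (B i \<times> Pi\<^sub>E I B)" by (intro small_Sigma) auto
  then show ?case unfolding PiE_insert_eq by (rule small_image)
qed

text \<open>An enriched functor out of finitely many objects is a finite tuple of objects and
  arrows. Applied to the finite enriched categories of \<open>Phi\<close>, this puts the simplices
  of a nerve into small sets.\<close>

lemma small_wfunctors:
  assumes loc: "locally_small u W" and C: "is_wcat W C" and fin: "finite (wOb C)"
    and D: "is_wcat W D" and small: "small u (wOb D)" and W: "monoidal_category W"
  shows "small u {F. is_wfunctor W C D F}"
proof (rule small_inj)
  interpret monoidal W using W by unfold_locales
  let ?V = "wOb C" and ?B = "\<lambda>(x, y). \<Union>a\<in>wOb D. \<Union>b\<in>wOb D. Hom W (wHom C x y) (wHom D a b)"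
  let ?f = "\<lambda>F. (wfO F, \<lambda>p\<in>?V \<times> ?V. wfH F (fst p) (snd p))"
  show "inj_on ?f {F. is_wfunctor W C D F}"
  proof (rule inj_onI)
    fix F G assume "F \<in> {F. is_wfunctor W C D F}" "G \<in> {F. is_wfunctor W C D F}" and eq: "?f F =
      ?f G"
    then have FG: "is_wfunctor W C D F" "is_wfunctor W C D G" by auto
    show "F = G"
    proof (rule wfun_eqI[OF FG])
      show "wfH F x y = wfH G x y" if "x \<in> ?V" "y \<in> ?V" for x y
        using eq that by (auto simp: fun_eq_iff restrict_def dest!: spec[of _ x] split: if_splits)
    qed (use eq in simp)
  qed
  have "ar (homW C D F x y)" if "is_wfunctor W C D F" "x \<in> ?V" "y \<in> ?V" for F x y
    using ar_homW[OF that(1) C D that(2,3)] .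
  then show "?f ` {F. is_wfunctor W C D F} \<subseteq> (?V \<rightarrow>\<^sub>E wOb D) \<times> Pi\<^sub>E (?V \<times> ?V) ?B"
    using wfO_ext[of C D] wfO_Ob[of C D] by (fastforce simp: homW_def ar_triple)
  show "small u ((?V \<rightarrow>\<^sub>E wOb D) \<times> Pi\<^sub>E (?V \<times> ?V) ?B)"
    using fin small loc wHom_Ob[OF C] wHom_Ob[OF D] unfolding locally_small_def
    by (intro small_Sigma small_PiE) (auto intro!: small_UN)
qed

section \<open>Transport of diagrams to index categories with objects and arrows in the universe
  type\<close>

context
  fixes J :: "('j, 'k) cat" and W :: "('o, 'a, 'z) cat_scheme"
  assumes J: "category J" and Ob_small: "small u (Ob J)"
    and Hom_small: "small u (\<Union>X\<in>Ob J. \<Union>Y\<in>Ob J. Hom J X Y)"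
begin

definition emb_ob :: "'j \<Rightarrow> 'u" where "emb_ob = (SOME e. inj_on e (Ob J))"
definition emb_ar :: "'k \<Rightarrow> 'u" where "emb_ar = (SOME e. inj_on e (\<Union>X\<in>Ob J. \<Union>Y\<in>Ob J. Hom J X Y))"

abbreviation "unemb_ob \<equiv> inv_into (Ob J) emb_ob"
abbreviation "unemb_ar \<equiv> inv_into (\<Union>X\<in>Ob J. \<Union>Y\<in>Ob J. Hom J X Y) emb_ar"

lemma emb_inj: "inj_on emb_ob (Ob J)" "inj_on emb_ar (\<Union>X\<in>Ob J. \<Union>Y\<in>Ob J. Hom J X Y)"
proof -
  obtain e :: "'j \<Rightarrow> 'u" where "inj_on e (Ob J)" using small_embedding[OF Ob_small] .
  then show "inj_on emb_ob (Ob J)" unfolding emb_ob_def by (rule someI[where P = "\<lambda>e.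
    inj_on e (Ob J)"])
  obtain e :: "'k \<Rightarrow> 'u" where "inj_on e (\<Union>X\<in>Ob J. \<Union>Y\<in>Ob J. Hom J X Y)"
    using small_embedding[OF Hom_small] .
  then show "inj_on emb_ar (\<Union>X\<in>Ob J. \<Union>Y\<in>Ob J. Hom J X Y)" unfolding emb_ar_def
    by (rule someI[where P = "\<lambda>e. inj_on e (\<Union>X\<in>Ob J. \<Union>Y\<in>Ob J. Hom J X Y)"])
qed

lemma unemb [simp]:
  "X \<in> Ob J \<Longrightarrow> unemb_ob (emb_ob X) = X"
  "\<lbrakk>f \<in> Hom J X Y; X \<in> Ob J; Y \<in> Ob J\<rbrakk> \<Longrightarrow> unemb_ar (emb_ar f) = f"
  "X \<in> Ob J \<Longrightarrow> unemb_ar (emb_ar (Ident J X)) = Ident J X"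
  "\<lbrakk>f \<in> Hom J X Y; g \<in> Hom J Y V; X \<in> Ob J; Y \<in> Ob J; V \<in> Ob J\<rbrakk> \<Longrightarrow>
    unemb_ar (emb_ar (Comp J X Y V g f)) = Comp J X Y V g f"
  using emb_inj category_Ident[OF J] category_Comp[OF J, of f X Y g V]
    by (auto intro!: inv_into_f_f)

text \<open>The property \<open>cocomplete\<close> quantifies over index categories of one fixed
  type. All arrows of J are encoded by a single embedding, so an arrow can be decoded without
  knowledge of its hom-set.\<close>

definition copy :: "('u, 'u) cat" where
  "copy = \<lparr>Ob = emb_ob ` Ob J, Hom = (\<lambda>x y. emb_ar ` Hom J (unemb_ob x) (unemb_ob y)),
     Ident = (\<lambda>x. emb_ar (Ident J (unemb_ob x))),
     Comp = (\<lambda>x y v g f. emb_ar (Comp J (unemb_ob x) (unemb_ob y) (unemb_ob v) (unemb_ar g)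
       (unemb_ar f)))\<rparr>"

lemma copy_simps:
  "Ob copy = emb_ob ` Ob J"
  "\<lbrakk>X \<in> Ob J; Y \<in> Ob J\<rbrakk> \<Longrightarrow> Hom copy (emb_ob X) (emb_ob Y) = emb_ar ` Hom J X Y"
  "X \<in> Ob J \<Longrightarrow> Ident copy (emb_ob X) = emb_ar (Ident J X)"
  "\<lbrakk>X \<in> Ob J; Y \<in> Ob J; V \<in> Ob J; f \<in> Hom J X Y; g \<in> Hom J Y V\<rbrakk> \<Longrightarrow>
    Comp copy (emb_ob X) (emb_ob Y) (emb_ob V) (emb_ar g) (emb_ar f) = emb_ar (Comp J X Y V g f)"
  by (simp_all add: copy_def)

lemma category_copy: "category copy"
  unfolding category_def copy_simps(1)
  by (auto simp: copy_simps category_simps[OF J])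

lemma small_copy: "small_category u copy"
proof -
  have "small u (Hom J X Y)" if "X \<in> Ob J" "Y \<in> Ob J" for X Y
    by (rule small_inj[OF _ _ Hom_small, of id]) (use that in auto)
  then show ?thesis
    unfolding small_category_def locally_small_def copy_simps(1)
    using category_copy small_image[OF Ob_small] by (auto simp: copy_simps small_image)
qed

definition copy_ftor :: "('j, 'k, 'o, 'a) ftor \<Rightarrow> ('u, 'u, 'o, 'a) ftor" where
  "copy_ftor F = mk_ftor copy (\<lambda>x. fob F (unemb_ob x)) (\<lambda>x y f.
    far F (unemb_ob x) (unemb_ob y) (unemb_ar f))"

lemma copy_ftor_simps:
  "X \<in> Ob J \<Longrightarrow> fob (copy_ftor F) (emb_ob X) = fob F X"
  "\<lbrakk>X \<in> Ob J; Y \<in> Ob J; f \<in> Hom J X Y\<rbrakk> \<Longrightarrow> far (copy_ftor F) (emb_ob X) (emb_ob Y) (emb_ar f) =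
    far F X Y f"
  by (simp_all add: copy_ftor_def mk_ftor_def copy_simps)

lemma is_functor_copy: "is_functor J W F \<Longrightarrow> is_functor copy W (copy_ftor F)"
  unfolding copy_ftor_def
  by (rule is_functor_mk_ftor[OF category_copy])
    (auto simp: copy_simps functor_simps functor_cod category_simps[OF J])

lemma cocone_copy: "cocone copy W (copy_ftor F) c m \<longleftrightarrow> cocone J W F c (\<lambda>j. m (emb_ob j))"
  unfolding cocone_def copy_simps(1) by (auto simp: copy_simps copy_ftor_simps)

text \<open>Cocones over the copy and over J correspond by re-indexing along \<open>emb_ob\<close>,
  so universality passes in both directions.\<close>

lemma is_colimit_copy: "is_colimit copy W (copy_ftor F) c m \<longleftrightarrow> is_colimit J W F c (\<lambda>j. m (emb_ob j))"
proof -
  have eq: "(\<forall>d m'. cocone copy W (copy_ftor F) d m' \<longrightarrow>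
        (\<exists>!h. h \<in> Hom W c d \<and> (\<forall>j\<in>Ob copy. Comp W (fob (copy_ftor F) j) c d h (m j) = m' j))) \<longleftrightarrow>
     (\<forall>d m'. cocone J W F d m' \<longrightarrow> (\<exists>!h. h \<in> Hom W c d \<and>
       (\<forall>j\<in>Ob J. Comp W (fob F j) c d h (m (emb_ob j)) = m' j)))"
    (is "?L \<longleftrightarrow> ?R")
  proof
    assume L: ?L
    show ?R
    proof (intro allI impI)
      fix d m' assume m': "cocone J W F d m'"
      have "cocone copy W (copy_ftor F) d (\<lambda>x. m' (unemb_ob x))"
        using m' unfolding cocone_copy by (simp add: cocone_def)
      from L[rule_format, OF this] show "\<exists>!h. h \<in> Hom W c d \<and>
        (\<forall>j\<in>Ob J. Comp W (fob F j) c d h (m (emb_ob j)) = m' j)"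
        by (simp add: copy_simps(1) copy_ftor_simps)
    qed
  next
    assume R: ?R
    show ?L
    proof (intro allI impI)
      fix d m' assume "cocone copy W (copy_ftor F) d m'"
      from R[rule_format, OF this[unfolded cocone_copy]]
      show "\<exists>!h. h \<in> Hom W c d \<and> (\<forall>j\<in>Ob copy. Comp W (fob (copy_ftor F) j) c d h (m j) = m' j)"
        by (simp add: copy_simps(1) copy_ftor_simps)
    qed
  qed
  show ?thesis unfolding is_colimit_def eq unfolding cocone_copy ..
qed

lemma is_colimit_cong: "(\<And>j. j \<in> Ob J \<Longrightarrow> m j = m' j) \<Longrightarrow> is_colimit J W F c m \<longleftrightarrow> is_colimit J W F c m'"
  unfolding is_colimit_def cocone_def by simp

lemma colimit_exists:
  fixes F :: "('j, 'k, 'o, 'a) ftor"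
  assumes "cocomplete u W" "is_functor J W F"
  obtains c l where "is_colimit J W F c l"
  using assms is_functor_copy small_copy is_colimit_copy unfolding cocomplete_def by metis

lemma colimit_preserved:
  fixes F :: "('j, 'k, 'o, 'a) ftor" and H :: "('o, 'a, 'o, 'a) ftor"
  assumes H: "preserves_colimits u W W H" "is_functor W W H" and F: "is_functor J W F"
    and l: "is_colimit J W F c l"
  shows "is_colimit J W (comp_ftor J H F) (fob H c) (\<lambda>j. far H (fob F j) c (l j))"
proof -
  have "is_colimit copy W (copy_ftor F) c (\<lambda>x. l (unemb_ob x))"
    unfolding is_colimit_copy using l by (subst is_colimit_cong[where m' = l]) simp_all
  with H F have "is_colimit copy W (comp_ftor copy H (copy_ftor F)) (fob H c)
      (\<lambda>x. far H (fob (copy_ftor F) x) c (l (unemb_ob x)))"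
    unfolding preserves_colimits_def using small_copy is_functor_copy by blast
  moreover have "comp_ftor copy H (copy_ftor F) = copy_ftor (comp_ftor J H F)"
  proof (rule ftor_eqI[of copy W _ W])
    show "is_functor copy W (comp_ftor copy H (copy_ftor F))" "is_functor copy W
      (copy_ftor (comp_ftor J H F))"
      by (rule is_functor_comp[OF is_functor_copy[OF F] H(2)])
        (rule is_functor_copy[OF is_functor_comp[OF F H(2)]])
  qed (auto simp: copy_simps comp_ftor_simps copy_ftor_simps)
  ultimately have "is_colimit J W (comp_ftor J H F) (fob H c) (\<lambda>j.
    far H (fob (copy_ftor F) (emb_ob j)) c (l (unemb_ob (emb_ob j))))"
    by (simp add: is_colimit_copy)
  then show ?thesis
    by (subst is_colimit_cong[where m' = "\<lambda>j. far H (fob (copy_ftor F) (emb_ob j)) c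
      (l (unemb_ob (emb_ob j)))"])
      (simp_all add: copy_ftor_simps)
qed

end

end

section \<open>Colimits and their tensor products in tagged form\<close>

context monoidal
begin

text \<open>Diagram and legs need to match a functor and a cocone on J only, so tensored diagrams
  can be written directly with tagged arrows.\<close>

definition colim :: "('j, 'k) cat \<Rightarrow> ('j \<Rightarrow> 'o) \<Rightarrow> ('j \<Rightarrow> 'j \<Rightarrow> 'k \<Rightarrow> 'o \<times> 'a \<times> 'o) \<Rightarrow> 'o \<Rightarrow>
  ('j \<Rightarrow> 'o \<times> 'a \<times> 'o) \<Rightarrow> bool" where
  "colim J Fo Fa c l \<longleftrightarrow> (\<exists>(F :: ('j, 'k, 'o, 'a) ftor) m. is_functor J W F \<and> is_colimit J W F c m \<and>
     (\<forall>j\<in>Ob J. fob F j = Fo j \<and> l j = (Fo j, m j, c)) \<and>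
     (\<forall>j\<in>Ob J. \<forall>k\<in>Ob J. \<forall>f\<in>Hom J j k. Fa j k f = (Fo j, far F j k f, Fo k)))"

context
  fixes J :: "('j, 'k) cat" and Fo Fa c l
  assumes l: "colim J Fo Fa c l"
begin

lemma colim_ar:
  "c \<in> Ob W"
  "j \<in> Ob J \<Longrightarrow> ar (l j)" "j \<in> Ob J \<Longrightarrow> dm (l j) = Fo j" "j \<in> Ob J \<Longrightarrow> cd (l j) = c"
  "j \<in> Ob J \<Longrightarrow> Fo j \<in> Ob W"
  "\<lbrakk>f \<in> Hom J j k; j \<in> Ob J; k \<in> Ob J\<rbrakk> \<Longrightarrow> ar (Fa j k f)"
  "\<lbrakk>f \<in> Hom J j k; j \<in> Ob J; k \<in> Ob J\<rbrakk> \<Longrightarrow> dm (Fa j k f) = Fo j"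
  "\<lbrakk>f \<in> Hom J j k; j \<in> Ob J; k \<in> Ob J\<rbrakk> \<Longrightarrow> cd (Fa j k f) = Fo k"
  "\<lbrakk>f \<in> Hom J j k; j \<in> Ob J; k \<in> Ob J\<rbrakk> \<Longrightarrow> l k \<cdot> Fa j k f = l j"
proof -
  obtain F :: "('j, 'k, 'o, 'a) ftor" and m where F: "is_functor J W F"
    and m: "is_colimit J W F c m"
    and eq: "\<And>j. j \<in> Ob J \<Longrightarrow> fob F j = Fo j" "\<And>j. j \<in> Ob J \<Longrightarrow> l j = (Fo j, m j, c)"
     "\<And>j k f. \<lbrakk>j \<in> Ob J; k \<in> Ob J; f \<in> Hom J j k\<rbrakk> \<Longrightarrow> Fa j k f = (Fo j, far F j k f, Fo k)"
    using l unfolding colim_def by blast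
  have c: "cocone J W F c m" using m unfolding is_colimit_def by blast
  note c' = c[unfolded cocone_def]
  show "c \<in> Ob W" using c' by blast
  show "j \<in> Ob J \<Longrightarrow> ar (l j)" "j \<in> Ob J \<Longrightarrow> dm (l j) = Fo j" "j \<in> Ob J \<Longrightarrow> cd (l j) = c" "j \<in> Ob J \<Longrightarrow>
    Fo j \<in> Ob W" for j
    using c' functor_ob[OF F, of j] by (auto simp: eq ar_triple)
  show "\<lbrakk>f \<in> Hom J j k; j \<in> Ob J; k \<in> Ob J\<rbrakk> \<Longrightarrow> ar (Fa j k f)"
    "\<lbrakk>f \<in> Hom J j k; j \<in> Ob J; k \<in> Ob J\<rbrakk> \<Longrightarrow> dm (Fa j k f) = Fo j"
    "\<lbrakk>f \<in> Hom J j k; j \<in> Ob J; k \<in> Ob J\<rbrakk> \<Longrightarrow> cd (Fa j k f) = Fo k"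
    "\<lbrakk>f \<in> Hom J j k; j \<in> Ob J; k \<in> Ob J\<rbrakk> \<Longrightarrow> l k \<cdot> Fa j k f = l j" for j k f
    using c' functor_ob[OF F, of j] functor_ob[OF F, of k] functor_ar[OF F, of f j k]
    by (auto simp: eq ar_triple cmp_def)
qed

lemma colim_epi:
  assumes "ar h" "ar h'" "dm h = c" "dm h' = c" "cd h = cd h'" "\<And>j. j \<in> Ob J \<Longrightarrow> h \<cdot> l j = h' \<cdot> l j"
  shows "h = h'"
proof -
  obtain F :: "('j, 'k, 'o, 'a) ftor" and m where F: "is_functor J W F"
    and m: "is_colimit J W F c m"
    and eq: "\<And>j. j \<in> Ob J \<Longrightarrow> fob F j = Fo j" "\<And>j. j \<in> Ob J \<Longrightarrow> l j = (Fo j, m j, c)"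
    using l unfolding colim_def by blast
  have cc: "cocone J W F c m" using m unfolding is_colimit_def by blast
  let ?m = "\<lambda>j. md (h \<cdot> l j)" and ?d = "cd h"
  have "cocone J W F ?d ?m"
    unfolding cocone_def
  proof (intro conjI ballI)
    show "?d \<in> Ob W" using assms by simp
    show "?m j \<in> Hom W (fob F j) ?d" if "j \<in> Ob J" for j
      using that assms(1,3) colim_ar(2-4)[of j] ar_cmp[of "l j" h]
        by (simp add: ar_def eq del: ar_Ob)
    show "Comp W (fob F j) (fob F k) ?d (?m k) (far F j k f) = ?m j"
      if "j \<in> Ob J" "k \<in> Ob J" "f \<in> Hom J j k" for j k f
      using that cc assms(1,3) functor_ar[OF F, of f j k] functor_ob[OF F, of j] functor_ob[OF F, of
        k] colim_ar(1)
      unfolding cocone_def by (simp add: cmp_def eq ar_def category_assoc[OF catW] del: ar_Ob)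
  qed
  with m have "\<exists>!x. x \<in> Hom W c ?d \<and> (\<forall>j\<in>Ob J. Comp W (fob F j) c ?d x (m j) = ?m j)"
    unfolding is_colimit_def by blast
  moreover have "md h \<in> Hom W c ?d \<and> (\<forall>j\<in>Ob J. Comp W (fob F j) c ?d (md h) (m j) = ?m j)"
    using assms(1,3) by (auto simp: ar_def eq cmp_def simp del: ar_Ob)
  moreover have "md h' \<in> Hom W c ?d \<and> (\<forall>j\<in>Ob J. Comp W (fob F j) c ?d (md h') (m j) = ?m j)"
    using assms(2-6) by (auto simp: ar_def eq cmp_def simp del: ar_Ob)
  ultimately have "md h = md h'" by blast
  then show ?thesis using assms by (simp add: prod_eq_iff)
qed

lemma colim_universal:
  assumes "d \<in> Ob W" "\<And>j. j \<in> Ob J \<Longrightarrow> ar (t j)" "\<And>j. j \<in> Ob J \<Longrightarrow> dm (t j) = Fo j" "\<And>j. j \<in> Ob J \<Longrightarrow>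
    cd (t j) = d"
    and nat: "\<And>j k f. \<lbrakk>j \<in> Ob J; k \<in> Ob J; f \<in> Hom J j k\<rbrakk> \<Longrightarrow> t k \<cdot> Fa j k f = t j"
  obtains h where "ar h" "dm h = c" "cd h = d" "\<And>j. j \<in> Ob J \<Longrightarrow> h \<cdot> l j = t j"
proof -
  obtain F :: "('j, 'k, 'o, 'a) ftor" and m where F: "is_functor J W F"
    and m: "is_colimit J W F c m"
    and eq: "\<And>j. j \<in> Ob J \<Longrightarrow> fob F j = Fo j" "\<And>j. j \<in> Ob J \<Longrightarrow> l j = (Fo j, m j, c)"
     "\<And>j k f. \<lbrakk>j \<in> Ob J; k \<in> Ob J; f \<in> Hom J j k\<rbrakk> \<Longrightarrow> Fa j k f = (Fo j, far F j k f, Fo k)"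
    using l unfolding colim_def by blast
  have "cocone J W F d (\<lambda>j. md (t j))"
    unfolding cocone_def
  proof (intro conjI ballI)
    show "md (t j) \<in> Hom W (fob F j) d" if "j \<in> Ob J" for j
      using assms(2-4)[OF that] that by (simp add: ar_def eq del: ar_Ob)
    show "Comp W (fob F j) (fob F k) d (md (t k)) (far F j k f) = md (t j)"
      if "j \<in> Ob J" "k \<in> Ob J" "f \<in> Hom J j k" for j k f
      using arg_cong[OF nat[OF that], of md] that assms(3,4) by (simp add: cmp_def eq)
  qed (rule assms)
  then obtain x where "x \<in> Hom W c d" "\<forall>j\<in>Ob J. Comp W (fob F j) c d x (m j) = md (t j)"
    using m unfolding is_colimit_def by blast
  then show thesis
    using assms(1,3,4) colim_ar(1)
    by (intro that[of "(c, x, d)"]) (auto simp: ar_triple cmp_def eq prod_eq_iff)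
qed

end

end

locale cocomplete_monoidal = monoidal W for W :: "('o, 'a) moncat" +
  fixes u :: "'u itself"
  assumes U: "regular_universe u" and cocomplete: "cocomplete u W"
    and tensor_colimits: "tensor_preserves_colimits u W"
begin

lemma is_functor_tensor:
  assumes X: "X \<in> Ob W"
  shows "is_functor W W (tensor_left W X)" "is_functor W W (tensor_right W X)"
proof -
  have ids: "ar (X, Ident W X, X)" "\<And>Y. Y \<in> Ob W \<Longrightarrow> ar (Y, Ident W Y, Y)"
    using X ar_idt unfolding idt_def by auto
  show "is_functor W W (tensor_left W X)" unfolding tensor_left_def
  proof (rule is_functor_mk_ftor[OF catW catW])
    fix A B C f g assume h: "A \<in> Ob W" "B \<in> Ob W" "C \<in> Ob W" "f \<in> Hom W A B" "g \<in> Hom W B C"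
    show "TensA W X X A C (Ident W X) (Comp W A B C g f) =
      Comp W (X \<odot> A) (X \<odot> B) (X \<odot> C) (TensA W X X B C (Ident W X) g) (TensA W X X A B
        (Ident W X) f)"
      using monoidal_interchange[of X X X A B C "Ident W X" "Ident W X" f g] h X
      by (simp add: category_Ident[OF catW] category_Ident_Comp[OF catW])
  qed (use X monoidal_TensA monoidal_Ident category_Ident[OF catW] in auto)
  show "is_functor W W (tensor_right W X)" unfolding tensor_right_def
  proof (rule is_functor_mk_ftor[OF catW catW])
    fix A B C f g assume h: "A \<in> Ob W" "B \<in> Ob W" "C \<in> Ob W" "f \<in> Hom W A B" "g \<in> Hom W B C"
    show "TensA W A C X X (Comp W A B C g f) (Ident W X) =
      Comp W (A \<odot> X) (B \<odot> X) (C \<odot> X) (TensA W B C X X g (Ident W X)) (TensA W A B X X f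
        (Ident W X))"
      using monoidal_interchange[of A B C X X X f g "Ident W X" "Ident W X"] h X
      by (simp add: category_Ident[OF catW] category_Ident_Comp[OF catW])
  qed (use X monoidal_TensA monoidal_Ident category_Ident[OF catW] in auto)
qed

context
  fixes J :: "('j, 'k) cat"
  assumes J: "category J" and Ob_small: "small u (Ob J)"
    and Hom_small: "small u (\<Union>X\<in>Ob J. \<Union>Y\<in>Ob J. Hom J X Y)"
begin

lemma colim_exists:
  fixes F :: "('j, 'k, 'o, 'a) ftor"
  assumes F: "is_functor J W F"
  shows "\<exists>c l. colim J (fob F) (\<lambda>j k f. (fob F j, far F j k f, fob F k)) c l"
proof -
  obtain c l where l: "is_colimit J W F c l" using colimit_exists[OF U J Ob_small Hom_small
    cocomplete F] .
  then show ?thesis unfolding colim_def using F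
    by (intro exI[of _ c] exI[of _ "\<lambda>j. (fob F j, l j, c)"] exI[of _ F] exI[of _ l]) auto
qed

lemma colim_tensor_right:
  assumes l: "colim J Fo Fa c l" and Y: "Y \<in> Ob W"
  shows "colim J (\<lambda>j. Fo j \<odot> Y) (\<lambda>j k f. Fa j k f \<otimes> idt Y) (c \<odot> Y) (\<lambda>j. l j \<otimes> idt Y)"
proof -
  obtain F :: "('j, 'k, 'o, 'a) ftor" and m where F: "is_functor J W F"
    and m: "is_colimit J W F c m"
    and eq: "\<And>j. j \<in> Ob J \<Longrightarrow> fob F j = Fo j" "\<And>j. j \<in> Ob J \<Longrightarrow> l j = (Fo j, m j, c)"
     "\<And>j k f. \<lbrakk>j \<in> Ob J; k \<in> Ob J; f \<in> Hom J j k\<rbrakk> \<Longrightarrow> Fa j k f = (Fo j, far F j k f, Fo k)"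
    using l unfolding colim_def by blast
  let ?H = "tensor_right W Y"
  have pres: "preserves_colimits u W W ?H" using tensor_colimits Y
    unfolding tensor_preserves_colimits_def by blast
  have c: "c \<in> Ob W" "\<And>j. j \<in> Ob J \<Longrightarrow> m j \<in> Hom W (fob F j) c" using m
    unfolding is_colimit_def cocone_def by auto
  show ?thesis
    unfolding colim_def
    using colimit_preserved[OF U J Ob_small Hom_small pres is_functor_tensor(2)[OF Y] F m]
      is_functor_comp[OF F is_functor_tensor(2)[OF Y]] functor_ob[OF F] functor_ar[OF F] c
    by (intro exI[of _ "comp_ftor J ?H F"] exI[of _ "\<lambda>j. far ?H (fob F j) c (m j)"])
      (auto simp: comp_ftor_simps tensor_right_def mk_ftor_def eq tns_def idt_def)
qed

lemma colim_tensor_left: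
  assumes l: "colim J Fo Fa c l" and Y: "Y \<in> Ob W"
  shows "colim J (\<lambda>j. Y \<odot> Fo j) (\<lambda>j k f. idt Y \<otimes> Fa j k f) (Y \<odot> c) (\<lambda>j. idt Y \<otimes> l j)"
proof -
  obtain F :: "('j, 'k, 'o, 'a) ftor" and m where F: "is_functor J W F"
    and m: "is_colimit J W F c m"
    and eq: "\<And>j. j \<in> Ob J \<Longrightarrow> fob F j = Fo j" "\<And>j. j \<in> Ob J \<Longrightarrow> l j = (Fo j, m j, c)"
     "\<And>j k f. \<lbrakk>j \<in> Ob J; k \<in> Ob J; f \<in> Hom J j k\<rbrakk> \<Longrightarrow> Fa j k f = (Fo j, far F j k f, Fo k)"
    using l unfolding colim_def by blast
  let ?H = "tensor_left W Y"
  have pres: "preserves_colimits u W W ?H" using tensor_colimits Y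
    unfolding tensor_preserves_colimits_def by blast
  have c: "c \<in> Ob W" "\<And>j. j \<in> Ob J \<Longrightarrow> m j \<in> Hom W (fob F j) c" using m
    unfolding is_colimit_def cocone_def by auto
  show ?thesis
    unfolding colim_def
    using colimit_preserved[OF U J Ob_small Hom_small pres is_functor_tensor(1)[OF Y] F m]
      is_functor_comp[OF F is_functor_tensor(1)[OF Y]] functor_ob[OF F] functor_ar[OF F] c
    by (intro exI[of _ "comp_ftor J ?H F"] exI[of _ "\<lambda>j. far ?H (fob F j) c (m j)"])
      (auto simp: comp_ftor_simps tensor_left_def mk_ftor_def eq tns_def idt_def)
qed

end

text \<open>An initial object is the colimit of the empty diagram, and tensoring with X on either
  side preserves this colimit.\<close>

lemma initial_tensor:
  assumes Y: "initial W Y" and X: "X \<in> Ob W"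
  shows "initial W (X \<odot> Y)" "initial W (Y \<odot> X)"
proof -
  define J :: "('u, 'u) cat" where "J = \<lparr>Ob = {}, Hom = (\<lambda>_ _. {}), Ident = undefined, Comp =
    undefined\<rparr>"
  have [simp]: "Ob J = {}" by (simp add: J_def)
  have J: "category J" by (simp add: category_def)
  have sm: "small_category u J" using J small_finite[OF U, of "{} :: 'u set"]
    by (simp add: small_category_def locally_small_def)
  define F :: "('u, 'u, 'o, 'a) ftor" where "F = mk_ftor J undefined undefined"
  have F: "is_functor J W F" unfolding F_def by (rule is_functor_mk_ftor[OF J catW]) auto
  have init: "is_colimit J W G c l \<longleftrightarrow> initial W c" for G :: "('u, 'u, 'o, 'a) ftor" and c l
    by (auto simp: is_colimit_def cocone_def initial_def)
  have Yo: "Y \<in> Ob W" using Y by (simp add: initial_def)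
  have pres: "initial W (fob H Y)" if "preserves_colimits u W W H" for H
    using that[unfolded preserves_colimits_def, rule_format, OF sm F, of Y] Y by (simp add: init)
  show "initial W (X \<odot> Y)" "initial W (Y \<odot> X)"
    using pres[of "tensor_left W X"] pres[of "tensor_right W X"] tensor_colimits X Yo
    unfolding tensor_preserves_colimits_def by (simp_all add: tensor_left_def tensor_right_def
      mk_ftor_simps)
qed

context
  fixes J :: "('j, 'k) cat" and K :: "('j2, 'k2) cat" and Fo Fa c l Go Ga d r
  assumes J: "category J" "small u (Ob J)" "small u (\<Union>X\<in>Ob J. \<Union>Y\<in>Ob J. Hom J X Y)"
    and K: "category K" "small u (Ob K)" "small u (\<Union>X\<in>Ob K. \<Union>Y\<in>Ob K. Hom K X Y)"
    and l: "colim J Fo Fa c l" and r: "colim K Go Ga d r"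
begin

text \<open>A tensor product of legs factors as one leg in the second variable followed by one in
  the first, so joint epimorphy is tested one variable at a time.\<close>

lemma bicolim_epi:
  assumes "ar h" "ar h'" "dm h = c \<odot> d" "dm h' = c \<odot> d" "cd h = cd h'"
    and eq: "\<And>j k. \<lbrakk>j \<in> Ob J; k \<in> Ob K\<rbrakk> \<Longrightarrow> h \<cdot> (l j \<otimes> r k) = h' \<cdot> (l j \<otimes> r k)"
  shows "h = h'"
proof (rule colim_epi[OF colim_tensor_right[OF J l colim_ar(1)[OF r]] assms(1-5)])
  note a = colim_ar[OF l] colim_ar[OF r]
  fix j assume j: "j \<in> Ob J"
  show "h \<cdot> (l j \<otimes> idt d) = h' \<cdot> (l j \<otimes> idt d)"
  proof (rule colim_epi[OF colim_tensor_left[OF K r, of "Fo j"]])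
    fix k assume k: "k \<in> Ob K"
    have "(l j \<otimes> idt d) \<cdot> (idt (Fo j) \<otimes> r k) = l j \<otimes> r k" using j k a by (simp add: fuse)
    then show "(h \<cdot> (l j \<otimes> idt d)) \<cdot> (idt (Fo j) \<otimes> r k) = (h' \<cdot> (l j \<otimes> idt d)) \<cdot> (idt (Fo j) \<otimes> r k)"
      using j k a eq[OF j k] assms(1-5) by simp
  qed (use assms(1-5) j a in simp_all)
qed

text \<open>With j fixed, the legs are glued over K to an arrow out of the tensor product of
  \<open>Fo j\<close> with d. Naturality of these arrows in j is again tested on the colimit over K,
  and then they are glued over J.\<close>

lemma bicolim_universal:
  assumes e: "e \<in> Ob W"
    and t: "\<And>j k. \<lbrakk>j \<in> Ob J; k \<in> Ob K\<rbrakk> \<Longrightarrow> ar (t j k)" "\<And>j k. \<lbrakk>j \<in> Ob J; k \<in> Ob K\<rbrakk> \<Longrightarrow> dm (t j k) =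
      Fo j \<odot> Go k"
      "\<And>j k. \<lbrakk>j \<in> Ob J; k \<in> Ob K\<rbrakk> \<Longrightarrow> cd (t j k) = e"
    and nat1: "\<And>j j' f k. \<lbrakk>j \<in> Ob J; j' \<in> Ob J; f \<in> Hom J j j'; k \<in> Ob K\<rbrakk> \<Longrightarrow> t j' k \<cdot>
      (Fa j j' f \<otimes> idt (Go k)) = t j k"
    and nat2: "\<And>k k' g j. \<lbrakk>k \<in> Ob K; k' \<in> Ob K; g \<in> Hom K k k'; j \<in> Ob J\<rbrakk> \<Longrightarrow> t j k' \<cdot>
      (idt (Fo j) \<otimes> Ga k k' g) = t j k"
  obtains h where "ar h" "dm h = c \<odot> d" "cd h = e" "\<And>j k. \<lbrakk>j \<in> Ob J; k \<in> Ob K\<rbrakk> \<Longrightarrow> h \<cdot> (l j \<otimes> r k) =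
    t j k"
proof -
  note a = colim_ar[OF l] colim_ar[OF r]
  have "\<exists>h. ar h \<and> dm h = Fo j \<odot> d \<and> cd h = e \<and> (\<forall>k\<in>Ob K. h \<cdot> (idt (Fo j) \<otimes> r k) = t j k)"
    if j: "j \<in> Ob J" for j
    by (rule colim_universal[OF colim_tensor_left[OF K r, of "Fo j"], of e "t j"])
      (use j a e t nat2 in auto)
  then obtain h where h: "\<And>j. j \<in> Ob J \<Longrightarrow> ar (h j)" "\<And>j. j \<in> Ob J \<Longrightarrow> dm (h j) = Fo j \<odot> d" "\<And>j.
    j \<in> Ob J \<Longrightarrow> cd (h j) = e"
    "\<And>j k. \<lbrakk>j \<in> Ob J; k \<in> Ob K\<rbrakk> \<Longrightarrow> h j \<cdot> (idt (Fo j) \<otimes> r k) = t j k"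
    by metis
  have nat: "h j' \<cdot> (Fa j j' f \<otimes> idt d) = h j" if j: "j \<in> Ob J" "j' \<in> Ob J" "f \<in> Hom J j j'"
    for j j' f
  proof (rule colim_epi[OF colim_tensor_left[OF K r, of "Fo j"]])
    fix k assume k: "k \<in> Ob K"
    have "(h j' \<cdot> (Fa j j' f \<otimes> idt d)) \<cdot> (idt (Fo j) \<otimes> r k) = (h j' \<cdot> (idt (Fo j') \<otimes> r k)) \<cdot>
      (Fa j j' f \<otimes> idt (Go k))"
      using j k a h(1-3) by (simp add: fuse)
    also have "\<dots> = h j \<cdot> (idt (Fo j) \<otimes> r k)" using j k by (simp add: h(4) nat1)
    finally show "(h j' \<cdot> (Fa j j' f \<otimes> idt d)) \<cdot> (idt (Fo j) \<otimes> r k) = h j \<cdot> (idt (Fo j) \<otimes> r k)" .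
  qed (use j a h in simp_all)
  obtain q where q: "ar q" "dm q = c \<odot> d" "cd q = e" "\<And>j. j \<in> Ob J \<Longrightarrow> q \<cdot> (l j \<otimes> idt d) = h j"
    by (rule colim_universal[OF colim_tensor_right[OF J l colim_ar(1)[OF r]], of e h])
      (use e h nat in auto)
  show thesis
  proof (rule that[OF q(1-3)])
    fix j k assume jk: "j \<in> Ob J" "k \<in> Ob K"
    have "l j \<otimes> r k = (l j \<otimes> idt d) \<cdot> (idt (Fo j) \<otimes> r k)" using jk a by (simp add: fuse)
    then have "q \<cdot> (l j \<otimes> r k) = (q \<cdot> (l j \<otimes> idt d)) \<cdot> (idt (Fo j) \<otimes> r k)" using jk a q(1-3) by simp
    then show "q \<cdot> (l j \<otimes> r k) = t j k" using jk by (simp only: q(4) h(4))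
  qed
qed

text \<open>The same test in three variables; it reduces associativity in the left adjoint to
  triples of labelled necklaces.\<close>

lemma tricolim_epi:
  fixes L :: "('j3, 'k3) cat"
  assumes L: "category L" "small u (Ob L)" "small u (\<Union>X\<in>Ob L. \<Union>Y\<in>Ob L. Hom L X Y)"
    and s: "colim L Ho Ha e s"
    and "ar h" "ar h'" "dm h = (c \<odot> d) \<odot> e" "dm h' = (c \<odot> d) \<odot> e" "cd h = cd h'"
    and eq: "\<And>j k i. \<lbrakk>j \<in> Ob J; k \<in> Ob K; i \<in> Ob L\<rbrakk> \<Longrightarrow> h \<cdot> ((l j \<otimes> r k) \<otimes> s i) = h' \<cdot> ((l j \<otimes> r k) \<otimes>
      s i)"
  shows "h = h'"
proof (rule colim_epi[OF colim_tensor_left[OF L s, of "c \<odot> d"]])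
  note a = colim_ar[OF l] colim_ar[OF r] colim_ar[OF s]
  show "c \<odot> d \<in> Ob W" using a by simp
  fix i assume i: "i \<in> Ob L"
  show "h \<cdot> (idt (c \<odot> d) \<otimes> s i) = h' \<cdot> (idt (c \<odot> d) \<otimes> s i)"
  proof (rule colim_epi[OF colim_tensor_right[OF J colim_tensor_right[OF J l colim_ar(1)[OF r]], of
    "Ho i"]])
    fix j assume j: "j \<in> Ob J"
    show "(h \<cdot> (idt (c \<odot> d) \<otimes> s i)) \<cdot> ((l j \<otimes> idt d) \<otimes> idt (Ho i)) = (h' \<cdot> (idt (c \<odot> d) \<otimes> s i)) \<cdot>
      ((l j \<otimes> idt d) \<otimes> idt (Ho i))"
    proof (rule colim_epi[OF colim_tensor_right[OF K colim_tensor_left[OF K r, of "Fo j"], of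
      "Ho i"]])
      fix k assume k: "k \<in> Ob K"
      have "(((idt (c \<odot> d) \<otimes> s i) \<cdot> ((l j \<otimes> idt d) \<otimes> idt (Ho i)))) \<cdot> ((idt (Fo j) \<otimes> r k) \<otimes>
        idt (Ho i)) = (l j \<otimes> r k) \<otimes> s i"
        using i j k a by (simp add: fuse)
      then have *: "(x \<cdot> (idt (c \<odot> d) \<otimes> s i)) \<cdot> ((l j \<otimes> idt d) \<otimes> idt (Ho i)) \<cdot> ((idt (Fo j) \<otimes> r k) \<otimes>
        idt (Ho i)) = x \<cdot> ((l j \<otimes> r k) \<otimes> s i)"
        if "ar x" "dm x = (c \<odot> d) \<odot> e" for x
        using i j k a that by (simp add: fuse)
      show "((h \<cdot> (idt (c \<odot> d) \<otimes> s i)) \<cdot> ((l j \<otimes> idt d) \<otimes> idt (Ho i))) \<cdot> ((idt (Fo j) \<otimes> r k) \<otimes>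
        idt (Ho i)) =
        ((h' \<cdot> (idt (c \<odot> d) \<otimes> s i)) \<cdot> ((l j \<otimes> idt d) \<otimes> idt (Ho i))) \<cdot> ((idt (Fo j) \<otimes> r k) \<otimes>
          idt (Ho i))"
        using *[OF assms(5,7)] *[OF assms(6,8)] eq[OF j k i] i j k a assms(5-9) by simp
    qed (use assms(5-9) i j a in simp_all)
  qed (use assms(5-9) i a in simp_all)
qed (use assms(5-9) in simp_all)

end

end

section \<open>Necklaces in a simplicial set\<close>

locale necklaces_in =
  fixes X :: "'x sset" and u :: "'u itself"
  assumes X: "is_functor (op_cat Delta) (SetCat u) X"
begin

lemma act_in: "\<lbrakk>h \<in> Hom Delta m n; s \<in> fob X n\<rbrakk> \<Longrightarrow> far X n m h s \<in> fob X m"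
  using functor_ar[OF X, of h n m] by auto

lemma act_id: "s \<in> fob X n \<Longrightarrow> far X n n (Ident Delta n) s = s"
  using functor_Ident[OF X, of n] by simp

lemma act_comp:
  "\<lbrakk>h \<in> Hom Delta m n; g \<in> Hom Delta p m; s \<in> fob X n\<rbrakk> \<Longrightarrow> far X n p (compose {..p} h g) s =
    far X m p g (far X n m h s)"
  using functor_Comp[OF X, of h n m g p] by (simp add: compose_def)

text \<open>Simplicial maps \<open>x\<close> from the necklace \<open>A\<close> to \<open>X\<close>, given by their values on the simplices of
  \<open>A\<close>.\<close>

definition lab :: "necklace \<Rightarrow> (nat \<Rightarrow> (nat \<Rightarrow> nat) \<Rightarrow> 'x) \<Rightarrow> bool" where
  "lab A x \<longleftrightarrow> A \<in> Ob Nec \<and>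
     (\<forall>n g. (g \<in> nmaps (simplex n) A \<longrightarrow> x n g \<in> fob X n) \<and> (g \<notin> nmaps (simplex n) A \<longrightarrow> x n g =
       undefined)) \<and>
     (\<forall>n. \<forall>g\<in>nmaps (simplex n) A. \<forall>m. \<forall>h\<in>Hom Delta m n. x m (compose {..m} g h) =
       far X n m h (x n g))"

text \<open>Precomposition with f, cut off to \<open>undefined\<close> outside the simplices of A so
  that labellings are equal once they agree on simplices.\<close>

definition pull :: "necklace \<Rightarrow> (nat \<Rightarrow> nat) \<Rightarrow> (nat \<Rightarrow> (nat \<Rightarrow> nat) \<Rightarrow> 'x) \<Rightarrow> nat \<Rightarrow> (nat \<Rightarrow> nat) \<Rightarrow>
  'x" where
  "pull A f y = (\<lambda>n g. if g \<in> nmaps (simplex n) A then y n (compose {..n} f g) else undefined)"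

definition vert :: "(nat \<Rightarrow> (nat \<Rightarrow> nat) \<Rightarrow> 'x) \<Rightarrow> nat \<Rightarrow> 'x" where
  "vert x i = x 0 (shift 0 i)"

text \<open>The simplicial map from the standard simplex to X that corresponds to s by the Yoneda
  lemma.\<close>

definition hat :: "nat \<Rightarrow> 'x \<Rightarrow> nat \<Rightarrow> (nat \<Rightarrow> nat) \<Rightarrow> 'x" where
  "hat n s = (\<lambda>m g. if g \<in> nmaps (simplex m) (simplex n) then far X n m g s else undefined)"

definition sub :: "necklace \<Rightarrow> (nat \<Rightarrow> (nat \<Rightarrow> nat) \<Rightarrow> 'x) \<Rightarrow> nat \<Rightarrow> nat \<Rightarrow> nat \<Rightarrow> (nat \<Rightarrow> nat) \<Rightarrow> 'x" where
  "sub A x i j = pull (restr A i j) (shift (j - i) i) x"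

lemma lab_Ob: "lab A x \<Longrightarrow> A \<in> Ob Nec"
  and lab_in: "\<lbrakk>lab A x; g \<in> nmaps (simplex n) A\<rbrakk> \<Longrightarrow> x n g \<in> fob X n"
  and lab_undef: "\<lbrakk>lab A x; g \<notin> nmaps (simplex n) A\<rbrakk> \<Longrightarrow> x n g = undefined"
  and lab_act: "\<lbrakk>lab A x; g \<in> nmaps (simplex n) A; h \<in> Hom Delta m n\<rbrakk> \<Longrightarrow> x m (compose {..m} g h) =
    far X n m h (x n g)"
  unfolding lab_def by blast+

lemma labI:
  assumes "A \<in> Ob Nec" "\<And>n g. g \<in> nmaps (simplex n) A \<Longrightarrow> x n g \<in> fob X n" "\<And>n g.
    g \<notin> nmaps (simplex n) A \<Longrightarrow> x n g = undefined"
    "\<And>n m g h. \<lbrakk>g \<in> nmaps (simplex n) A; h \<in> Hom Delta m n\<rbrakk> \<Longrightarrow> x m (compose {..m} g h) =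
      far X n m h (x n g)"
  shows "lab A x"
  using assms unfolding lab_def by blast

lemma nmaps_compose_Delta: "\<lbrakk>g \<in> nmaps (simplex n) A; h \<in> Hom Delta m n\<rbrakk> \<Longrightarrow>
  compose {..m} g h \<in> nmaps (simplex m) A"
  using nmaps_comp[of h "simplex m" "simplex n" g A] by (simp add: nmaps_simplices)

lemma compose_assoc': "h \<in> Hom Delta m n \<Longrightarrow> compose {..m} f (compose {..m} g h) =
  compose {..m} (compose {..n} f g) h"
  by (auto simp: compose_def fun_eq_iff)

lemma nmaps_Delta: "g \<in> nmaps (simplex n) A \<Longrightarrow> g \<in> Hom Delta n (snd A)"
  by (simp add: nmaps_simplex)

lemma lab_pull: "\<lbrakk>lab B y; f \<in> nmaps A B\<rbrakk> \<Longrightarrow> lab A (pull A f y)"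
proof (rule labI)
  assume y: "lab B y" and f: "f \<in> nmaps A B"
  show "A \<in> Ob Nec" using nmapsD(5)[OF f] .
  show "pull A f y n g \<in> fob X n" if "g \<in> nmaps (simplex n) A" for n g
    using that lab_in[OF y nmaps_comp[OF that f]] by (simp add: pull_def)
  show "pull A f y m (compose {..m} g h) = far X n m h (pull A f y n g)"
    if g: "g \<in> nmaps (simplex n) A" and h: "h \<in> Hom Delta m n" for n m g h
    using nmaps_comp[OF g f] lab_act[OF y _ h, of "compose {..n} f g"] g nmaps_compose_Delta[OF g h]
      compose_assoc'[OF h, of f g]
    by (simp add: pull_def)
qed (simp add: pull_def)

lemma pull_pull: "\<lbrakk>f \<in> nmaps A B\<rbrakk> \<Longrightarrow> pull A f (pull B g y) = pull A (compose {..snd A} g f) y"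
proof (intro ext)
  fix n h assume f: "f \<in> nmaps A B"
  show "pull A f (pull B g y) n h = pull A (compose {..snd A} g f) y n h"
    using nmaps_comp[of h "simplex n" A f B] f compose_assoc'[OF nmaps_Delta, of h n A g f]
    by (cases "h \<in> nmaps (simplex n) A") (simp_all add: pull_def)
qed

lemma pull_id: "lab A x \<Longrightarrow> pull A (Ident Delta (snd A)) x = x"
proof (intro ext)
  fix n g assume x: "lab A x"
  have "compose {..n} (Ident Delta (snd A)) g = g" if "g \<in> nmaps (simplex n) A"
    using category_Ident_Comp[OF category_Delta nmaps_Delta[OF that]] by simp
  then show "pull A (Ident Delta (snd A)) x n g = x n g"
    using lab_undef[OF x] by (simp add: pull_def)
qed

lemma vert_in: "\<lbrakk>lab A x; i \<le> snd A\<rbrakk> \<Longrightarrow> vert x i \<in> fob X 0"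
  unfolding vert_def by (rule lab_in[where A = A and x = x]) (auto intro: nmaps_point lab_Ob)

lemma vert_pull: "\<lbrakk>f \<in> nmaps A B; i \<le> snd A\<rbrakk> \<Longrightarrow> vert (pull A f y) i = vert y (f i)"
proof -
  assume f: "f \<in> nmaps A B" and i: "i \<le> snd A"
  have "compose {..0} f (shift 0 i) = shift 0 (f i)"
    by (auto simp: compose_def shift_def fun_eq_iff)
  then show ?thesis using nmaps_point[OF nmapsD(5)[OF f] i] by (simp add: vert_def pull_def)
qed

lemma lab_hat: "s \<in> fob X n \<Longrightarrow> lab (simplex n) (hat n s)"
  unfolding hat_def nmaps_simplices
  by (rule labI) (auto simp: nmaps_simplices act_in act_comp compose_Hom_Delta simp
    del: Delta_simps(2))

lemma pull_hat: "\<lbrakk>lab A x; g \<in> nmaps (simplex n) A\<rbrakk> \<Longrightarrow> pull (simplex n) g x = hat n (x n g)"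
  unfolding pull_def hat_def by (auto simp: nmaps_simplices lab_act fun_eq_iff simp
    del: Delta_simps(2))

lemma vert_hat0: "s \<in> fob X 0 \<Longrightarrow> vert (hat 0 s) 0 = s"
  using act_id[of s 0] nmaps_id[of "simplex 0"]
  by (simp add: vert_def hat_def shift_def) (simp add: Delta_simps(3))

lemma lab_sub: "\<lbrakk>lab A x; i \<le> j; j \<le> snd A\<rbrakk> \<Longrightarrow> lab (restr A i j) (sub A x i j)"
  unfolding sub_def using lab_pull nmaps_restr lab_Ob by blast

lemma vert_sub: "\<lbrakk>lab A x; i \<le> j; j \<le> snd A; k \<le> j - i\<rbrakk> \<Longrightarrow> vert (sub A x i j) k = vert x (k + i)"
  unfolding sub_def using vert_pull[OF nmaps_restr, of A i j k x] lab_Ob[of A x] by simp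

lemma sub_full: "lab A x \<Longrightarrow> sub A x 0 (snd A) = x"
proof -
  assume x: "lab A x"
  have "shift (snd A) 0 = Ident Delta (snd A)" by (auto simp: shift_def Delta_simps(3))
  then show ?thesis using pull_id[OF x] restr_full[OF lab_Ob[OF x]] by (simp add: sub_def)
qed

lemma sub_point: "\<lbrakk>lab A x; i \<le> snd A\<rbrakk> \<Longrightarrow> sub A x i i = hat 0 (vert x i)"
  using pull_hat[OF _ nmaps_point] lab_Ob[of A x] by (simp add: sub_def restr_point vert_def)

lemma sub_pull:
  assumes f: "f \<in> nmaps A B" and ij: "i \<le> j" "j \<le> snd A"
  shows "pull (restr A i j) (seg f i j) (sub B y (f i) (f j)) = sub A (pull A f y) i j"
proof -
  have A: "A \<in> Ob Nec" and B: "B \<in> Ob Nec" using nmapsD[OF f] by auto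
  have le: "f i \<le> f j" "f j \<le> snd B" using nmapsD(2,3)[OF f] ij by auto
  have s: "seg f i j \<in> nmaps (restr A i j) (restr B (f i) (f j))"
    using seg_Hom[OF f ij] Hom_Nec_nmaps[of "restr A i j" "restr B (f i) (f j)"] ij le by simp
  show ?thesis
    unfolding sub_def pull_pull[OF s] pull_pull[OF nmaps_restr[OF A ij]]
    using compose_shift[OF nmapsD(1)[OF f] ij] by simp
qed

section \<open>Gluing labellings along a wedge\<close>

abbreviation "inl A \<equiv> shift (snd A) 0"
abbreviation "inr A B \<equiv> shift (snd B) (snd A)"

lemma inl: "\<lbrakk>A \<in> Ob Nec; B \<in> Ob Nec\<rbrakk> \<Longrightarrow> inl A \<in> nmaps A (wedge A B)"
  using nmaps_restr[OF wedge_Ob, of A B 0 "snd A"] restr_wedge_left[of A B 0 "snd A"] restr_full[of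
    A] by simp

lemma inr: "\<lbrakk>A \<in> Ob Nec; B \<in> Ob Nec\<rbrakk> \<Longrightarrow> inr A B \<in> nmaps B (wedge A B)"
  using nmaps_restr[OF wedge_Ob, of A B "snd A" "snd A + snd B"] restr_wedge_right[of A B 0 "snd B"]
    restr_full[of B] by simp

text \<open>Every simplex of a wedge lies in one half, decided by its last vertex. A simplex
  constant at the glued vertex lies in both and is assigned to the first.\<close>

definition wlab :: "necklace \<Rightarrow> (nat \<Rightarrow> (nat \<Rightarrow> nat) \<Rightarrow> 'x) \<Rightarrow> necklace \<Rightarrow> (nat \<Rightarrow> (nat \<Rightarrow> nat) \<Rightarrow> 'x) \<Rightarrow>
  nat \<Rightarrow> (nat \<Rightarrow> nat) \<Rightarrow> 'x" where
  "wlab A x B y = (\<lambda>n g. if g \<in> nmaps (simplex n) (wedge A B) then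
      (if g n \<le> snd A then x n g else y n (\<lambda>k\<in>{..n}. g k - snd A)) else undefined)"

context
  fixes A B
  assumes A: "A \<in> Ob Nec" and B: "B \<in> Ob Nec"
begin

lemma wedge_simplex_left:
  assumes g: "g \<in> nmaps (simplex n) (wedge A B)" and le: "g n \<le> snd A"
  shows "g \<in> nmaps (simplex n) A" "compose {..n} (inl A) g = g"
proof -
  have gD: "g \<in> {..n} \<rightarrow>\<^sub>E {..snd A + snd B}" "mono_on {..n} g" and b: "bead (wedge A B) (g 0) (g n)"
    using g by (auto simp: nmaps_simplex)
  have gle: "g k \<le> snd A" if "k \<le> n" for k using gD(2) that le unfolding monotone_on_def
    by (meson atMost_iff order_refl le_trans)
  have "bead A (g 0) (g n)" using b unfolding bead_def by (auto simp: wedge_def)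
  then show "g \<in> nmaps (simplex n) A" using A gD gle by (auto simp: nmaps_simplex PiE_def Pi_def)
  show "compose {..n} (inl A) g = g" using gD gle
    by (auto simp: compose_def fun_eq_iff PiE_def extensional_def)
qed

lemma wedge_simplex_right:
  assumes g: "g \<in> nmaps (simplex n) (wedge A B)" and le: "snd A \<le> g 0"
  shows "(\<lambda>k\<in>{..n}. g k - snd A) \<in> nmaps (simplex n) B" "compose {..n} (inr A B) (\<lambda>k\<in>{..n}.
    g k - snd A) = g"
proof -
  have gD: "g \<in> {..n} \<rightarrow>\<^sub>E {..snd A + snd B}" "mono_on {..n} g" and b: "bead (wedge A B) (g 0) (g n)"
    using g by (auto simp: nmaps_simplex)
  have gle: "snd A \<le> g k" "g k \<le> snd A + snd B" if "k \<le> n" for k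
    using gD that le unfolding monotone_on_def by (auto intro: le_trans)
  have "bead B (g 0 - snd A) (g n - snd A)" unfolding bead_def
  proof
    assume "\<exists>t\<in>fst B. g 0 - snd A < t \<and> t < g n - snd A"
    then obtain t where t: "t \<in> fst B" "g 0 < snd A + t" "snd A + t < g n" by auto
    then have "snd A + t \<in> fst (wedge A B)" by (auto simp: wedge_def)
    with b t show False unfolding bead_def by blast
  qed
  then show "(\<lambda>k\<in>{..n}. g k - snd A) \<in> nmaps (simplex n) B"
    using B gD(2) gle by (auto simp: nmaps_simplex monotone_on_def intro!: diff_le_mono)
      (metis add.commute le_diff_conv)
  have "g k - snd A \<le> snd B" if "k \<le> n" for k using gle[OF that] by simp
  then show "compose {..n} (inr A B) (\<lambda>k\<in>{..n}. g k - snd A) = g"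
    using gD gle by (auto simp: compose_def fun_eq_iff PiE_def extensional_def shift_def)
qed

text \<open>The glued vertex is a joint and a simplex stays in one bead, so a simplex that passes
  beyond this vertex cannot start before it.\<close>

lemma wedge_simplex_cases:
  assumes g: "g \<in> nmaps (simplex n) (wedge A B)" and le: "\<not> g n \<le> snd A"
  shows "snd A \<le> g 0"
proof -
  have "snd A \<in> fst (wedge A B)" using A by (auto simp: wedge_def Ob_Nec)
  then show ?thesis using g le unfolding nmaps_simplex bead_def by force
qed

text \<open>A labelling of a wedge amounts to its two restrictions. The identities for glued
  labellings below are therefore checked on the halves.\<close>

lemma wlab_eq:
  assumes w: "lab (wedge A B) w"
  shows "w = wlab A (pull A (inl A) w) B (pull B (inr A B) w)"
proof (intro ext)
  fix n g
  show "w n g = wlab A (pull A (inl A) w) B (pull B (inr A B) w) n g"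
  proof (cases "g \<in> nmaps (simplex n) (wedge A B)")
    case True
    show ?thesis
    proof (cases "g n \<le> snd A")
      case le: True
      then show ?thesis using True wedge_simplex_left[OF True le] by (simp add: wlab_def pull_def)
    next
      case False
      then show ?thesis using True wedge_simplex_right[OF True wedge_simplex_cases[OF True False]]
        by (simp add: wlab_def pull_def)
    qed
  qed (simp add: wlab_def lab_undef[OF w])
qed

context
  fixes x y
  assumes x: "lab A x" and y: "lab B y" and xy: "vert x (snd A) = vert y 0"
begin

text \<open>Both sides are the degenerate simplex at the common vertex. This makes the two branches
  of \<open>wlab\<close> consistent where they overlap.\<close>

lemma wlab_const: "x n (\<lambda>k\<in>{..n}. snd A) = y n (\<lambda>k\<in>{..n}. 0)"
proof -
  have h: "(\<lambda>k\<in>{..n}. 0) \<in> Hom Delta n 0" by (auto simp: monotone_on_def)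
  have "compose {..n} (shift 0 (snd A)) (\<lambda>k\<in>{..n}. 0) = (\<lambda>k\<in>{..n}. snd A)"
    "compose {..n} (shift 0 0) (\<lambda>k\<in>{..n}. 0) = (\<lambda>k\<in>{..n}. 0)" by (auto simp: compose_def fun_eq_iff)
  then show ?thesis
    using lab_act[OF x nmaps_point[OF A] h, of "snd A"] lab_act[OF y nmaps_point[OF B] h, of 0] xy
      by (simp add: vert_def)
qed

lemma lab_wlab: "lab (wedge A B) (wlab A x B y)"
proof (rule labI)
  show "wedge A B \<in> Ob Nec" using A B by simp
  show "wlab A x B y n g \<in> fob X n" if g: "g \<in> nmaps (simplex n) (wedge A B)" for n g
    using g wedge_simplex_left(1)[OF g] wedge_simplex_right(1)[OF g wedge_simplex_cases[OF g]]
      lab_in[OF x] lab_in[OF y]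
    by (simp add: wlab_def)
  fix n m g h assume g: "g \<in> nmaps (simplex n) (wedge A B)" and h: "h \<in> Hom Delta m n"
  note gh = nmaps_compose_Delta[OF g h]
  have hm: "h k \<le> n" if "k \<le> m" for k using h that by auto
  have mono: "g k \<le> g l" if "k \<le> l" "l \<le> n" for k l using nmapsD(3)[OF g] that by simp
  show "wlab A x B y m (compose {..m} g h) = far X n m h (wlab A x B y n g)"
  proof (cases "g n \<le> snd A")
    case True
    then have "g (h m) \<le> snd A" using mono[of "h m" n] hm[of m] by simp
    then show ?thesis using True g gh lab_act[OF x wedge_simplex_left(1)[OF g True] h]
      by (simp add: wlab_def) (simp add: compose_def)
  next
    case False
    let ?g = "\<lambda>k\<in>{..n}. g k - snd A"
    note g0 = wedge_simplex_cases[OF g False]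
    note g' = wedge_simplex_right[OF g g0]
    have c: "compose {..m} ?g h = (\<lambda>k\<in>{..m}. compose {..m} g h k - snd A)" using hm
      by (auto simp: compose_def fun_eq_iff)
    have R: "far X n m h (wlab A x B y n g) = y m (compose {..m} ?g h)"
      using lab_act[OF y g'(1) h] False g by (simp add: wlab_def)
    show ?thesis
    proof (cases "compose {..m} g h m \<le> snd A")
      case True
      \<comment> \<open>A face of a simplex in the second half can shrink to the glued vertex, and
        \<open>wlab\<close> then counts it in the first half; \<open>wlab_const\<close> reconciles
        the two values.\<close>
      have "g (h k) = snd A" if "k \<le> m" for k
      proof -
        have "h k \<le> h m" using h that by (auto simp: monotone_on_def)
        then show ?thesis using True g0 mono[of 0 "h k"] mono[of "h k" "h m"] hm[of m] hm[OF that]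
          by (simp add: compose_def)
      qed
      then have "compose {..m} g h = (\<lambda>k\<in>{..m}. snd A)" "compose {..m} ?g h = (\<lambda>k\<in>{..m}. 0)"
        using hm by (auto simp: compose_def fun_eq_iff)
      then show ?thesis unfolding R using True gh wlab_const by (simp add: wlab_def)
    next
      case False
      then show ?thesis unfolding R c using gh by (simp add: wlab_def)
    qed
  qed
qed (simp add: wlab_def)

lemma pull_wlab: "pull A (inl A) (wlab A x B y) = x" "pull B (inr A B) (wlab A x B y) = y"
proof -
  show "pull A (inl A) (wlab A x B y) = x"
  proof (intro ext)
    fix n g
    show "pull A (inl A) (wlab A x B y) n g = x n g"
    proof (cases "g \<in> nmaps (simplex n) A")
      case True
      have "compose {..n} (inl A) g = g"
        using nmapsD(2)[OF True] nmaps_Delta[OF True]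
          by (auto simp: compose_def fun_eq_iff PiE_def extensional_def)
      then show ?thesis using True nmaps_comp[OF True inl[OF A B]] nmapsD(2)[OF True, of n]
        by (simp add: pull_def wlab_def)
    qed (simp add: pull_def lab_undef[OF x])
  qed
  show "pull B (inr A B) (wlab A x B y) = y"
  proof (intro ext)
    fix n g
    show "pull B (inr A B) (wlab A x B y) n g = y n g"
    proof (cases "g \<in> nmaps (simplex n) B")
      case True
      let ?g = "compose {..n} (inr A B) g"
      have g: "?g k = g k + snd A" if "k \<le> n" for k using nmapsD(2)[OF True, of k] that
        by (simp add: compose_def)
      have "(\<lambda>k\<in>{..n}. ?g k - snd A) = g"
        using g nmaps_Delta[OF True] by (auto simp: fun_eq_iff PiE_def extensional_def)
      \<comment> \<open>Simplices constant at the first vertex of B are assigned to A by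
        \<open>wlab\<close>, so these alone need \<open>wlab_const\<close>.\<close>
      moreover have "?g = (\<lambda>k\<in>{..n}. snd A)" "g = (\<lambda>k\<in>{..n}. 0)" if "g n = 0"
      proof -
        have "g k = 0" if "k \<le> n" for k using nmapsD(3)[OF True, of k n] that \<open>g n = 0\<close> by simp
        then show "?g = (\<lambda>k\<in>{..n}. snd A)" "g = (\<lambda>k\<in>{..n}. 0)"
          using g nmaps_Delta[OF True] by (auto simp: compose_def fun_eq_iff PiE_def
            extensional_def)
      qed
      ultimately show ?thesis
        using True nmaps_comp[OF True inr[OF A B]] g[of n] wlab_const[of n]
        by (cases "g n = 0") (simp_all add: pull_def wlab_def)
    qed (simp add: pull_def lab_undef[OF y])
  qed
qed

lemma vert_wlab: "i \<le> snd A \<Longrightarrow> vert (wlab A x B y) i = vert x i" "j \<le> snd B \<Longrightarrow>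
  vert (wlab A x B y) (snd A + j) = vert y j"
  using vert_pull[OF inl[OF A B], of i "wlab A x B y"] vert_pull[OF inr[OF A B], of j
    "wlab A x B y"]
  by (simp_all add: pull_wlab add.commute)

end

end

lemma wlab_unit_left: assumes x: "lab A x" shows "wlab (simplex 0) (hat 0 (vert x 0)) A x = x"
proof -
  note A = lab_Ob[OF x]
  have w: "lab (wedge (simplex 0) A) x" using x wedge_unit[OF A] by simp
  have s: "shift (snd A) 0 = Ident Delta (snd A)" by (auto simp: shift_def Delta_simps(3))
  show ?thesis
    using wlab_eq[OF simplex_Ob A w] pull_id[OF x] pull_hat[OF x nmaps_point[OF A], of 0]
      by (simp add: vert_def s)
qed

lemma wlab_unit_right: assumes x: "lab A x" shows "wlab A x (simplex 0) (hat 0 (vert x (snd A))) =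
  x"
proof -
  note A = lab_Ob[OF x]
  have w: "lab (wedge A (simplex 0)) x" using x wedge_unit[OF A] by simp
  have s: "shift (snd A) 0 = Ident Delta (snd A)" by (auto simp: shift_def Delta_simps(3))
  show ?thesis
    using wlab_eq[OF A simplex_Ob w] pull_id[OF x] pull_hat[OF x nmaps_point[OF A], of "snd A"]
      by (simp add: vert_def s)
qed

text \<open>The inclusions of the three pieces into the triple wedge agree for both bracketings
  (\<open>c1\<close> to \<open>c3\<close>), and \<open>wlab_eq\<close> compares labellings on the
  pieces.\<close>

lemma wlab_assoc:
  assumes x: "lab A x" and y: "lab B y" and v: "lab C v" and xy: "vert x (snd A) = vert y 0"
    and yv: "vert y (snd B) = vert v 0"
  shows "wlab (wedge A B) (wlab A x B y) C v = wlab A x (wedge B C) (wlab B y C v)"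
proof -
  note ob = lab_Ob[OF x] lab_Ob[OF y] lab_Ob[OF v]
  note xyl = lab_wlab[OF ob(1,2) x y xy] and yvl = lab_wlab[OF ob(2,3) y v yv]
  have o2: "wedge A B \<in> Ob Nec" "wedge B C \<in> Ob Nec" using ob by simp_all
  have e1: "vert (wlab A x B y) (snd (wedge A B)) = vert v 0"
    using vert_wlab(2)[OF ob(1,2) x y xy, of "snd B"] yv by simp
  let ?w = "wlab (wedge A B) (wlab A x B y) C v"
  have w: "lab (wedge A (wedge B C)) ?w" using lab_wlab[OF o2(1) ob(3) xyl v e1]
    by (simp add: wedge_assoc)
  note p = pull_wlab[OF o2(1) ob(3) xyl v e1]
  have c1: "compose {..snd A} (inl (wedge A B)) (inl A) = inl A"
    by (auto simp: compose_def shift_def fun_eq_iff)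
  have c2: "compose {..snd B} (inr A (wedge B C)) (inl B) =
    compose {..snd B} (inl (wedge A B)) (inr A B)"
    by (auto simp: compose_def shift_def fun_eq_iff)
  have c3: "compose {..snd C} (inr A (wedge B C)) (inr B C) = inr (wedge A B) C"
    by (auto simp: compose_def shift_def fun_eq_iff)
  have 1: "pull A (inl A) ?w = x"
    using pull_pull[OF inl[OF ob(1,2)], of "inl (wedge A B)" ?w] p(1) pull_wlab(1)[OF ob(1,2) x y
      xy] by (simp only: c1)
  have "pull B (inl B) (pull (wedge B C) (inr A (wedge B C)) ?w) = y"
    unfolding pull_pull[OF inl[OF ob(2,3)]] c2 pull_pull[OF inr[OF ob(1,2)], symmetric] p(1)
    by (rule pull_wlab(2)[OF ob(1,2) x y xy])
  moreover have "pull C (inr B C) (pull (wedge B C) (inr A (wedge B C)) ?w) = v"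
    unfolding pull_pull[OF inr[OF ob(2,3)]] c3 by (rule p(2))
  moreover have "lab (wedge B C) (pull (wedge B C) (inr A (wedge B C)) ?w)"
    by (rule lab_pull[OF w inr[OF ob(1) o2(2)]])
  ultimately have 2: "pull (wedge B C) (inr A (wedge B C)) ?w = wlab B y C v"
    using wlab_eq[OF ob(2,3)] by metis
  show ?thesis using wlab_eq[OF ob(1) o2(2) w] unfolding 1 2 .
qed

text \<open>Gluing is natural in both necklaces, because wedge maps restrict to the given maps on
  the halves. Naturality of the legs that define \<open>mult\<close> rests on this.\<close>

lemma wlab_pull:
  assumes x: "lab A' x" and y: "lab B' y" and xy: "vert x (snd A') = vert y 0"
    and f: "f \<in> Hom Nec A A'" and g: "g \<in> Hom Nec B B'" and A: "A \<in> Ob Nec" and B: "B \<in> Ob Nec"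
    and fg: "wedge_map A A' B B' f g \<in> Hom Nec (wedge A B) (wedge A' B')"
  shows "pull (wedge A B) (wedge_map A A' B B' f g) (wlab A' x B' y) =
    wlab A (pull A f x) B (pull B g y)"
proof -
  note ob = lab_Ob[OF x] lab_Ob[OF y] A B
  let ?w = "wlab A' x B' y" and ?f = "wedge_map A A' B B' f g"
  have f': "f \<in> nmaps A A'" and g': "g \<in> nmaps B B'" and fg': "?f \<in> nmaps (wedge A B) (wedge A' B')"
    and fg0: "f (snd A) = snd A'" "g 0 = 0"
    using f g fg ob by (simp_all add: Hom_Nec_nmaps)
  have fle: "f k \<le> snd A'" if "k \<le> snd A" for k using nmapsD(2)[OF f' that] .
  have gle: "g k \<le> snd B'" if "k \<le> snd B" for k using nmapsD(2)[OF g' that] .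
  have c1: "compose {..snd A} ?f (inl A) = compose {..snd A} (inl A') f"
    using fle by (auto simp: compose_def wedge_map_def fun_eq_iff)
  have c2: "compose {..snd B} ?f (inr A B) = compose {..snd B} (inr A' B') g"
    using gle fg0 by (auto simp: compose_def wedge_map_def fun_eq_iff)
  have 1: "pull A (inl A) (pull (wedge A B) ?f ?w) = pull A f x"
    unfolding pull_pull[OF inl[OF A B]] c1 pull_pull[OF f', symmetric]
      by (simp add: pull_wlab[OF ob(1,2) x y xy])
  have 2: "pull B (inr A B) (pull (wedge A B) ?f ?w) = pull B g y"
    unfolding pull_pull[OF inr[OF A B]] c2 pull_pull[OF g', symmetric]
      by (simp add: pull_wlab[OF ob(1,2) x y xy])
  show ?thesis
    using wlab_eq[OF A B lab_pull[OF lab_wlab[OF ob(1,2) x y xy] fg']] unfolding 1 2 .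
qed

text \<open>Cutting at a vertex that is not a joint amounts to pulling back along the vertex
  identity that forgets it. This matches the shape of the composition of \<open>Psi\<close>.\<close>

lemma wlab_sub:
  assumes x: "lab A x" and ikj: "i \<le> k" "k \<le> j" "j \<le> snd A"
  shows "wlab (restr A i k) (sub A x i k) (restr A k j) (sub A x k j) =
    pull (wedge (restr A i k) (restr A k j)) (Ident Delta (j - i)) (sub A x i j)"
proof -
  note A = lab_Ob[OF x]
  let ?A = "restr A i k" and ?B = "restr A k j" and ?f = "Ident Delta (j - i)"
  have ob: "?A \<in> Ob Nec" "?B \<in> Ob Nec" "restr A i j \<in> Ob Nec" using ikj by simp_all
  have f: "?f \<in> nmaps (wedge ?A ?B) (restr A i j)"
    using restr_wedge_sub[OF ikj(1,2), of A] ob by (simp add: Hom_Nec_nmaps)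
  have sx: "lab (restr A i j) (sub A x i j)" using lab_sub[OF x] ikj by simp
  let ?w = "pull (wedge ?A ?B) ?f (sub A x i j)"
  have i1: "compose {..k - i} ?f (inl ?A) \<in> nmaps ?A (restr A i j)"
    using nmaps_comp[OF inl[OF ob(1,2)] f] by simp
  have i2: "compose {..j - k} ?f (inr ?A ?B) \<in> nmaps ?B (restr A i j)"
    using nmaps_comp[OF inr[OF ob(1,2)] f] by simp
  have c1: "compose {..k - i} (shift (j - i) i) (compose {..k - i} ?f (inl ?A)) = shift (k - i) i"
    using ikj by (auto simp: compose_def shift_def fun_eq_iff Delta_simps(3))
  have c2: "compose {..j - k} (shift (j - i) i) (compose {..j - k} ?f (inr ?A ?B)) =
    shift (j - k) k"
    using ikj by (auto simp: compose_def shift_def fun_eq_iff Delta_simps(3))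
  have 1: "pull ?A (inl ?A) ?w = sub A x i k"
    using pull_pull[OF inl[OF ob(1,2)], of ?f "sub A x i j"] pull_pull[OF i1, of "shift (j - i) i"
      x] c1 by (simp add: sub_def)
  have 2: "pull ?B (inr ?A ?B) ?w = sub A x k j"
    using pull_pull[OF inr[OF ob(1,2)], of ?f "sub A x i j"] pull_pull[OF i2, of "shift (j - i) i"
      x] c2 by (simp add: sub_def)
  show ?thesis using wlab_eq[OF ob(1,2) lab_pull[OF sx f]] unfolding 1 2 by (rule sym)
qed

end

section \<open>The left adjoint on objects\<close>

type_synonym 'x labelled = "necklace \<times> (nat \<Rightarrow> (nat \<Rightarrow> nat) \<Rightarrow> 'x)"

locale necklace_realization = monoidal_initial W z + cocomplete_monoidal W u + necklaces_in X u
  for W :: "('o, 'a) moncat" and z :: 'o and u :: "'u itself" and X :: "'x sset" +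
  fixes D :: "(necklace, nat \<Rightarrow> nat, 'o, 'a) mftor"
  assumes D: "strong_monoidal Nec W D"
begin

lemmas [simp] = D_Ob[OF D] ar_DA[OF D] mu_iso[OF D] ep_iso[OF D] DA_id[OF D] restr_wedge_sub'[OF D]
  is_wcat_Psi[OF D]

text \<open>
  The category of necklaces in \<open>X\<close> from \<open>a\<close> to \<open>b\<close>.  The hom-object \<open>L(a, b)\<close> of the left adjoint is
  the colimit of \<open>D\<close> over it.
\<close>

definition J :: "'x \<Rightarrow> 'x \<Rightarrow> ('x labelled, nat \<Rightarrow> nat) cat" where
  "J a b = \<lparr>Ob = {(A, x). lab A x \<and> vert x 0 = a \<and> vert x (snd A) = b},
     Hom = (\<lambda>(A, x) (B, y). {f \<in> Hom Nec A B. x = pull A f y}),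
     Ident = (\<lambda>(A, x). Ident Delta (snd A)),
     Comp = (\<lambda>(A, x) (B, y) (C, v) g f. compose {..snd A} g f)\<rparr>"

lemma J_simps [simp]:
  "(A, x) \<in> Ob (J a b) \<longleftrightarrow> lab A x \<and> vert x 0 = a \<and> vert x (snd A) = b"
  "f \<in> Hom (J a b) (A, x) (B, y) \<longleftrightarrow> f \<in> Hom Nec A B \<and> x = pull A f y"
  "Ident (J a b) (A, x) = Ident Delta (snd A)"
  "Comp (J a b) (A, x) (B, y) (C, v) g f = compose {..snd A} g f"
  by (simp_all add: J_def)

lemma catN: "category Nec"
  using functor_dom[OF functor_D[OF D]] .

lemma nmaps_Hom: "\<lbrakk>f \<in> Hom Nec A B; A \<in> Ob Nec; B \<in> Ob Nec\<rbrakk> \<Longrightarrow> f \<in> nmaps A B"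
  by (simp add: Hom_Nec_nmaps)

lemma category_J: "category (J a b)"
  unfolding category_def
proof (intro conjI ballI)
  fix P assume "P \<in> Ob (J a b)"
  then show "Ident (J a b) P \<in> Hom (J a b) P P"
    using category_Ident[OF catN, of "fst P"] pull_id lab_Ob by (cases P) auto
next
  fix P Q f assume h: "P \<in> Ob (J a b)" "Q \<in> Ob (J a b)" "f \<in> Hom (J a b) P Q"
  then have o: "fst P \<in> Ob Nec" "fst Q \<in> Ob Nec" using lab_Ob by (cases P, cases Q, auto)+
  show "Comp (J a b) P P Q f (Ident (J a b) P) = f" "Comp (J a b) P Q Q (Ident (J a b) Q) f = f"
    using h category_Comp_Ident[OF catN _ o, of f] category_Ident_Comp[OF catN _ o, of f]
      by (cases P, cases Q, simp)+
next
  fix P Q R f g assume h: "P \<in> Ob (J a b)" "Q \<in> Ob (J a b)" "R \<in> Ob (J a b)" "f \<in> Hom (J a b) P Q"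
    "g \<in> Hom (J a b) Q R"
  then have o: "fst P \<in> Ob Nec" "fst Q \<in> Ob Nec" "fst R \<in> Ob Nec" using lab_Ob
    by (cases P, cases Q, cases R, auto)+
  show "Comp (J a b) P Q R g f \<in> Hom (J a b) P R"
    using h category_Comp[OF catN _ _ o, of f g] pull_pull[OF nmaps_Hom[OF _ o(1,2)], of f g]
    by (cases P, cases Q, cases R, simp)
next
  fix P Q R S f g k
  assume h: "P \<in> Ob (J a b)" "Q \<in> Ob (J a b)" "R \<in> Ob (J a b)" "S \<in> Ob (J a b)"
    "f \<in> Hom (J a b) P Q" "g \<in> Hom (J a b) Q R" "k \<in> Hom (J a b) R S"
  then have o: "fst P \<in> Ob Nec" "fst Q \<in> Ob Nec" "fst R \<in> Ob Nec" "fst S \<in> Ob Nec"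
    using lab_Ob by (cases P, cases Q, cases R, cases S, auto)+
  show "Comp (J a b) P R S k (Comp (J a b) P Q R g f) =
    Comp (J a b) P Q S (Comp (J a b) Q R S k g) f"
    using h category_assoc[OF catN _ _ _ o, of f g k]
    by (cases P, cases Q, cases R, cases S, simp)
qed

lemma X_small: "small u (fob X n)"
  using functor_ob[OF X, of n] by simp

text \<open>Each simplex of A factors through a stretch inclusion into a bead. A labelling is thus
  given by finitely many values, which makes \<open>lab_small\<close> a finite product
  argument.\<close>

lemma lab_determined:
  assumes x: "lab A x" and y: "lab A y"
    and eq: "\<And>i j. \<lbrakk>i \<le> j; j \<le> snd A; bead A i j\<rbrakk> \<Longrightarrow> x (j - i) (shift (j - i) i) =
      y (j - i) (shift (j - i) i)"
  shows "x = y"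
proof (intro ext)
  fix n g
  show "x n g = y n g"
  proof (cases "g \<in> nmaps (simplex n) A")
    case True
    then have g: "g \<in> Hom Delta n (snd A)" "bead A (g 0) (g n)" by (simp_all add: nmaps_simplex)
    have le: "g 0 \<le> g n" "g n \<le> snd A" using nmapsD(2,3)[OF True] by auto
    let ?s = "shift (g n - g 0) (g 0)"
    have s: "?s \<in> nmaps (simplex (g n - g 0)) A" using bead_shift[OF lab_Ob[OF x] g(2) le] .
    have h: "seg g 0 n \<in> Hom Delta n (g n - g 0)" using seg_Delta[OF g(1), of 0 n] by simp
    have "compose {..n} ?s (seg g 0 n) = compose {..n} g (shift n 0)"
      using compose_shift[OF g(1), of 0 n] by simp
    also have "\<dots> = g" using g(1) by (auto simp: compose_def fun_eq_iff PiE_def extensional_def)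
    finally show ?thesis using lab_act[OF x s h] lab_act[OF y s h] eq[OF le g(2)] by simp
  qed (simp add: lab_undef[OF x] lab_undef[OF y])
qed

lemma lab_small: "small u {x. lab A x}"
proof (cases "A \<in> Ob Nec")
  case True
  let ?I = "{(i, j). i \<le> j \<and> j \<le> snd A \<and> bead A i j}"
  let ?f = "\<lambda>x. \<lambda>(i, j)\<in>?I. x (j - i) (shift (j - i) i)"
  show ?thesis
  proof (rule small_inj[OF U])
    show "inj_on ?f {x. lab A x}"
    proof (rule inj_onI)
      fix x y assume xy: "x \<in> {x. lab A x}" "y \<in> {x. lab A x}" and eq: "?f x = ?f y"
      show "x = y"
      proof (rule lab_determined)
        show "x (j - i) (shift (j - i) i) = y (j - i) (shift (j - i) i)"
          if "i \<le> j" "j \<le> snd A" "bead A i j" for i j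
          using fun_cong[OF eq, of "(i, j)"] that by simp
      qed (use xy in auto)
    qed
    show "?f ` {x. lab A x} \<subseteq> Pi\<^sub>E ?I (\<lambda>(i, j). fob X (j - i))"
    proof (rule image_subsetI)
      fix x assume "x \<in> {x. lab A x}"
      then have "x (j - i) (shift (j - i) i) \<in> fob X (j - i)" if "i \<le> j" "j \<le> snd A" "bead A i j"
        for i j
        using lab_in[of A x] bead_shift[OF True that(3,1,2)] by simp
      then show "?f x \<in> Pi\<^sub>E ?I (\<lambda>(i, j). fob X (j - i))" unfolding restrict_PiE_iff by auto
    qed
    have "finite ?I" by (rule finite_subset[of _ "{..snd A} \<times> {..snd A}"]) auto
    then show "small u (Pi\<^sub>E ?I (\<lambda>(i, j). fob X (j - i)))"
      by (rule small_PiE[OF U]) (auto simp: X_small)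
  qed
next
  case False
  then have "{x. lab A x} = {}" using lab_Ob by blast
  then show ?thesis by (simp add: small_finite[OF U])
qed

text \<open>A necklace is a number with a finite set of numbers, and countable sets are small
  because the universe is uncountable.\<close>

lemma Nec_small: "small u (Ob Nec)"
proof -
  have "small u (Sigma (UNIV :: nat set) (\<lambda>p. Pow {..p}))"
    by (intro small_Sigma[OF U] small_nat[OF U] small_finite[OF U]) simp
  then have "small u ((\<lambda>(p, T). (T, p)) ` Sigma (UNIV :: nat set) (\<lambda>p. Pow {..p}))"
    by (rule small_image[OF U])
  moreover have "Ob Nec \<subseteq> (\<lambda>(p, T). (T, p)) ` Sigma (UNIV :: nat set) (\<lambda>p. Pow {..p})"
    by (auto simp: Ob_Nec image_iff)
  ultimately show ?thesis using small_inj[OF U, of id] by simp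
qed

lemma Ob_J_small: "small u (Ob (J a b))"
proof (rule small_inj[OF U, of id])
  show "small u (Sigma (Ob Nec) (\<lambda>A. {x. lab A x}))"
    by (intro small_Sigma[OF U] Nec_small lab_small)
  show "id ` Ob (J a b) \<subseteq> Sigma (Ob Nec) (\<lambda>A. {x. lab A x})" using lab_Ob by auto
qed simp

text \<open>One bound for all hom-sets together, as the transport to \<open>copy\<close> embeds all
  arrows by one map.\<close>

lemma Hom_J_small: "small u (\<Union>P\<in>Ob (J a b). \<Union>Q\<in>Ob (J a b). Hom (J a b) P Q)"
proof (rule small_inj[OF U, of id])
  show "small u (\<Union>p\<in>(UNIV :: nat set). \<Union>q\<in>(UNIV :: nat set). {..p} \<rightarrow>\<^sub>E {..q})"
    by (intro small_UN[OF U] small_nat[OF U] small_finite[OF U] finite_PiE) auto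
  show "id ` (\<Union>P\<in>Ob (J a b). \<Union>Q\<in>Ob (J a b). Hom (J a b) P Q) \<subseteq> (\<Union>p\<in>(UNIV :: nat set).
    \<Union>q\<in>(UNIV :: nat set). {..p} \<rightarrow>\<^sub>E {..q})"
    by (auto simp: Hom_Nec) blast
qed simp

definition DJ :: "'x \<Rightarrow> 'x \<Rightarrow> ('x labelled, nat \<Rightarrow> nat, 'o, 'a) ftor" where
  "DJ a b = mk_ftor (J a b) (\<lambda>P. fob D (fst P)) (\<lambda>P Q f. far D (fst P) (fst Q) f)"

lemma is_functor_DJ: "is_functor (J a b) W (DJ a b)"
  unfolding DJ_def
proof (rule is_functor_mk_ftor[OF category_J catW])
  note Df = functor_D[OF D]
  show "fob D (fst P) \<in> Ob W" if "P \<in> Ob (J a b)" for P using that lab_Ob by (cases P) auto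
  show "far D (fst P) (fst Q) f \<in> Hom W (fob D (fst P)) (fob D (fst Q))"
    if "P \<in> Ob (J a b)" "Q \<in> Ob (J a b)" "f \<in> Hom (J a b) P Q" for P Q f
    using that lab_Ob functor_ar[OF Df, of f "fst P" "fst Q"] by (cases P, cases Q) auto
  show "far D (fst P) (fst P) (Ident (J a b) P) = Ident W (fob D (fst P))" if "P \<in> Ob (J a b)" for P
    using that lab_Ob functor_Ident[OF Df, of "fst P"] by (cases P) auto
  show "far D (fst P) (fst R) (Comp (J a b) P Q R g f) =
    Comp W (fob D (fst P)) (fob D (fst Q)) (fob D (fst R)) (far D (fst Q) (fst R) g) (far D (fst P)
      (fst Q) f)"
    if "P \<in> Ob (J a b)" "Q \<in> Ob (J a b)" "R \<in> Ob (J a b)" "f \<in> Hom (J a b) P Q"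
      "g \<in> Hom (J a b) Q R" for P Q R f g
    using that lab_Ob functor_Comp[OF Df, of f "fst P" "fst Q" g "fst R"]
      by (cases P, cases Q, cases R) auto
qed

section \<open>Hom-objects of the left adjoint and their composition\<close>

definition Fo :: "'x labelled \<Rightarrow> 'o" where "Fo P = fob D (fst P)"
definition Fa :: "'x labelled \<Rightarrow> 'x labelled \<Rightarrow> (nat \<Rightarrow> nat) \<Rightarrow> 'o \<times> 'a \<times> 'o" where "Fa P Q f =
  DA D (fst P) (fst Q) f"

definition Lob :: "'x \<Rightarrow> 'x \<Rightarrow> 'o" where "Lob a b = (SOME c. \<exists>l. colim (J a b) Fo Fa c l)"
definition Lin :: "'x \<Rightarrow> 'x \<Rightarrow> 'x labelled \<Rightarrow> 'o \<times> 'a \<times> 'o" where "Lin a b =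
  (SOME l. colim (J a b) Fo Fa (Lob a b) l)"

lemma colim_L: "colim (J a b) Fo Fa (Lob a b) (Lin a b)"
proof -
  obtain c l where "colim (J a b) (fob (DJ a b)) (\<lambda>P Q f.
    (fob (DJ a b) P, far (DJ a b) P Q f, fob (DJ a b) Q)) c l"
    using colim_exists[OF category_J Ob_J_small Hom_J_small is_functor_DJ] by blast
  then have "colim (J a b) Fo Fa c l"
    unfolding colim_def by (auto simp: DJ_def mk_ftor_simps Fo_def Fa_def DA_def)
  then show ?thesis unfolding Lin_def Lob_def by (metis (mono_tags, lifting) someI_ex)
qed

lemma Lob [simp]: "Lob a b \<in> Ob W"
  using colim_ar(1)[OF colim_L] .

text \<open>The coprojection of the colimit at a labelled necklace; the indices of the hom-object
  are read off from the labels of the endpoints.\<close>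

definition inc :: "necklace \<Rightarrow> (nat \<Rightarrow> (nat \<Rightarrow> nat) \<Rightarrow> 'x) \<Rightarrow> 'o \<times> 'a \<times> 'o" where
  "inc A x = Lin (vert x 0) (vert x (snd A)) (A, x)"

lemma inc [simp]:
  assumes "lab A x"
  shows "ar (inc A x)" "dm (inc A x) = fob D A" "cd (inc A x) = Lob (vert x 0) (vert x (snd A))"
  using colim_ar(2-4)[OF colim_L, of "(A, x)" "vert x 0" "vert x (snd A)"] assms
    by (simp_all add: inc_def Fo_def)

lemma inc_natural:
  assumes f: "f \<in> Hom Nec A B" and A: "A \<in> Ob Nec" and y: "lab B y"
  shows "inc B y \<cdot> DA D A B f = inc A (pull A f y)"
proof -
  note B = lab_Ob[OF y]
  note f' = nmaps_Hom[OF f A B]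
  have e: "f 0 = 0" "f (snd A) = snd B" using f by (simp_all add: Hom_Nec)
  have v: "vert (pull A f y) 0 = vert y 0" "vert (pull A f y) (snd A) = vert y (snd B)"
    using vert_pull[OF f', of 0 y] vert_pull[OF f', of "snd A" y] e by simp_all
  have "Lin (vert y 0) (vert y (snd B)) (B, y) \<cdot> Fa (A, pull A f y) (B, y) f =
    Lin (vert y 0) (vert y (snd B)) (A, pull A f y)"
    using f y lab_pull[OF y f'] v by (intro colim_ar(9)[OF colim_L]) simp_all
  then show ?thesis by (simp add: inc_def Fa_def v)
qed

lemma L_epi:
  assumes "ar h" "ar h'" "dm h = Lob a b" "dm h' = Lob a b" "cd h = cd h'"
    and "\<And>A x. \<lbrakk>lab A x; vert x 0 = a; vert x (snd A) = b\<rbrakk> \<Longrightarrow> h \<cdot> inc A x = h' \<cdot> inc A x"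
  shows "h = h'"
proof (rule colim_epi[OF colim_L assms(1-5)])
  fix P assume "P \<in> Ob (J a b)"
  then show "h \<cdot> Lin a b P = h' \<cdot> Lin a b P" using assms(6)[of "fst P" "snd P"]
    by (cases P) (simp add: inc_def)
qed

text \<open>On a pair of labelled necklaces the product is \<open>mu\<close> followed by the
  coprojection at the glued necklace. By \<open>mu_natural\<close> and \<open>wlab_pull\<close>
  these arrows are natural in both variables, so they descend to the tensor product of the two
  colimits.\<close>

lemma mult_ex: "\<exists>h. ar h \<and> dm h = Lob a b \<odot> Lob b c \<and> cd h = Lob a c \<and>
  (\<forall>A x B y. lab A x \<longrightarrow> lab B y \<longrightarrow> vert x 0 = a \<longrightarrow> vert x (snd A) = b \<longrightarrow> vert y 0 = b \<longrightarrow> vert y (snd B) =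
    c \<longrightarrow>
    h \<cdot> (inc A x \<otimes> inc B y) = inc (wedge A B) (wlab A x B y) \<cdot> mu D A B)"
proof -
  let ?t = "\<lambda>P Q. inc (wedge (fst P) (fst Q)) (wlab (fst P) (snd P) (fst Q) (snd Q)) \<cdot>
    mu D (fst P) (fst Q)"
  have W: "lab (wedge A B) (wlab A x B y)" "vert (wlab A x B y) 0 =
    a" "vert (wlab A x B y) (snd (wedge A B)) = c"
    if "lab A x" "lab B y" "vert x 0 = a" "vert x (snd A) = b" "vert y 0 = b" "vert y (snd B) = c"
      for A x B y
  proof -
    have xy: "vert x (snd A) = vert y 0" using that by simp
    note o = lab_Ob[OF that(1)] lab_Ob[OF that(2)]
    show "lab (wedge A B) (wlab A x B y)" "vert (wlab A x B y) 0 =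
      a" "vert (wlab A x B y) (snd (wedge A B)) = c"
      using lab_wlab[OF o that(1,2) xy] vert_wlab(1)[OF o that(1,2) xy, of 0] vert_wlab(2)[OF o
        that(1,2) xy, of "snd B"] that
      by simp_all
  qed
  have nat: "inc (wedge A' B') (wlab A' x B' y) \<cdot> (mu D A' B' \<cdot> (DA D A A' f \<otimes> DA D B B' g)) =
      inc (wedge A B) (wlab A (pull A f x) B (pull B g y)) \<cdot> mu D A B"
    if h: "lab A' x" "lab B' y" "vert x 0 = a" "vert x (snd A') = b" "vert y 0 =
      b" "vert y (snd B') = c"
      "f \<in> Hom Nec A A'" "g \<in> Hom Nec B B'" "A \<in> Ob Nec" "B \<in> Ob Nec" for A A' x B B' y f g
  proof -
    note ob = h(9,10) lab_Ob[OF h(1)] lab_Ob[OF h(2)]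
    have w: "wedge_map A A' B B' f g \<in> Hom Nec (wedge A B) (wedge A' B')"
      using wedge_map_Hom[OF D h(7,8)] ob by simp
    have "mu D A' B' \<cdot> (DA D A A' f \<otimes> DA D B B' g) =
      DA D (wedge A B) (wedge A' B') (wedge_map A A' B B' f g) \<cdot> mu D A B"
      using mu_natural[OF D h(7,8)] ob by simp
    then have "inc (wedge A' B') (wlab A' x B' y) \<cdot> (mu D A' B' \<cdot> (DA D A A' f \<otimes> DA D B B' g)) =
      (inc (wedge A' B') (wlab A' x B' y) \<cdot> DA D (wedge A B) (wedge A' B')
        (wedge_map A A' B B' f g)) \<cdot> mu D A B"
      using W[OF h(1-6)] w ob by simp
    also have "inc (wedge A' B') (wlab A' x B' y) \<cdot>
      DA D (wedge A B) (wedge A' B') (wedge_map A A' B B' f g) =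
      inc (wedge A B) (wlab A (pull A f x) B (pull B g y))"
      using inc_natural[OF w _ W(1)[OF h(1-6)]] ob wlab_pull[OF h(1,2) _ h(7,8) ob(1,2) w] h by simp
    finally show ?thesis .
  qed
  \<comment> \<open>The identity in the variable held fixed is written as D of an identity, so that
    both naturality conditions become instances of \<open>nat\<close>.\<close>
  have idD: "idt (fob D A) = DA D A A (Ident Delta (snd A))" "Ident Delta (snd A) \<in> Hom Nec A A"
    if "A \<in> Ob Nec" for A
    using that category_Ident[OF catN that] by simp_all
  show ?thesis
  proof (rule bicolim_universal[OF category_J Ob_J_small Hom_J_small category_J Ob_J_small
    Hom_J_small colim_L colim_L, of "Lob a c" a b b c ?t])
    show "Lob a c \<in> Ob W" by simp
    show "ar (?t P Q)" "dm (?t P Q) = Fo P \<odot> Fo Q" "cd (?t P Q) = Lob a c"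
      if "P \<in> Ob (J a b)" "Q \<in> Ob (J b c)" for P Q
      using that W[of "fst P" "snd P" "fst Q" "snd Q"] lab_Ob[of "fst P" "snd P"] lab_Ob[of "fst Q"
        "snd Q"] by (cases P, cases Q, simp add: Fo_def)+
    show "?t P' Q \<cdot> (Fa P P' f \<otimes> idt (Fo Q)) = ?t P Q"
      if "P \<in> Ob (J a b)" "P' \<in> Ob (J a b)" "f \<in> Hom (J a b) P P'" "Q \<in> Ob (J b c)" for P P' f Q
    proof -
      obtain A x A' x' B y where eq: "P = (A, x)" "P' = (A', x')" "Q = (B, y)"
        by (cases P, cases P', cases Q) auto
      note h = that[unfolded eq J_simps]
      have o: "A \<in> Ob Nec" "A' \<in> Ob Nec" "B \<in> Ob Nec" using h by (auto intro: lab_Ob)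
      have f: "f \<in> Hom Nec A A'" "x = pull A f x'" and y: "lab B y" and W': "lab A' x'" "vert x' 0 =
        a" "vert x' (snd A') = b" "vert y 0 = b" "vert y (snd B) = c"
        using h by blast+
      have "?t P' Q \<cdot> (Fa P P' f \<otimes> idt (Fo Q)) =
        inc (wedge A' B) (wlab A' x' B y) \<cdot> (mu D A' B \<cdot> (DA D A A' f \<otimes>
          DA D B B (Ident Delta (snd B))))"
        unfolding idD(1)[OF o(3), symmetric] using W(1)[OF W'(1) y W'(2-5)] o f(1)
          by (simp add: eq Fo_def Fa_def)
      also have "\<dots> = ?t P Q"
        unfolding nat[OF W'(1) y W'(2-5) f(1) idD(2)[OF o(3)] o(1,3)]
          by (simp add: eq f(2) pull_id[OF y])
      finally show ?thesis .
    qed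
    show "?t P Q' \<cdot> (idt (Fo P) \<otimes> Fa Q Q' g) = ?t P Q"
      if "Q \<in> Ob (J b c)" "Q' \<in> Ob (J b c)" "g \<in> Hom (J b c) Q Q'" "P \<in> Ob (J a b)" for Q Q' g P
    proof -
      obtain A x B y B' y' where eq: "P = (A, x)" "Q = (B, y)" "Q' = (B', y')"
        by (cases P, cases Q, cases Q') auto
      note h = that[unfolded eq J_simps]
      have o: "A \<in> Ob Nec" "B \<in> Ob Nec" "B' \<in> Ob Nec" using h by (auto intro: lab_Ob)
      have g: "g \<in> Hom Nec B B'" "y = pull B g y'" and x: "lab A x" and W': "lab B' y'" "vert x 0 =
        a" "vert x (snd A) = b" "vert y' 0 = b" "vert y' (snd B') = c"
        using h by blast+
      have "?t P Q' \<cdot> (idt (Fo P) \<otimes> Fa Q Q' g) =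
        inc (wedge A B') (wlab A x B' y') \<cdot> (mu D A B' \<cdot> (DA D A A (Ident Delta (snd A)) \<otimes>
          DA D B B' g))"
        unfolding idD(1)[OF o(1), symmetric] using W(1)[OF x W'(1-5)] o g(1)
          by (simp add: eq Fo_def Fa_def)
      also have "\<dots> = ?t P Q"
        unfolding nat[OF x W'(1-5) idD(2)[OF o(1)] g(1) o(1,2)] by (simp add: eq g(2) pull_id[OF x])
      finally show ?thesis .
    qed
    fix h assume h: "ar h" "dm h = Lob a b \<odot> Lob b c" "cd h = Lob a c"
      "\<And>P Q. \<lbrakk>P \<in> Ob (J a b); Q \<in> Ob (J b c)\<rbrakk> \<Longrightarrow> h \<cdot> (Lin a b P \<otimes> Lin b c Q) = ?t P Q"
    have "h \<cdot> (inc A x \<otimes> inc B y) = inc (wedge A B) (wlab A x B y) \<cdot> mu D A B"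
      if "lab A x" "lab B y" "vert x 0 = a" "vert x (snd A) = b" "vert y 0 = b" "vert y (snd B) = c"
        for A x B y
      using that h(4)[of "(A, x)" "(B, y)"] by (simp add: inc_def)
    with h(1-3) show ?thesis by blast
  qed
qed

definition mult :: "'x \<Rightarrow> 'x \<Rightarrow> 'x \<Rightarrow> 'o \<times> 'a \<times> 'o" where
  "mult a b c = (SOME h. ar h \<and> dm h = Lob a b \<odot> Lob b c \<and> cd h = Lob a c \<and>
  (\<forall>A x B y. lab A x \<longrightarrow> lab B y \<longrightarrow> vert x 0 = a \<longrightarrow> vert x (snd A) = b \<longrightarrow> vert y 0 = b \<longrightarrow> vert y (snd B) =
    c \<longrightarrow>
    h \<cdot> (inc A x \<otimes> inc B y) = inc (wedge A B) (wlab A x B y) \<cdot> mu D A B))"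

lemma mult [simp]: "ar (mult a b c)" "dm (mult a b c) = Lob a b \<odot> Lob b c" "cd (mult a b c) =
  Lob a c"
  and mult_inc: "\<lbrakk>lab A x; lab B y; vert x 0 = a; vert x (snd A) = b; vert y 0 = b; vert y (snd B) =
    c\<rbrakk> \<Longrightarrow>
    mult a b c \<cdot> (inc A x \<otimes> inc B y) = inc (wedge A B) (wlab A x B y) \<cdot> mu D A B"
  using someI_ex[OF mult_ex[of a b c]] unfolding mult_def by blast+

definition unit :: "'x \<Rightarrow> 'o \<times> 'a \<times> 'o" where
  "unit a = inc (simplex 0) (hat 0 a) \<cdot> ep D"

lemma unit [simp]: "a \<in> fob X 0 \<Longrightarrow> ar (unit a)" "dm (unit a) = Unit W" "a \<in> fob X 0 \<Longrightarrow> cd (unit a) =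
  Lob a a"
  using lab_hat[of a 0] vert_hat0[of a] by (simp_all add: unit_def)

text \<open>On coprojections both sides become the coprojection at the triple wedge;
  \<open>wlab_assoc\<close> identifies the labellings and \<open>mu_assoc\<close> the structure
  maps.\<close>

lemma mult_assoc:
  "mult a c d \<cdot> (mult a b c \<otimes> idt (Lob c d)) =
   mult a b d \<cdot> ((idt (Lob a b) \<otimes> mult b c d) \<cdot> asc (Lob a b) (Lob b c) (Lob c d))"
proof (rule tricolim_epi[OF category_J Ob_J_small Hom_J_small category_J Ob_J_small Hom_J_small
  colim_L colim_L
      category_J Ob_J_small Hom_J_small colim_L])
  fix P Q R assume PQR: "P \<in> Ob (J a b)" "Q \<in> Ob (J b c)" "R \<in> Ob (J c d)"
  obtain A x B y C v where eq: "P = (A, x)" "Q = (B, y)" "R = (C, v)"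
    by (cases P, cases Q, cases R) blast
  then have P: "P = (A, x)" "lab A x" "vert x 0 = a" "vert x (snd A) = b"
    and Q: "Q = (B, y)" "lab B y" "vert y 0 = b" "vert y (snd B) = c"
    and R: "R = (C, v)" "lab C v" "vert v 0 = c" "vert v (snd C) = d" using PQR by simp_all
  note o = lab_Ob[OF P(2)] lab_Ob[OF Q(2)] lab_Ob[OF R(2)]
  have L: "Lin a b P = inc A x" "Lin b c Q = inc B y" "Lin c d R = inc C v" using P Q R
    by (simp_all add: inc_def)
  have xy: "vert x (snd A) = vert y 0" and yv: "vert y (snd B) = vert v 0" using P Q R by simp_all
  have XY: "lab (wedge A B) (wlab A x B y)" "vert (wlab A x B y) 0 =
    a" "vert (wlab A x B y) (snd (wedge A B)) = c"
    using lab_wlab[OF o(1,2) P(2) Q(2) xy] vert_wlab[OF o(1,2) P(2) Q(2) xy] P Q by simp_all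
  have YV: "lab (wedge B C) (wlab B y C v)" "vert (wlab B y C v) 0 =
    b" "vert (wlab B y C v) (snd (wedge B C)) = d"
    using lab_wlab[OF o(2,3) Q(2) R(2) yv] vert_wlab[OF o(2,3) Q(2) R(2) yv] Q R by simp_all
  note r = P Q R o
  have iXYV: "ar (inc (wedge (wedge A B) C) (wlab (wedge A B) (wlab A x B y) C v))"
    "dm (inc (wedge (wedge A B) C) (wlab (wedge A B) (wlab A x B y) C v)) =
    fob D (wedge (wedge A B) C)"
    using lab_wlab[OF wedge_Ob[OF o(1,2)] o(3) XY(1) R(2)] XY(3) R(3) by simp_all
  have iXYV': "ar (inc (wedge A (wedge B C)) (wlab A x (wedge B C) (wlab B y C v)))"
    "dm (inc (wedge A (wedge B C)) (wlab A x (wedge B C) (wlab B y C v))) =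
    fob D (wedge A (wedge B C))"
    using lab_wlab[OF o(1) wedge_Ob[OF o(2,3)] P(2) YV(1)] YV(2) P(4) by simp_all
  have "(mult a c d \<cdot> (mult a b c \<otimes> idt (Lob c d))) \<cdot> ((inc A x \<otimes> inc B y) \<otimes> inc C v) =
    mult a c d \<cdot> ((mult a b c \<cdot> (inc A x \<otimes> inc B y)) \<otimes> inc C v)"
    using r by (simp add: fuse)
  also have "mult a b c \<cdot> (inc A x \<otimes> inc B y) = inc (wedge A B) (wlab A x B y) \<cdot> mu D A B" using r
    by (intro mult_inc)
  also have "mult a c d \<cdot> ((inc (wedge A B) (wlab A x B y) \<cdot> mu D A B) \<otimes> inc C v) =
    (mult a c d \<cdot> (inc (wedge A B) (wlab A x B y) \<otimes> inc C v)) \<cdot> (mu D A B \<otimes> idt (fob D C))"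
    using r XY by (simp add: fuse)
  also have "mult a c d \<cdot> (inc (wedge A B) (wlab A x B y) \<otimes> inc C v) =
    inc (wedge (wedge A B) C) (wlab (wedge A B) (wlab A x B y) C v) \<cdot> mu D (wedge A B) C" using r XY
      by (intro mult_inc)
  also have "\<dots> \<cdot> (mu D A B \<otimes> idt (fob D C)) =
    inc (wedge (wedge A B) C) (wlab (wedge A B) (wlab A x B y) C v) \<cdot> (mu D (wedge A B) C \<cdot>
      (mu D A B \<otimes> idt (fob D C)))"
    using r iXYV by simp
  also have "\<dots> = inc (wedge A (wedge B C)) (wlab A x (wedge B C) (wlab B y C v)) \<cdot>
    (mu D A (wedge B C) \<cdot> ((idt (fob D A) \<otimes> mu D B C) \<cdot> asc (fob D A) (fob D B) (fob D C)))"
    unfolding mu_assoc[OF D o] wlab_assoc[OF P(2) Q(2) R(2) xy yv] wedge_assoc ..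
  also have "\<dots> = (inc (wedge A (wedge B C)) (wlab A x (wedge B C) (wlab B y C v)) \<cdot>
    mu D A (wedge B C)) \<cdot>
     ((idt (fob D A) \<otimes> mu D B C) \<cdot> asc (fob D A) (fob D B) (fob D C))"
    using r iXYV' by simp
  also have "inc (wedge A (wedge B C)) (wlab A x (wedge B C) (wlab B y C v)) \<cdot> mu D A (wedge B C) =
    mult a b d \<cdot> (inc A x \<otimes> inc (wedge B C) (wlab B y C v))" using r YV
      by (intro mult_inc[symmetric])
  also have "\<dots> \<cdot> ((idt (fob D A) \<otimes> mu D B C) \<cdot> asc (fob D A) (fob D B) (fob D C)) =
    mult a b d \<cdot> ((inc A x \<otimes> (inc (wedge B C) (wlab B y C v) \<cdot> mu D B C)) \<cdot>
      asc (fob D A) (fob D B) (fob D C))"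
    using r YV by (simp add: fuse)
  also have "inc (wedge B C) (wlab B y C v) \<cdot> mu D B C = mult b c d \<cdot> (inc B y \<otimes> inc C v)" using r
    by (intro mult_inc[symmetric])
  also have "mult a b d \<cdot> ((inc A x \<otimes> (mult b c d \<cdot> (inc B y \<otimes> inc C v))) \<cdot>
    asc (fob D A) (fob D B) (fob D C)) =
    mult a b d \<cdot> ((idt (Lob a b) \<otimes> mult b c d) \<cdot> ((inc A x \<otimes> (inc B y \<otimes> inc C v)) \<cdot>
      asc (fob D A) (fob D B) (fob D C)))"
    using r by (simp add: fuse)
  also have "(inc A x \<otimes> (inc B y \<otimes> inc C v)) \<cdot> asc (fob D A) (fob D B) (fob D C) =
    asc (Lob a b) (Lob b c) (Lob c d) \<cdot> ((inc A x \<otimes> inc B y) \<otimes> inc C v)"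
    using r by (subst asc_natural) simp_all
  finally show "(mult a c d \<cdot> (mult a b c \<otimes> idt (Lob c d))) \<cdot> ((Lin a b P \<otimes> Lin b c Q) \<otimes>
    Lin c d R) =
    (mult a b d \<cdot> ((idt (Lob a b) \<otimes> mult b c d) \<cdot> asc (Lob a b) (Lob b c) (Lob c d))) \<cdot>
      ((Lin a b P \<otimes> Lin b c Q) \<otimes> Lin c d R)"
    unfolding L using r by simp
qed simp_all

text \<open>Gluing a necklace of length 0 changes nothing, so on coprojections the unit laws reduce
  to those of D.\<close>

lemma mult_unit:
  assumes "a \<in> fob X 0" "b \<in> fob X 0"
  shows "mult a a b \<cdot> (unit a \<otimes> idt (Lob a b)) = lun (Lob a b)"
    and "mult a b b \<cdot> (idt (Lob a b) \<otimes> unit b) = run (Lob a b)"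
proof -
  note h = lab_hat[OF assms(1)] lab_hat[OF assms(2)] vert_hat0[OF assms(1)] vert_hat0[OF assms(2)]
  show "mult a a b \<cdot> (unit a \<otimes> idt (Lob a b)) = lun (Lob a b)"
  proof (rule colim_epi[OF colim_tensor_left[OF category_J Ob_J_small Hom_J_small colim_L, of
    "Unit W" a b]])
    fix P assume "P \<in> Ob (J a b)"
    then obtain A x where P: "P = (A, x)" "lab A x" "vert x 0 = a" "vert x (snd A) = b"
      by (cases P) auto
    note A = lab_Ob[OF P(2)]
    have L: "Lin a b P = inc A x" using P by (simp add: inc_def)
    have "(mult a a b \<cdot> (unit a \<otimes> idt (Lob a b))) \<cdot> (idt (Unit W) \<otimes> inc A x) =
      (mult a a b \<cdot> (inc (simplex 0) (hat 0 a) \<otimes> inc A x)) \<cdot> (ep D \<otimes> idt (fob D A))"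
      using P h A assms by (simp add: fuse) (simp add: unit_def)
    also have "mult a a b \<cdot> (inc (simplex 0) (hat 0 a) \<otimes> inc A x) = inc A x \<cdot> mu D (simplex 0) A"
      using mult_inc[OF h(1) P(2), of a a b] wlab_unit_left[OF P(2)] P h wedge_unit[OF A] by simp
    also have "\<dots> \<cdot> (ep D \<otimes> idt (fob D A)) = inc A x \<cdot> (mu D (simplex 0) A \<cdot> (ep D \<otimes> idt (fob D A)))"
      using P A wedge_unit[OF A] by simp
    also have "\<dots> = inc A x \<cdot> lun (fob D A)" by (simp only: mu_unit[OF D A])
    also have "\<dots> = lun (Lob a b) \<cdot> (idt (Unit W) \<otimes> inc A x)" using P by (subst lun_natural) simp_all
    finally show "(mult a a b \<cdot> (unit a \<otimes> idt (Lob a b))) \<cdot> (idt (Unit W) \<otimes> Lin a b P) =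
      lun (Lob a b) \<cdot> (idt (Unit W) \<otimes> Lin a b P)"
      unfolding L .
  qed (use assms in simp_all)
  show "mult a b b \<cdot> (idt (Lob a b) \<otimes> unit b) = run (Lob a b)"
  proof (rule colim_epi[OF colim_tensor_right[OF category_J Ob_J_small Hom_J_small colim_L, of
    "Unit W" a b]])
    fix P assume "P \<in> Ob (J a b)"
    then obtain A x where P: "P = (A, x)" "lab A x" "vert x 0 = a" "vert x (snd A) = b"
      by (cases P) auto
    note A = lab_Ob[OF P(2)]
    have L: "Lin a b P = inc A x" using P by (simp add: inc_def)
    have "(mult a b b \<cdot> (idt (Lob a b) \<otimes> unit b)) \<cdot> (inc A x \<otimes> idt (Unit W)) =
      (mult a b b \<cdot> (inc A x \<otimes> inc (simplex 0) (hat 0 b))) \<cdot> (idt (fob D A) \<otimes> ep D)"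
      using P h A assms by (simp add: fuse) (simp add: unit_def)
    also have "mult a b b \<cdot> (inc A x \<otimes> inc (simplex 0) (hat 0 b)) = inc A x \<cdot> mu D A (simplex 0)"
      using mult_inc[OF P(2) h(2), of a b b] wlab_unit_right[OF P(2)] P h wedge_unit[OF A] by simp
    also have "\<dots> \<cdot> (idt (fob D A) \<otimes> ep D) = inc A x \<cdot> (mu D A (simplex 0) \<cdot> (idt (fob D A) \<otimes> ep D))"
      using P A wedge_unit[OF A] by simp
    also have "\<dots> = inc A x \<cdot> run (fob D A)" by (simp only: mu_unit[OF D A])
    also have "\<dots> = run (Lob a b) \<cdot> (inc A x \<otimes> idt (Unit W))" using P by (subst run_natural) simp_all
    finally show "(mult a b b \<cdot> (idt (Lob a b) \<otimes> unit b)) \<cdot> (Lin a b P \<otimes> idt (Unit W)) =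
      run (Lob a b) \<cdot> (Lin a b P \<otimes> idt (Unit W))"
      unfolding L .
  qed (use assms in simp_all)
qed

text \<open>Objects of enriched categories in \<open>WCat\<close> have a fixed type, so the small
  set of vertices of X is embedded in it.\<close>

definition code :: "'x \<Rightarrow> 'u pt" where
  "code = Inr \<circ> (SOME e. inj_on e (fob X 0))"

abbreviation "decode \<equiv> inv_into (fob X 0) code"

lemma code_inj: "inj_on code (fob X 0)"
proof -
  obtain e :: "'x \<Rightarrow> 'u" where "inj_on e (fob X 0)" using small_embedding[OF U X_small] .
  then have "inj_on (SOME e :: 'x \<Rightarrow> 'u. inj_on e (fob X 0)) (fob X 0)" by (rule someI[where P = "\<lambda>e.
    inj_on e (fob X 0)"])
  then show ?thesis unfolding code_def by (simp add: inj_on_def)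
qed

lemma decode [simp]: "a \<in> fob X 0 \<Longrightarrow> decode (code a) = a"
  using code_inj by (rule inv_into_f_f)

definition L :: "('u pt, 'o, 'a) wcat" where
  "L = (let V = code ` fob X 0 in
      \<lparr>wOb = V,
       wHom = (\<lambda>x y. if x \<in> V \<and> y \<in> V then Lob (decode x) (decode y) else undefined),
       wComp = (\<lambda>x y v. if x \<in> V \<and> y \<in> V \<and> v \<in> V then md (mult (decode x) (decode y)
         (decode v)) else undefined),
       wId = (\<lambda>x\<in>V. md (unit (decode x)))\<rparr>)"

lemma L_simps [simp]:
  "wOb L = code ` fob X 0"
  "\<lbrakk>a \<in> fob X 0; b \<in> fob X 0\<rbrakk> \<Longrightarrow> wHom L (code a) (code b) = Lob a b"
  by (simp_all add: L_def Let_def)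

lemma cmpW_L [simp]: "\<lbrakk>a \<in> fob X 0; b \<in> fob X 0; c \<in> fob X 0\<rbrakk> \<Longrightarrow> cmpW L (code a) (code b) (code c) =
  mult a b c"
  by (simp add: prod_eq_iff) (simp add: cmpW_def L_def Let_def)

lemma idW_L [simp]: "a \<in> fob X 0 \<Longrightarrow> idW L (code a) = unit a"
  by (simp add: prod_eq_iff) (simp add: idW_def L_def Let_def)

lemma is_wcat_L: "is_wcat W L"
  by (rule is_wcatI) (auto simp: mult_assoc mult_unit, auto simp: L_def Let_def)

lemma small_L: "small u (wOb L)"
  by (simp add: small_image[OF U X_small])

end

section \<open>The universal property of the left adjoint\<close>

context necklace_realization
begin

lemmas L_wcat [simp] = is_wcat_L

text \<open>A necklace in X induces an enriched functor to L, which on the hom-object from i to j is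
  the coprojection at the sub-necklace between them. On simplices it gives the unit of the
  adjunction.\<close>

definition theta :: "necklace \<Rightarrow> (nat \<Rightarrow> (nat \<Rightarrow> nat) \<Rightarrow> 'x) \<Rightarrow> ('u pt, 'a) wfun" where
  "theta A x = mk_wfun W z L (snd A) (\<lambda>i. code (vert x i)) (\<lambda>i j. inc (restr A i j) (sub A x i j))"

lemma vert_sub_ends:
  assumes "lab A x" "i \<le> j" "j \<le> snd A"
  shows "vert (sub A x i j) 0 = vert x i" "vert (sub A x i j) (j - i) = vert x j"
  using vert_sub[OF assms, of 0] vert_sub[OF assms, of "j - i"] assms(2) by simp_all

lemma theta:
  assumes x: "lab A x"
  shows "is_wfunctor W (Psi W z D A) L (theta A x)"
    and "i \<le> snd A \<Longrightarrow> wfO (theta A x) (Inl i) = code (vert x i)"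
    and "\<lbrakk>i \<le> j; j \<le> snd A\<rbrakk> \<Longrightarrow>
      homW (Psi W z D A) L (theta A x) (Inl i) (Inl j) = inc (restr A i j) (sub A x i j)"
proof -
  let ?P = "Psi W z D A :: ('u pt, 'o, 'a) wcat" and ?t = "\<lambda>i j. inc (restr A i j) (sub A x i j)"
  have vx: "code (vert x i) \<in> wOb L" if "i \<le> snd A" for i using vert_in[OF x that] by simp
  have t: "ar (?t i j)" "dm (?t i j) = fob D (restr A i j)" "cd (?t i j) =
    wHom L (code (vert x i)) (code (vert x j))"
    if "i \<le> j" "j \<le> snd A" for i j
    using lab_sub[OF x that] vert_sub_ends[OF x that] vert_in[OF x, of i] vert_in[OF x, of j] that
      by simp_all
  have comp: "?t i j \<cdot> cmpW ?P (Inl i) (Inl k) (Inl j) =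
    cmpW L (code (vert x i)) (code (vert x k)) (code (vert x j)) \<cdot> (?t i k \<otimes> ?t k j)"
    if ikj: "i \<le> k" "k \<le> j" "j \<le> snd A" for i k j
  proof -
    let ?A = "restr A i k" and ?B = "restr A k j"
    have ks: "k \<le> snd A" "i \<le> j" "i \<le> snd A" using ikj by auto
    note s1 = lab_sub[OF x ikj(1) ks(1)] and s2 = lab_sub[OF x ikj(2,3)]
      and s = lab_sub[OF x ks(2) ikj(3)]
    have f: "Ident Delta (j - i) \<in> Hom Nec (wedge ?A ?B) (restr A i j)"
      using restr_wedge_sub[OF ikj(1,2)] by simp
    have "?t i j \<cdot> cmpW ?P (Inl i) (Inl k) (Inl j) =
      (inc (restr A i j) (sub A x i j) \<cdot> DA D (wedge ?A ?B) (restr A i j) (Ident Delta (j - i))) \<cdot>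
        mu D ?A ?B"
      using ikj ks s f by (simp add: Psi_cmpW[OF D])
    \<comment> \<open>Forgetting k before the coprojection yields the coprojection at the glued
      pieces, by \<open>wlab_sub\<close>; there \<open>mult_inc\<close> recognises the composition
      of L.\<close>
    also have "inc (restr A i j) (sub A x i j) \<cdot>
      DA D (wedge ?A ?B) (restr A i j) (Ident Delta (j - i)) =
      inc (wedge ?A ?B) (wlab ?A (sub A x i k) ?B (sub A x k j))"
      using inc_natural[OF f _ s] wlab_sub[OF x ikj] ikj by simp
    also have "\<dots> \<cdot> mu D ?A ?B = mult (vert x i) (vert x k) (vert x j) \<cdot> (?t i k \<otimes> ?t k j)"
      using vert_sub_ends[OF x ikj(1) ks(1)] vert_sub_ends[OF x ikj(2,3)]
      by (intro mult_inc[OF s1 s2, symmetric]) simp_all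
    finally show ?thesis using vert_in[OF x] ikj ks by simp
  qed
  have unit: "?t i i \<cdot> ep D = idW L (code (vert x i))" if "i \<le> snd A" for i
    using sub_point[OF x that] vert_in[OF x that] by (simp add: restr_point unit_def)
  note mk = mk_wfun[OF D is_wcat_L, where A = A and vx = "\<lambda>i. code (vert x i)"
    and t = ?t, OF vx t comp unit, folded theta_def]
  show "is_wfunctor W ?P L (theta A x)" by (rule mk)
  show "i \<le> snd A \<Longrightarrow> wfO (theta A x) (Inl i) = code (vert x i)" by (rule mk)
  show "\<lbrakk>i \<le> j; j \<le> snd A\<rbrakk> \<Longrightarrow> homW ?P L (theta A x) (Inl i) (Inl j) = ?t i j" by (rule mk)
qed

lemma theta_natural:
  assumes f: "f \<in> nmaps A B" and y: "lab B y"
  shows "comp_wfun W (Psi W z D A) (Psi W z D B) L (theta B y) (Psi_ar D A B f) =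
    theta A (pull A f y)"
proof -
  note x = lab_pull[OF y f]
  note F = Psi_ar[OF D f, where 'u = 'u]
  show ?thesis
  proof (rule Psi_wfun_eqI[OF D is_wcat_L])
    show "is_wfunctor W (Psi W z D A) L (comp_wfun W (Psi W z D A) (Psi W z D B) L (theta B y)
      (Psi_ar D A B f))"
      by (rule is_wfunctor_comp[OF _ _ _ F(1) theta(1)[OF y]]) simp_all
    show "is_wfunctor W (Psi W z D A) L (theta A (pull A f y))" by (rule theta(1)[OF x])
    show "wfO (comp_wfun W (Psi W z D A) (Psi W z D B) L (theta B y) (Psi_ar D A B f)) (Inl i) =
      wfO (theta A (pull A f y)) (Inl i)"
      if "i \<le> snd A" for i
      using that nmapsD(2)[OF f that] by (simp add: F theta(2)[OF y] theta(2)[OF x] vert_pull[OF f])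
    show "homW (Psi W z D A) L (comp_wfun W (Psi W z D A) (Psi W z D B) L (theta B y)
      (Psi_ar D A B f)) (Inl i) (Inl j) =
      homW (Psi W z D A) L (theta A (pull A f y)) (Inl i) (Inl j)" if ij: "i \<le> j" "j \<le> snd A"
        for i j
    proof -
      have le: "f i \<le> f j" "f j \<le> snd B" using nmapsD(2,3)[OF f] ij by auto
      show ?thesis
        using ij le inc_natural[OF seg_Hom[OF f ij] _ lab_sub[OF y le]]
        by (simp add: homW_comp_wfun F theta(3)[OF y] theta(3)[OF x] sub_pull[OF f ij])
    qed
  qed
qed

text \<open>The value at s of the universal map from X to the nerve of L.\<close>

definition eta :: "nat \<Rightarrow> 'x \<Rightarrow> ('u pt, 'a) wfun" where
  "eta n s = theta (simplex n) (hat n s)"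

lemma eta_wfun: "s \<in> fob X n \<Longrightarrow> is_wfunctor W (Psi W z D (simplex n)) L (eta n s)"
  unfolding eta_def by (intro theta lab_hat)

lemma theta_simplex:
  "\<lbrakk>g \<in> nmaps (simplex n) A; lab A x\<rbrakk> \<Longrightarrow>
    comp_wfun W (Psi W z D (simplex n)) (Psi W z D A) L (theta A x) (Psi_ar D (simplex n) A g) =
      eta n (x n g)"
  using theta_natural[of g "simplex n" A x] by (simp add: pull_hat eta_def)

lemma eta_natural:
  assumes s: "s \<in> fob X n" and h: "h \<in> Hom Delta m n"
  shows "eta m (far X n m h s) = comp_wfun W (Psi W z D (simplex m)) (Psi W z D (simplex n)) L
    (eta n s) (Psi_ar D (simplex m) (simplex n) h)"
proof -
  have h': "h \<in> nmaps (simplex m) (simplex n)" using h by (simp add: nmaps_simplices)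
  show ?thesis using theta_simplex[OF h' lab_hat[OF s]] h' by (simp add: eta_def hat_def)
qed

text \<open>Agreement on simplices spreads to every \<open>theta\<close> by
  \<open>simplex_family_unique\<close>. Between endpoints \<open>theta\<close> is a coprojection,
  and the coprojections are jointly epimorphic.\<close>

lemma L_wfun_unique:
  fixes C :: "('u pt, 'o, 'a) wcat"
  assumes C: "is_wcat W C" and G: "is_wfunctor W L C G" and H: "is_wfunctor W L C H"
    and eq: "\<And>n s. s \<in> fob X n \<Longrightarrow> comp_wfun W (Psi W z D (simplex n)) L C G (eta n s) =
      comp_wfun W (Psi W z D (simplex n)) L C H (eta n s)"
  shows "G = H"
proof -
  have th: "comp_wfun W (Psi W z D A) L C G (theta A x) =
    comp_wfun W (Psi W z D A) L C H (theta A x)" if x: "lab A x" for A x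
  proof (rule simplex_family_unique[OF D lab_Ob[OF x] C])
    show "is_wfunctor W (Psi W z D A) C (comp_wfun W (Psi W z D A) L C G (theta A x))"
      "is_wfunctor W (Psi W z D A) C (comp_wfun W (Psi W z D A) L C H (theta A x))"
      by (rule is_wfunctor_comp[OF _ _ C theta(1)[OF x] G]; simp) (rule is_wfunctor_comp[OF _ _ C
        theta(1)[OF x] H]; simp)
    fix n g assume g: "g \<in> nmaps (simplex n) A"
    note Gr = Psi_ar(1)[OF D g, where 'u = 'u]
    show "comp_wfun W (Psi W z D (simplex n)) (Psi W z D A) C (comp_wfun W (Psi W z D A) L C G
      (theta A x)) (Psi_ar D (simplex n) A g) =
      comp_wfun W (Psi W z D (simplex n)) (Psi W z D A) C (comp_wfun W (Psi W z D A) L C H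
        (theta A x)) (Psi_ar D (simplex n) A g)"
      using comp_wfun_assoc[OF _ _ _ C Gr theta(1)[OF x] G] comp_wfun_assoc[OF _ _ _ C Gr
        theta(1)[OF x] H]
        eq[OF lab_in[OF x g]] by (simp add: theta_simplex[OF g x])
  qed
  have o: "wfO G (code a) = wfO H (code a)" if a: "a \<in> fob X 0" for a
    using arg_cong[OF eq[OF a], of "\<lambda>F. wfO F (Inl 0)"] theta(2)[OF lab_hat[OF a], of 0]
      vert_hat0[OF a] by (simp add: eta_def)
  have h: "homW L C G (code a) (code b) = homW L C H (code a) (code b)"
    if ab: "a \<in> fob X 0" "b \<in> fob X 0" for a b
  proof (rule L_epi[of _ _ a b])
    fix A x assume x: "lab A x" "vert x 0 = a" "vert x (snd A) = b"
    show "homW L C G (code a) (code b) \<cdot> inc A x = homW L C H (code a) (code b) \<cdot> inc A x"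
      using arg_cong[OF th[OF x(1)], of "\<lambda>F. homW (Psi W z D A) C F (Inl 0) (Inl (snd A))"]
        theta(2)[OF x(1), of 0] theta(2)[OF x(1), of "snd A"] theta(3)[OF x(1), of 0 "snd A"] x
        restr_full[OF lab_Ob[OF x(1)]] sub_full[OF x(1)] by (simp add: homW_comp_wfun)
  qed (use ar_homW[OF G _ C] ar_homW[OF H _ C] ab o in simp_all)
  show ?thesis
    by (rule wfun_eqI[OF G H]) (use o h homW_eq_wfH[of L C G _ _ C H] in auto)
qed

section \<open>Extending a simplicial map \<sigma> from X to the nerve of C\<close>

context
  fixes C :: "('u pt, 'o, 'a) wcat" and \<sigma> :: "nat \<Rightarrow> 'x \<Rightarrow> ('u pt, 'a) wfun"
  assumes C: "is_wcat W C" and \<sigma>: "\<And>n s. s \<in> fob X n \<Longrightarrow>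
    is_wfunctor W (Psi W z D (simplex n)) C (\<sigma> n s)"
    and \<sigma>_natural: "\<And>n s m h. \<lbrakk>s \<in> fob X n; h \<in> Hom Delta m n\<rbrakk> \<Longrightarrow> \<sigma> m (far X n m h s) =
      comp_wfun W (Psi W z D (simplex m)) (Psi W z D (simplex n)) C (\<sigma> n s) (Psi_ar D (simplex m)
        (simplex n) h)"
begin

lemma phi_ex:
  assumes x: "lab A x"
  shows "\<exists>F. is_wfunctor W (Psi W z D A) C F \<and> (\<forall>n. \<forall>g\<in>nmaps (simplex n) A.
    comp_wfun W (Psi W z D (simplex n)) (Psi W z D A) C F (Psi_ar D (simplex n) A g) = \<sigma> n (x n g))"
proof -
  have "simplex_family D A C (\<lambda>n g. \<sigma> n (x n g))"
    unfolding simplex_family_def using \<sigma> lab_in[OF x] lab_act[OF x] \<sigma>_natural by simp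
  then show ?thesis by (rule simplex_family_extension[OF D lab_Ob[OF x] C]) blast
qed

text \<open>The enriched functor that represents the necklace x followed by \<sigma>. It is unique
  by \<open>simplex_family_unique\<close>, so the choice is immaterial.\<close>

definition phi :: "necklace \<Rightarrow> (nat \<Rightarrow> (nat \<Rightarrow> nat) \<Rightarrow> 'x) \<Rightarrow> ('u pt, 'a) wfun" where
  "phi A x = (SOME F. is_wfunctor W (Psi W z D A) C F \<and> (\<forall>n. \<forall>g\<in>nmaps (simplex n) A.
    comp_wfun W (Psi W z D (simplex n)) (Psi W z D A) C F (Psi_ar D (simplex n) A g) =
      \<sigma> n (x n g)))"

lemma phi:
  assumes "lab A x"
  shows "is_wfunctor W (Psi W z D A) C (phi A x)"
    and "g \<in> nmaps (simplex n) A \<Longrightarrow> comp_wfun W (Psi W z D (simplex n)) (Psi W z D A) C (phi A x)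
      (Psi_ar D (simplex n) A g) = \<sigma> n (x n g)"
  using someI_ex[OF phi_ex[OF assms]] unfolding phi_def by blast+

lemma phi_natural:
  assumes f: "f \<in> nmaps A B" and y: "lab B y"
  shows "comp_wfun W (Psi W z D A) (Psi W z D B) C (phi B y) (Psi_ar D A B f) = phi A (pull A f y)"
proof (rule simplex_family_unique[OF D nmapsD(5)[OF f] C])
  note x = lab_pull[OF y f]
  note F = Psi_ar(1)[OF D f, where 'u = 'u]
  show "is_wfunctor W (Psi W z D A) C (comp_wfun W (Psi W z D A) (Psi W z D B) C (phi B y)
    (Psi_ar D A B f))"
    by (rule is_wfunctor_comp[OF _ _ C F phi(1)[OF y]]) simp_all
  show "is_wfunctor W (Psi W z D A) C (phi A (pull A f y))" by (rule phi(1)[OF x])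
  fix n g assume g: "g \<in> nmaps (simplex n) A"
  note Gr = Psi_ar(1)[OF D g, where 'u = 'u]
  show "comp_wfun W (Psi W z D (simplex n)) (Psi W z D A) C (comp_wfun W (Psi W z D A)
    (Psi W z D B) C (phi B y) (Psi_ar D A B f)) (Psi_ar D (simplex n) A g) =
    comp_wfun W (Psi W z D (simplex n)) (Psi W z D A) C (phi A (pull A f y))
      (Psi_ar D (simplex n) A g)"
    using comp_wfun_assoc[OF _ _ _ C Gr F phi(1)[OF y]] Psi_ar_comp[OF D g f, where 'u = 'u]
      phi(2)[OF y nmaps_comp[OF g f]] phi(2)[OF x g] g
    by (simp add: pull_def)
qed

abbreviation "pO a \<equiv> wfO (\<sigma> 0 a) (Inl 0)"

lemma phi_ob:
  assumes x: "lab A x" and i: "i \<le> snd A"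
  shows "wfO (phi A x) (Inl i) = pO (vert x i)"
proof -
  note g = nmaps_point[OF lab_Ob[OF x] i]
  show ?thesis
    using arg_cong[OF phi(2)[OF x g], of "\<lambda>F. wfO F (Inl 0)"] Psi_ar(2)[OF D g, of 0, where 'u = 'u]
      by (simp add: vert_def)
qed

lemma pO_in: "a \<in> fob X 0 \<Longrightarrow> pO a \<in> wOb C"
  using wfO_Ob[OF \<sigma>, of a 0 "Inl 0"] by simp

text \<open>The leg at (A, x) of the cocone that induces the action on the hom-objects of L.\<close>

definition ph :: "necklace \<Rightarrow> (nat \<Rightarrow> (nat \<Rightarrow> nat) \<Rightarrow> 'x) \<Rightarrow> 'o \<times> 'a \<times> 'o" where
  "ph A x = homW (Psi W z D A) C (phi A x) (Inl 0) (Inl (snd A))"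

lemma ph [simp]:
  assumes x: "lab A x"
  shows "ar (ph A x)" "dm (ph A x) = fob D A" "cd (ph A x) =
    wHom C (pO (vert x 0)) (pO (vert x (snd A)))"
  using ar_homW[OF phi(1)[OF x] _ C, of "Inl 0" "Inl (snd A)"] phi_ob[OF x, of 0] phi_ob[OF x, of
    "snd A"] restr_full[OF lab_Ob[OF x]]
  by (simp_all add: ph_def)

lemma phi_hom_natural:
  assumes f: "f \<in> nmaps A B" and y: "lab B y" and ij: "i \<le> j" "j \<le> snd A"
  shows "homW (Psi W z D B) C (phi B y) (Inl (f i)) (Inl (f j)) \<cdot>
    DA D (restr A i j) (restr B (f i) (f j)) (seg f i j) =
    homW (Psi W z D A) C (phi A (pull A f y)) (Inl i) (Inl j)"
  using arg_cong[OF phi_natural[OF f y], of "\<lambda>F. homW (Psi W z D A) C F (Inl i) (Inl j)"] ij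
    Psi_ar(2)[OF D f, of i, where 'u = 'u] Psi_ar(2)[OF D f, of j, where 'u = 'u] Psi_ar(3)[OF D f
      ij, where 'u = 'u]
  by (simp add: homW_comp_wfun)

text \<open>Naturality along the inclusion of the sub-necklace moves i and j to its
  endpoints.\<close>

lemma phi_hom:
  assumes x: "lab A x" and ij: "i \<le> j" "j \<le> snd A"
  shows "homW (Psi W z D A) C (phi A x) (Inl i) (Inl j) = ph (restr A i j) (sub A x i j)"
proof -
  have R: "restr A i j \<in> Ob Nec" using ij by simp
  have "DA D (restr A i j) (restr A i j) (Ident Delta (j - i)) = idt (fob D (restr A i j))"
    using DA_id[OF D R] by simp
  then show ?thesis
    using phi_hom_natural[OF nmaps_restr[OF lab_Ob[OF x] ij] x, of 0 "j - i"] ij restr_full[OF R]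
      ar_homW[OF phi(1)[OF x] _ C, of "Inl i" "Inl j"]
    by (simp add: seg_shift ph_def sub_def)
qed

lemma ph_natural:
  assumes f: "f \<in> Hom Nec A B" and A: "A \<in> Ob Nec" and y: "lab B y"
  shows "ph B y \<cdot> DA D A B f = ph A (pull A f y)"
proof -
  note B = lab_Ob[OF y]
  have "f 0 = 0" "f (snd A) = snd B" using f by (simp_all add: Hom_Nec)
  then show ?thesis
    using phi_hom_natural[OF nmaps_Hom[OF f A B] y, of 0 "snd A"] restr_full[OF A] restr_full[OF B]
      seg_full[OF f]
    by (simp add: ph_def)
qed

text \<open>This is functoriality of \<open>phi\<close> at the glued vertex of the wedge, a joint
  where the composition of \<open>Psi\<close> is \<open>mu\<close>.\<close>

lemma ph_mu:
  assumes x: "lab A x" and y: "lab B y" and xy: "vert x (snd A) = vert y 0"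
  shows "ph (wedge A B) (wlab A x B y) \<cdot> mu D A B =
    cmpW C (pO (vert x 0)) (pO (vert y 0)) (pO (vert y (snd B))) \<cdot> (ph A x \<otimes> ph B y)"
proof -
  note A = lab_Ob[OF x] and B = lab_Ob[OF y]
  let ?AB = "wedge A B" and ?w = "wlab A x B y"
  note w = lab_wlab[OF A B x y xy] and v = vert_wlab[OF A B x y xy] and p = pull_wlab[OF A B x y xy]
  have r: "restr ?AB 0 (snd A) = A" "restr ?AB (snd A) (snd A + snd B) = B"
    using restr_wedge_left[OF A B, of 0 "snd A"] restr_wedge_right[OF A B, of 0 "snd B"]
      restr_full[OF A] restr_full[OF B] by simp_all
  have j: "snd A \<in> fst ?AB" using A by (simp add: wedge_def Ob_Nec)
  have c: "cmpW (Psi W z D ?AB :: ('u pt, 'o, 'a) wcat) (Inl 0) (Inl (snd A))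
    (Inl (snd A + snd B)) = mu D A B"
    using Psi_cmpW_joint(1)[OF D j, of 0 "snd A + snd B", where 'b = 'u] r by simp
  have s: "sub ?AB ?w 0 (snd A) = x" "sub ?AB ?w (snd A) (snd A + snd B) = y" using p r
    by (simp_all add: sub_def)
  show ?thesis
    using homW_cmpW[OF phi(1)[OF w], of "Inl 0" "Inl (snd A)" "Inl (snd A + snd B)"]
      phi_hom[OF w, of 0 "snd A"] phi_hom[OF w, of "snd A" "snd A + snd B"]
      phi_ob[OF w, of 0] phi_ob[OF w, of "snd A"] phi_ob[OF w, of "snd A + snd B"] v(1)[of 0]
        v(1)[of "snd A"] v(2)[of "snd B"] xy c
    by (simp add: r s) (simp add: ph_def)
qed

lemma ph_unit: "a \<in> fob X 0 \<Longrightarrow> ph (simplex 0) (hat 0 a) \<cdot> ep D = idW C (pO a)"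
  using homW_idW[OF phi(1)[OF lab_hat[of a 0]], of "Inl 0"] phi_ob[OF lab_hat[of a 0], of 0]
    vert_hat0[of a]
  by (simp add: ph_def Psi_idW[OF D])

lemma Gh_ex:
  assumes "a \<in> fob X 0" "b \<in> fob X 0"
  shows "\<exists>h. ar h \<and> dm h = Lob a b \<and> cd h = wHom C (pO a) (pO b) \<and>
    (\<forall>A x. lab A x \<longrightarrow> vert x 0 = a \<longrightarrow> vert x (snd A) = b \<longrightarrow> h \<cdot> inc A x = ph A x)"
proof (rule colim_universal[OF colim_L, of "wHom C (pO a) (pO b)" a b "\<lambda>P. ph (fst P) (snd P)"])
  show "wHom C (pO a) (pO b) \<in> Ob W" using wHom_Ob[OF C] pO_in assms by blast
  show "ar (ph (fst P) (snd P))" "dm (ph (fst P) (snd P)) = Fo P" "cd (ph (fst P) (snd P)) =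
    wHom C (pO a) (pO b)" if "P \<in> Ob (J a b)" for P
    using that by (cases P, auto simp: Fo_def)+
  show "ph (fst Q) (snd Q) \<cdot> Fa P Q f = ph (fst P) (snd P)" if "P \<in> Ob (J a b)" "Q \<in> Ob (J a b)"
    "f \<in> Hom (J a b) P Q" for P Q f
  proof -
    obtain A x B y where eq: "P = (A, x)" "Q = (B, y)" by (cases P, cases Q) auto
    then have "f \<in> Hom Nec A B" "lab B y" "x = pull A f y" "lab A x" using that by simp_all
    then show ?thesis using ph_natural[of f A B y] lab_Ob[of A x] by (simp add: eq Fa_def)
  qed
  fix h assume h: "ar h" "dm h = Lob a b" "cd h = wHom C (pO a) (pO b)" "\<And>P. P \<in> Ob (J a b) \<Longrightarrow> h \<cdot>
    Lin a b P = ph (fst P) (snd P)"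
  have "h \<cdot> inc A x = ph A x" if "lab A x" "vert x 0 = a" "vert x (snd A) = b" for A x
    using that h(4)[of "(A, x)"] by (simp add: inc_def)
  with h(1-3) show ?thesis by blast
qed

definition Gh :: "'x \<Rightarrow> 'x \<Rightarrow> 'o \<times> 'a \<times> 'o" where
  "Gh a b = (SOME h. ar h \<and> dm h = Lob a b \<and> cd h = wHom C (pO a) (pO b) \<and>
    (\<forall>A x. lab A x \<longrightarrow> vert x 0 = a \<longrightarrow> vert x (snd A) = b \<longrightarrow> h \<cdot> inc A x = ph A x))"

lemma Gh:
  assumes "a \<in> fob X 0" "b \<in> fob X 0"
  shows "ar (Gh a b)" "dm (Gh a b) = Lob a b" "cd (Gh a b) = wHom C (pO a) (pO b)"
    and "\<lbrakk>lab A x; vert x 0 = a; vert x (snd A) = b\<rbrakk> \<Longrightarrow> Gh a b \<cdot> inc A x = ph A x"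
  using someI_ex[OF Gh_ex[OF assms]] unfolding Gh_def by blast+

definition Gf :: "('u pt, 'a) wfun" where
  "Gf = \<lparr>wfO = (\<lambda>v\<in>wOb L. pO (decode v)),
        wfH = (\<lambda>v w. if v \<in> wOb L \<and> w \<in> wOb L then md (Gh (decode v) (decode w)) else undefined)\<rparr>"

lemma Gf_simps:
  "a \<in> fob X 0 \<Longrightarrow> wfO Gf (code a) = pO a"
  "\<lbrakk>a \<in> fob X 0; b \<in> fob X 0\<rbrakk> \<Longrightarrow> homW L C Gf (code a) (code b) = Gh a b"
proof -
  show o: "wfO Gf (code a) = pO a" if "a \<in> fob X 0" for a using that by (simp add: Gf_def)
  show "\<lbrakk>a \<in> fob X 0; b \<in> fob X 0\<rbrakk> \<Longrightarrow> homW L C Gf (code a) (code b) = Gh a b"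
    using Gh(2,3)[of a b] by (simp add: prod_eq_iff o) (simp add: homW_def Gf_def)
qed

lemma is_wfunctor_Gf: "is_wfunctor W L C Gf"
proof (rule is_wfunctorI)
  show "wfO Gf \<in> wOb L \<rightarrow>\<^sub>E wOb C" using pO_in by (auto simp: Gf_def)
  show "ar (homW L C Gf x y)" if "x \<in> wOb L" "y \<in> wOb L" for x y using that Gh(1)
    by (auto simp: Gf_simps)
  show "homW L C Gf x x \<cdot> idW L x = idW C (wfO Gf x)" if "x \<in> wOb L" for x
  proof -
    from that obtain a where a: "x = code a" "a \<in> fob X 0" unfolding L_simps by blast
    note h = lab_hat[OF a(2)] vert_hat0[OF a(2)]
    have "Gh a a \<cdot> unit a = (Gh a a \<cdot> inc (simplex 0) (hat 0 a)) \<cdot> ep D"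
      unfolding unit_def using h Gh(1-3)[OF a(2) a(2)] by simp
    also have "\<dots> = idW C (pO a)" using h Gh(4)[OF a(2) a(2) h(1)] ph_unit[OF a(2)] by simp
    finally show ?thesis using a by (simp add: Gf_simps)
  qed
  fix x y v assume "x \<in> wOb L" "y \<in> wOb L" "v \<in> wOb L"
  then obtain a b c where eq: "x = code a" "y = code b" "v = code c"
    and abc: "a \<in> fob X 0" "b \<in> fob X 0" "c \<in> fob X 0"
    unfolding L_simps by blast
  note G = Gh(1-3)[OF abc(1,2)] Gh(1-3)[OF abc(2,3)] Gh(1-3)[OF abc(1,3)]
  have car: "ar (cmpW C (pO a) (pO b) (pO c))" using ar_cmpW[OF C] pO_in abc by blast
  \<comment> \<open>Tested on pairs of coprojections: \<open>mult_inc\<close> glues the two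
    necklaces, and \<open>ph_mu\<close> splits the leg at the glued necklace.\<close>
  have "Gh a c \<cdot> mult a b c = cmpW C (pO a) (pO b) (pO c) \<cdot> (Gh a b \<otimes> Gh b c)"
  proof (rule bicolim_epi[OF category_J Ob_J_small Hom_J_small category_J Ob_J_small Hom_J_small
    colim_L colim_L])
    fix P Q assume PQ: "P \<in> Ob (J a b)" "Q \<in> Ob (J b c)"
    obtain A x B y where eq: "P = (A, x)" "Q = (B, y)" by (cases P, cases Q) auto
    then have P: "lab A x" "vert x 0 = a" "vert x (snd A) = b" and Q: "lab B y" "vert y 0 =
      b" "vert y (snd B) = c"
      using PQ by simp_all
    note o = lab_Ob[OF P(1)] lab_Ob[OF Q(1)]
    have xy: "vert x (snd A) = vert y 0" using P Q by simp
    note w = lab_wlab[OF o P(1) Q(1) xy]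
    have v: "vert (wlab A x B y) 0 = a" "vert (wlab A x B y) (snd (wedge A B)) = c"
      using vert_wlab[OF o P(1) Q(1) xy] P Q by simp_all
    have L: "Lin a b P = inc A x" "Lin b c Q = inc B y" using eq P Q by (simp_all add: inc_def)
    have "(Gh a c \<cdot> mult a b c) \<cdot> (inc A x \<otimes> inc B y) = Gh a c \<cdot> (inc (wedge A B) (wlab A x B y) \<cdot>
      mu D A B)"
      using G P Q by (simp add: mult_inc[OF P(1) Q(1)])
    also have "\<dots> = (Gh a c \<cdot> inc (wedge A B) (wlab A x B y)) \<cdot> mu D A B" using G w v o by simp
    also have "\<dots> = cmpW C (pO a) (pO b) (pO c) \<cdot> (ph A x \<otimes> ph B y)"
      using Gh(4)[OF abc(1,3) w v] ph_mu[OF P(1) Q(1) xy] P Q by simp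
    also have "\<dots> = (cmpW C (pO a) (pO b) (pO c) \<cdot> (Gh a b \<otimes> Gh b c)) \<cdot> (inc A x \<otimes> inc B y)"
      using G car P Q by (simp add: fuse Gh(4)[OF abc(1,2) P] Gh(4)[OF abc(2,3) Q])
    finally show "(Gh a c \<cdot> mult a b c) \<cdot> (Lin a b P \<otimes> Lin b c Q) = (cmpW C (pO a) (pO b) (pO c) \<cdot>
      (Gh a b \<otimes> Gh b c)) \<cdot> (Lin a b P \<otimes> Lin b c Q)"
      unfolding L .
  qed (use G car in simp_all)
  then show "homW L C Gf x v \<cdot> cmpW L x y v = cmpW C (wfO Gf x) (wfO Gf y) (wfO Gf v) \<cdot>
    (homW L C Gf x y \<otimes> homW L C Gf y v)"
    using abc by (simp add: eq Gf_simps)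
next
  show "wfH Gf x y = undefined" if "\<not> (x \<in> wOb L \<and> y \<in> wOb L)" for x y
    using that unfolding Gf_def by (auto simp del: L_simps)
qed

lemma Gf_eta:
  assumes s: "s \<in> fob X n"
  shows "comp_wfun W (Psi W z D (simplex n)) L C Gf (eta n s) = \<sigma> n s"
proof -
  note h = lab_hat[OF s]
  have idn: "Ident Delta n \<in> nmaps (simplex n) (simplex n)" using nmaps_id[of "simplex n"] by simp
  \<comment> \<open>In \<open>hat n s\<close> the identity simplex is labelled by s itself, so the
    defining property of \<open>phi\<close> there is the claim.\<close>
  have "phi (simplex n) (hat n s) = \<sigma> n s"
    using phi(2)[OF h idn] Psi_ar_id[OF D, of "simplex n", where 'u = 'u] comp_wfun_id(1)[OF _ C
      phi(1)[OF h]] act_id[OF s] idn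
    by (simp add: hat_def)
  moreover have "comp_wfun W (Psi W z D (simplex n)) L C Gf (eta n s) = phi (simplex n) (hat n s)"
  proof (rule Psi_wfun_eqI[OF D C])
    show "is_wfunctor W (Psi W z D (simplex n)) C (comp_wfun W (Psi W z D (simplex n)) L C Gf
      (eta n s))"
      by (rule is_wfunctor_comp[OF _ _ C eta_wfun[OF s] is_wfunctor_Gf]) simp_all
    show "is_wfunctor W (Psi W z D (simplex n)) C (phi (simplex n) (hat n s))"
      by (rule phi(1)[OF h])
    show "wfO (comp_wfun W (Psi W z D (simplex n)) L C Gf (eta n s)) (Inl i) =
      wfO (phi (simplex n) (hat n s)) (Inl i)" if "i \<le> snd (simplex n)" for i
      using that theta(2)[OF h that] phi_ob[OF h that] vert_in[OF h that]
        by (simp add: eta_def Gf_simps)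
    show "homW (Psi W z D (simplex n)) C (comp_wfun W (Psi W z D (simplex n)) L C Gf (eta n s))
      (Inl i) (Inl j) =
      homW (Psi W z D (simplex n)) C (phi (simplex n) (hat n s)) (Inl i) (Inl j)"
        if "i \<le> j" "j \<le> snd (simplex n)" for i j
      using that theta(2)[OF h, of i] theta(2)[OF h, of j] theta(3)[OF h that] vert_in[OF h, of i]
        vert_in[OF h, of j]
        phi_hom[OF h that] lab_sub[OF h that] vert_sub_ends[OF h that]
        Gh(4)[of "vert (hat n s) i" "vert (hat n s) j" "restr (simplex n) i j"
          "sub (simplex n) (hat n s) i j"]
      by (simp add: homW_comp_wfun eta_def Gf_simps)
  qed
  ultimately show ?thesis by simp
qed

theorem L_universal:
  "\<exists>!G. is_wfunctor W L C G \<and> (\<forall>n. \<forall>s\<in>fob X n. comp_wfun W (Psi W z D (simplex n)) L C G (eta n s) =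
    \<sigma> n s)"
proof (rule ex1I[of _ Gf])
  show "is_wfunctor W L C Gf \<and> (\<forall>n. \<forall>s\<in>fob X n.
    comp_wfun W (Psi W z D (simplex n)) L C Gf (eta n s) = \<sigma> n s)"
    using is_wfunctor_Gf Gf_eta by blast
  fix G assume G: "is_wfunctor W L C G \<and> (\<forall>n. \<forall>s\<in>fob X n.
    comp_wfun W (Psi W z D (simplex n)) L C G (eta n s) = \<sigma> n s)"
  show "G = Gf"
    by (rule L_wfun_unique[OF C]) (use G is_wfunctor_Gf Gf_eta in simp_all)
qed

end

end

section \<open>Necklicial nerves\<close>

lemma isomorphic_refl: "\<lbrakk>category C; X \<in> Ob C\<rbrakk> \<Longrightarrow> isomorphic C X X"
  unfolding isomorphic_def iso_arr_def
  by (intro exI[of _ "Ident C X"] conjI bexI[of _ "Ident C X"]) (simp_all add: category_simps)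

locale necklicial_setting = monoidal_initial W z + cocomplete_monoidal W u
  for W :: "('o, 'a) moncat" and z :: 'o and u :: "'u itself" +
  assumes loc_small: "locally_small u W"
begin

abbreviation V where "V \<equiv> WCat u W"

lemma finite_small: "finite (Y :: 'u pt set) \<Longrightarrow> small u Y"
  by (rule small_finite[OF U])

text \<open>The enriched categories of the diagram have finitely many objects and W is locally
  small, so \<open>small_wfunctors\<close> bounds the sets of simplices.\<close>

lemma is_functor_nerve_Phi:
  assumes D: "strong_monoidal Nec W D"
  shows "is_functor V (SSet u) (nerve_of V (Phi_diagram W z D))"
proof (rule is_functor_nerve_of[OF category_WCat is_functor_Phi_diagram[OF finite_small D]])
  fix n C assume "C \<in> Ob V"
  then show "small u (Hom V (fob (Phi_diagram W z D) n) C)"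
    using small_wfunctors[OF U loc_small is_wcat_Psi[OF D] _ _ _ W, of "simplex n" C]
    by (simp add: Phi_diagram_simps[OF D])
qed

text \<open>The map \<open>eta\<close> from X to the nerve of L is the universal arrow that
  \<open>right_adjointI\<close> asks for; a simplicial map h into the nerve of B plays the role of
  \<sigma> in \<open>L_universal\<close>.\<close>

theorem right_adjoint_nerve_Phi:
  assumes D: "strong_monoidal Nec W D"
  shows "right_adjoint V (SSet u) (nerve_of V (Phi_diagram W z D))"
proof (rule right_adjointI[OF is_functor_nerve_Phi[OF D]])
  let ?R = "nerve_of V (Phi_diagram W z D)"
  fix X :: "('u pt, 'a) wfun sset" assume "X \<in> Ob (SSet u)"
  then have X: "is_functor (op_cat Delta) (SetCat u) X" by (simp add: SSet_def)
  interpret necklace_realization W z u X D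
    using X D by unfold_locales
  let ?P = "\<lambda>n. Psi W z D (simplex n) :: ('u pt, 'o, 'a) wcat"
  let ?y = "\<lambda>n. \<lambda>s\<in>fob X n. eta n s"
  have L: "L \<in> Ob V" using is_wcat_L small_L by simp
  note N = nerve_of_simps[where V = V and DD = "Phi_diagram W z D"] Phi_diagram_simps[OF D]
  have far_N: "far (nerve_ob V (Phi_diagram W z D) C) n m h = (\<lambda>x\<in>{F. is_wfunctor W (?P n) C F}.
    comp_wfun W (?P m) (?P n) C x (Psi_ar D (simplex m) (simplex n) h))"
    if "h \<in> Hom Delta m n" for C n m h
    unfolding nerve_ob_simps(2)[OF that] Phi_diagram_simps[OF D] Phi_diagram_simps(2)[OF D that]
      by simp
  have fob_N: "fob (nerve_ob V (Phi_diagram W z D) C) n = {F. is_wfunctor W (?P n) C F}" for C n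
    by (simp add: N)
  have y: "?y \<in> Hom (SSet u) X (fob ?R L)"
    unfolding SSet_def Fun_simps nat_trans_def mem_Collect_eq N(1)[OF L]
  proof (intro conjI ballI)
    show "?y n \<in> Hom (SetCat u) (fob X n) (fob (nerve_ob V (Phi_diagram W z D) L) n)" for n
      using eta_wfun by (auto simp: Phi_diagram_simps[OF D])
    fix n m h assume "h \<in> Hom (op_cat Delta) n m"
    then have h: "h \<in> Hom Delta m n" by simp
    show "Comp (SetCat u) (fob X n) (fob X m) (fob (nerve_ob V (Phi_diagram W z D) L) m) (?y m)
      (far X n m h) =
       Comp (SetCat u) (fob X n) (fob (nerve_ob V (Phi_diagram W z D) L) n)
         (fob (nerve_ob V (Phi_diagram W z D) L) m)
        (far (nerve_ob V (Phi_diagram W z D) L) n m h) (?y n)"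
      unfolding far_N[OF h] using eta_natural[OF _ h] act_in[OF h] eta_wfun
        by (auto simp: compose_def fun_eq_iff)
  qed (simp add: extensional_def)
  show "\<exists>A\<in>Ob V. \<exists>y\<in>Hom (SSet u) X (fob ?R A). \<forall>B\<in>Ob V. \<forall>h\<in>Hom (SSet u) X (fob ?R B).
      \<exists>!k. k \<in> Hom V A B \<and> Comp (SSet u) X (fob ?R A) (fob ?R B) (far ?R A B k) y = h"
  proof (rule bexI[OF _ L], rule bexI[OF _ y], intro ballI)
    fix B h assume B: "B \<in> Ob V" and "h \<in> Hom (SSet u) X (fob ?R B)"
    then have h: "nat_trans (op_cat Delta) (SetCat u) X (nerve_ob V (Phi_diagram W z D) B) h"
      by (simp add: SSet_def N(1))
    have Bw: "is_wcat W B" using B by simp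
    have h1: "h n \<in> fob X n \<rightarrow>\<^sub>E {F. is_wfunctor W (?P n) B F}" for n
      using nat_transD(2)[OF h, of n] by (simp add: Phi_diagram_simps[OF D])
    have h2: "h m (far X n m g s) = comp_wfun W (?P m) (?P n) B (h n s) (Psi_ar D (simplex m)
      (simplex n) g)"
      if s: "s \<in> fob X n" and g: "g \<in> Hom Delta m n" for n s m g
      using fun_cong[OF nat_transD(3)[OF h, of n m g], of s] s g h1[of n] unfolding far_N[OF g]
      by (auto simp: compose_def)
    have "\<exists>!G. is_wfunctor W L B G \<and> (\<forall>n. \<forall>s\<in>fob X n. comp_wfun W (?P n) L B G (eta n s) = h n s)"
      by (rule L_universal[OF Bw]) (use h1 h2 in blast)+
    \<comment> \<open>Off \<open>fob X n\<close> both sides are \<open>undefined\<close>, so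
      equality of simplicial maps is the equation of \<open>L_universal\<close> on
      simplices.\<close>
    moreover have "Comp (SSet u) X (fob ?R L) (fob ?R B) (far ?R L B k) ?y = h \<longleftrightarrow>
        (\<forall>n. \<forall>s\<in>fob X n. comp_wfun W (?P n) L B k (eta n s) = h n s)" if k: "is_wfunctor W L B k"
          for k
    proof -
      have "Comp (SSet u) X (fob ?R L) (fob ?R B) (far ?R L B k) ?y n s =
        (if s \<in> fob X n then comp_wfun W (?P n) L B k (eta n s) else undefined)" for n s
        using L B k eta_wfun[of s n] by (simp add: SSet_def N(2)[OF L B] N compose_def)
      moreover have "h n s = undefined" if "s \<notin> fob X n" for n s
        using h1[of n] that by (auto simp: PiE_def extensional_def)
      ultimately show ?thesis by (auto simp: fun_eq_iff)
    qed
    ultimately show "\<exists>!k. k \<in> Hom V L B \<and> Comp (SSet u) X (fob ?R L) (fob ?R B) (far ?R L B k) ?y =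
      h"
      unfolding WCat_simps mem_Collect_eq by (metis (no_types, lifting))
  qed
qed

section \<open>Comparison of necklicial nerves with strong monoidal functors\<close>

lemma category_NerveNec: "category (NerveNec u W z)"
  unfolding NerveNec_def RightAdjoints_def
  by (intro category_full_subcat category_Fun category_WCat category_SSet)

lemma NerveNec_simps [simp]:
  "Ob (NerveNec u W z) = {R. is_functor V (SSet u) R \<and> right_adjoint V (SSet u) R \<and>
    necklicial u W z R}"
  "Hom (NerveNec u W z) = Hom (Fun V (SSet u))" "Ident (NerveNec u W z) = Ident (Fun V (SSet u))"
  "Comp (NerveNec u W z) = Comp (Fun V (SSet u))"
  by (auto simp: NerveNec_def RightAdjoints_def)

lemma fob_Phi: "strong_monoidal Nec W D \<Longrightarrow> fob (Phi u W z) D = Phi_diagram W z D"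
  and far_Phi: "\<lbrakk>strong_monoidal Nec W D; strong_monoidal Nec W E; monoidal_nat_trans Nec W D E t\<rbrakk> \<Longrightarrow>
    far (Phi u W z) D E t = Phi_nat W z t"
  by (simp_all add: Phi_def mk_ftor_simps)

lemma nerve_Phi_NerveNec:
  assumes D: "strong_monoidal Nec W D"
  shows "nerve_of V (Phi_diagram W z D) \<in> Ob (NerveNec u W z)"
proof -
  note Phi = is_functor_Phi_diagram[OF finite_small D]
  have "isomorphic (Fun Delta V) (Phi_diagram W z D) (fob (Phi u W z) D)"
    using isomorphic_refl[OF category_Fun[OF category_Delta category_WCat], of "Phi_diagram W z D"]
      Phi D by (simp add: fob_Phi)
  then have "necklicial u W z (nerve_of V (Phi_diagram W z D))"
    unfolding necklicial_def nerve_eq using Phi D by auto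
  then show ?thesis using is_functor_nerve_Phi[OF D] right_adjoint_nerve_Phi[OF D] by simp
qed

text \<open>The assignment \<open>nerve_nat\<close> respects identities and reverses composition, so
  it carries mutually inverse transformations of diagrams to mutually inverse transformations of
  nerves.\<close>

lemma isomorphic_nerve:
  assumes DD: "is_functor Delta V DD" and EE: "is_functor Delta V EE"
    and iso: "isomorphic (Fun Delta V) DD EE"
  shows "isomorphic (Fun V (SSet u)) (nerve_of V EE) (nerve_of V DD)"
proof -
  obtain t s where t: "nat_trans Delta V DD EE t" and s: "nat_trans Delta V EE DD s"
    and ts: "Comp (Fun Delta V) DD EE DD s t =
      Ident (Fun Delta V) DD" "Comp (Fun Delta V) EE DD EE t s = Ident (Fun Delta V) EE"
    using iso unfolding isomorphic_def iso_arr_def by (auto simp del: Fun_simps(3,4))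
  show ?thesis
    unfolding isomorphic_def iso_arr_def
  proof (intro exI[of _ "nerve_nat V DD EE t"] conjI bexI[of _ "nerve_nat V EE DD s"])
    show "Comp (Fun V (SSet u)) (nerve_of V EE) (nerve_of V DD) (nerve_of V EE)
      (nerve_nat V EE DD s) (nerve_nat V DD EE t) =
      Ident (Fun V (SSet u)) (nerve_of V EE)"
      by (simp only: nerve_nat_Comp[OF category_WCat EE DD EE t s, symmetric] ts nerve_nat_Ident[OF
        category_WCat EE])
    show "Comp (Fun V (SSet u)) (nerve_of V DD) (nerve_of V EE) (nerve_of V DD)
      (nerve_nat V DD EE t) (nerve_nat V EE DD s) =
      Ident (Fun V (SSet u)) (nerve_of V DD)"
      by (simp only: nerve_nat_Comp[OF category_WCat DD EE DD s t, symmetric] ts nerve_nat_Ident[OF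
        category_WCat DD])
  qed (use nat_trans_nerve_nat[OF category_WCat DD EE t] nat_trans_nerve_nat[OF category_WCat EE DD
    s] in simp_all)
qed

definition nerve_Phi where
  "nerve_Phi = mk_ftor (op_cat (StrMon Nec W)) (\<lambda>D. nerve_of V (Phi_diagram W z D))
     (\<lambda>D E t. nerve_nat V (Phi_diagram W z E) (Phi_diagram W z D) (Phi_nat W z t))"

text \<open>On hom-sets the functor is the bijection of \<open>Phi\<close> followed by the Yoneda
  bijection \<open>nerve_nat\<close>; the latter reverses direction, hence the opposite
  category.\<close>

lemma fully_faithful_nerve_Phi: "fully_faithful (op_cat (StrMon Nec W)) (NerveNec u W z) nerve_Phi"
  unfolding fully_faithful_def
proof (intro conjI ballI)
  note ff = fully_faithful_Phi[OF finite_small]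
  have Phi: "is_functor (StrMon Nec W) (Fun Delta V) (Phi u W z)"
    using ff unfolding fully_faithful_def by blast
  have PhiF: "is_functor Delta V (Phi_diagram W z D)" if "strong_monoidal Nec W D" for D
    by (rule is_functor_Phi_diagram[OF finite_small that])
  have PhiN: "nat_trans Delta V (Phi_diagram W z D) (Phi_diagram W z E) (Phi_nat W z t)"
    if "strong_monoidal Nec W D" "strong_monoidal Nec W E" "monoidal_nat_trans Nec W D E t"
      for D E t
    by (rule nat_trans_Phi_nat[OF finite_small that])
  show "is_functor (op_cat (StrMon Nec W)) (NerveNec u W z) nerve_Phi"
    unfolding nerve_Phi_def
  proof (rule is_functor_mk_ftor[OF category_op_cat[OF category_StrMon] category_NerveNec])
    show "nerve_of V (Phi_diagram W z D) \<in> Ob (NerveNec u W z)" if "D \<in> Ob (op_cat (StrMon Nec W))"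
      for D
      using that nerve_Phi_NerveNec by simp
    show "nerve_nat V (Phi_diagram W z E) (Phi_diagram W z D) (Phi_nat W z t) \<in>
        Hom (NerveNec u W z) (nerve_of V (Phi_diagram W z D)) (nerve_of V (Phi_diagram W z E))"
      if "D \<in> Ob (op_cat (StrMon Nec W))" "E \<in> Ob (op_cat (StrMon Nec W))"
        "t \<in> Hom (op_cat (StrMon Nec W)) D E" for D E t
      using that nat_trans_nerve_nat[OF category_WCat PhiF PhiF PhiN, of E D t] by simp
    fix D assume "D \<in> Ob (op_cat (StrMon Nec W))"
    then have D: "strong_monoidal Nec W D" by simp
    have "Phi_nat W z (Ident (StrMon Nec W) D) = Ident (Fun Delta V) (Phi_diagram W z D)"
      using functor_Ident[OF Phi, of D] D monoidal_nat_trans_id[OF D]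
        by (simp add: fob_Phi far_Phi del: Fun_simps(3))
    then show "nerve_nat V (Phi_diagram W z D) (Phi_diagram W z D)
      (Phi_nat W z (Ident (op_cat (StrMon Nec W)) D)) =
         Ident (NerveNec u W z) (nerve_of V (Phi_diagram W z D))"
      using nerve_nat_Ident[OF category_WCat PhiF[OF D]] by (simp del: Fun_simps(3) StrMon_simps(3))
  next
    fix D E F t s
    assume "D \<in> Ob (op_cat (StrMon Nec W))" "E \<in> Ob (op_cat (StrMon Nec W))"
      "F \<in> Ob (op_cat (StrMon Nec W))"
      "t \<in> Hom (op_cat (StrMon Nec W)) D E" "s \<in> Hom (op_cat (StrMon Nec W)) E F"
    then have D: "strong_monoidal Nec W D" and E: "strong_monoidal Nec W E"
      and F: "strong_monoidal Nec W F"
      and t: "monoidal_nat_trans Nec W E D t" and s: "monoidal_nat_trans Nec W F E s" by auto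
    have "Phi_nat W z (Comp (StrMon Nec W) F E D t s) =
      Comp (Fun Delta V) (Phi_diagram W z F) (Phi_diagram W z E) (Phi_diagram W z D) (Phi_nat W z t)
        (Phi_nat W z s)"
      using functor_Comp[OF Phi, of s F E t D] D E F t s monoidal_nat_trans_comp[OF F E D s t]
      by (simp add: fob_Phi far_Phi del: Fun_simps(4))
    then show "nerve_nat V (Phi_diagram W z F) (Phi_diagram W z D)
      (Phi_nat W z (Comp (op_cat (StrMon Nec W)) D E F s t)) =
      Comp (NerveNec u W z) (nerve_of V (Phi_diagram W z D)) (nerve_of V (Phi_diagram W z E))
        (nerve_of V (Phi_diagram W z F))
        (nerve_nat V (Phi_diagram W z F) (Phi_diagram W z E) (Phi_nat W z s))
        (nerve_nat V (Phi_diagram W z E) (Phi_diagram W z D) (Phi_nat W z t))"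
      using nerve_nat_Comp[OF category_WCat PhiF[OF D] PhiF[OF E] PhiF[OF F] PhiN[OF E D t] PhiN[OF
        F E s]]
      by (simp del: Fun_simps(4) StrMon_simps(4))
  qed
  fix D E assume "D \<in> Ob (op_cat (StrMon Nec W))" "E \<in> Ob (op_cat (StrMon Nec W))"
  then have D: "strong_monoidal Nec W D" and E: "strong_monoidal Nec W E" by auto
  have "bij_betw (far (Phi u W z) E D) {t. monoidal_nat_trans Nec W E D t} {s.
    nat_trans Delta V (Phi_diagram W z E) (Phi_diagram W z D) s}"
    using ff D E unfolding fully_faithful_def by (auto simp: fob_Phi)
  then have "bij_betw (Phi_nat W z) {t. monoidal_nat_trans Nec W E D t} {s.
    nat_trans Delta V (Phi_diagram W z E) (Phi_diagram W z D) s}"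
    by (rule bij_betw_cong[THEN iffD1, rotated]) (simp add: far_Phi D E)
  then have "bij_betw (nerve_nat V (Phi_diagram W z E) (Phi_diagram W z D) \<circ> Phi_nat W z) {t.
    monoidal_nat_trans Nec W E D t}
    {s. nat_trans V (SSet u) (nerve_of V (Phi_diagram W z D)) (nerve_of V (Phi_diagram W z E)) s}"
    by (rule bij_betw_trans[OF _ bij_betw_nerve_nat[OF category_WCat PhiF[OF D] PhiF[OF E]]])
  then have "bij_betw (far nerve_Phi D E) {t. monoidal_nat_trans Nec W E D t}
    {s. nat_trans V (SSet u) (nerve_of V (Phi_diagram W z D)) (nerve_of V (Phi_diagram W z E)) s}"
    by (rule bij_betw_cong[THEN iffD1, rotated]) (simp add: nerve_Phi_def mk_ftor_def D E)
  then show "bij_betw (far nerve_Phi D E) (Hom (op_cat (StrMon Nec W)) D E) (Hom (NerveNec u W z)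
    (fob nerve_Phi D) (fob nerve_Phi E))"
    using D E by (simp add: nerve_Phi_def mk_ftor_simps)
qed

text \<open>Essential surjectivity is built into \<open>necklicial\<close>: the diagram of such a
  nerve is isomorphic to some \<open>Phi(D)\<close>, and taking nerves preserves this up to
  direction.\<close>

theorem NerveNec_equivalence: "equivalent_categories (NerveNec u W z) (op_cat (StrMon Nec W))"
proof (rule fully_faithful_essentially_surjective_equivalence[OF fully_faithful_nerve_Phi])
  fix R assume R: "R \<in> Ob (NerveNec u W z)"
  then obtain DD D where h: "is_functor Delta V DD" "R = nerve_of V DD" "strong_monoidal Nec W D"
    "isomorphic (Fun Delta V) DD (fob (Phi u W z) D)"
    by (auto simp: necklicial_def nerve_eq)
  have "isomorphic (Fun V (SSet u)) (nerve_of V (Phi_diagram W z D)) R"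
    unfolding h(2) using isomorphic_nerve[OF h(1) is_functor_Phi_diagram[OF finite_small h(3)]]
      h(3,4) by (simp add: fob_Phi)
  then have "isomorphic (NerveNec u W z) (fob nerve_Phi D) R"
    using h(3) by (simp add: isomorphic_def iso_arr_def nerve_Phi_def mk_ftor_simps)
  then show "\<exists>D\<in>Ob (op_cat (StrMon Nec W)). isomorphic (NerveNec u W z) (fob nerve_Phi D) R"
    using h(3) by auto
qed

end

theorem proposition3p4:
  fixes W :: "('o, 'a) moncat" and zero :: 'o
  assumes "regular_universe TYPE('u)"
    and "monoidal_category W"
    and "locally_small TYPE('u) W"
    and "cocomplete TYPE('u) W"
    and "tensor_preserves_colimits TYPE('u) W"
    and "initial W zero"
  shows "fully_faithful (StrMon Nec W) (Fun Delta (WCat TYPE('u) W)) (Phi TYPE('u) W zero)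
    \<and> equivalent_categories (NerveNec TYPE('u) W zero) (op_cat (StrMon Nec W))"
proof -
  interpret cocomplete_monoidal W "TYPE('u)"
    using assms by unfold_locales
  \<comment> \<open>The absorption of initial objects that this locale assumes is provided by
    \<open>initial_tensor\<close>.\<close>
  interpret necklicial_setting W zero "TYPE('u)"
    using assms initial_tensor by unfold_locales
  show ?thesis
    using fully_faithful_Phi[OF finite_small] NerveNec_equivalence by blast
qed

end
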